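(* Let $\zeta_1,\zeta_2,\kappa_1,\kappa_2,\sigma>0$ and $\gamma\in(0,1)$. Consider the SDE $$\mathrm d\bm v(t)=\bm f(\bm v(t))\,\mathrm dt+\bm g(\bm v(t))\,\mathrm dW(t)$$ with $\bm f,\bm g$ as defined in the context, driven by the two-sided Brownian motion $W(t,\omega)=\omega(t)$ on the canonical metric dynamical system $(\Omega,\mathcal F,\mathbb P,\theta)$. For all $\omega\in\Omega$ and all initial values $\bm x\in\mathbb R^4$ (third coordinate understood modulo $2\pi$), this SDE admits a unique solution. The associated solution mapping $\varphi$, $(t,\omega,\bm x)\mapsto\varphi(t,\omega,\bm x)$, generates a continuous random dynamical system. Moreover, $\varphi$ possesses a random attractor.
   Context: **The SDE.** The state is $\bm v=(v_1,v_2,u_1,u_2)^\top$ in $\mathcal N:=\mathbb R^2\times\mathbb R/(2\pi\mathbb Z)\times\mathbb R$; the angle (third coordinate) is always understood modulo $2\pi$, with representative in $[0,2\pi)$, so it is bounded by $2\pi$; "$\mathbb R^4$" as a state space is understood with this convention. For $\bm x=(x_1,x_2,x_3,x_4)$, $$f_1(\bm x)=\frac{-2\zeta_1x_2-\kappa_1x_1+\gamma x_4^2\cos x_3-2\gamma\zeta_2x_4\sin x_3-\gamma\kappa_2\sin^2x_3}{1-\gamma\sin^2x_3},$$ $$f_2(\bm x)=\frac{-2\zeta_2x_4-\kappa_2\sin x_3-2\zeta_1x_2\sin x_3-\kappa_1x_1\sin x_3+\gamma x_4^2\sin x_3\cos x_3}{1-\gamma\sin^2x_3},$$ $$\bm f(\bm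 x)=(x_2,f_1(\bm x),x_4,f_2(\bm x))^\top,\qquad \bm g(\bm x)=\frac{\sigma}{1-\gamma\sin^2x_3}(0,1,0,\sin x_3)^\top.$$ **Noise.** $\Omega=C_0(\mathbb R;\mathbb R)$ is the space of continuous $\omega:\mathbb R\to\mathbb R$ with $\omega(0)=0$ (compact-open topology), $\mathcal F$ its Borel $\sigma$-algebra, $\mathbb P$ Wiener measure, $\theta_t\omega(\cdot)=\omega(t+\cdot)-\omega(t)$. For $\alpha>0$ let $z(\theta_t\omega)=\sigma\int_{-\infty}^0e^{\alpha s}\,\mathrm d(\theta_t\omega)(s)$ be the stationary Ornstein–Uhlenbeck solution of $\mathrm dz=-\alpha z\,\mathrm dt+\sigma\,\mathrm d\omega(t)$. $\Omega$ is restricted to a $\theta$-invariant set of full measure on which $\lim_{t\to\pm\infty}|\omega(t)|/|t|=0$ and $|z(\theta_t\omega)|^2\le C(\omega)(1+|t|)$ for all $t\in\mathbb R$ (and on which the ergodic limit $\frac1t\int_0^t|z(\theta_r\omega)|\mathrm dr\to\mathbb E|z|$ as $t\to\pm\infty$ holds); the restricted space is again denoted $(\Omega,\mathcal F,\mathbb P,\theta)$. **Pathwise solution.** Let $\mathcal T:\mathcal N\to\mathcal N$, $\mathcal T(v_1,v_2,u_1,u_2)=(v_1,\;v_2-\gamma u_2\sin u_1,\;u_1,\;u_2-v_2\sin u_1)^\top$, which is a diffeomorphism. With $(v,x,u,y)=\mathcal T(\bm v)$ and $\tilde x(t)=x(t)-z(\theta_t\omega)$, the SDE is equivalent to the random ODE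 (in which $x=\tilde x+z(\theta_t\omega)$) $$\dot v=\frac{x+\gamma y\sin u}{1-\gamma\sin^2u},\quad \dot{\tilde x}=-\kappa_1v-\frac{2\zeta_1(x+\gamma y\sin u)}{1-\gamma\sin^2u}+\alpha z(\theta_t\omega),\quad \dot u=\frac{x\sin u+y}{1-\gamma\sin^2u},$$ $$\dot y=-\kappa_2\sin u-\frac{2\zeta_2(x\sin u+y)}{1-\gamma\sin^2u}-\frac{(x+\gamma y\sin u)(x\sin u+y)\cos u}{(1-\gamma\sin^2u)^2}.$$ If $\tilde\varphi(t,\omega,\cdot)$ denotes the solution map of this random ODE and $\bm z(\omega)=(0,z(\omega),0,0)^\top$, the solution map of the SDE is $\varphi(t,\omega,\bm x)=\mathcal T^{-1}\big(\tilde\varphi(t,\omega,\mathcal T\bm x-\bm z(\omega))+\bm z(\theta_t\omega)\big)$. **RDS.** A continuous RDS on a state space $X$ over $(\Omega,\mathcal F,\mathbb P,\theta)$ is a measurable map $\varphi:\mathbb R\times\Omega\times X\to X$ such that $(t,x)\mapsto\varphi(t,\omega,x)$ is continuous for every $\omega$, $\varphi(0,\omega,\cdot)=\mathrm{id}$ and $\varphi(t+s,\omega,\cdot)=\varphi(t,\theta_s\omega,\cdot)\circ\varphi(s,\omega,\cdot)$. **Random attractor.** A random set $D$ is tempered if $D(\omega)\subset B_{\rho(\omega)}(0)$ for all $\omega$, where $\rho$ is a random variable with $\lim_{t\to\infty}\frac1t\log^+\rho(\theta_{-t}\omega)=0$. $\mathcal D$ is the family of all compact tempered random sets. A random compact set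 $A\in\mathcal D$ is a random attractor for $\varphi$ if $\varphi(t,\omega,A(\omega))=A(\theta_t\omega)$ for all $t>0$, $\omega\in\Omega$, and for every $D\in\mathcal D$, $\lim_{t\to\infty}d\big(\varphi(t,\theta_{-t}\omega,D(\theta_{-t}\omega)),A(\omega)\big)=0$ for all $\omega\in\Omega$, where $d(B_1,B_2)=\sup_{x\in B_1}\inf_{y\in B_2}\|x-y\|$ is the Hausdorff semi-distance (topology and distance being those of $\mathcal N$). *)

theory Defs
  imports "HOL-Probability.Probability"
begin

section \<open>The state space\<close>

quotient_type angle = real / "\<lambda>x y. \<exists>k::int. x - y = 2 * pi * of_int k"
proof (rule equivpI)
  show "reflp (\<lambda>x y::real. \<exists>k::int. x - y = 2 * pi * of_int k)"
    by (rule reflpI) (rule exI[of _ 0], simp)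
  show "symp (\<lambda>x y::real. \<exists>k::int. x - y = 2 * pi * of_int k)"
  proof (rule sympI)
    fix x y :: real
    assume "\<exists>k::int. x - y = 2 * pi * of_int k"
    then obtain k :: int where "x - y = 2 * pi * of_int k" by blast
    then have "y - x = 2 * pi * of_int (- k)" by simp
    then show "\<exists>k::int. y - x = 2 * pi * of_int k" by blast
  qed
  show "transp (\<lambda>x y::real. \<exists>k::int. x - y = 2 * pi * of_int k)"
  proof (rule transpI)
    fix x y z :: real
    assume "\<exists>k::int. x - y = 2 * pi * of_int k" "\<exists>k::int. y - z = 2 * pi * of_int k"
    then obtain k l :: int where "x - y = 2 * pi * of_int k" "y - z = 2 * pi * of_int l" by blast
    then have "x - z = 2 * pi * of_int (k + l)" by (simp add: algebra_simps)
    then show "\<exists>k::int. x - z = 2 * pi * of_int k" by blast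
  qed
qed

lift_definition angle_of :: "real \<Rightarrow> angle" is "\<lambda>x. x" .

lemma angle_of_eq_iff: "angle_of x = angle_of y \<longleftrightarrow> (\<exists>k::int. x - y = 2 * pi * of_int k)"
  by transfer simp

lemma angle_of_surj: "\<exists>x. a = angle_of x"
  by transfer (metis cancel_comm_monoid_add_class.diff_cancel mult_zero_right of_int_0)

definition circ_dist :: "real \<Rightarrow> real \<Rightarrow> real" where
  "circ_dist x y = (INF k::int. \<bar>x - y - 2 * pi * of_int k\<bar>)"

lemma circ_dist_le: "circ_dist x y \<le> \<bar>x - y - 2 * pi * of_int k\<bar>"
  unfolding circ_dist_def by (rule cINF_lower) (auto intro!: bdd_belowI[of _ 0])

lemma circ_dist_attained: "\<exists>k::int. circ_dist x y = \<bar>x - y - 2 * pi * of_int k\<bar>"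
proof -
  define r where "r = round ((x - y) / (2 * pi))"
  have scale: "\<bar>x - y - 2 * pi * of_int k\<bar> = 2 * pi * \<bar>(x - y) / (2 * pi) - of_int k\<bar>" for k :: int
  proof -
    have "x - y - 2 * pi * of_int k = 2 * pi * ((x - y) / (2 * pi) - of_int k)"
      by (simp add: field_simps)
    then show ?thesis by (simp add: abs_mult)
  qed
  have "\<bar>x - y - 2 * pi * of_int r\<bar> \<le> \<bar>x - y - 2 * pi * of_int k\<bar>" for k :: int
    unfolding scale r_def
    by (intro mult_left_mono) (simp_all only: round_diff_minimal, simp)
  then have "\<bar>x - y - 2 * pi * of_int r\<bar> \<le> circ_dist x y"
    unfolding circ_dist_def by (intro cINF_greatest) auto
  with circ_dist_le[of x y r] show ?thesis by (intro exI[of _ r]) simp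
qed

lemma circ_dist_nonneg: "0 \<le> circ_dist x y"
  using circ_dist_attained[of x y] by auto

lemma circ_dist_commute: "circ_dist x y = circ_dist y x"
proof -
  have "circ_dist x y \<le> circ_dist y x" for x y
  proof -
    obtain k :: int where "circ_dist y x = \<bar>y - x - 2 * pi * of_int k\<bar>"
      using circ_dist_attained by blast
    with circ_dist_le[of x y "- k"] show ?thesis by simp
  qed
  then show ?thesis by (simp add: antisym)
qed

lemma circ_dist_triangle: "circ_dist x z \<le> circ_dist x y + circ_dist y z"
proof -
  obtain k l :: int where "circ_dist x y = \<bar>x - y - 2 * pi * of_int k\<bar>"
    "circ_dist y z = \<bar>y - z - 2 * pi * of_int l\<bar>"
    using circ_dist_attained by metis
  with circ_dist_le[of x z "k + l"] show ?thesis by (simp add: distrib_left)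
qed

lemma circ_dist_eq_0_iff: "circ_dist x y = 0 \<longleftrightarrow> (\<exists>k::int. x - y = 2 * pi * of_int k)"
proof
  assume "circ_dist x y = 0"
  with circ_dist_attained[of x y] show "\<exists>k::int. x - y = 2 * pi * of_int k" by auto
next
  assume "\<exists>k::int. x - y = 2 * pi * of_int k"
  then obtain k :: int where "x - y = 2 * pi * of_int k" by blast
  with circ_dist_le[of x y k] circ_dist_nonneg[of x y] show "circ_dist x y = 0" by simp
qed

lemma circ_dist_cong:
  assumes "\<exists>k::int. x - x' = 2 * pi * of_int k" and "\<exists>k::int. y - y' = 2 * pi * of_int k"
  shows "circ_dist x y = circ_dist x' y'"
proof -
  have "circ_dist x x' = 0" "circ_dist y y' = 0"
    using assms by (simp_all add: circ_dist_eq_0_iff)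
  then show ?thesis
    using circ_dist_triangle[of x y x'] circ_dist_triangle[of x' y y']
      circ_dist_triangle[of x' y' x] circ_dist_triangle[of x y' y]
      circ_dist_commute[of x' x] circ_dist_commute[of y' y] by simp
qed

text \<open>The quotient metric; it induces the quotient topology of \<open>\<real>/2\<pi>\<int>\<close>.\<close>

instantiation angle :: metric_space
begin

lift_definition dist_angle :: "angle \<Rightarrow> angle \<Rightarrow> real" is circ_dist
  by (rule circ_dist_cong)

definition uniformity_angle :: "(angle \<times> angle) filter" where
  "uniformity_angle = (INF e\<in>{0<..}. principal {(x, y). dist x y < e})"

definition open_angle :: "angle set \<Rightarrow> bool" where
  "open_angle U = (\<forall>x\<in>U. eventually (\<lambda>(x', y). x' = x \<longrightarrow> y \<in> U) uniformity)"

instance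
proof
  fix a b c :: angle
  show "dist a b = 0 \<longleftrightarrow> a = b"
    by transfer (simp add: circ_dist_eq_0_iff)
  show "dist a b \<le> dist a c + dist b c"
    by transfer (metis circ_dist_commute circ_dist_triangle)
qed (simp_all only: uniformity_angle_def open_angle_def)

end

text \<open>
  The space \<open>\<N> = \<real>\<^sup>2 \<times> \<real>/2\<pi>\<int> \<times> \<real>\<close>, with the product metric, and its universal
  cover \<open>\<real>\<^sup>4\<close>, on which the coefficients of the equation are given.
\<close>

type_synonym state = "real \<times> real \<times> angle \<times> real"
type_synonym lifted = "real \<times> real \<times> real \<times> real"

definition to_state :: "lifted \<Rightarrow> state" where
  "to_state = (\<lambda>(x1, x2, x3, x4). (x1, x2, angle_of x3, x4))"

definition origin :: state where
  "origin = (0, 0, angle_of 0, 0)"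

section \<open>The canonical noise\<close>

definition path_space :: "(real \<Rightarrow> real) set" where
  "path_space = {\<omega>. continuous_on UNIV \<omega> \<and> \<omega> 0 = 0}"

definition compact_open_topology :: "(real \<Rightarrow> real) topology" where
  "compact_open_topology =
     topology_generated_by {{\<omega> \<in> path_space. \<omega> ` K \<subseteq> U} | K U. compact K \<and> open U}"

definition path_borel :: "(real \<Rightarrow> real) measure" where
  "path_borel = sigma path_space {U. openin compact_open_topology U}"

definition wiener_measure :: "(real \<Rightarrow> real) measure \<Rightarrow> bool" where
  "wiener_measure P \<longleftrightarrow>
     prob_space P \<and> space P = path_space \<and> sets P = sets path_borel \<and>
     (\<forall>s t. s < t \<longrightarrow>
        distributed P lborel (\<lambda>\<omega>. \<omega> t - \<omega> s) (normal_density 0 (sqrt (t - s)))) \<and>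
     (\<forall>\<tau>::nat \<Rightarrow> real. strict_mono \<tau> \<longrightarrow>
        prob_space.indep_vars P (\<lambda>_. borel) (\<lambda>i \<omega>. \<omega> (\<tau> (Suc i)) - \<omega> (\<tau> i)) UNIV)"

definition wiener_shift :: "real \<Rightarrow> (real \<Rightarrow> real) \<Rightarrow> real \<Rightarrow> real" where
  "wiener_shift t \<omega> = (\<lambda>s. \<omega> (t + s) - \<omega> t)"

text \<open>
  The Riemann--Stieltjes integral \<open>\<integral>\<^sub>a\<^sup>b G d\<omega>\<close>, as the limit of the sums
  \<open>\<Sum> (\<omega>(t\<^sub>i\<^sub>+\<^sub>1) - \<omega>(t\<^sub>i)) G(\<xi>\<^sub>i)\<close> as the mesh tends to zero.
  No bounded variation of \<open>\<omega>\<close> is needed for it to exist if \<open>G\<close> is of class C1.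
\<close>

definition has_rs_integral ::
  "(real \<Rightarrow> 'a::real_normed_vector) \<Rightarrow> (real \<Rightarrow> real) \<Rightarrow> real \<Rightarrow> real \<Rightarrow> 'a \<Rightarrow> bool" where
  "has_rs_integral G \<omega> a b I \<longleftrightarrow>
     (\<forall>e>0. \<exists>d>0. \<forall>p. p tagged_division_of {a..b} \<and> (\<lambda>\<xi>. ball \<xi> d) fine p \<longrightarrow>
        norm ((\<Sum>(\<xi>, K)\<in>p. (\<omega> (Sup K) - \<omega> (Inf K)) *\<^sub>R G \<xi>) - I) < e)"

definition rs_integral ::
  "(real \<Rightarrow> 'a::real_normed_vector) \<Rightarrow> (real \<Rightarrow> real) \<Rightarrow> real \<Rightarrow> real \<Rightarrow> 'a" where
  "rs_integral G \<omega> a b = (THE I. has_rs_integral G \<omega> a b I)"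

text \<open>The random variable \<open>z(\<omega>) = \<sigma> \<integral>\<^bsub>-\<infinity>\<^esub>\<^sup>0 exp(\<alpha>s) d\<omega>(s)\<close>, as an improper integral.\<close>

definition ou :: "real \<Rightarrow> real \<Rightarrow> (real \<Rightarrow> real) \<Rightarrow> real" where
  "ou \<alpha> \<sigma> \<omega> = \<sigma> * Lim at_bot (\<lambda>a. rs_integral (\<lambda>s. exp (\<alpha> * s)) \<omega> a 0)"

text \<open>
  The sets of full measure to which the noise may be restricted. The rate \<open>\<alpha>\<close> of the
  Ornstein--Uhlenbeck process is an auxiliary parameter that does not occur in the
  stochastic differential equation, so the conditions are imposed for each \<open>\<alpha> > 0\<close>;
  almost every path satisfies all of them simultaneously.
\<close>

definition regular_noise :: "(real \<Rightarrow> real) measure \<Rightarrow> real \<Rightarrow> (real \<Rightarrow> real) set \<Rightarrow> bool" where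
  "regular_noise P \<sigma> \<Omega> \<longleftrightarrow>
     \<Omega> \<in> sets P \<and> emeasure P \<Omega> = 1 \<and> (\<forall>t. wiener_shift t ` \<Omega> = \<Omega>) \<and>
     (\<forall>\<omega>\<in>\<Omega>.
        ((\<lambda>t. \<bar>\<omega> t\<bar> / \<bar>t\<bar>) \<longlongrightarrow> 0) at_top \<and> ((\<lambda>t. \<bar>\<omega> t\<bar> / \<bar>t\<bar>) \<longlongrightarrow> 0) at_bot \<and>
        (\<forall>\<alpha>>0.
           (\<exists>C. \<forall>t. \<bar>ou \<alpha> \<sigma> (wiener_shift t \<omega>)\<bar>\<^sup>2 \<le> C * (1 + \<bar>t\<bar>)) \<and>
           (\<forall>F\<in>{at_top, at_bot}.
              ((\<lambda>t. (1 / t) * (LBINT r=0..ereal t. \<bar>ou \<alpha> \<sigma> (wiener_shift r \<omega>)\<bar>))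
                 \<longlongrightarrow> (\<integral>\<eta>. \<bar>ou \<alpha> \<sigma> \<eta>\<bar> \<partial>restrict_space P \<Omega>)) F)))"

section \<open>The stochastic differential equation\<close>

definition drift :: "real \<Rightarrow> real \<Rightarrow> real \<Rightarrow> real \<Rightarrow> real \<Rightarrow> lifted \<Rightarrow> lifted" where
  "drift \<zeta>1 \<zeta>2 \<kappa>1 \<kappa>2 \<gamma> = (\<lambda>(x1, x2, x3, x4).
     (x2,
      (- 2 * \<zeta>1 * x2 - \<kappa>1 * x1 + \<gamma> * x4\<^sup>2 * cos x3 - 2 * \<gamma> * \<zeta>2 * x4 * sin x3
         - \<gamma> * \<kappa>2 * (sin x3)\<^sup>2) / (1 - \<gamma> * (sin x3)\<^sup>2),
      x4,
      (- 2 * \<zeta>2 * x4 - \<kappa>2 * sin x3 - 2 * \<zeta>1 * x2 * sin x3 - \<kappa>1 * x1 * sin x3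
         + \<gamma> * x4\<^sup>2 * sin x3 * cos x3) / (1 - \<gamma> * (sin x3)\<^sup>2)))"

definition diffusion :: "real \<Rightarrow> real \<Rightarrow> lifted \<Rightarrow> lifted" where
  "diffusion \<gamma> \<sigma> = (\<lambda>(x1, x2, x3, x4).
     (\<sigma> / (1 - \<gamma> * (sin x3)\<^sup>2)) *\<^sub>R (0, 1, 0, sin x3))"

text \<open>
  Pathwise solutions, on the whole time axis, of \<open>dv = f(v) dt + g(v) d\<omega>\<close>. The coefficients
  are \<open>2\<pi>\<close>-periodic in the third coordinate, so the equation is one on the state space; it is
  written for a continuous lift \<open>V\<close> of \<open>v\<close> to \<open>\<real>\<^sup>4\<close>. Since \<open>g\<close> depends only on the third
  coordinate, whose differential is \<open>x\<^sub>4 dt\<close>, the integrand \<open>g(V)\<close> is of class C1, so that the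
  stochastic integral exists for every path as a Riemann--Stieltjes integral, and it agrees
  almost surely with both the Ito and the Stratonovich integral.
\<close>

definition sde_solution ::
  "real \<Rightarrow> real \<Rightarrow> real \<Rightarrow> real \<Rightarrow> real \<Rightarrow> real \<Rightarrow> (real \<Rightarrow> real) \<Rightarrow> (real \<Rightarrow> state) \<Rightarrow> bool" where
  "sde_solution \<zeta>1 \<zeta>2 \<kappa>1 \<kappa>2 \<gamma> \<sigma> \<omega> v \<longleftrightarrow>
     (\<exists>V::real \<Rightarrow> lifted. continuous_on UNIV V \<and> (\<forall>t. v t = to_state (V t)) \<and>
        (\<forall>s t. s \<le> t \<longrightarrow>
           has_rs_integral (\<lambda>r. diffusion \<gamma> \<sigma> (V r)) \<omega> s t
             (V t - V s - integral {s..t} (\<lambda>r. drift \<zeta>1 \<zeta>2 \<kappa>1 \<kappa>2 \<gamma> (V r)))))"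

definition solution_map ::
  "real \<Rightarrow> real \<Rightarrow> real \<Rightarrow> real \<Rightarrow> real \<Rightarrow> real \<Rightarrow>
     real \<Rightarrow> (real \<Rightarrow> real) \<Rightarrow> state \<Rightarrow> state" where
  "solution_map \<zeta>1 \<zeta>2 \<kappa>1 \<kappa>2 \<gamma> \<sigma> t \<omega> x =
     (THE v. sde_solution \<zeta>1 \<zeta>2 \<kappa>1 \<kappa>2 \<gamma> \<sigma> \<omega> v \<and> v 0 = x) t"

section \<open>Random dynamical systems and random attractors\<close>

definition continuous_rds ::
  "'w measure \<Rightarrow> (real \<Rightarrow> 'w \<Rightarrow> 'w) \<Rightarrow> (real \<Rightarrow> 'w \<Rightarrow> 'x::topological_space \<Rightarrow> 'x) \<Rightarrow> bool" where
  "continuous_rds M \<theta> \<phi> \<longleftrightarrow>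
     (\<lambda>(t, \<omega>, x). \<phi> t \<omega> x) \<in> borel \<Otimes>\<^sub>M (M \<Otimes>\<^sub>M borel) \<rightarrow>\<^sub>M borel \<and>
     (\<forall>\<omega>\<in>space M.
        continuous_on UNIV (\<lambda>(t, x). \<phi> t \<omega> x) \<and>
        (\<forall>x. \<phi> 0 \<omega> x = x) \<and>
        (\<forall>t s x. \<phi> (t + s) \<omega> x = \<phi> t (\<theta> s \<omega>) (\<phi> s \<omega> x)))"

definition compact_random_set :: "'w measure \<Rightarrow> ('w \<Rightarrow> 'x::metric_space set) \<Rightarrow> bool" where
  "compact_random_set M D \<longleftrightarrow>
     (\<forall>\<omega>\<in>space M. compact (D \<omega>) \<and> D \<omega> \<noteq> {}) \<and>
     (\<forall>x. (\<lambda>\<omega>. infdist x (D \<omega>)) \<in> borel_measurable M)"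

text \<open>Here \<open>log\<^sup>+ r\<close> is written as \<open>ln (max 1 r)\<close>.\<close>

definition tempered :: "'w measure \<Rightarrow> (real \<Rightarrow> 'w \<Rightarrow> 'w) \<Rightarrow> ('w \<Rightarrow> state set) \<Rightarrow> bool" where
  "tempered M \<theta> D \<longleftrightarrow>
     (\<exists>\<rho> \<in> borel_measurable M. \<forall>\<omega>\<in>space M.
        D \<omega> \<subseteq> ball origin (\<rho> \<omega>) \<and>
        ((\<lambda>t. (1 / t) * ln (max 1 (\<rho> (\<theta> (- t) \<omega>)))) \<longlongrightarrow> 0) at_top)"

definition tempered_family :: "'w measure \<Rightarrow> (real \<Rightarrow> 'w \<Rightarrow> 'w) \<Rightarrow> ('w \<Rightarrow> state set) set" where
  "tempered_family M \<theta> = {D. compact_random_set M D \<and> tempered M \<theta> D}"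

definition hausdorff_semidist :: "'x::metric_space set \<Rightarrow> 'x set \<Rightarrow> real" where
  "hausdorff_semidist A B = (SUP x\<in>A. infdist x B)"

definition random_attractor ::
  "'w measure \<Rightarrow> (real \<Rightarrow> 'w \<Rightarrow> 'w) \<Rightarrow> (real \<Rightarrow> 'w \<Rightarrow> state \<Rightarrow> state) \<Rightarrow>
     ('w \<Rightarrow> state set) \<Rightarrow> bool" where
  "random_attractor M \<theta> \<phi> A \<longleftrightarrow>
     A \<in> tempered_family M \<theta> \<and>
     (\<forall>t>0. \<forall>\<omega>\<in>space M. \<phi> t \<omega> ` A \<omega> = A (\<theta> t \<omega>)) \<and>
     (\<forall>D\<in>tempered_family M \<theta>. \<forall>\<omega>\<in>space M.
        ((\<lambda>t. hausdorff_semidist (\<phi> t (\<theta> (- t) \<omega>) ` D (\<theta> (- t) \<omega>)) (A \<omega>)) \<longlongrightarrow> 0) at_top)"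

end

theory Submission
  imports Defs
begin

text \<open>
  In the momentum coordinates \<open>x = v\<^sub>2 - \<gamma> u\<^sub>2 sin u\<^sub>1\<close>, \<open>y = u\<^sub>2 - v\<^sub>2 sin u\<^sub>1\<close> the noise is additive and acts on
  \<open>x\<close> only. Integration by parts therefore turns the equation, path by path, into the random ordinary
  differential equation \<open>p' = b (p + \<sigma> \<omega>(t) e\<^sub>2)\<close> with \<open>p = (v, x, u, y) - \<sigma> \<omega>(t) e\<^sub>2\<close>. The Hamiltonian of the
  undamped system grows at most exponentially on bounded time intervals, so that the flow exists for all
  times; it depends continuously on the initial value and on the path, hence is measurable.

  With \<open>x\<close> shifted by the stationary Ornstein--Uhlenbeck process \<open>z\<close> instead of \<open>\<sigma> \<omega>\<close>, the perturbed
  energy \<open>E = H + \<epsilon> v x\<close> satisfies \<open>E' \<le> (- c + C \<bar>z\<bar>) E + h(z)\<close>, where \<open>c\<close> and \<open>C\<close> do not depend on the rate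
  \<open>\<alpha>\<close> of \<open>z\<close>. Since the mean of \<open>\<bar>z\<bar>\<close> is at most \<open>2 \<sigma> / sqrt \<alpha>\<close>, the ergodic theorem makes the linear
  equation contracting for large \<open>\<alpha>\<close>. If \<open>R\<close> is its stationary solution, then the closures of the sets
  \<open>{E < 2 R}\<close> are forward invariant, tempered and absorbing, and their pullbacks decrease to the attractor.
\<close>

section \<open>The state space and its universal cover\<close>

text \<open>Two shifts of the momentum serve two purposes. Subtracting
  \<open>\<sigma> * \<omega>\<close> gives a field that depends on the path by mere evaluation, so
  that dependence on the path is a Gronwall estimate in the compact-open topology; but this shift is
  not stationary. Decay is sought along the stationary shift \<open>z\<close>. The obstacle is one
  term of the energy balance, noise times the squared angular velocity: Young's inequality cannot
  absorb it into the damping, so the rate \<open>- c + C * \<bar>z\<bar>\<close> has no sign and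
  only its time average can be made negative. The equation does not contain \<alpha>, so a large
  \<alpha> can be taken without changing the flow whose attractor is sought. The angle plays a
  double role: it is bounded in the state space, so that sublevel sets of the energy are compact
  there, but on the cover, where the equation is solved, it may grow, and excluding blow-up needs an
  additional term \<open>u\<^sup>2\<close>. Finally, \<open>{E < 2 R}\<close> leaves a gap above the
  level \<open>R\<close> of the decay estimate, and it is open, which makes the random sets
  measurable through a countable dense set.\<close>

lemma dist_angle_of: "dist (angle_of x) (angle_of y) = circ_dist x y"
  by transfer simp

lemma dist_angle_of_le: "dist (angle_of x) (angle_of y) \<le> dist x y"
  using circ_dist_le[of x y 0] by (simp add: dist_angle_of dist_real_def)

text \<open>The infimum in the distance on the circle is attained, so one can move to the
  representative of \<open>a\<close> nearest to \<open>x\<close>. Distances thus lift exactly, not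
  just up to a constant.\<close>

lemma angle_lift: "\<exists>y. angle_of y = a \<and> dist x y = dist (angle_of x) a"
proof -
  obtain y where y: "a = angle_of y" using angle_of_surj by blast
  obtain k :: int where k: "circ_dist x y = \<bar>x - y - 2 * pi * of_int k\<bar>"
    using circ_dist_attained by blast
  have "angle_of (y + 2 * pi * of_int k) = a"
    unfolding y angle_of_eq_iff by (rule exI[of _ k]) simp
  moreover have "dist x (y + 2 * pi * of_int k) = dist (angle_of x) a"
    unfolding y dist_angle_of k dist_real_def by (simp add: algebra_simps)
  ultimately show ?thesis by blast
qed

lemma dist_angle_bounded: "dist (a::angle) b \<le> 2 * pi"
proof -
  obtain x y where xy: "a = angle_of x" "b = angle_of y" using angle_of_surj by metis
  define k where "k = \<lfloor>(x - y) / (2 * pi)\<rfloor>"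
  have "of_int k \<le> (x - y) / (2 * pi)" "(x - y) / (2 * pi) < of_int k + 1"
    unfolding k_def by linarith+
  then have "2 * pi * of_int k \<le> x - y" "x - y \<le> 2 * pi * of_int k + 2 * pi"
    by (simp_all add: field_simps)
  then have "\<bar>x - y - 2 * pi * of_int k\<bar> \<le> 2 * pi" by simp
  with circ_dist_le[of x y k] show ?thesis unfolding xy dist_angle_of by linarith
qed

text \<open>Required for the Borel sets of products to be generated by rectangles and for countable
  dense subsets. Rational points of the line project to a dense set of centres on the
  circle.\<close>

instance angle :: second_countable_topology
proof
  let ?B = "range (\<lambda>(q, r). ball (angle_of (real_of_rat q)) (real_of_rat r))"
  have "topological_basis ?B"
  proof (rule topological_basisI)
    fix U :: "angle set" and a
    assume "open U" "a \<in> U"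
    then obtain e where e: "e > 0" "ball a e \<subseteq> U" using open_contains_ball by blast
    obtain x where x: "a = angle_of x" using angle_of_surj by blast
    obtain r where r: "e / 4 < real_of_rat r" "real_of_rat r < e / 2"
      using of_rat_dense[of "e / 4" "e / 2"] e by auto
    obtain q where q: "x - e / 4 < real_of_rat q" "real_of_rat q < x + e / 4"
      using of_rat_dense[of "x - e / 4" "x + e / 4"] e by auto
    have d: "dist (angle_of (real_of_rat q)) a < e / 4"
      using dist_angle_of_le[of "real_of_rat q" x] q unfolding x dist_real_def by linarith
    have "ball (angle_of (real_of_rat q)) (real_of_rat r) \<subseteq> ball a e"
    proof
      fix b assume "b \<in> ball (angle_of (real_of_rat q)) (real_of_rat r)"
      then show "b \<in> ball a e"
        using d r e dist_triangle[of a b "angle_of (real_of_rat q)"]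
        by (simp add: dist_commute)
    qed
    moreover have "a \<in> ball (angle_of (real_of_rat q)) (real_of_rat r)"
      using d r by simp
    ultimately show "\<exists>B'\<in>?B. a \<in> B' \<and> B' \<subseteq> U" using e by (auto intro!: bexI[of _ "(q, r)"])
  qed auto
  then show "\<exists>B::angle set set. countable B \<and> open = generate_topology B"
    using topological_basis_imp_subbasis by (intro exI[of _ ?B]) auto
qed

lemma to_state_lift: "\<exists>Y. to_state Y = x \<and> dist X Y = dist (to_state X) x"
proof -
  obtain X1 X2 X3 X4 where X: "X = (X1, X2, X3, X4)" by (cases X)
  obtain x1 x2 a x4 where x: "x = (x1, x2, a, x4)" by (cases x)
  obtain y where "angle_of y = a" "dist X3 y = dist (angle_of X3) a" using angle_lift by blast
  then show ?thesis
    by (intro exI[of _ "(x1, x2, y, x4)"]) (simp add: X x to_state_def dist_prod_def)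
qed

lemma to_state_surj: "\<exists>X. to_state X = x"
  using to_state_lift by blast

lemma dist_to_state_le: "dist (to_state X) (to_state Y) \<le> dist X Y"
  by (cases X; cases Y)
    (auto simp: to_state_def dist_prod_def intro!: power_mono dist_angle_of_le)

lemma continuous_on_to_state: "continuous_on S to_state"
  unfolding continuous_on_iff using dist_to_state_le by (meson le_less_trans)

lemma to_state_eq_iff:
  "to_state X = to_state Y \<longleftrightarrow> (\<exists>k::int. X = Y + (0, 0, 2 * pi * of_int k, 0))"
  by (cases X; cases Y) (auto simp: to_state_def angle_of_eq_iff algebra_simps)

text \<open>Every point of the state space lifts to a point at the same distance from a given lift,
  so the \<delta> that works on the cover works on the quotient.\<close>

lemma continuous_on_state_descend:
  fixes f :: "'a::metric_space \<Rightarrow> state \<Rightarrow> 'b::metric_space"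
  assumes "continuous_on UNIV (\<lambda>(t, X). f t (to_state X))"
  shows "continuous_on UNIV (\<lambda>(t, x). f t x)"
  unfolding continuous_on_iff
proof safe
  fix t0 :: 'a and v1 v2 v4 e :: real and v3 :: angle assume e: "e > 0"
  let ?x0 = "(v1, v2, v3, v4)"
  obtain X0 where X0: "to_state X0 = ?x0" using to_state_surj by blast
  obtain d where d: "d > 0"
    "\<And>t X. dist (t, X) (t0, X0) < d \<Longrightarrow> dist (f t (to_state X)) (f t0 ?x0) < e"
    using assms e X0 unfolding continuous_on_iff by fastforce
  have "dist (f t x) (f t0 ?x0) < e" if "dist (t, x) (t0, ?x0) < d" for t x
  proof -
    obtain X where X: "to_state X = x" "dist X0 X = dist ?x0 x" using to_state_lift X0 by metis
    then have "dist (t, X) (t0, X0) = dist (t, x) (t0, ?x0)"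
      unfolding dist_Pair_Pair by (simp add: dist_commute)
    then show ?thesis using d(2)[of t X] that X by simp
  qed
  then show "\<exists>d>0. \<forall>x'\<in>UNIV. dist x' (t0, ?x0) < d \<longrightarrow>
      dist (case x' of (t, x) \<Rightarrow> f t x) (f t0 ?x0) < e"
    using d(1) by auto
qed

text \<open>The angle contributes at most 2 pi, hence only the other three coordinates decide about
  boundedness and temperedness.\<close>

lemma dist_origin_to_state_le: "dist origin (to_state (x1, x2, x3, x4)) \<le> \<bar>x1\<bar> + \<bar>x2\<bar> + \<bar>x4\<bar> + 2 * pi"
  and dist_origin_to_state_ge: "\<bar>x1\<bar> \<le> dist origin (to_state (x1, x2, x3, x4))"
    "\<bar>x2\<bar> \<le> dist origin (to_state (x1, x2, x3, x4))"
    "\<bar>x4\<bar> \<le> dist origin (to_state (x1, x2, x3, x4))"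
proof -
  have tri: "sqrt (a\<^sup>2 + b\<^sup>2) \<le> \<bar>a\<bar> + \<bar>b\<bar>" for a b :: real by (rule sqrt_sum_squares_le_sum_abs)
  have "dist origin (to_state (x1, x2, x3, x4)) \<le> \<bar>x1\<bar> + \<bar>sqrt (x2\<^sup>2 + (sqrt ((dist (angle_of 0) (angle_of x3))\<^sup>2 + x4\<^sup>2))\<^sup>2)\<bar>"
    using tri[of x1 "sqrt (x2\<^sup>2 + (sqrt ((dist (angle_of 0) (angle_of x3))\<^sup>2 + x4\<^sup>2))\<^sup>2)"]
    by (simp add: origin_def to_state_def dist_prod_def)
  also have "\<dots> \<le> \<bar>x1\<bar> + (\<bar>x2\<bar> + \<bar>sqrt ((dist (angle_of 0) (angle_of x3))\<^sup>2 + x4\<^sup>2)\<bar>)"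
    using tri[of x2 "sqrt ((dist (angle_of 0) (angle_of x3))\<^sup>2 + x4\<^sup>2)"] by simp
  also have "\<dots> \<le> \<bar>x1\<bar> + (\<bar>x2\<bar> + (\<bar>dist (angle_of 0) (angle_of x3)\<bar> + \<bar>x4\<bar>))"
    using tri[of "dist (angle_of 0) (angle_of x3)" x4] by simp
  also have "\<dots> \<le> \<bar>x1\<bar> + \<bar>x2\<bar> + \<bar>x4\<bar> + 2 * pi"
    using dist_angle_bounded[of "angle_of 0" "angle_of x3"] by simp
  finally show "dist origin (to_state (x1, x2, x3, x4)) \<le> \<bar>x1\<bar> + \<bar>x2\<bar> + \<bar>x4\<bar> + 2 * pi" .
  show "\<bar>x1\<bar> \<le> dist origin (to_state (x1, x2, x3, x4))"
    "\<bar>x2\<bar> \<le> dist origin (to_state (x1, x2, x3, x4))"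
    "\<bar>x4\<bar> \<le> dist origin (to_state (x1, x2, x3, x4))"
    by (auto simp: origin_def to_state_def dist_prod_def intro!: real_le_rsqrt)
qed

section \<open>Riemann--Stieltjes integrals\<close>

lemma has_rs_integralE:
  assumes "has_rs_integral G \<omega> a b I" "e > 0"
  obtains d where "d > 0"
    "\<And>p. p tagged_division_of {a..b} \<Longrightarrow> (\<lambda>\<xi>. ball \<xi> d) fine p \<Longrightarrow>
      norm ((\<Sum>(\<xi>, K)\<in>p. (\<omega> (Sup K) - \<omega> (Inf K)) *\<^sub>R G \<xi>) - I) < e"
proof -
  have "\<exists>d>0. \<forall>p. p tagged_division_of {a..b} \<and> (\<lambda>\<xi>. ball \<xi> d) fine p \<longrightarrow>
        norm ((\<Sum>(\<xi>, K)\<in>p. (\<omega> (Sup K) - \<omega> (Inf K)) *\<^sub>R G \<xi>) - I) < e"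
    using assms unfolding has_rs_integral_def by simp
  then show thesis using that by auto
qed

text \<open>Both limits are tested on one tagged division that is fine for both meshes; it exists by
  Cousin's lemma, \<open>fine_division_exists_real\<close>.\<close>

lemma has_rs_integral_unique:
  assumes "has_rs_integral G \<omega> a b I" "has_rs_integral G \<omega> a b J" "a \<le> b"
  shows "I = J"
proof (rule ccontr)
  assume "I \<noteq> J"
  define e where "e = norm (I - J) / 2"
  have e: "e > 0" using \<open>I \<noteq> J\<close> by (simp add: e_def)
  define S where "S p = (\<Sum>(\<xi>, K)\<in>p. (\<omega> (Sup K) - \<omega> (Inf K)) *\<^sub>R G \<xi>)" for p
  obtain d1 where d1: "d1 > 0"
    "\<And>p. p tagged_division_of {a..b} \<Longrightarrow> (\<lambda>\<xi>. ball \<xi> d1) fine p \<Longrightarrow> norm (S p - I) < e"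
    by (rule has_rs_integralE[OF assms(1) e, folded S_def]) (rule that)
  obtain d2 where d2: "d2 > 0"
    "\<And>p. p tagged_division_of {a..b} \<Longrightarrow> (\<lambda>\<xi>. ball \<xi> d2) fine p \<Longrightarrow> norm (S p - J) < e"
    by (rule has_rs_integralE[OF assms(2) e, folded S_def]) (rule that)
  have "gauge (\<lambda>\<xi>::real. ball \<xi> d1 \<inter> ball \<xi> d2)" using d1 d2 by (simp add: gauge_def open_Int)
  then obtain p where p: "p tagged_division_of {a..b}" "(\<lambda>\<xi>. ball \<xi> d1 \<inter> ball \<xi> d2) fine p"
    using fine_division_exists_real by metis
  have "(\<lambda>\<xi>. ball \<xi> d1) fine p" "(\<lambda>\<xi>. ball \<xi> d2) fine p"
    using p(2) by (simp_all add: fine_Int)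
  then have "norm (S p - I) < e" "norm (S p - J) < e" using d1 d2 p by auto
  moreover have "norm (I - J) \<le> norm (S p - I) + norm (S p - J)"
    using norm_triangle_ineq4[of "S p - J" "S p - I"] by simp
  ultimately show False unfolding e_def by simp
qed

lemma has_rs_integral_bounded_linear:
  assumes "has_rs_integral G \<omega> a b I" "bounded_linear f"
  shows "has_rs_integral (\<lambda>r. f (G r)) \<omega> a b (f I)"
  unfolding has_rs_integral_def
proof safe
  fix e :: real assume e: "e > 0"
  interpret f: bounded_linear f by fact
  obtain K where K: "K > 0" "\<And>x. norm (f x) \<le> norm x * K" using f.pos_bounded by blast
  obtain d where d: "d > 0"
    "\<And>p. p tagged_division_of {a..b} \<Longrightarrow> (\<lambda>\<xi>. ball \<xi> d) fine p \<Longrightarrow>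
      norm ((\<Sum>(\<xi>, K)\<in>p. (\<omega> (Sup K) - \<omega> (Inf K)) *\<^sub>R G \<xi>) - I) < e / K"
    by (rule has_rs_integralE[OF assms(1) divide_pos_pos[OF e K(1)]]) (rule that)
  have "norm ((\<Sum>(\<xi>, K)\<in>p. (\<omega> (Sup K) - \<omega> (Inf K)) *\<^sub>R f (G \<xi>)) - f I) < e"
    if "p tagged_division_of {a..b}" "(\<lambda>\<xi>. ball \<xi> d) fine p" for p
  proof -
    have "(\<Sum>(\<xi>, K)\<in>p. (\<omega> (Sup K) - \<omega> (Inf K)) *\<^sub>R f (G \<xi>)) - f I
        = f ((\<Sum>(\<xi>, K)\<in>p. (\<omega> (Sup K) - \<omega> (Inf K)) *\<^sub>R G \<xi>) - I)"
      by (simp add: f.diff f.sum f.scaleR case_prod_beta)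
    also have "norm \<dots> \<le> norm ((\<Sum>(\<xi>, K)\<in>p. (\<omega> (Sup K) - \<omega> (Inf K)) *\<^sub>R G \<xi>) - I) * K"
      by (rule K)
    also have "\<dots> < e" using d(2)[OF that] K by (simp add: pos_less_divide_eq)
    finally show ?thesis .
  qed
  then show "\<exists>d>0. \<forall>p. p tagged_division_of {a..b} \<and> (\<lambda>\<xi>. ball \<xi> d) fine p \<longrightarrow>
      norm ((\<Sum>(\<xi>, K)\<in>p. (\<omega> (Sup K) - \<omega> (Inf K)) *\<^sub>R f (G \<xi>)) - f I) < e"
    using d(1) by (intro exI[of _ d]) simp
qed

text \<open>The smoothness of \<open>G\<close> takes the place of bounded variation of \<omega>. On
  a cell, the Stieltjes term and the increment of the claimed integral differ by an integral of an
  oscillation of \<omega> against \<open>G'\<close>, which is at most a small constant times the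
  length of the cell, and the lengths add up to \<open>b - a\<close>.\<close>

lemma has_rs_integral_by_parts:
  fixes G G' :: "real \<Rightarrow> 'a::euclidean_space"
  assumes ab: "a \<le> b" and \<omega>: "continuous_on {a..b} \<omega>"
    and G: "\<And>r. r \<in> {a..b} \<Longrightarrow> (G has_vector_derivative G' r) (at r within {a..b})"
    and G': "continuous_on {a..b} G'"
  shows "has_rs_integral G \<omega> a b (\<omega> b *\<^sub>R G b - \<omega> a *\<^sub>R G a - integral {a..b} (\<lambda>r. \<omega> r *\<^sub>R G' r))"
  unfolding has_rs_integral_def
proof safe
  fix e :: real assume e: "e > 0"
  obtain M where M: "M > 0" "\<And>r. r \<in> {a..b} \<Longrightarrow> norm (G' r) \<le> M"
    using compact_imp_bounded[OF compact_continuous_image[OF G' compact_Icc]]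
    unfolding bounded_pos by auto
  \<comment> \<open>The summand 1 keeps the denominator positive when \<open>a = b\<close>.\<close>
  define e' where "e' = e / (2 * M * (b - a + 1))"
  have e': "e' > 0" using e M ab by (simp add: e'_def)
  have "uniformly_continuous_on {a..b} \<omega>"
    using \<omega> compact_uniformly_continuous by blast
  then obtain d where d: "d > 0"
    "\<And>r s. r \<in> {a..b} \<Longrightarrow> s \<in> {a..b} \<Longrightarrow> dist s r < d \<Longrightarrow> dist (\<omega> s) (\<omega> r) < e'"
    using e' unfolding uniformly_continuous_on_def by metis
  \<comment> \<open>The claimed indefinite integral: its increments over the cells
    telescope.\<close>
  define F where "F r = \<omega> r *\<^sub>R G r - integral {a..r} (\<lambda>r. \<omega> r *\<^sub>R G' r)" for r
  have cont: "continuous_on {a..b} (\<lambda>r. \<omega> r *\<^sub>R G' r)"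
    by (intro continuous_intros \<omega> G')
  have piece: "norm ((\<omega> y - \<omega> x) *\<^sub>R G \<xi> - (F y - F x)) \<le> e' * M * (y - x)"
    if "a \<le> x" "x \<le> \<xi>" "\<xi> \<le> y" "y \<le> b" "{x..y} \<subseteq> ball \<xi> (d / 2)" for x y \<xi>
  proof -
    have sub: "continuous_on {c..d'} f" if "continuous_on {a..b} f" "a \<le> c" "d' \<le> b"
      for f :: "real \<Rightarrow> 'a" and c d' using that by (auto intro: continuous_on_subset)
    have int: "(\<lambda>r. \<omega> r *\<^sub>R G' r) integrable_on {c..d'}" "G' integrable_on {c..d'}"
      if "a \<le> c" "d' \<le> b" for c d'
      using that by (auto intro!: integrable_continuous_real sub cont G')
    have FT: "(G' has_integral (G d' - G c)) {c..d'}" if "a \<le> c" "c \<le> d'" "d' \<le> b" for c d'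
      using that by (intro fundamental_theorem_of_calculus)
        (auto intro!: has_vector_derivative_within_subset[OF G])
    have split: "integral {a..y} f = integral {a..x} f + integral {x..\<xi>} f + integral {\<xi>..y} f"
      if "f integrable_on {a..y}" for f :: "real \<Rightarrow> 'a"
    proof -
      have "integral {a..x} f + integral {x..y} f = integral {a..y} f"
        using \<open>a \<le> x\<close> \<open>x \<le> \<xi>\<close> \<open>\<xi> \<le> y\<close> that by (intro Henstock_Kurzweil_Integration.integral_combine) auto
      moreover have "integral {x..\<xi>} f + integral {\<xi>..y} f = integral {x..y} f"
        using \<open>a \<le> x\<close> \<open>x \<le> \<xi>\<close> \<open>\<xi> \<le> y\<close> that
        by (intro Henstock_Kurzweil_Integration.integral_combine) (auto elim: integrable_on_subinterval)
      ultimately show ?thesis by (metis add.assoc)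
    qed
    have osc: "\<bar>\<omega> s - \<omega> r\<bar> \<le> e'" if "s \<in> {x..y}" "r \<in> {x..y}" for s r
    proof -
      have "dist \<xi> s < d / 2" "dist \<xi> r < d / 2" using that \<open>{x..y} \<subseteq> ball \<xi> (d / 2)\<close> by auto
      then have "dist s r < d" using dist_triangle_half_r[of \<xi> s d r] by simp
      then have "dist (\<omega> s) (\<omega> r) < e'" using d(2)[of r s] that \<open>a \<le> x\<close> \<open>y \<le> b\<close> by auto
      then show ?thesis by (simp add: dist_real_def)
    qed
    have seg: "norm (\<omega> s *\<^sub>R (G d' - G c) - integral {c..d'} (\<lambda>r. \<omega> r *\<^sub>R G' r)) \<le> e' * M * (d' - c)"
      if "s \<in> {x..y}" "x \<le> c" "c \<le> d'" "d' \<le> y" for s c d'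
    proof -
      have I: "((\<lambda>r. \<omega> s *\<^sub>R G' r - \<omega> r *\<^sub>R G' r) has_integral
          (\<omega> s *\<^sub>R (G d' - G c) - integral {c..d'} (\<lambda>r. \<omega> r *\<^sub>R G' r))) {c..d'}"
        using that \<open>a \<le> x\<close> \<open>y \<le> b\<close>
        by (intro has_integral_diff has_integral_cmul FT integrable_integral int) auto
      have le: "norm (\<omega> s *\<^sub>R G' r - \<omega> r *\<^sub>R G' r) \<le> e' * M" if "r \<in> {c..d'}" for r
      proof -
        have "norm ((\<omega> s - \<omega> r) *\<^sub>R G' r) \<le> e' * M"
          unfolding norm_scaleR using that \<open>s \<in> {x..y}\<close> \<open>x \<le> c\<close> \<open>d' \<le> y\<close> \<open>a \<le> x\<close> \<open>y \<le> b\<close> e'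
          by (intro mult_mono osc M) auto
        then show ?thesis by (simp add: scaleR_diff_left)
      qed
      have "0 \<le> e' * M" using e' M by simp
      from has_integral_bound_real[OF this finite.emptyI I] le show ?thesis using that by simp
    qed
    \<comment> \<open>The cell is split at its tag: to the left of \<xi> the path is frozen at
      \<open>\<omega> x\<close>, to the right at \<open>\<omega> y\<close>.\<close>
    have "(\<omega> y - \<omega> x) *\<^sub>R G \<xi> - (F y - F x)
        = - (\<omega> x *\<^sub>R (G \<xi> - G x) - integral {x..\<xi>} (\<lambda>r. \<omega> r *\<^sub>R G' r))
          - (\<omega> y *\<^sub>R (G y - G \<xi>) - integral {\<xi>..y} (\<lambda>r. \<omega> r *\<^sub>R G' r))"
      using split[OF int(1)[of a y]] \<open>y \<le> b\<close> by (simp add: F_def algebra_simps)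
    also have "norm \<dots> \<le> e' * M * (\<xi> - x) + e' * M * (y - \<xi>)"
    proof -
      have "norm (- A - B) \<le> norm A + norm B" for A B :: 'a
        using norm_triangle_ineq4[of "- A" B] by simp
      from order_trans[OF this add_mono[OF seg[of x x \<xi>] seg[of y \<xi> y]]] that
      show ?thesis by auto
    qed
    also have "\<dots> = e' * M * (y - x)" by (simp add: algebra_simps)
    finally show ?thesis .
  qed
  have total: "F b - F a = \<omega> b *\<^sub>R G b - \<omega> a *\<^sub>R G a - integral {a..b} (\<lambda>r. \<omega> r *\<^sub>R G' r)"
    by (simp add: F_def)
  have "norm ((\<Sum>(\<xi>, K)\<in>p. (\<omega> (Sup K) - \<omega> (Inf K)) *\<^sub>R G \<xi>) - (F b - F a)) < e"
    if p: "p tagged_division_of {a..b}" "(\<lambda>\<xi>. ball \<xi> (d / 2)) fine p" for p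
  proof -
    have sums: "(\<Sum>(\<xi>, K)\<in>p. F (Sup K) - F (Inf K)) = F b - F a"
      "(\<Sum>(\<xi>, K)\<in>p. e' * M * Sup K - e' * M * Inf K) = e' * M * b - e' * M * a"
      by (rule additive_tagged_division_1[OF ab p(1)])+
    have "norm ((\<Sum>(\<xi>, K)\<in>p. (\<omega> (Sup K) - \<omega> (Inf K)) *\<^sub>R G \<xi>) - (F b - F a))
      = norm (\<Sum>(\<xi>, K)\<in>p. (\<omega> (Sup K) - \<omega> (Inf K)) *\<^sub>R G \<xi> - (F (Sup K) - F (Inf K)))"
      unfolding sums(1)[symmetric] by (simp add: sum_subtractf case_prod_beta)
    also have "\<dots> \<le> (\<Sum>(\<xi>, K)\<in>p. e' * M * Sup K - e' * M * Inf K)"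
    proof (rule sum_norm_le, safe)
      fix \<xi> K assume K: "(\<xi>, K) \<in> p"
      obtain x y where xy: "K = {x..y}" using tagged_division_ofD(4)[OF p(1) K] by auto
      have "\<xi> \<in> K" "K \<subseteq> {a..b}" using tagged_division_ofD(2,3)[OF p(1) K] by auto
      moreover have "K \<subseteq> ball \<xi> (d / 2)" using p(2) K by (auto simp: fine_def)
      ultimately have "norm ((\<omega> y - \<omega> x) *\<^sub>R G \<xi> - (F y - F x)) \<le> e' * M * (y - x)"
        unfolding xy by (intro piece) auto
      moreover have "Sup K = y" "Inf K = x" using \<open>\<xi> \<in> K\<close> unfolding xy by auto
      ultimately show "norm ((\<omega> (Sup K) - \<omega> (Inf K)) *\<^sub>R G \<xi> - (F (Sup K) - F (Inf K)))
          \<le> e' * M * Sup K - e' * M * Inf K" by (simp add: algebra_simps)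
    qed
    also have "\<dots> = e' * M * (b - a)" unfolding sums(2) by (simp add: algebra_simps)
    also have "\<dots> < e"
    proof -
      have "e' * M * (b - a) = e * ((b - a) / (2 * (b - a + 1)))"
      proof -
        have "e / (2 * M * D) * M * l = e * (l / (2 * D))" if "D > 0" for D l
          using that M by (simp add: field_simps)
        then show ?thesis using ab by (simp only: e'_def)
      qed
      also have "\<dots> < e * 1" using e ab by (intro mult_strict_left_mono) (auto simp: field_simps)
      finally show ?thesis by simp
    qed
    finally show ?thesis .
  qed
  then show "\<exists>d>0. \<forall>p. p tagged_division_of {a..b} \<and> (\<lambda>\<xi>. ball \<xi> d) fine p \<longrightarrow>
      norm ((\<Sum>(\<xi>, K)\<in>p. (\<omega> (Sup K) - \<omega> (Inf K)) *\<^sub>R G \<xi>) -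
        (\<omega> b *\<^sub>R G b - \<omega> a *\<^sub>R G a - integral {a..b} (\<lambda>r. \<omega> r *\<^sub>R G' r))) < e"
    unfolding total[symmetric] using d(1) by (intro exI[of _ "d / 2"]) auto
qed

section \<open>Ordinary differential equations\<close>

text \<open>Gronwall's inequality in both directions of time: bounding the modulus of the derivative
  makes the hypothesis invariant under reflection of time, so the case \<open>t < 0\<close> follows
  from the other one.\<close>

lemma growth_bound:
  fixes g g' :: "real \<Rightarrow> real"
  assumes g: "\<And>t. \<bar>t\<bar> \<le> T \<Longrightarrow> (g has_real_derivative g' t) (at t)"
    and bound: "\<And>t. \<bar>t\<bar> \<le> T \<Longrightarrow> \<bar>g' t\<bar> \<le> K * g t"
    and t: "\<bar>t\<bar> \<le> T"
  shows "g t \<le> g 0 * exp (K * \<bar>t\<bar>)"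
proof -
  have fwd: "h t \<le> h 0 * exp (K * t)"
    if h: "\<And>t. \<bar>t\<bar> \<le> T \<Longrightarrow> (h has_real_derivative h' t) (at t)"
      and hb: "\<And>t. \<bar>t\<bar> \<le> T \<Longrightarrow> \<bar>h' t\<bar> \<le> K * h t" and "0 \<le> t" "t \<le> T"
    for h h' :: "real \<Rightarrow> real" and t
  proof -
    have "exp (- K * t) * h t \<le> exp (- K * 0) * h 0"
    proof (rule DERIV_nonpos_imp_nonincreasing[OF \<open>0 \<le> t\<close>])
      fix x assume x: "0 \<le> x" "x \<le> t"
      then have "\<bar>x\<bar> \<le> T" using \<open>t \<le> T\<close> by simp
      then have "((\<lambda>x. exp (- K * x) * h x) has_real_derivative exp (- K * x) * (h' x - K * h x)) (at x)"
        using h by (auto intro!: derivative_eq_intros simp: algebra_simps)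
      moreover have "exp (- K * x) * (h' x - K * h x) \<le> 0"
        using hb[OF \<open>\<bar>x\<bar> \<le> T\<close>] by (simp add: mult_nonneg_nonpos)
      ultimately show "\<exists>y. ((\<lambda>x. exp (- K * x) * h x) has_real_derivative y) (at x) \<and> y \<le> 0" by blast
    qed
    then show ?thesis by (simp add: exp_minus field_simps)
  qed
  show ?thesis
  proof (cases "t \<ge> 0")
    case True then show ?thesis using fwd[of g g' t] g bound t by auto
  next
    case False
    have "((\<lambda>s. g (- s)) has_real_derivative - g' (- s)) (at s)" if "\<bar>s\<bar> \<le> T" for s
      using g[of "- s"] that by (simp add: DERIV_mirror)
    then have "g (- (- t)) \<le> g (- 0) * exp (K * (- t))"
      using fwd[of "\<lambda>s. g (- s)" "\<lambda>s. - g' (- s)" "- t"] bound[of "- s" for s] False t by auto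
    then show ?thesis using False by simp
  qed
qed

section \<open>Integrals from 0 to t for t of either sign\<close>

definition signed_integral :: "(real \<Rightarrow> 'a::banach) \<Rightarrow> real \<Rightarrow> 'a" where
  "signed_integral g t = integral {0..t} g - integral {t..0} g"

lemma signed_integral_0 [simp]: "signed_integral g 0 = 0"
  by (simp add: signed_integral_def)

lemma signed_integral_eq:
  assumes "continuous_on UNIV g" "c \<le> 0" "c \<le> t"
  shows "signed_integral g t = integral {c..t} g - integral {c..0} g"
proof -
  have int: "g integrable_on {a..b}" for a b
    by (rule integrable_continuous_real) (use assms continuous_on_subset in blast)
  show ?thesis
  proof (cases "t \<ge> 0")
    case True
    then have "integral {c..0} g + integral {0..t} g = integral {c..t} g"
      using assms by (intro Henstock_Kurzweil_Integration.integral_combine int) auto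
    moreover have "integral {t..0} g = 0"
      using True by (cases "t = 0") auto
    ultimately show ?thesis by (simp add: signed_integral_def algebra_simps)
  next
    case False
    then have "integral {c..t} g + integral {t..0} g = integral {c..0} g"
      using assms by (intro Henstock_Kurzweil_Integration.integral_combine int) auto
    then show ?thesis using False by (simp add: signed_integral_def algebra_simps)
  qed
qed

lemma signed_integral_has_vector_derivative:
  fixes g :: "real \<Rightarrow> 'a::banach"
  assumes "continuous_on UNIV g"
  shows "(signed_integral g has_vector_derivative g t) (at t)"
proof -
  let ?c = "min t 0 - 1"
  have "((\<lambda>u. integral {?c..u} g) has_vector_derivative g t) (at t within {?c..t + 1})"
    by (rule integral_has_vector_derivative) (use assms continuous_on_subset in auto)
  then have "((\<lambda>u. integral {?c..u} g) has_vector_derivative g t) (at t)"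
    by (subst (asm) at_within_interior) auto
  then have "((\<lambda>u. integral {?c..u} g - integral {?c..0} g) has_vector_derivative g t) (at t)"
    by (auto intro!: derivative_eq_intros)
  then show ?thesis
    by (rule has_vector_derivative_transform_within_open[where S = "{?c<..}"])
       (auto simp: signed_integral_eq[OF assms, symmetric])
qed

lemma continuous_on_signed_integral [continuous_intros]:
  fixes g :: "real \<Rightarrow> 'a::banach"
  assumes "continuous_on UNIV g"
  shows "continuous_on S (signed_integral g)"
  using signed_integral_has_vector_derivative[OF assms]
  by (meson has_vector_derivative_continuous continuous_at_imp_continuous_on)

text \<open>Banach's theorem applied to the difference of the solution and its initial value,
  measured in the norm with weight \<open>exp (- K \<bar>t\<bar>)\<close>.\<close>

lemma picard_lindelof_global:
  fixes F :: "real \<Rightarrow> 'a::banach \<Rightarrow> 'a"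
  assumes F: "continuous_on UNIV (\<lambda>(t, x). F t x)"
    and lip: "\<And>t x y. norm (F t x - F t y) \<le> L * norm (x - y)"
    and M: "\<And>t x. norm (F t x) \<le> M"
  shows "\<exists>y. y 0 = x0 \<and> (\<forall>t. (y has_vector_derivative F t (y t)) (at t))"
proof -
  define L' where "L' = max L 0"
  have lip': "norm (F t x - F t y) \<le> L' * norm (x - y)" for t x y
    using lip[of t x y] mult_right_mono[of L L' "norm (x - y)"] by (simp add: L'_def)
  \<comment> \<open>With weight rate \<open>K\<close> the iteration contracts by
    \<open>L' / K\<close>, which is at most 1/2; the 1 keeps \<open>K\<close> positive when
    \<open>L' = 0\<close>.\<close>
  define K where "K = 2 * L' + 1"
  have K: "K > 0" "L' \<ge> 0" "2 * L' \<le> K" by (auto simp: K_def L'_def)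
  have M0: "M \<ge> 0" using M[of 0 0] norm_ge_zero order_trans by blast
  \<comment> \<open>The field is bounded by \<open>M\<close>, so displacements grow at most linearly
    and become bounded continuous functions once weighted. \<open>X\<close> undoes the weight,
    \<open>\<Psi>\<close> is the Picard iteration in weighted form.\<close>
  define X where "X u t = x0 + exp (K * \<bar>t\<bar>) *\<^sub>R apply_bcontfun u t" for u t
  define \<Psi> where "\<Psi> u t = exp (- K * \<bar>t\<bar>) *\<^sub>R signed_integral (\<lambda>s. F s (X u s)) t" for u t
  have contX: "continuous_on UNIV (X u)" for u
    unfolding X_def by (intro continuous_intros continuous_on_apply_bcontfun)
  have contF: "continuous_on UNIV (\<lambda>s. F s (X u s))" for u
    using continuous_on_compose2[OF F continuous_on_Pair[OF continuous_on_id contX[of u]]] by simp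
  have exp_abs: "norm (exp (- K * \<bar>t\<bar>) *\<^sub>R (x::'a)) \<le> c"
    if "norm x \<le> exp (K * \<bar>t\<bar>) * c" for t x c
  proof -
    have "exp (- K * \<bar>t\<bar>) * norm x \<le> exp (- K * \<bar>t\<bar>) * (exp (K * \<bar>t\<bar>) * c)"
      using that by (intro mult_left_mono) auto
    also have "\<dots> = c" by (simp add: mult.assoc[symmetric] exp_add[symmetric])
    finally show ?thesis by simp
  qed
  \<comment> \<open>Integrating a function of weight \<open>exp (K * \<bar>s\<bar>)\<close> gains
    the factor \<open>1 / K\<close>. This is used twice, for the self-map property and for the
    contraction.\<close>
  have weight: "norm (signed_integral g t) \<le> exp (K * \<bar>t\<bar>) * (c / K)"
    if g: "continuous_on UNIV g" "\<And>s. norm (g s) \<le> c * exp (K * \<bar>s\<bar>)" and c: "c \<ge> 0"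
    for g :: "real \<Rightarrow> 'a" and c t
  proof -
    have sub: "norm (g s) \<le> b" if "c * exp (K * \<bar>s\<bar>) \<le> b" for s b using g(2)[of s] that by simp
    have cts: "continuous_on {a..b} g" for a b using g(1) continuous_on_subset by blast
    show ?thesis
    proof (cases "t \<ge> 0")
      case True
      have I: "((\<lambda>s. c * exp (K * s)) has_integral (c / K * exp (K * t) - c / K * exp (K * 0))) {0..t}"
        using K True by (intro fundamental_theorem_of_calculus)
          (auto intro!: derivative_eq_intros simp: has_real_derivative_iff_has_vector_derivative[symmetric])
      have "norm (integral {0..t} g) \<le> integral {0..t} (\<lambda>s. c * exp (K * s))"
        by (intro integral_norm_bound_integral has_integral_integrable[OF I]
          integrable_continuous_real[OF cts] sub) (use True in auto)
      also have "\<dots> = c / K * exp (K * t) - c / K" using integral_unique[OF I] by simp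
      also have "\<dots> \<le> c / K * exp (K * t)" using c K by simp
      finally show ?thesis using True
        by (cases "t = 0") (auto simp: signed_integral_def mult.commute)
    next
      case False
      have I: "((\<lambda>s. c * exp (- K * s)) has_integral (- (c / K) * exp (- K * 0) - - (c / K) * exp (- K * t))) {t..0}"
        using K False by (intro fundamental_theorem_of_calculus)
          (auto intro!: derivative_eq_intros simp: has_real_derivative_iff_has_vector_derivative[symmetric])
      have "norm (integral {t..0} g) \<le> integral {t..0} (\<lambda>s. c * exp (- K * s))"
        by (intro integral_norm_bound_integral has_integral_integrable[OF I]
          integrable_continuous_real[OF cts] sub) (use False in auto)
      also have "\<dots> = c / K * exp (- K * t) - c / K" using integral_unique[OF I] by simp
      also have "\<dots> \<le> c / K * exp (- K * t)" using c K by simp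
      finally show ?thesis using False by (auto simp: signed_integral_def mult.commute)
    qed
  qed
  have cont\<Psi>: "continuous_on UNIV (\<Psi> u)" for u
    unfolding \<Psi>_def by (intro continuous_intros contF)
  have bnd: "\<Psi> u \<in> bcontfun" for u
  proof (rule bcontfun_normI[OF cont\<Psi>])
    fix t
    have "norm (F s (X u s)) \<le> M * exp (K * \<bar>s\<bar>)" for s
      using M[of s "X u s"] mult_left_mono[OF _ M0, of 1 "exp (K * \<bar>s\<bar>)"] K by simp
    then show "norm (\<Psi> u t) \<le> M / K"
      unfolding \<Psi>_def by (intro exp_abs weight contF M0)
  qed
  define \<Phi> where "\<Phi> u = Bcontfun (\<Psi> u)" for u
  have app: "apply_bcontfun (\<Phi> u) = \<Psi> u" for u
    unfolding \<Phi>_def by (rule Bcontfun_inverse[OF bnd])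
  have contr: "dist (\<Phi> u) (\<Phi> v) \<le> (1 / 2) * dist u v" for u v
  proof (rule dist_bound)
    fix t
    have "norm (F s (X u s) - F s (X v s)) \<le> (L' * dist u v) * exp (K * \<bar>s\<bar>)" for s
    proof -
      have "X u s - X v s = exp (K * \<bar>s\<bar>) *\<^sub>R (apply_bcontfun u s - apply_bcontfun v s)"
        by (simp add: X_def algebra_simps)
      then have "norm (X u s - X v s) = exp (K * \<bar>s\<bar>) * dist (apply_bcontfun u s) (apply_bcontfun v s)"
        by (simp add: dist_norm)
      also have "\<dots> \<le> exp (K * \<bar>s\<bar>) * dist u v" by (intro mult_left_mono dist_bounded) auto
      finally have "L' * norm (X u s - X v s) \<le> L' * (exp (K * \<bar>s\<bar>) * dist u v)"
        using K by (intro mult_left_mono) auto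
      with lip'[of s "X u s" "X v s"] show ?thesis by (simp add: mult_ac)
    qed
    then have "norm (exp (- K * \<bar>t\<bar>) *\<^sub>R signed_integral (\<lambda>s. F s (X u s) - F s (X v s)) t)
        \<le> (L' * dist u v) / K"
      by (intro exp_abs weight continuous_on_diff contF) (use K in auto)
    moreover have "signed_integral (\<lambda>s. F s (X u s) - F s (X v s)) t =
        signed_integral (\<lambda>s. F s (X u s)) t - signed_integral (\<lambda>s. F s (X v s)) t"
    proof -
      have "(\<lambda>s. F s (X w s)) integrable_on {a..b}" for w a b
        using contF[of w] by (intro integrable_continuous_real) (auto intro: continuous_on_subset)
      then show ?thesis unfolding signed_integral_def by (simp add: integral_diff)
    qed
    ultimately have "dist (\<Psi> u t) (\<Psi> v t) \<le> (L' * dist u v) / K"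
      by (simp add: \<Psi>_def dist_norm scaleR_diff_right)
    also have "\<dots> \<le> (1 / 2) * dist u v"
      using K mult_right_mono[OF K(3) zero_le_dist[of u v]] by (simp add: field_simps)
    finally show "dist (apply_bcontfun (\<Phi> u) t) (apply_bcontfun (\<Phi> v) t) \<le> (1 / 2) * dist u v"
      by (simp add: app)
  qed
  have "\<exists>!u. \<Phi> u = u"
    by (rule banach_fix_type[where c = "1 / 2"]) (use contr in auto)
  then obtain u where u: "\<Phi> u = u" by blast
  define y where "y = X u"
  have fix_eq: "y t = x0 + signed_integral (\<lambda>s. F s (y s)) t" for t
  proof -
    have "apply_bcontfun u t = \<Psi> u t" using app[of u] u by simp
    then show ?thesis
      by (simp add: y_def X_def \<Psi>_def exp_minus)
  qed
  have "continuous_on UNIV (\<lambda>s. F s (y s))" unfolding y_def by (rule contF)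
  then have "((\<lambda>t. x0 + signed_integral (\<lambda>s. F s (y s)) t) has_vector_derivative F t (y t)) (at t)" for t
    by (auto intro!: derivative_eq_intros signed_integral_has_vector_derivative)
  moreover have "(\<lambda>t. x0 + signed_integral (\<lambda>s. F s (y s)) t) = y"
    by (rule ext) (rule fix_eq[symmetric])
  ultimately have "(y has_vector_derivative F t (y t)) (at t)" for t by (simp only:)
  moreover have "y 0 = x0" using fix_eq[of 0] by simp
  ultimately show ?thesis by blast
qed

text \<open>Gronwall's inequality for the squared distance, which is differentiable where the
  distance is not. Young's inequality on the cross term with \<delta> costs the 1 in the rate, and
  adding \<open>\<delta>\<^sup>2\<close> to the function makes the inequality homogeneous.\<close>

lemma ode_dependence:
  fixes y1 y2 :: "real \<Rightarrow> 'a::real_inner"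
  assumes y1: "\<And>t. \<bar>t\<bar> \<le> T \<Longrightarrow> (y1 has_vector_derivative f1 t) (at t)"
    and y2: "\<And>t. \<bar>t\<bar> \<le> T \<Longrightarrow> (y2 has_vector_derivative f2 t) (at t)"
    and diff: "\<And>t. \<bar>t\<bar> \<le> T \<Longrightarrow> norm (f1 t - f2 t) \<le> L * norm (y1 t - y2 t) + \<delta>"
    and L: "0 \<le> L" and t: "\<bar>t\<bar> \<le> T"
  shows "(norm (y1 t - y2 t))\<^sup>2 \<le> ((norm (y1 0 - y2 0))\<^sup>2 + \<delta>\<^sup>2) * exp ((2 * L + 1) * \<bar>t\<bar>)"
proof -
  define g where "g t = (y1 t - y2 t) \<bullet> (y1 t - y2 t) + \<delta>\<^sup>2" for t
  have "g t \<le> g 0 * exp ((2 * L + 1) * \<bar>t\<bar>)"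
  proof (rule growth_bound[OF _ _ t])
    fix s assume s: "\<bar>s\<bar> \<le> T"
    have "((\<lambda>t. y1 t - y2 t) has_vector_derivative f1 s - f2 s) (at s)"
      by (intro has_vector_derivative_diff y1 y2 s)
    then have D: "((\<lambda>t. y1 t - y2 t) has_derivative (\<lambda>h. h *\<^sub>R (f1 s - f2 s))) (at s)"
      by (simp only: has_vector_derivative_def)
    show "(g has_real_derivative 2 * ((y1 s - y2 s) \<bullet> (f1 s - f2 s))) (at s)"
      unfolding g_def has_field_derivative_def
      by (rule has_derivative_eq_rhs[OF has_derivative_add[OF has_derivative_inner[OF D D] has_derivative_const]])
        (auto simp: inner_commute algebra_simps)
    have "\<bar>2 * ((y1 s - y2 s) \<bullet> (f1 s - f2 s))\<bar> \<le> 2 * (norm (y1 s - y2 s) * norm (f1 s - f2 s))"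
      using Cauchy_Schwarz_ineq2[of "y1 s - y2 s" "f1 s - f2 s"] by simp
    also have "\<dots> \<le> 2 * (norm (y1 s - y2 s) * (L * norm (y1 s - y2 s) + \<delta>))"
      by (intro mult_left_mono diff s) auto
    also have "\<dots> = 2 * L * (norm (y1 s - y2 s))\<^sup>2 + 2 * norm (y1 s - y2 s) * \<delta>"
      by (simp add: algebra_simps power2_eq_square)
    also have "\<dots> \<le> 2 * L * (norm (y1 s - y2 s))\<^sup>2 + ((norm (y1 s - y2 s))\<^sup>2 + \<delta>\<^sup>2)"
      using sum_squares_bound[of "norm (y1 s - y2 s)" \<delta>] by simp
    also have "\<dots> \<le> (2 * L + 1) * g s"
      using L by (simp add: g_def power2_norm_eq_inner algebra_simps)
    finally show "\<bar>2 * ((y1 s - y2 s) \<bullet> (f1 s - f2 s))\<bar> \<le> (2 * L + 1) * g s" .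
  qed
  from order_trans[OF _ this, of "(norm (y1 t - y2 t))\<^sup>2"] show ?thesis
    by (simp add: g_def power2_norm_eq_inner)
qed

section \<open>Uniqueness and non-explosion\<close>

definition ball_lipschitz :: "(real \<Rightarrow> 'a::real_normed_vector \<Rightarrow> 'a) \<Rightarrow> bool" where
  "ball_lipschitz F \<longleftrightarrow> (\<forall>T M. \<exists>L\<ge>0. \<forall>t x y. \<bar>t\<bar> \<le> T \<longrightarrow> norm x \<le> M \<longrightarrow> norm y \<le> M \<longrightarrow>
     norm (F t x - F t y) \<le> L * norm (x - y))"

lemma ode_unique:
  fixes y1 y2 :: "real \<Rightarrow> 'a::real_inner"
  assumes F: "ball_lipschitz F"
    and y1: "\<And>t. \<bar>t\<bar> \<le> T \<Longrightarrow> (y1 has_vector_derivative F t (y1 t)) (at t)"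
    and y2: "\<And>t. \<bar>t\<bar> \<le> T \<Longrightarrow> (y2 has_vector_derivative F t (y2 t)) (at t)"
    and eq: "y1 0 = y2 0" and t: "\<bar>t\<bar> \<le> T"
  shows "y1 t = y2 t"
proof -
  have bd: "\<exists>M. \<forall>t\<in>{-T..T}. norm (y t) \<le> M"
    if "\<And>t. \<bar>t\<bar> \<le> T \<Longrightarrow> (y has_vector_derivative F t (y t)) (at t)" for y
  proof -
    have "continuous_on {-T..T} y"
      by (intro continuous_at_imp_continuous_on ballI has_vector_derivative_continuous[OF that]) auto
    then have "bounded (y ` {-T..T})" by (intro compact_imp_bounded compact_continuous_image) auto
    then show ?thesis by (auto simp: bounded_iff)
  qed
  obtain M1 M2 where M: "\<forall>t\<in>{-T..T}. norm (y1 t) \<le> M1" "\<forall>t\<in>{-T..T}. norm (y2 t) \<le> M2"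
    using bd y1 y2 by metis
  obtain L where L: "L \<ge> 0" "\<And>t x y. \<bar>t\<bar> \<le> T \<Longrightarrow> norm x \<le> max M1 M2 \<Longrightarrow> norm y \<le> max M1 M2 \<Longrightarrow>
     norm (F t x - F t y) \<le> L * norm (x - y)"
    using F unfolding ball_lipschitz_def by metis
  have M': "norm (y1 s) \<le> max M1 M2" "norm (y2 s) \<le> max M1 M2" if "\<bar>s\<bar> \<le> T" for s
    using M that by (auto simp: abs_le_iff le_max_iff_disj)
  have "(norm (y1 t - y2 t))\<^sup>2 \<le> ((norm (y1 0 - y2 0))\<^sup>2 + 0\<^sup>2) * exp ((2 * L + 1) * \<bar>t\<bar>)"
  proof (rule ode_dependence[OF y1 y2 _ L(1) t])
    fix s assume s: "\<bar>s\<bar> \<le> T"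
    show "norm (F s (y1 s) - F s (y2 s)) \<le> L * norm (y1 s - y2 s) + 0"
      using L(2)[OF s M'(1)[OF s] M'(2)[OF s]] by simp
  qed
  then show ?thesis using eq by simp
qed

text \<open>The field is multiplied by a cutoff with values in the unit interval to make
  \<open>picard_lindelof_global\<close> applicable. As \<open>DV\<close> is homogeneous in the
  direction, the cutoff only weakens the growth estimate, so the truncated solution stays where the
  cutoff equals 1 and solves the original equation. Solutions on growing intervals agree by
  uniqueness.\<close>

lemma ode_global_existence:
  fixes F :: "real \<Rightarrow> 'a::euclidean_space \<Rightarrow> 'a" and V :: "'a \<Rightarrow> real"
  assumes cont: "continuous_on UNIV (\<lambda>(t, x). F t x)" and lip: "ball_lipschitz F"
    and V: "\<And>y d t. (y has_vector_derivative d) (at t) \<Longrightarrow>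
      ((\<lambda>t. V (y t)) has_real_derivative DV (y t) d) (at t)"
    and DV: "\<And>x r d. DV x (r *\<^sub>R d) = r * DV x d"
    and coercive: "\<And>x. (norm x)\<^sup>2 \<le> c * V x" and c: "c > 0"
    and growth: "\<And>T. \<exists>C. \<forall>t x. \<bar>t\<bar> \<le> T \<longrightarrow> \<bar>DV x (F t x)\<bar> \<le> C * V x"
  shows "\<exists>y. y 0 = x0 \<and> (\<forall>t. (y has_vector_derivative F t (y t)) (at t))"
proof -
  have V0: "V x \<ge> 0" for x
    using coercive[of x] c zero_le_power2[of "norm x"] by (metis order_trans zero_le_mult_iff not_less)
  have loc: "\<exists>y. y 0 = x0 \<and> (\<forall>t. \<bar>t\<bar> \<le> T \<longrightarrow> (y has_vector_derivative F t (y t)) (at t))"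
    if T: "T \<ge> 0" for T
  proof -
    obtain C where C: "\<And>t x. \<bar>t\<bar> \<le> T \<Longrightarrow> \<bar>DV x (F t x)\<bar> \<le> C * V x" using growth by metis
    define C' where "C' = max C 0"
    have C': "\<bar>DV x (F t x)\<bar> \<le> C' * V x" "C' \<ge> 0" if "\<bar>t\<bar> \<le> T" for t x
      using C[OF that, of x] mult_right_mono[of C C' "V x"] V0[of x] by (auto simp: C'_def)
    \<comment> \<open>The radius that Gronwall's inequality for \<open>V\<close> and coercivity
      allow on \<open>{-T..T}\<close>; the cutoff equals 1 up to here and vanishes beyond
      \<open>N + 1\<close>.\<close>
    define N where "N = sqrt (c * (V x0 * exp (C' * T)))"
    have N: "N \<ge> 0" using c V0[of x0] by (simp add: N_def)
    define \<psi> :: "'a \<Rightarrow> real" where "\<psi> x = max 0 (min 1 (N + 1 - norm x))" for x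
    have \<psi>: "0 \<le> \<psi> x" "\<psi> x \<le> 1" "norm x \<le> N \<Longrightarrow> \<psi> x = 1" "norm x \<ge> N + 1 \<Longrightarrow> \<psi> x = 0" for x
      by (auto simp: \<psi>_def)
    have \<psi>_lip: "\<bar>\<psi> x - \<psi> y\<bar> \<le> norm (x - y)" for x y
      using norm_triangle_ineq3[of x y] by (auto simp: \<psi>_def max_def min_def)
    \<comment> \<open>Time is frozen outside \<open>{-T..T}\<close>: the bounds on the field hold on
      bounded time intervals, but the truncated field has to be bounded and Lipschitz for all
      times.\<close>
    define cl where "cl t = max (-T) (min T t)" for t :: real
    have cl: "\<bar>cl t\<bar> \<le> T" "\<bar>t\<bar> \<le> T \<Longrightarrow> cl t = t" for t using T by (auto simp: cl_def)
    define G where "G t x = \<psi> x *\<^sub>R F (cl t) x" for t x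
    have contcl: "continuous_on UNIV cl" unfolding cl_def by (intro continuous_intros)
    have contFcl: "continuous_on UNIV (\<lambda>(t, x). F (cl t) x)"
    proof -
      have "continuous_on UNIV (\<lambda>p. case (cl (fst p), snd p :: 'a) of (t, x) \<Rightarrow> F t x)"
        by (intro continuous_on_compose2[OF cont] continuous_on_Pair continuous_on_compose2[OF contcl] continuous_intros) auto
      then show ?thesis by (simp add: case_prod_beta)
    qed
    have contG: "continuous_on UNIV (\<lambda>(t, x). G t x)"
    proof -
      have "continuous_on UNIV (\<lambda>p::real \<times> 'a. \<psi> (snd p) *\<^sub>R (case p of (t, x) \<Rightarrow> F (cl t) x))"
        unfolding \<psi>_def by (intro continuous_intros contFcl)
      then show ?thesis by (simp add: G_def case_prod_beta)
    qed
    obtain B where B: "B \<ge> 0" "\<And>t x. \<bar>t\<bar> \<le> T \<Longrightarrow> norm x \<le> N + 1 \<Longrightarrow> norm (F t x) \<le> B"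
    proof -
      have "compact ((\<lambda>(t, x). F t x) ` ({-T..T} \<times> cball 0 (N + 1)))"
        by (intro compact_continuous_image compact_Times continuous_on_subset[OF cont]) auto
      from compact_imp_bounded[OF this] obtain B where
        B: "\<forall>z\<in>(\<lambda>(t, x). F t x) ` ({-T..T} \<times> cball 0 (N + 1)). norm z \<le> B" unfolding bounded_iff by blast
      have "norm (F t x) \<le> max B 0" if "\<bar>t\<bar> \<le> T" "norm x \<le> N + 1" for t x
      proof -
        have "F t x \<in> (\<lambda>(t, x). F t x) ` ({-T..T} \<times> cball 0 (N + 1))"
          using that by (intro image_eqI[of _ _ "(t, x)"]) (auto simp: abs_le_iff)
        from bspec[OF B this] show ?thesis by simp
      qed
      then show ?thesis using that[of "max B 0"] by simp
    qed
    obtain L where L: "L \<ge> 0" "\<And>t x y. \<bar>t\<bar> \<le> T \<Longrightarrow> norm x \<le> N + 1 \<Longrightarrow> norm y \<le> N + 1 \<Longrightarrow>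
        norm (F t x - F t y) \<le> L * norm (x - y)"
      using lip unfolding ball_lipschitz_def by metis
    have G_bd: "norm (G t x) \<le> B" for t x
    proof (cases "norm x \<le> N + 1")
      case True
      have "\<psi> x * norm (F (cl t) x) \<le> 1 * B"
        using B \<psi>[of x] cl(1)[of t] True by (intro mult_mono) auto
      then show ?thesis using \<psi>[of x] by (simp add: G_def)
    next
      case False then show ?thesis using \<psi>(4)[of x] B by (simp add: G_def)
    qed
    \<comment> \<open>The difference is split so that the difference of the cutoffs multiplies the
      field at \<open>x\<close>, which lies in the ball; the other term vanishes unless
      \<open>y\<close> lies there, too. One point in the ball is therefore enough.\<close>
    have half: "norm (G t x - G t y) \<le> (B + L) * norm (x - y)" if x: "norm x \<le> N + 1" for t x y
    proof -
      have "G t x - G t y = (\<psi> x - \<psi> y) *\<^sub>R F (cl t) x + \<psi> y *\<^sub>R (F (cl t) x - F (cl t) y)"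
        by (simp add: G_def algebra_simps)
      then have "norm (G t x - G t y) \<le> \<bar>\<psi> x - \<psi> y\<bar> * norm (F (cl t) x) + \<psi> y * norm (F (cl t) x - F (cl t) y)"
        using norm_triangle_ineq[of "(\<psi> x - \<psi> y) *\<^sub>R F (cl t) x" "\<psi> y *\<^sub>R (F (cl t) x - F (cl t) y)"]
          \<psi>(1)[of y] by simp
      also have "\<dots> \<le> norm (x - y) * B + L * norm (x - y)"
      proof (rule add_mono)
        show "\<bar>\<psi> x - \<psi> y\<bar> * norm (F (cl t) x) \<le> norm (x - y) * B"
          using B x cl(1)[of t] by (intro mult_mono \<psi>_lip) auto
        show "\<psi> y * norm (F (cl t) x - F (cl t) y) \<le> L * norm (x - y)"
        proof (cases "norm y \<le> N + 1")
          case True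
          then have "\<psi> y * norm (F (cl t) x - F (cl t) y) \<le> 1 * (L * norm (x - y))"
            using L x \<psi>[of y] cl(1)[of t] by (intro mult_mono) auto
          then show ?thesis by simp
        next
          case False then show ?thesis using \<psi>(4)[of y] L(1) by simp
        qed
      qed
      finally show ?thesis by (simp add: algebra_simps)
    qed
    have G_lip: "norm (G t x - G t y) \<le> (B + L) * norm (x - y)" for t x y
    proof (cases "norm x \<le> N + 1 \<or> norm y \<le> N + 1")
      case True then show ?thesis using half[of x t y] half[of y t x] by (auto simp: norm_minus_commute)
    next
      case False then show ?thesis using \<psi>(4)[of x] \<psi>(4)[of y] B L by (simp add: G_def)
    qed
    obtain y where y: "y 0 = x0" "\<And>t. (y has_vector_derivative G t (y t)) (at t)"
      using picard_lindelof_global[OF contG G_lip G_bd] by metis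
    have small: "norm (y t) \<le> N" if t: "\<bar>t\<bar> \<le> T" for t
    proof -
      have "V (y t) \<le> V (y 0) * exp (C' * \<bar>t\<bar>)"
      proof (rule growth_bound[OF _ _ t])
        fix s assume s: "\<bar>s\<bar> \<le> T"
        show "((\<lambda>t. V (y t)) has_real_derivative DV (y s) (G s (y s))) (at s)"
          by (rule V[OF y(2)])
        have "\<bar>DV (y s) (G s (y s))\<bar> = \<psi> (y s) * \<bar>DV (y s) (F s (y s))\<bar>"
          using \<psi>[of "y s"] cl(2)[OF s] by (simp add: G_def DV abs_mult)
        also have "\<dots> \<le> 1 * (C' * V (y s))"
          using \<psi>[of "y s"] C'(1)[OF s] by (intro mult_mono) auto
        finally show "\<bar>DV (y s) (G s (y s))\<bar> \<le> C' * V (y s)" by simp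
      qed
      also have "\<dots> \<le> V x0 * exp (C' * T)"
        using t y(1) V0[of x0] C'(2)[of 0] T by (intro mult_mono) (auto intro: mult_left_mono)
      finally have "(norm (y t))\<^sup>2 \<le> c * (V x0 * exp (C' * T))"
        using coercive[of "y t"] c by (meson mult_left_mono less_imp_le order_trans)
      then show ?thesis unfolding N_def by (rule real_le_rsqrt)
    qed
    have "(y has_vector_derivative F t (y t)) (at t)" if t: "\<bar>t\<bar> \<le> T" for t
      using y(2)[of t] cl(2)[OF t] \<psi>(3)[OF small[OF t]] by (simp add: G_def)
    with y(1) show ?thesis by blast
  qed
  then obtain Y where Y: "\<And>T. T \<ge> 0 \<Longrightarrow> Y T 0 = x0"
    "\<And>T t. T \<ge> 0 \<Longrightarrow> \<bar>t\<bar> \<le> T \<Longrightarrow> (Y T has_vector_derivative F t (Y T t)) (at t)" by metis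
  \<comment> \<open>The extra 1 makes one and the same local solution valid on a neighbourhood of
    \<open>t\<close>, as the derivative at \<open>t\<close> requires.\<close>
  define y where "y t = Y (\<bar>t\<bar> + 1) t" for t
  have agree: "y t = Y T t" if "\<bar>t\<bar> \<le> T" for t T
  proof -
    have "Y (\<bar>t\<bar> + 1) t = Y T t"
      by (rule ode_unique[OF lip, where T = "\<bar>t\<bar>"]) (use Y that in auto)
    then show ?thesis by (simp add: y_def)
  qed
  have "(y has_vector_derivative F t (y t)) (at t)" for t
  proof -
    have "(Y (\<bar>t\<bar> + 1) has_vector_derivative F t (y t)) (at t)"
      unfolding y_def using Y(2)[of "\<bar>t\<bar> + 1" t] by simp
    then show ?thesis
      by (rule has_vector_derivative_transform_within_open[where S = "{-\<bar>t\<bar>-1<..<\<bar>t\<bar>+1}"])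
         (auto intro!: agree[symmetric])
  qed
  moreover have "y 0 = x0" using Y(1) by (simp add: y_def)
  ultimately show ?thesis by blast
qed

section \<open>Locally Lipschitz functions\<close>

text \<open>Lipschitz on every ball. The class is closed under sums, products, sine, cosine and
  division by functions bounded away from zero, so the regularity of all coefficients is read off
  their terms, without derivatives.\<close>

definition lips :: "('a::real_normed_vector \<Rightarrow> 'b::real_normed_vector) \<Rightarrow> bool" where
  "lips f \<longleftrightarrow> (\<forall>M. \<exists>L\<ge>0. \<forall>x y. norm x \<le> M \<longrightarrow> norm y \<le> M \<longrightarrow> norm (f x - f y) \<le> L * norm (x - y))"

lemma lipsE:
  assumes "lips f"
  obtains L where "L \<ge> 0" "\<And>x y. norm x \<le> M \<Longrightarrow> norm y \<le> M \<Longrightarrow> norm (f x - f y) \<le> L * norm (x - y)"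
  using assms unfolding lips_def by metis

lemma lips_bounded:
  assumes "lips f" shows "\<exists>B\<ge>0. \<forall>x. norm x \<le> M \<longrightarrow> norm (f x) \<le> B"
proof (cases "M \<ge> 0")
  case True
  obtain L where L: "L \<ge> 0" "\<And>x y. norm x \<le> M \<Longrightarrow> norm y \<le> M \<Longrightarrow> norm (f x - f y) \<le> L * norm (x - y)"
    using lipsE[OF assms] by metis
  have "norm (f x) \<le> norm (f 0) + L * M" if "norm x \<le> M" for x
    using L(2)[of x 0] that True norm_triangle_sub[of "f x" "f 0"] mult_left_mono[OF that L(1)] by simp
  then show ?thesis using L True by (intro exI[of _ "norm (f 0) + L * M"]) auto
next
  case False
  then have "\<not> norm x \<le> M" for x :: 'a using norm_ge_zero[of x] by linarith
  then show ?thesis by (intro exI[of _ 0]) auto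
qed

lemma lips_compose_nonexpansive:
  assumes "lips f" "\<And>x y. norm (g x - g y) \<le> norm (x - y)"
  shows "lips (\<lambda>x. g (f x))"
  using assms unfolding lips_def by (meson order_trans)

lemma lips_const: "lips (\<lambda>_. c)"
  unfolding lips_def by (auto intro: exI[of _ 0])

lemma lips_id: "lips (\<lambda>x. x)"
  unfolding lips_def by (auto intro: exI[of _ 1])

lemma lips_bounded_linear:
  assumes "bounded_linear g" "lips f" shows "lips (\<lambda>x. g (f x))"
  unfolding lips_def
proof
  fix M
  interpret bounded_linear g by fact
  obtain K where K: "K > 0" "\<And>x. norm (g x) \<le> norm x * K" using pos_bounded by blast
  obtain L where L: "L \<ge> 0" "\<And>x y. norm x \<le> M \<Longrightarrow> norm y \<le> M \<Longrightarrow> norm (f x - f y) \<le> L * norm (x - y)"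
    using lipsE[OF assms(2)] by metis
  have "norm (g (f x) - g (f y)) \<le> (L * K) * norm (x - y)" if "norm x \<le> M" "norm y \<le> M" for x y
    using order_trans[OF K(2)[of "f x - f y"] mult_right_mono[OF L(2)[OF that], of K]] K(1)
    by (simp add: diff mult_ac)
  then show "\<exists>L\<ge>0. \<forall>x y. norm x \<le> M \<longrightarrow> norm y \<le> M \<longrightarrow> norm (g (f x) - g (f y)) \<le> L * norm (x - y)"
    using L K by (intro exI[of _ "L * K"]) auto
qed

lemma lips_add:
  assumes "lips f" "lips g" shows "lips (\<lambda>x. f x + g x)"
  unfolding lips_def
proof
  fix M
  obtain L where L: "L \<ge> 0" "\<And>x y. norm x \<le> M \<Longrightarrow> norm y \<le> M \<Longrightarrow> norm (f x - f y) \<le> L * norm (x - y)"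
    using lipsE[OF assms(1)] by metis
  obtain K where K: "K \<ge> 0" "\<And>x y. norm x \<le> M \<Longrightarrow> norm y \<le> M \<Longrightarrow> norm (g x - g y) \<le> K * norm (x - y)"
    using lipsE[OF assms(2)] by metis
  have "norm (f x + g x - (f y + g y)) \<le> (L + K) * norm (x - y)" if "norm x \<le> M" "norm y \<le> M" for x y
    using L(2)[OF that] K(2)[OF that] norm_diff_triangle_ineq[of "f x" "g x" "f y" "g y"]
    by (simp add: algebra_simps)
  then show "\<exists>L\<ge>0. \<forall>x y. norm x \<le> M \<longrightarrow> norm y \<le> M \<longrightarrow> norm (f x + g x - (f y + g y)) \<le> L * norm (x - y)"
    using L K by (intro exI[of _ "L + K"]) auto
qed

lemma lips_mult:
  fixes f g :: "'a::real_normed_vector \<Rightarrow> real"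
  assumes "lips f" "lips g" shows "lips (\<lambda>x. f x * g x)"
  unfolding lips_def
proof
  fix M
  obtain L where L: "L \<ge> 0" "\<And>x y. norm x \<le> M \<Longrightarrow> norm y \<le> M \<Longrightarrow> norm (f x - f y) \<le> L * norm (x - y)"
    using lipsE[OF assms(1)] by metis
  obtain K where K: "K \<ge> 0" "\<And>x y. norm x \<le> M \<Longrightarrow> norm y \<le> M \<Longrightarrow> norm (g x - g y) \<le> K * norm (x - y)"
    using lipsE[OF assms(2)] by metis
  obtain A where A: "A \<ge> 0" "\<And>x. norm x \<le> M \<Longrightarrow> norm (f x) \<le> A" using lips_bounded[OF assms(1)] by blast
  obtain B where B: "B \<ge> 0" "\<And>x. norm x \<le> M \<Longrightarrow> norm (g x) \<le> B" using lips_bounded[OF assms(2)] by blast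
  have "norm (f x * g x - f y * g y) \<le> (A * K + L * B) * norm (x - y)"
    if "norm x \<le> M" "norm y \<le> M" for x y
  proof -
    have "f x * g x - f y * g y = f x * (g x - g y) + (f x - f y) * g y" by (simp add: algebra_simps)
    then have "norm (f x * g x - f y * g y) \<le> norm (f x) * norm (g x - g y) + norm (f x - f y) * norm (g y)"
      using norm_triangle_ineq[of "f x * (g x - g y)" "(f x - f y) * g y"] by (simp only: norm_mult)
    also have "\<dots> \<le> A * (K * norm (x - y)) + (L * norm (x - y)) * B"
      using A(1) L(1) by (intro add_mono mult_mono A(2) B(2) L(2) K(2) that) auto
    finally show ?thesis by (simp add: algebra_simps)
  qed
  then show "\<exists>L\<ge>0. \<forall>x y. norm x \<le> M \<longrightarrow> norm y \<le> M \<longrightarrow> norm (f x * g x - f y * g y) \<le> L * norm (x - y)"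
    using L K A B by (intro exI[of _ "A * K + L * B"]) auto
qed

lemma lips_uminus:
  assumes "lips f" shows "lips (\<lambda>x. - f x)"
  by (rule lips_bounded_linear[OF bounded_linear_minus[OF bounded_linear_ident] assms])

lemma lips_diff:
  assumes "lips f" "lips g" shows "lips (\<lambda>x. f x - g x)"
  using lips_add[OF assms(1) lips_uminus[OF assms(2)]] by simp

lemma lips_power2: "lips f \<Longrightarrow> lips (\<lambda>x. (f x)\<^sup>2)" for f :: "'a::real_normed_vector \<Rightarrow> real"
  using lips_mult[of f f] by (simp add: power2_eq_square)

lemma lips_divide:
  fixes f g :: "'a::real_normed_vector \<Rightarrow> real"
  assumes "lips f" "lips g" "\<And>x. g x \<ge> c" "c > 0" shows "lips (\<lambda>x. f x / g x)"
proof -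
  have "lips (\<lambda>x. inverse (g x))"
    unfolding lips_def
  proof
    fix M
    obtain K where K: "K \<ge> 0" "\<And>x y. norm x \<le> M \<Longrightarrow> norm y \<le> M \<Longrightarrow> norm (g x - g y) \<le> K * norm (x - y)"
      using lipsE[OF assms(2)] by metis
    have "norm (inverse (g x) - inverse (g y)) \<le> (K / (c * c)) * norm (x - y)"
      if "norm x \<le> M" "norm y \<le> M" for x y
    proof -
      have pos: "g x > 0" "g y > 0" using assms(3)[of x] assms(3)[of y] assms(4) by linarith+
      have "norm (inverse (g x) - inverse (g y)) = norm (g x - g y) / (g x * g y)"
        using pos by (subst inverse_diff_inverse) (auto simp: abs_mult divide_simps)
      also have "\<dots> \<le> (K * norm (x - y)) / (c * c)"
        using pos assms(3,4) K(1) by (intro frac_le K(2) that mult_mono) auto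
      finally show ?thesis by simp
    qed
    then show "\<exists>L\<ge>0. \<forall>x y. norm x \<le> M \<longrightarrow> norm y \<le> M \<longrightarrow> norm (inverse (g x) - inverse (g y)) \<le> L * norm (x - y)"
      using K by (intro exI[of _ "K / (c * c)"]) auto
  qed
  from lips_mult[OF assms(1) this] show ?thesis by (simp add: divide_inverse)
qed

lemma lips_sin: "lips f \<Longrightarrow> lips (\<lambda>x. sin (f x))" for f :: "'a::real_normed_vector \<Rightarrow> real"
proof (erule lips_compose_nonexpansive)
  fix a b :: real
  have "\<bar>sin a - sin b\<bar> = 2 * (\<bar>sin ((a - b) / 2)\<bar> * \<bar>cos ((a + b) / 2)\<bar>)"
    by (simp add: sin_diff_sin abs_mult)
  also have "\<dots> \<le> 2 * (\<bar>(a - b) / 2\<bar> * 1)"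
    by (intro mult_left_mono mult_mono abs_sin_x_le_abs_x) auto
  finally show "norm (sin a - sin b) \<le> norm (a - b)" by simp
qed

lemma lips_cos: "lips f \<Longrightarrow> lips (\<lambda>x. cos (f x))" for f :: "'a::real_normed_vector \<Rightarrow> real"
  using lips_sin[OF lips_diff[OF lips_const[of "pi / 2"]], of f] by (simp add: sin_diff)

lemma lips_Pair:
  assumes "lips f" "lips g" shows "lips (\<lambda>x. (f x, g x))"
proof -
  have "lips (\<lambda>x. (f x, 0) + (0, g x))"
    by (intro lips_add lips_bounded_linear[OF bounded_linear_Pair[OF bounded_linear_ident bounded_linear_zero] assms(1)]
      lips_bounded_linear[OF bounded_linear_Pair[OF bounded_linear_zero bounded_linear_ident] assms(2)])
  then show ?thesis by simp
qed

lemma lips_fst: "lips f \<Longrightarrow> lips (\<lambda>x. fst (f x))" and lips_snd: "lips f \<Longrightarrow> lips (\<lambda>x. snd (f x))"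
  by (rule lips_bounded_linear[OF bounded_linear_fst] lips_bounded_linear[OF bounded_linear_snd]; assumption)+

lemmas lips_intros = lips_const lips_id lips_add lips_diff lips_uminus lips_mult lips_power2
  lips_sin lips_cos lips_Pair lips_fst lips_snd

lemma lips_continuous:
  fixes f :: "'a::real_normed_vector \<Rightarrow> 'b::real_normed_vector"
  assumes "lips f" shows "continuous_on UNIV f"
  unfolding continuous_on_iff
proof safe
  fix x :: 'a and e :: real assume e: "e > 0"
  obtain L where L: "L \<ge> 0" "\<And>y z. norm y \<le> norm x + 1 \<Longrightarrow> norm z \<le> norm x + 1 \<Longrightarrow> norm (f y - f z) \<le> L * norm (y - z)"
    using lipsE[OF assms] by metis
  have "dist (f y) (f x) < e" if "dist y x < min 1 (e / (L + 1))" for y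
  proof -
    have "norm y \<le> norm x + 1" using that norm_triangle_sub[of y x] by (simp add: dist_norm)
    then have "dist (f y) (f x) \<le> L * dist y x" using L(2)[of y x] by (simp add: dist_norm)
    also have "\<dots> \<le> (L + 1) * dist y x" by (simp add: mult_right_mono)
    also have "\<dots> < e" using that L(1) by (simp add: pos_less_divide_eq mult.commute)
    finally show ?thesis .
  qed
  then show "\<exists>d>0. \<forall>x'\<in>UNIV. dist x' x < d \<longrightarrow> dist (f x') (f x) < e"
    using e L(1) by (intro exI[of _ "min 1 (e / (L + 1))"]) auto
qed

section \<open>Stieltjes equations as ordinary differential equations\<close>

lemma has_vector_derivative_quad_iff:
  "((\<lambda>t. (a t, b t, c t, d t)) has_vector_derivative (a', b', c', d')) (at t) \<longleftrightarrow>
    (a has_real_derivative a') (at t) \<and> (b has_real_derivative b') (at t) \<and>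
    (c has_real_derivative c') (at t) \<and> (d has_real_derivative d') (at t)"
  (is "?L \<longleftrightarrow> ?R")
proof
  assume ?L
  note fst' = bounded_linear.has_vector_derivative[OF bounded_linear_fst]
    and snd' = bounded_linear.has_vector_derivative[OF bounded_linear_snd]
  show ?R
    using fst'[OF \<open>?L\<close>] snd'[OF \<open>?L\<close>] fst'[OF snd'[OF \<open>?L\<close>]] snd'[OF snd'[OF \<open>?L\<close>]]
      fst'[OF snd'[OF snd'[OF \<open>?L\<close>]]] snd'[OF snd'[OF snd'[OF \<open>?L\<close>]]]
    by (simp add: has_real_derivative_iff_has_vector_derivative)
next
  assume ?R
  then show ?L
    unfolding has_real_derivative_iff_has_vector_derivative by (intro has_vector_derivative_Pair) simp_all
qed

lemma integrated_form_iff: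
  fixes W h :: "real \<Rightarrow> 'a::euclidean_space"
  assumes h: "continuous_on UNIV h"
  shows "(\<forall>s t. s \<le> t \<longrightarrow> W t - W s = integral {s..t} h) \<longleftrightarrow> (\<forall>t. (W has_vector_derivative h t) (at t))"
proof
  assume *: "\<forall>s t. s \<le> t \<longrightarrow> W t - W s = integral {s..t} h"
  have "(\<lambda>t. W 0 + signed_integral h t) = W"
  proof
    fix t have "W t = W 0 + signed_integral h t"
    proof (cases "0 \<le> t")
      case True
      then have "integral {t..0} h = 0" by (cases "t = 0") auto
      then show ?thesis using *[rule_format, OF True] by (simp add: signed_integral_def algebra_simps)
    next
      case False
      then show ?thesis using *[rule_format, of t 0] by (simp add: signed_integral_def algebra_simps)
    qed
    then show "W 0 + signed_integral h t = W t" ..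
  qed
  moreover have "((\<lambda>t. W 0 + signed_integral h t) has_vector_derivative h t) (at t)" for t
    using signed_integral_has_vector_derivative[OF h] by (auto intro!: derivative_eq_intros)
  ultimately show "\<forall>t. (W has_vector_derivative h t) (at t)" by (simp only: simp_thms)
next
  assume *: "\<forall>t. (W has_vector_derivative h t) (at t)"
  show "\<forall>s t. s \<le> t \<longrightarrow> W t - W s = integral {s..t} h"
  proof safe
    fix s t :: real assume "s \<le> t"
    then have "(h has_integral (W t - W s)) {s..t}"
      using * by (intro fundamental_theorem_of_calculus) (auto intro: has_vector_derivative_at_within)
    from integral_unique[OF this] show "W t - W s = integral {s..t} h" ..
  qed
qed

text \<open>Integration by parts trades the increments of \<omega> for its values: although the path
  is merely continuous, what remains of \<open>V\<close> after subtracting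
  \<open>\<omega> t *\<^sub>R G t\<close> has a continuous derivative.\<close>

lemma rs_equation_iff:
  fixes V G G' f :: "real \<Rightarrow> 'a::euclidean_space"
  assumes \<omega>: "continuous_on UNIV \<omega>" and f: "continuous_on UNIV f"
    and G: "\<And>r. (G has_vector_derivative G' r) (at r)" and G': "continuous_on UNIV G'"
  shows "(\<forall>s t. s \<le> t \<longrightarrow> has_rs_integral G \<omega> s t (V t - V s - integral {s..t} f)) \<longleftrightarrow>
    (\<forall>t. ((\<lambda>t. V t - \<omega> t *\<^sub>R G t) has_vector_derivative (f t - \<omega> t *\<^sub>R G' t)) (at t))"
proof -
  define W where "W t = V t - \<omega> t *\<^sub>R G t" for t
  have int: "f integrable_on {s..t}" "(\<lambda>r. \<omega> r *\<^sub>R G' r) integrable_on {s..t}" for s t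
    by (intro integrable_continuous_real continuous_on_subset[OF f] 
      continuous_on_subset[OF continuous_on_scaleR[OF \<omega> G']]; simp)+
  have bp: "has_rs_integral G \<omega> s t (\<omega> t *\<^sub>R G t - \<omega> s *\<^sub>R G s - integral {s..t} (\<lambda>r. \<omega> r *\<^sub>R G' r))"
    if "s \<le> t" for s t
    by (intro has_rs_integral_by_parts that has_vector_derivative_at_within[OF G]
      continuous_on_subset[OF \<omega>] continuous_on_subset[OF G'] subset_UNIV)
  have "has_rs_integral G \<omega> s t (V t - V s - integral {s..t} f) \<longleftrightarrow>
      W t - W s = integral {s..t} (\<lambda>r. f r - \<omega> r *\<^sub>R G' r)" if "s \<le> t" for s t
  proof -
    have "has_rs_integral G \<omega> s t (V t - V s - integral {s..t} f) \<longleftrightarrow>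
      V t - V s - integral {s..t} f = \<omega> t *\<^sub>R G t - \<omega> s *\<^sub>R G s - integral {s..t} (\<lambda>r. \<omega> r *\<^sub>R G' r)"
      using has_rs_integral_unique[OF _ bp[OF that] that] bp[OF that] by metis
    also have "\<dots> \<longleftrightarrow> W t - W s = integral {s..t} f - integral {s..t} (\<lambda>r. \<omega> r *\<^sub>R G' r)"
      unfolding W_def by (auto simp: algebra_simps)
    also have "integral {s..t} f - integral {s..t} (\<lambda>r. \<omega> r *\<^sub>R G' r) = integral {s..t} (\<lambda>r. f r - \<omega> r *\<^sub>R G' r)"
      by (rule integral_diff[symmetric]) (rule int)+
    finally show ?thesis .
  qed
  then have "(\<forall>s t. s \<le> t \<longrightarrow> has_rs_integral G \<omega> s t (V t - V s - integral {s..t} f)) \<longleftrightarrow>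
     (\<forall>s t. s \<le> t \<longrightarrow> W t - W s = integral {s..t} (\<lambda>r. f r - \<omega> r *\<^sub>R G' r))" by blast
  also have "\<dots> \<longleftrightarrow> (\<forall>t. (W has_vector_derivative (f t - \<omega> t *\<^sub>R G' t)) (at t))"
    by (intro integrated_form_iff continuous_intros f \<omega> G')
  finally show ?thesis unfolding W_def .
qed

lemma continuous_on_compose_UNIV: "continuous_on UNIV f \<Longrightarrow> continuous_on S g \<Longrightarrow> continuous_on S (\<lambda>x. f (g x))"
  by (rule continuous_on_compose2) auto

section \<open>The equation in momentum coordinates\<close>

locale pendulum =
  fixes \<zeta>1 \<zeta>2 \<kappa>1 \<kappa>2 \<gamma> \<sigma> :: real
  assumes \<zeta>1: "\<zeta>1 > 0" and \<zeta>2: "\<zeta>2 > 0" and \<kappa>1: "\<kappa>1 > 0" and \<kappa>2: "\<kappa>2 > 0" and \<sigma>: "\<sigma> > 0"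
    and \<gamma>: "0 < \<gamma>" "\<gamma> < 1"
begin

definition den :: "real \<Rightarrow> real" where "den u = 1 - \<gamma> * (sin u)\<^sup>2"

lemma den_bounds: "1 - \<gamma> \<le> den u" "den u \<le> 1" "0 < den u" "den u \<noteq> 0"
proof -
  have "0 \<le> (sin u)\<^sup>2" "(sin u)\<^sup>2 \<le> 1" by (auto simp: abs_square_le_1)
  then have "\<gamma> * (sin u)\<^sup>2 \<le> \<gamma> * 1" "0 \<le> \<gamma> * (sin u)\<^sup>2" using \<gamma> by (intro mult_left_mono mult_nonneg_nonneg; simp)+
  then show "1 - \<gamma> \<le> den u" "den u \<le> 1" by (auto simp: den_def)
  then show "0 < den u" "den u \<noteq> 0" using \<gamma> by linarith+
qed

lemma den_eq: "den u = 1 - \<gamma> * (sin u * sin u)"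
  by (simp add: den_def power2_eq_square)

text \<open>The velocities of the cart and of the pendulum as functions of the momenta \<open>x\<close> and \<open>y\<close>.\<close>

definition vel1 :: "real \<Rightarrow> real \<Rightarrow> real \<Rightarrow> real" where
  "vel1 x u y = (x + \<gamma> * y * sin u) / den u"

definition vel2 :: "real \<Rightarrow> real \<Rightarrow> real \<Rightarrow> real" where
  "vel2 x u y = (x * sin u + y) / den u"

text \<open>The diffeomorphism that makes the noise additive, lifted to the cover.\<close>

definition mom :: "lifted \<Rightarrow> lifted" where
  "mom = (\<lambda>(v1, v2, u1, u2). (v1, v2 - \<gamma> * u2 * sin u1, u1, u2 - v2 * sin u1))"

definition unmom :: "lifted \<Rightarrow> lifted" where
  "unmom = (\<lambda>(v, x, u, y). (v, vel1 x u y, u, vel2 x u y))"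

lemma vel_mom:
  "vel1 (v2 - \<gamma> * u2 * sin u) u (u2 - v2 * sin u) = v2"
  "vel2 (v2 - \<gamma> * u2 * sin u) u (u2 - v2 * sin u) = u2"
  using den_bounds(4)[of u]
  by (simp_all add: vel1_def vel2_def divide_eq_eq) (simp_all add: den_eq algebra_simps)

lemma mom_vel:
  "vel1 x u y - \<gamma> * vel2 x u y * sin u = x" "vel2 x u y - vel1 x u y * sin u = y"
proof -
  have "vel1 x u y - \<gamma> * vel2 x u y * sin u = ((x + \<gamma> * y * sin u) - \<gamma> * (x * sin u + y) * sin u) / den u"
    "vel2 x u y - vel1 x u y * sin u = ((x * sin u + y) - (x + \<gamma> * y * sin u) * sin u) / den u"
    by (simp_all add: vel1_def vel2_def diff_divide_distrib)
  then show "vel1 x u y - \<gamma> * vel2 x u y * sin u = x" "vel2 x u y - vel1 x u y * sin u = y"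
    using den_bounds(4)[of u] by (simp_all add: divide_eq_eq) (simp_all add: den_eq algebra_simps)
qed

lemma unmom_mom [simp]: "unmom (mom X) = X"
  by (cases X) (simp add: mom_def unmom_def vel_mom)

lemma mom_unmom [simp]: "mom (unmom p) = p"
  by (cases p) (simp add: mom_def unmom_def mom_vel)

lemma lips_den: "lips f \<Longrightarrow> lips (\<lambda>p. den (f p))" for f :: "'a::real_normed_vector \<Rightarrow> real"
  unfolding den_def by (intro lips_intros)

lemma lips_vel1: "lips f \<Longrightarrow> lips g \<Longrightarrow> lips h \<Longrightarrow> lips (\<lambda>p. vel1 (f p) (g p) (h p))"
  and lips_vel2: "lips f \<Longrightarrow> lips g \<Longrightarrow> lips h \<Longrightarrow> lips (\<lambda>p. vel2 (f p) (g p) (h p))"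
  for f g h :: "'a::real_normed_vector \<Rightarrow> real"
  unfolding vel1_def vel2_def
  by (rule lips_divide[where c = "1 - \<gamma>"]; use den_bounds(1) \<gamma> in \<open>auto simp: den_def intro!: lips_intros\<close>)+

lemma lips_mom: "lips mom"
  unfolding mom_def case_prod_beta by (intro lips_intros)

lemma lips_unmom: "lips unmom"
  unfolding unmom_def case_prod_beta by (intro lips_intros lips_vel1 lips_vel2)

text \<open>The deterministic vector field in the momentum coordinates, in which the noise is additive.\<close>

definition field :: "lifted \<Rightarrow> lifted" where
  "field = (\<lambda>(v, x, u, y). (vel1 x u y, - \<kappa>1 * v - 2 * \<zeta>1 * vel1 x u y, vel2 x u y,
     - \<kappa>2 * sin u - 2 * \<zeta>2 * vel2 x u y - vel1 x u y * vel2 x u y * cos u))"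

lemma lips_field: "lips field"
  unfolding field_def case_prod_beta by (intro lips_intros lips_vel1 lips_vel2)

definition noise_vec :: "real \<Rightarrow> lifted" where "noise_vec a = (0, a, 0, 0)"

lemma noise_vec_simps [simp]: "(v, x, u, y) + noise_vec a = (v, x + a, u, y)" "(v, x, u, y) - noise_vec a = (v, x - a, u, y)"
  "noise_vec 0 = 0" "noise_vec (a + b) = noise_vec a + noise_vec b"
  by (simp_all add: noise_vec_def zero_prod_def)

lemma norm_noise_vec [simp]: "norm (noise_vec a) = \<bar>a\<bar>"
  by (simp add: noise_vec_def norm_prod_def)

definition path_ode :: "(real \<Rightarrow> real) \<Rightarrow> (real \<Rightarrow> lifted) \<Rightarrow> bool" where
  "path_ode \<omega> p \<longleftrightarrow> (\<forall>t. (p has_vector_derivative field (p t + noise_vec (\<sigma> * \<omega> t))) (at t))"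

section \<open>Equivalence of the stochastic equation and the random differential equation\<close>

abbreviation "F \<equiv> drift \<zeta>1 \<zeta>2 \<kappa>1 \<kappa>2 \<gamma>"
abbreviation "G \<equiv> diffusion \<gamma> \<sigma>"

text \<open>The reciprocal is kept as an atom that satisfies one polynomial relation with the sine;
  identities with denominators become polynomial identities modulo that relation and the Pythagorean
  one.\<close>

definition rden :: "real \<Rightarrow> real" where "rden u = inverse (den u)"

lemma rden_eq: "rden u * (1 - \<gamma> * (sin u * sin u)) = 1"
  using den_bounds(4)[of u] by (simp add: rden_def den_eq)

lemma diffusion_eq: "G (x1, x2, x3, x4) = (0, \<sigma> * rden x3, 0, \<sigma> * rden x3 * sin x3)"
  by (simp add: diffusion_def rden_def den_def divide_inverse)

lemma lips_drift: "lips F"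
  unfolding drift_def case_prod_beta den_def[symmetric]
  by (intro lips_intros lips_divide[where c = "1 - \<gamma>"] lips_den den_bounds) (simp_all add: \<gamma>)

text \<open>The time derivative of \<open>G\<close> along a motion with angle \<open>u\<close> and
  angular velocity \<open>m\<close>.\<close>

definition G' :: "real \<Rightarrow> real \<Rightarrow> lifted" where
  "G' u m = (0, \<sigma> * (2 * \<gamma> * sin u * cos u * m * (rden u)\<^sup>2), 0,
     \<sigma> * (2 * \<gamma> * sin u * cos u * m * (rden u)\<^sup>2) * sin u + \<sigma> * rden u * (cos u * m))"

lemma rden_deriv:
  assumes "(u has_real_derivative m) (at t)"
  shows "((\<lambda>t. rden (u t)) has_real_derivative 2 * \<gamma> * sin (u t) * cos (u t) * m * (rden (u t))\<^sup>2) (at t)"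
  unfolding rden_def den_def using assms den_bounds(4)[of "u t", unfolded den_def]
  by (auto intro!: derivative_eq_intros simp: power2_eq_square)

lemma G_has_derivative:
  assumes "(V3 has_real_derivative m) (at t)"
  shows "((\<lambda>t. G (V1 t, V2 t, V3 t, V4 t)) has_vector_derivative G' (V3 t) m) (at t)"
  unfolding diffusion_eq G'_def has_vector_derivative_quad_iff
  using assms
  by (auto intro!: derivative_eq_intros rden_deriv)

text \<open>Both sides concern the same functions up to a linear change of variables whose
  coefficients depend on the angle, which is differentiable by assumption. The change is the
  momentum map, applied to the velocities after subtraction of their stochastic part.\<close>

lemma momentum_equation_iff:
  assumes V3: "\<And>t. (V3 has_real_derivative V4 t) (at t)"
  shows "(\<forall>t. ((\<lambda>t. (V1 t, V2 t, V3 t, V4 t) - \<omega> t *\<^sub>R G (V1 t, V2 t, V3 t, V4 t))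
        has_vector_derivative F (V1 t, V2 t, V3 t, V4 t) - \<omega> t *\<^sub>R G' (V3 t) (V4 t)) (at t)) \<longleftrightarrow>
    path_ode \<omega> (\<lambda>t. mom (V1 t, V2 t, V3 t, V4 t) - noise_vec (\<sigma> * \<omega> t))"
proof -
  define R where "R t = rden (V3 t)" for t
  define s where "s t = sin (V3 t)" for t
  define c where "c t = cos (V3 t)" for t
  define A where "A t = V2 t - \<omega> t * (\<sigma> * R t)" for t
  define B where "B t = V4 t - \<omega> t * (\<sigma> * R t * s t)" for t
  define x where "x t = V2 t - \<gamma> * V4 t * s t - \<sigma> * \<omega> t" for t
  define y where "y t = V4 t - V2 t * s t" for t
  define dR where "dR t = 2 * \<gamma> * s t * c t * V4 t * (R t)\<^sup>2" for t
  define dA where "dA t = (- 2 * \<zeta>1 * V2 t - \<kappa>1 * V1 t + \<gamma> * (V4 t)\<^sup>2 * c t - 2 * \<gamma> * \<zeta>2 * V4 t * s t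
         - \<gamma> * \<kappa>2 * (s t)\<^sup>2) * R t - \<omega> t * (\<sigma> * dR t)" for t
  define dB where "dB t = (- 2 * \<zeta>2 * V4 t - \<kappa>2 * s t - 2 * \<zeta>1 * V2 t * s t - \<kappa>1 * V1 t * s t
         + \<gamma> * (V4 t)\<^sup>2 * s t * c t) * R t
       - \<omega> t * (\<sigma> * dR t * s t + \<sigma> * R t * (c t * V4 t))" for t
  define dx where "dx t = - \<kappa>1 * V1 t - 2 * \<zeta>1 * V2 t" for t
  define dy where "dy t = - \<kappa>2 * s t - 2 * \<zeta>2 * V4 t - V2 t * V4 t * c t" for t
  have L: "((\<lambda>t. (V1 t, V2 t, V3 t, V4 t) - \<omega> t *\<^sub>R G (V1 t, V2 t, V3 t, V4 t))
        has_vector_derivative F (V1 t, V2 t, V3 t, V4 t) - \<omega> t *\<^sub>R G' (V3 t) (V4 t)) (at t) \<longleftrightarrow>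
     (V1 has_real_derivative V2 t) (at t) \<and> (A has_real_derivative dA t) (at t) \<and> (B has_real_derivative dB t) (at t)" for t
    using V3[of t]
    by (simp add: diffusion_eq has_vector_derivative_quad_iff drift_def G'_def A_def[abs_def] B_def[abs_def]
      dA_def dB_def R_def s_def c_def dR_def rden_def den_def divide_inverse)
  have R: "((\<lambda>t. mom (V1 t, V2 t, V3 t, V4 t) - noise_vec (\<sigma> * \<omega> t)) has_vector_derivative
     field (mom (V1 t, V2 t, V3 t, V4 t) - noise_vec (\<sigma> * \<omega> t) + noise_vec (\<sigma> * \<omega> t))) (at t) \<longleftrightarrow>
     (V1 has_real_derivative V2 t) (at t) \<and> (x has_real_derivative dx t) (at t) \<and> (y has_real_derivative dy t) (at t)" for t
    using V3[of t]
    by (simp add: mom_def field_def has_vector_derivative_quad_iff x_def[abs_def] y_def[abs_def] s_def c_def dx_def dy_def vel_mom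
      del: diff_add_cancel)
  have rd: "R t * (1 - \<gamma> * (s t * s t)) = 1" for t using rden_eq by (simp add: R_def s_def)
  have sc: "s t * s t + c t * c t = 1" for t
    using sin_cos_squared_add[of "V3 t"] by (simp add: s_def c_def power2_eq_square)
  \<comment> \<open>\<open>(x, y)\<close> is the image of \<open>(A, B)\<close> under the momentum
    map: the noise cancels in \<open>y\<close>, and in \<open>x\<close> its coefficient collapses to
    \<sigma> because of \<open>rd\<close>.\<close>
  have sub: "x = (\<lambda>t. A t - \<gamma> * B t * s t)" "y = (\<lambda>t. B t - A t * s t)"
    "A = (\<lambda>t. (x t + \<gamma> * y t * s t) * R t)" "B = (\<lambda>t. (x t * s t + y t) * R t)"
  proof -
    have "x t = A t - \<gamma> * B t * s t" for t
      using rd[of t] unfolding x_def y_def A_def B_def by algebra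
    moreover have "y t = B t - A t * s t" for t
      unfolding x_def y_def A_def B_def by algebra
    moreover have "A t = (x t + \<gamma> * y t * s t) * R t" for t
      using rd[of t] unfolding x_def y_def A_def B_def by algebra
    moreover have "B t = (x t * s t + y t) * R t" for t
      using rd[of t] unfolding x_def y_def A_def B_def by algebra
    ultimately show "x = (\<lambda>t. A t - \<gamma> * B t * s t)" "y = (\<lambda>t. B t - A t * s t)"
      "A = (\<lambda>t. (x t + \<gamma> * y t * s t) * R t)" "B = (\<lambda>t. (x t * s t + y t) * R t)" by blast+
  qed
  have ds: "(s has_real_derivative c t * V4 t) (at t)" for t
    unfolding s_def c_def using V3[of t] by (auto intro!: derivative_eq_intros)
  have dR: "(R has_real_derivative dR t) (at t)" for t
    using rden_deriv[OF V3[of t]] by (simp add: R_def[abs_def] dR_def s_def c_def)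
  \<comment> \<open>Both directions use the product rule; that the resulting derivatives are the
    required ones is an identity modulo \<open>rd\<close> and \<open>sc\<close>.\<close>
  have "(A has_real_derivative dA t) (at t) \<and> (B has_real_derivative dB t) (at t) \<longleftrightarrow>
     (x has_real_derivative dx t) (at t) \<and> (y has_real_derivative dy t) (at t)" for t
  proof
    assume h: "(A has_real_derivative dA t) (at t) \<and> (B has_real_derivative dB t) (at t)"
    have "((\<lambda>t. A t - \<gamma> * B t * s t) has_real_derivative dA t - (\<gamma> * dB t * s t + \<gamma> * B t * (c t * V4 t))) (at t)"
      "((\<lambda>t. B t - A t * s t) has_real_derivative dB t - (dA t * s t + A t * (c t * V4 t))) (at t)"
      using h ds by (auto intro!: derivative_eq_intros)
    moreover have "dA t - (\<gamma> * dB t * s t + \<gamma> * B t * (c t * V4 t)) = dx t"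
      using rd[of t] sc[of t] unfolding dA_def dB_def dx_def dy_def A_def B_def dR_def by algebra
    moreover have "dB t - (dA t * s t + A t * (c t * V4 t)) = dy t"
      using rd[of t] sc[of t] unfolding dA_def dB_def dx_def dy_def A_def B_def dR_def by algebra
    ultimately show "(x has_real_derivative dx t) (at t) \<and> (y has_real_derivative dy t) (at t)"
      unfolding sub(1,2) by simp
  next
    assume h: "(x has_real_derivative dx t) (at t) \<and> (y has_real_derivative dy t) (at t)"
    have "((\<lambda>t. (x t + \<gamma> * y t * s t) * R t) has_real_derivative
        (dx t + (\<gamma> * dy t * s t + \<gamma> * y t * (c t * V4 t))) * R t + (x t + \<gamma> * y t * s t) * dR t) (at t)"
      "((\<lambda>t. (x t * s t + y t) * R t) has_real_derivative
        (dx t * s t + x t * (c t * V4 t) + dy t) * R t + (x t * s t + y t) * dR t) (at t)"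
      using h ds dR by (auto intro!: derivative_eq_intros)
    moreover have "(dx t + (\<gamma> * dy t * s t + \<gamma> * y t * (c t * V4 t))) * R t + (x t + \<gamma> * y t * s t) * dR t = dA t"
      using rd[of t] sc[of t] unfolding dA_def dB_def dx_def dy_def x_def y_def dR_def by algebra
    moreover have "(dx t * s t + x t * (c t * V4 t) + dy t) * R t + (x t * s t + y t) * dR t = dB t"
      using rd[of t] sc[of t] unfolding dA_def dB_def dx_def dy_def x_def y_def dR_def by algebra
    ultimately show "(A has_real_derivative dA t) (at t) \<and> (B has_real_derivative dB t) (at t)"
      unfolding sub(3,4) by simp
  qed
  then show ?thesis unfolding path_ode_def L R by blast
qed

lemma path_ode_imp_continuous:
  assumes "continuous_on UNIV \<omega>" "path_ode \<omega> p" shows "continuous_on UNIV (\<lambda>t. unmom (p t + noise_vec (\<sigma> * \<omega> t)))"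
proof -
  have "continuous_on UNIV p"
    using assms(2) unfolding path_ode_def
    by (meson has_vector_derivative_continuous continuous_at_imp_continuous_on)
  then show ?thesis
    unfolding noise_vec_def
    by (intro continuous_on_compose_UNIV[OF lips_continuous[OF lips_unmom]] continuous_intros assms)
qed

text \<open>Integration by parts requires \<open>G (V r)\<close> to be differentiable, which the
  notion of solution does not state. It suffices that the angle is, and the third component of
  either equation says that its derivative is the angular velocity.\<close>

lemma sde_iff_path_ode:
  assumes \<omega>: "continuous_on UNIV \<omega>" 
  shows "continuous_on UNIV V \<and> (\<forall>s t. s \<le> t \<longrightarrow>
        has_rs_integral (\<lambda>r. G (V r)) \<omega> s t (V t - V s - integral {s..t} (\<lambda>r. F (V r)))) \<longleftrightarrow>
    path_ode \<omega> (\<lambda>t. mom (V t) - noise_vec (\<sigma> * \<omega> t))" (is "?sde \<longleftrightarrow> ?ode")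
proof -
  define V1 where "V1 t = fst (V t)" for t
  define V2 where "V2 t = fst (snd (V t))" for t
  define V3 where "V3 t = fst (snd (snd (V t)))" for t
  define V4 where "V4 t = snd (snd (snd (V t)))" for t
  have V: "V = (\<lambda>t. (V1 t, V2 t, V3 t, V4 t))" by (simp add: V1_def V2_def V3_def V4_def)
  have key: "(\<forall>s t. s \<le> t \<longrightarrow>
        has_rs_integral (\<lambda>r. G (V r)) \<omega> s t (V t - V s - integral {s..t} (\<lambda>r. F (V r)))) \<longleftrightarrow> ?ode"
    if cV: "continuous_on UNIV V" and d3: "\<And>t. (V3 has_real_derivative V4 t) (at t)"
  proof -
    have cF: "continuous_on UNIV (\<lambda>r. F (V r))"
      by (intro continuous_on_compose_UNIV[OF lips_continuous[OF lips_drift]] cV)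
    have c3: "continuous_on UNIV V3" "continuous_on UNIV V4"
      unfolding V3_def V4_def by (intro continuous_intros cV)+
    have cG': "continuous_on UNIV (\<lambda>r. G' (V3 r) (V4 r))"
      unfolding G'_def rden_def den_def using den_bounds(4)[unfolded den_def]
      by (intro continuous_intros c3) auto
    have "((\<lambda>r. G (V r)) has_vector_derivative G' (V3 r) (V4 r)) (at r)" for r
      unfolding V by (rule G_has_derivative[OF d3])
    from rs_equation_iff[OF \<omega> cF this cG', of V] momentum_equation_iff[OF d3, of V1 V2 \<omega>]
    show ?thesis unfolding V by simp
  qed
  have d3_ode: "(V3 has_real_derivative V4 t) (at t)" if ?ode for t
    using that unfolding path_ode_def V
    by (simp add: mom_def field_def has_vector_derivative_quad_iff vel_mom del: diff_add_cancel)
  have c_ode: "continuous_on UNIV V" if ?ode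
    using path_ode_imp_continuous[OF \<omega> that] by simp
  have d3_sde: "(V3 has_real_derivative V4 t) (at t)" if ?sde for t
  proof -
    have bl: "bounded_linear (\<lambda>X::lifted. fst (snd (snd X)))"
      by (intro bounded_linear_intros)
    have cV: "continuous_on UNIV V" using that by simp
    have cF: "continuous_on UNIV (\<lambda>r. F (V r))"
      by (intro continuous_on_compose_UNIV[OF lips_continuous[OF lips_drift]] cV)
    have c4: "continuous_on UNIV V4" unfolding V4_def by (intro continuous_intros cV)
    \<comment> \<open>The diffusion has no third component, so the integrator drops out here and the
      angle is seen to have derivative \<open>V4\<close>.\<close>
    have "has_rs_integral (\<lambda>r. 0) \<omega> s t (V3 t - V3 s - integral {s..t} V4)" if "s \<le> t" for s t
    proof -
      have "has_rs_integral (\<lambda>r. G (V r)) \<omega> s t (V t - V s - integral {s..t} (\<lambda>r. F (V r)))"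
        using \<open>?sde\<close> that by simp
      from has_rs_integral_bounded_linear[OF this bl]
      have "has_rs_integral (\<lambda>r. fst (snd (snd (G (V r))))) \<omega> s t
        (fst (snd (snd (V t - V s - integral {s..t} (\<lambda>r. F (V r))))))" .
      moreover have "fst (snd (snd (integral {s..t} (\<lambda>r. F (V r))))) = integral {s..t} V4"
      proof -
        have "(\<lambda>r. F (V r)) integrable_on {s..t}"
          by (intro integrable_continuous_real continuous_on_subset[OF cF]) simp
        from integral_linear[OF this bl] show ?thesis by (simp add: V drift_def o_def)
      qed
      ultimately show ?thesis by (simp add: V diffusion_eq)
    qed
    then have "\<forall>t. ((\<lambda>t. V3 t - \<omega> t *\<^sub>R 0) has_vector_derivative (V4 t - \<omega> t *\<^sub>R 0)) (at t)"
      using rs_equation_iff[OF \<omega> c4, of "\<lambda>_. 0" "\<lambda>_. 0" V3] by simp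
    then show ?thesis by (simp add: has_real_derivative_iff_has_vector_derivative)
  qed
  show ?thesis using key d3_ode c_ode d3_sde by blast
qed

end

section \<open>The energy\<close>

lemma young: "a * b \<le> d / 2 * a\<^sup>2 + b\<^sup>2 / (2 * d)" if "d > 0" for a b d :: real
proof -
  have "0 \<le> (d * a - b)\<^sup>2 / (2 * d)" using that by simp
  also have "\<dots> = d / 2 * a\<^sup>2 + b\<^sup>2 / (2 * d) - a * b"
    using that by (simp add: power2_eq_square field_simps)
  finally show ?thesis by simp
qed

lemma abs_mult_le_squares: "2 * \<bar>a * b\<bar> \<le> a\<^sup>2 + b\<^sup>2" for a b :: real
  using sum_squares_bound[of "\<bar>a\<bar>" "\<bar>b\<bar>"] by (simp add: abs_mult)

context pendulum
begin

section \<open>Constants and bounds of the perturbed energy\<close>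

definition amax :: real where "amax = 1 / (1 - \<gamma>)"

lemma amax: "amax \<ge> 1" "amax > 0"
  using \<gamma> by (auto simp: amax_def)

lemma rden_bounds: "1 \<le> rden u" "rden u \<le> amax" "0 < rden u"
  using den_bounds[of u] \<gamma>
  by (auto simp: rden_def amax_def inverse_eq_divide intro!: divide_left_mono)

text \<open>The entries are the coefficients of the squares of the cart velocity, of the pendulum
  velocity and of \<open>v\<close> that remain in the unperturbed Hamiltonian once Young's
  inequality has removed the mixed term.\<close>

definition coer :: real where
  "coer = min ((1 - \<gamma>) / 4) (min (\<gamma> * (1 - \<gamma>) / (2 * (1 + \<gamma>))) (\<kappa>1 / 2))"

text \<open>The first entry keeps what the perturbation adds to the square of the cart velocity
  below half of its damping, the second does the same for the pendulum, the third keeps the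
  perturbed energy coercive.\<close>

definition eps :: real where
  "eps = min (\<zeta>1 / (1 + \<gamma> / 2 + 2 * \<zeta>1\<^sup>2 / \<kappa>1)) (min \<zeta>2 (coer / 2))"

lemma coer_le: "coer \<le> (1 - \<gamma>) / 4" "coer \<le> \<gamma> * (1 - \<gamma>) / (2 * (1 + \<gamma>))" "coer \<le> \<kappa>1 / 2"
  unfolding coer_def by (rule min.cobounded1 min.coboundedI2[OF min.cobounded1] min.coboundedI2[OF min.cobounded2])+

lemma coer_pos: "coer > 0"
  using \<gamma> \<kappa>1 by (simp add: coer_def)

lemma eps_bounds: "eps > 0" "eps * (1 + \<gamma> / 2 + 2 * \<zeta>1\<^sup>2 / \<kappa>1) \<le> \<zeta>1" "eps \<le> \<zeta>2" "eps \<le> coer / 2"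
proof -
  have p: "1 + \<gamma> / 2 + 2 * \<zeta>1\<^sup>2 / \<kappa>1 > 0" using \<gamma> \<kappa>1 by (intro add_pos_nonneg) auto
  then show "eps > 0" using \<zeta>1 \<zeta>2 coer_pos by (simp add: eps_def)
  have "eps \<le> \<zeta>1 / (1 + \<gamma> / 2 + 2 * \<zeta>1\<^sup>2 / \<kappa>1)" by (simp add: eps_def)
  then show "eps * (1 + \<gamma> / 2 + 2 * \<zeta>1\<^sup>2 / \<kappa>1) \<le> \<zeta>1" using p by (simp add: pos_le_divide_eq)
  show "eps \<le> \<zeta>2" unfolding eps_def by (rule min.coboundedI2[OF min.cobounded1])
  show "eps \<le> coer / 2" unfolding eps_def by (rule min.coboundedI2[OF min.cobounded2])
qed

text \<open>The angle is left out: the energy is periodic in it and controls only the other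
  coordinates.\<close>

definition sq_size :: "lifted \<Rightarrow> real" where
  "sq_size = (\<lambda>(v1, v2, u1, u2). v1\<^sup>2 + v2\<^sup>2 + u2\<^sup>2)"

lemma sq_size_nonneg: "sq_size X \<ge> 0"
  by (cases X) (simp add: sq_size_def)

text \<open>The Hamiltonian of the undamped system, perturbed by \<open>eps * v * x\<close> in order to make the
  damping of the velocities act on \<open>v\<close> as well.\<close>

definition energy :: "lifted \<Rightarrow> real" where
  "energy = (\<lambda>(v, x, u, y). (x\<^sup>2 + 2 * \<gamma> * sin u * x * y + \<gamma> * y\<^sup>2) / 2 * rden u + \<kappa>1 / 2 * v\<^sup>2
     + \<gamma> * \<kappa>2 * (1 - cos u) + eps * v * x)"

text \<open>The differential of the energy as a function of point and direction, because the
  existence theorem evaluates it along a rescaled field.\<close>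

definition Denergy :: "lifted \<Rightarrow> lifted \<Rightarrow> real" where
  "Denergy = (\<lambda>(v, x, u, y) (dv, dx, du, dy).
     rden u * (x * dx + \<gamma> * sin u * (dx * y + x * dy) + \<gamma> * cos u * du * x * y + \<gamma> * y * dy)
     + (x\<^sup>2 + 2 * \<gamma> * sin u * x * y + \<gamma> * y\<^sup>2) / 2 * (2 * \<gamma> * sin u * cos u * du * (rden u)\<^sup>2)
     + \<kappa>1 * v * dv + \<gamma> * \<kappa>2 * sin u * du + eps * (dv * x + v * dx))"

lemma energy_has_derivative:
  assumes "(p has_vector_derivative d) (at t)"
  shows "((\<lambda>t. energy (p t)) has_real_derivative Denergy (p t) d) (at t)"
proof -
  obtain dv dx du dy where d: "d = (dv, dx, du, dy)" by (cases d)
  define v where "v t = fst (p t)" for t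
  define x where "x t = fst (snd (p t))" for t
  define u where "u t = fst (snd (snd (p t)))" for t
  define y where "y t = snd (snd (snd (p t)))" for t
  have p: "p = (\<lambda>t. (v t, x t, u t, y t))" by (simp add: v_def x_def u_def y_def)
  have D: "(v has_real_derivative dv) (at t)" "(x has_real_derivative dx) (at t)"
    "(u has_real_derivative du) (at t)" "(y has_real_derivative dy) (at t)"
    using assms unfolding p d has_vector_derivative_quad_iff by auto
  show ?thesis unfolding p d energy_def Denergy_def prod.case
    by (rule derivative_eq_intros D rden_deriv refl | simp)+ (simp add: algebra_simps power2_eq_square)
qed

lemma Denergy_scale: "Denergy p (r *\<^sub>R d) = r * Denergy p d"
  by (cases p; cases d) (simp add: Denergy_def algebra_simps)

text \<open>In velocities the denominator disappears and the kinetic part is a quadratic form with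
  bounded coefficients; upper and lower bounds are proved in this form.\<close>

lemma energy_velocity:
  "energy (mom (v, w, u, m)) = (w\<^sup>2 - 2 * \<gamma> * sin u * w * m + \<gamma> * m\<^sup>2) / 2 + \<kappa>1 / 2 * v\<^sup>2
     + \<gamma> * \<kappa>2 * (1 - cos u) + eps * v * (w - \<gamma> * m * sin u)"
proof -
  define s where "s = sin u"
  define a where "a = rden u"
  have a: "a * (1 - \<gamma> * (s * s)) = 1" using rden_eq by (simp add: a_def s_def)
  have "((w - \<gamma> * m * s)\<^sup>2 + 2 * \<gamma> * s * (w - \<gamma> * m * s) * (m - w * s) + \<gamma> * (m - w * s)\<^sup>2) * a
     = w\<^sup>2 - 2 * \<gamma> * s * w * m + \<gamma> * m\<^sup>2"
    using a by algebra
  then show ?thesis by (simp add: energy_def mom_def s_def a_def)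
qed

text \<open>The kinetic form is definite because \<open>\<gamma> < 1\<close>. The weight
  \<open>(1 + \<gamma>) / 2\<close> in Young's inequality lies half way between \<gamma> and 1, the
  values at which one of the two squares would be used up, and leaves a positive multiple of both.
  The perturbation costs at most half of the result, since
  \<open>eps \<le> coer / 2\<close>.\<close>

lemma energy_lower: "coer / 2 * sq_size X \<le> energy (mom X)"
proof -
  obtain v w u m where X: "X = (v, w, u, m)" by (cases X)
  define s where "s = sin u"
  have s: "\<bar>s\<bar> \<le> 1" by (simp add: s_def)
  have combine: "R \<le> (A - P + B) / 2" if "P \<le> Q" "(A + B - Q) / 2 = R" for A B P Q R :: real
    using that by simp
  have "2 * \<gamma> * s * w * m \<le> (1 + \<gamma>) / 2 * w\<^sup>2 + 2 * \<gamma>\<^sup>2 / (1 + \<gamma>) * m\<^sup>2"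
  proof -
    have "2 * \<gamma> * s * w * m \<le> \<bar>s\<bar> * (2 * \<gamma> * \<bar>w * m\<bar>)"
      using \<gamma> abs_ge_self[of "2 * \<gamma> * s * w * m"] by (simp add: abs_mult mult_ac)
    also have "\<dots> \<le> 1 * (2 * \<gamma> * \<bar>w * m\<bar>)" using s \<gamma> by (intro mult_right_mono) auto
    also have "\<dots> = 2 * (\<bar>w\<bar> * (\<gamma> * \<bar>m\<bar>))" by (simp add: abs_mult)
    also have "\<dots> \<le> 2 * ((1 + \<gamma>) / 2 / 2 * \<bar>w\<bar>\<^sup>2 + (\<gamma> * \<bar>m\<bar>)\<^sup>2 / (2 * ((1 + \<gamma>) / 2)))"
      using \<gamma> by (intro mult_left_mono young) auto
    also have "\<dots> = (1 + \<gamma>) / 2 * w\<^sup>2 + 2 * \<gamma>\<^sup>2 / (1 + \<gamma>) * m\<^sup>2"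
      using \<gamma> by (simp add: power_mult_distrib field_simps)
    finally show ?thesis .
  qed
  moreover have "(w\<^sup>2 + \<gamma> * m\<^sup>2 - ((1 + \<gamma>) / 2 * w\<^sup>2 + 2 * \<gamma>\<^sup>2 / (1 + \<gamma>) * m\<^sup>2)) / 2
      = (1 - \<gamma>) / 4 * w\<^sup>2 + \<gamma> * (1 - \<gamma>) / (2 * (1 + \<gamma>)) * m\<^sup>2"
    using \<gamma> by (simp add: divide_simps) (simp add: algebra_simps power2_eq_square)
  ultimately have kin: "(w\<^sup>2 - 2 * \<gamma> * s * w * m + \<gamma> * m\<^sup>2) / 2 \<ge> (1 - \<gamma>) / 4 * w\<^sup>2 + \<gamma> * (1 - \<gamma>) / (2 * (1 + \<gamma>)) * m\<^sup>2"
    by (rule combine)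
  have "(1 - \<gamma>) / 4 * w\<^sup>2 \<ge> coer * w\<^sup>2" "\<gamma> * (1 - \<gamma>) / (2 * (1 + \<gamma>)) * m\<^sup>2 \<ge> coer * m\<^sup>2" "\<kappa>1 / 2 * v\<^sup>2 \<ge> coer * v\<^sup>2"
    by (intro mult_right_mono coer_le zero_le_power2)+
  moreover have "\<gamma> * \<kappa>2 * (1 - cos u) \<ge> 0" using \<gamma> \<kappa>2 by simp
  moreover have "eps * v * (w - \<gamma> * m * s) \<ge> - (coer / 2 * (v\<^sup>2 + w\<^sup>2 + m\<^sup>2))"
  proof -
    have "\<bar>\<gamma> * m * s\<bar> \<le> 1 * \<bar>m\<bar> * 1" unfolding abs_mult using s \<gamma> by (intro mult_mono) auto
    then have "\<bar>w - \<gamma> * m * s\<bar> \<le> \<bar>w\<bar> + \<bar>m\<bar>" by linarith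
    then have "\<bar>v * (w - \<gamma> * m * s)\<bar> \<le> \<bar>v\<bar> * (\<bar>w\<bar> + \<bar>m\<bar>)" unfolding abs_mult by (intro mult_left_mono) auto
    also have "\<dots> \<le> v\<^sup>2 + w\<^sup>2 + m\<^sup>2"
      using abs_mult_le_squares[of v w] abs_mult_le_squares[of v m]
        zero_le_power2[of w] zero_le_power2[of m]
      unfolding distrib_left abs_mult by linarith
    finally have "eps * \<bar>v * (w - \<gamma> * m * s)\<bar> \<le> coer / 2 * (v\<^sup>2 + w\<^sup>2 + m\<^sup>2)"
      using eps_bounds by (intro mult_mono) auto
    moreover have "eps * (v * (w - \<gamma> * m * s)) \<ge> eps * - \<bar>v * (w - \<gamma> * m * s)\<bar>"
      using eps_bounds by (intro mult_left_mono) auto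
    ultimately show ?thesis by (simp add: mult.assoc)
  qed
  moreover have "c / 2 * (v2 + w2 + m2) \<le> Kin + Vv + Pp + Cr"
    if "Kin \<ge> KA + KB" "KA \<ge> c * w2" "KB \<ge> c * m2" "Vv \<ge> c * v2" "Pp \<ge> 0" "Cr \<ge> - (c / 2 * (v2 + w2 + m2))"
    for c v2 w2 m2 Kin Vv Pp Cr KA KB :: real
    using that by (simp add: distrib_left)
  ultimately show ?thesis
    using kin unfolding X energy_velocity sq_size_def prod.case s_def[symmetric] by blast
qed

lemma energy_upper: "\<exists>C>0. \<forall>X. energy (mom X) \<le> C * (1 + sq_size X)"
proof (intro exI conjI allI)
  let ?C = "2 + \<kappa>1 + \<gamma> * \<kappa>2 * 2 + 2 * eps"
  show "?C > 0" using \<gamma> \<kappa>1 \<kappa>2 eps_bounds by (intro add_pos_pos) auto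
  fix X :: lifted
  obtain v w u m where X: "X = (v, w, u, m)" by (cases X)
  define s where "s = sin u"
  have s: "\<bar>s\<bar> \<le> 1" by (simp add: s_def)
  have sq: "\<bar>v * w\<bar> \<le> v\<^sup>2 + w\<^sup>2" for v w :: real
    using abs_mult_le_squares[of v w] abs_ge_zero[of "v * w"] by linarith
  have g: "\<bar>\<gamma> * s * z\<bar> \<le> \<bar>z\<bar>" for z
  proof -
    have "\<bar>\<gamma> * s * z\<bar> \<le> 1 * 1 * \<bar>z\<bar>" unfolding abs_mult using s \<gamma> by (intro mult_mono) auto
    then show ?thesis by simp
  qed
  have gm: "\<gamma> * m\<^sup>2 \<le> 1 * m\<^sup>2" using \<gamma> by (intro mult_right_mono) auto
  have "(w\<^sup>2 - 2 * \<gamma> * s * w * m + \<gamma> * m\<^sup>2) / 2 \<le> 2 * sq_size X"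
  proof -
    have "(A - 2 * Q + B) / 2 \<le> 2 * (V + A + M)"
      if "\<bar>Q\<bar> \<le> R" "R \<le> A + M" "B \<le> M" "V \<ge> 0" "A \<ge> 0" "M \<ge> 0" for A B M Q R V :: real
    proof -
      have "- Q \<le> R" using that(1) by (simp add: abs_le_iff)
      with that(2-) have "A - 2 * Q + B \<le> 4 * (V + A + M)" by (simp add: distrib_left)
      then show ?thesis by simp
    qed
    from this[OF g[of "w * m"] sq[of w m], of "\<gamma> * m\<^sup>2" "v\<^sup>2"] gm show ?thesis
      by (simp add: X sq_size_def mult.assoc)
  qed
  moreover have "\<kappa>1 / 2 * v\<^sup>2 \<le> \<kappa>1 * sq_size X"
    using \<kappa>1 by (intro mult_mono) (auto simp: X sq_size_def)
  moreover have "\<gamma> * \<kappa>2 * (1 - cos u) \<le> \<gamma> * \<kappa>2 * 2" using \<gamma> \<kappa>2 cos_ge_minus_one[of u] by (intro mult_left_mono) auto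
  moreover have "eps * (v * (w - \<gamma> * m * s)) \<le> eps * (2 * sq_size X)"
  proof -
    have "v * w \<le> v\<^sup>2 + w\<^sup>2" by (rule abs_le_D1[OF sq])
    moreover have "- (\<gamma> * s * (v * m)) \<le> v\<^sup>2 + m\<^sup>2" by (rule abs_le_D2[OF order_trans[OF g sq]])
    moreover have "v * (w - \<gamma> * m * s) = v * w - \<gamma> * s * (v * m)" by (simp add: algebra_simps)
    ultimately have "v * (w - \<gamma> * m * s) \<le> 2 * sq_size X"
      using zero_le_power2[of w] zero_le_power2[of m] unfolding X sq_size_def prod.case distrib_left by linarith
    then show ?thesis using eps_bounds(1) by (intro mult_left_mono) auto
  qed
  ultimately have "energy (mom X) \<le> 2 * sq_size X + \<kappa>1 * sq_size X + \<gamma> * \<kappa>2 * 2 + eps * (2 * sq_size X)"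
    unfolding X energy_velocity s_def[symmetric] mult.assoc by (intro add_mono)
  also have "\<dots> = ?C * (1 + sq_size X) - (2 + \<kappa>1 + 2 * eps + \<gamma> * \<kappa>2 * 2 * sq_size X)" by (simp add: algebra_simps)
  also have "\<dots> \<le> ?C * (1 + sq_size X)"
  proof -
    have "0 \<le> \<gamma> * \<kappa>2 * 2 * sq_size X" using \<gamma> \<kappa>2 sq_size_nonneg by simp
    then show ?thesis using \<kappa>1 eps_bounds(1) by linarith
  qed
  finally show "energy (mom X) \<le> ?C * (1 + sq_size X)" .
qed

lemma vel_shift:
  "vel1 (x + \<eta>) u y = vel1 x u y + rden u * \<eta>" "vel2 (x + \<eta>) u y = vel2 x u y + sin u * (rden u * \<eta>)"
  by (simp_all add: vel1_def vel2_def rden_def divide_inverse algebra_simps)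

text \<open>Only the terms with a factor \<open>a * \<eta>\<close>, where \<open>a = rden u\<close>, and \<open>\<beta>\<close> come from the noise. The
  term \<open>- \<gamma> * cos u * (a * \<eta>) * m\<^sup>2\<close> is the only one of them that is quadratic in the velocities.\<close>

lemma Denergy_field:
  "Denergy (mom (v, w, u, m)) (field (mom (v, w, u, m) + noise_vec \<eta>) + noise_vec \<beta>) =
     (- 2 * \<zeta>1 * w\<^sup>2 - 2 * \<gamma> * \<zeta>2 * m\<^sup>2 - eps * \<kappa>1 * v\<^sup>2 + eps * w\<^sup>2 - eps * \<gamma> * sin u * w * m - 2 * eps * \<zeta>1 * v * w)
     - \<gamma> * cos u * (rden u * \<eta>) * m\<^sup>2 + \<gamma> * \<kappa>2 * (sin u)\<^sup>2 * (rden u * \<eta>)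
     + v * (\<kappa>1 * (rden u * \<eta>) + eps * \<beta> - 2 * eps * \<zeta>1 * (rden u * \<eta>))
     + w * (\<beta> - 2 * \<zeta>1 * (rden u * \<eta>) + eps * (rden u * \<eta>))
     + m * (- 2 * \<gamma> * \<zeta>2 * (sin u * (rden u * \<eta>)) - \<gamma> * (cos u * sin u * (rden u * \<eta>)\<^sup>2)
         - eps * \<gamma> * (sin u * (rden u * \<eta>)))"
proof -
  define s where "s = sin u"
  define k where "k = cos u"
  define a where "a = rden u"
  have a: "a * (1 - \<gamma> * (s * s)) = 1" using rden_eq by (simp add: a_def s_def)
  have sk: "s * s + k * k = 1" using sin_cos_squared_add[of u] by (simp add: s_def k_def power2_eq_square)
  define x where "x = w - \<gamma> * m * s"
  define y where "y = m - w * s"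
  have vel: "vel1 (x + \<eta>) u y = w + a * \<eta>" "vel2 (x + \<eta>) u y = m + s * a * \<eta>"
    using vel_mom[of w m u] by (simp_all add: vel_shift x_def y_def s_def a_def)
  have 1: "a * (x\<^sup>2 + 2 * \<gamma> * s * x * y + \<gamma> * y\<^sup>2) = w\<^sup>2 - 2 * \<gamma> * s * w * m + \<gamma> * m\<^sup>2"
    using a unfolding x_def y_def by algebra
  have 2: "a * (x + \<gamma> * s * y) = w" "a * (s * x + y) = m"
  proof -
    show "a * (x + \<gamma> * s * y) = w" using a unfolding x_def y_def by algebra
    show "a * (s * x + y) = m" using a unfolding x_def y_def by algebra
  qed
  have 3: "a * (\<gamma> * k * du * x * y) + (x\<^sup>2 + 2 * \<gamma> * s * x * y + \<gamma> * y\<^sup>2) / 2 * (2 * \<gamma> * s * k * du * a\<^sup>2) = \<gamma> * k * w * m * du" for du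
  proof -
    have "a * (\<gamma> * k * du * x * y) + (x\<^sup>2 + 2 * \<gamma> * s * x * y + \<gamma> * y\<^sup>2) / 2 * (2 * \<gamma> * s * k * du * a\<^sup>2)
      = \<gamma> * k * du * (a * x * y + a * (x\<^sup>2 + 2 * \<gamma> * s * x * y + \<gamma> * y\<^sup>2) * s * a)"
      by (simp add: algebra_simps power2_eq_square)
    also have "a * x * y + a * (x\<^sup>2 + 2 * \<gamma> * s * x * y + \<gamma> * y\<^sup>2) * s * a = w * m"
      unfolding 1 using a unfolding x_def y_def by algebra
    finally show ?thesis by (simp add: mult_ac)
  qed
  \<comment> \<open>The velocities are, up to the factor \<gamma>, the derivatives of the kinetic
    energy with respect to the momenta, which gives the coefficients of \<open>dx\<close> and
    \<open>dy\<close>; the terms from the dependence on the angle combine by fact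
    \<open>3\<close>.\<close>
  have D: "Denergy (v, x, u, y) (dv, dx, du, dy) = w * dx + \<gamma> * m * dy + (\<gamma> * k * w * m + \<gamma> * \<kappa>2 * s) * du + \<kappa>1 * v * dv + eps * (dv * x + v * dx)"
    for dv dx du dy
  proof -
    have "Denergy (v, x, u, y) (dv, dx, du, dy) = a * (x + \<gamma> * s * y) * dx + \<gamma> * (a * (s * x + y)) * dy
       + (a * (\<gamma> * k * du * x * y) + (x\<^sup>2 + 2 * \<gamma> * s * x * y + \<gamma> * y\<^sup>2) / 2 * (2 * \<gamma> * s * k * du * a\<^sup>2))
       + \<gamma> * \<kappa>2 * s * du + \<kappa>1 * v * dv + eps * (dv * x + v * dx)"
      unfolding Denergy_def prod.case a_def[symmetric] s_def[symmetric] k_def[symmetric] by algebra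
    then show ?thesis unfolding 2 3 by (simp add: algebra_simps)
  qed
  have mom_eq: "mom (v, w, u, m) = (v, x, u, y)" by (simp add: mom_def x_def y_def s_def)
  show ?thesis
    unfolding mom_eq noise_vec_simps field_def prod.case vel D s_def[symmetric] k_def[symmetric] a_def[symmetric]
    unfolding x_def by algebra
qed

text \<open>Dominates every power of the noise that occurs in the remainder of the energy balance,
  and is at least 1, so that it absorbs constants as well.\<close>

definition gauge_term :: "real \<Rightarrow> real \<Rightarrow> real" where
  "gauge_term \<eta> \<beta> = 1 + \<bar>\<eta>\<bar> + \<eta>\<^sup>2 + \<bar>\<beta>\<bar>"

lemma gauge_term_ge: "1 \<le> gauge_term \<eta> \<beta>" "\<bar>\<eta>\<bar> \<le> gauge_term \<eta> \<beta>" "\<eta>\<^sup>2 \<le> gauge_term \<eta> \<beta>" "\<bar>\<beta>\<bar> \<le> gauge_term \<eta> \<beta>"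
  "gauge_term \<eta> \<beta> \<le> (gauge_term \<eta> \<beta>)\<^sup>2"
proof -
  show *: "1 \<le> gauge_term \<eta> \<beta>" by (simp add: gauge_term_def)
  show "\<bar>\<eta>\<bar> \<le> gauge_term \<eta> \<beta>" "\<eta>\<^sup>2 \<le> gauge_term \<eta> \<beta>" "\<bar>\<beta>\<bar> \<le> gauge_term \<eta> \<beta>"
    by (simp_all add: gauge_term_def)
  show "gauge_term \<eta> \<beta> \<le> (gauge_term \<eta> \<beta>)\<^sup>2"
    using self_le_power[OF *, of 2] by simp
qed

text \<open>The three parts are treated differently later. \<open>S\<close> is the dissipation
  without noise. The remainder \<open>R\<close>, at most linear in the velocities, can be absorbed
  by Young's inequality. The term \<open>n * m\<^sup>2\<close> cannot, being quadratic with a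
  coefficient unbounded in the noise; its bound does not involve \<beta>, where \<alpha> will appear
  as a factor.\<close>

lemma Denergy_estimate:
  obtains Q D where "Q \<ge> 0" "D > 0"
    "\<And>v w u m \<eta> \<beta>. \<exists>R S n. Denergy (mom (v, w, u, m)) (field (mom (v, w, u, m) + noise_vec \<eta>) + noise_vec \<beta>) = S + n * m\<^sup>2 + R
      \<and> S \<le> - D * (v\<^sup>2 + w\<^sup>2 + m\<^sup>2) \<and> \<bar>S\<bar> \<le> Q * (v\<^sup>2 + w\<^sup>2 + m\<^sup>2) \<and> \<bar>n\<bar> \<le> \<gamma> * amax * \<bar>\<eta>\<bar>
      \<and> \<bar>R\<bar> \<le> Q * gauge_term \<eta> \<beta> * (1 + \<bar>v\<bar> + \<bar>w\<bar> + \<bar>m\<bar>)"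
proof -
  \<comment> \<open>Half of each damping coefficient; the other half pays for the mixed terms caused
    by \<open>eps\<close>.\<close>
  define D where "D = min \<zeta>1 (min (\<gamma> * \<zeta>2) (eps * \<kappa>1 / 2))"
  have D: "D > 0" using \<zeta>1 \<zeta>2 \<gamma> \<kappa>1 eps_bounds by (simp add: D_def)
  have D_le: "D \<le> \<zeta>1" "D \<le> \<gamma> * \<zeta>2" "D \<le> eps * \<kappa>1 / 2"
    unfolding D_def by (rule min.cobounded1 min.coboundedI2[OF min.cobounded1] min.coboundedI2[OF min.cobounded2])+
  \<comment> \<open>\<open>Q0\<close> to \<open>Q3\<close> bound the coefficients of 1,
    \<open>v\<close>, \<open>w\<close> and \<open>m\<close> in the remainder, \<open>Q4\<close>
    bounds \<open>S\<close>.\<close>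
  define Q0 where "Q0 = \<gamma> * \<kappa>2 * amax"
  define Q1 where "Q1 = \<kappa>1 * amax + eps + 2 * eps * \<zeta>1 * amax"
  define Q2 where "Q2 = 1 + 2 * \<zeta>1 * amax + eps * amax"
  define Q3 where "Q3 = 2 * \<gamma> * \<zeta>2 * amax + \<gamma> * amax\<^sup>2 + eps * \<gamma> * amax"
  define Q4 where "Q4 = 2 * \<zeta>1 + 2 * \<gamma> * \<zeta>2 + eps * \<kappa>1 + eps + eps * \<gamma> + 2 * eps * \<zeta>1"
  define Q where "Q = Q0 + Q1 + Q2 + Q3 + Q4"
  have Qs: "0 \<le> Q0" "0 \<le> Q1" "0 \<le> Q2" "0 \<le> Q3" "0 \<le> Q4"
    using \<zeta>1 \<zeta>2 \<gamma> \<kappa>1 \<kappa>2 eps_bounds(1) amax by (simp_all add: Q0_def Q1_def Q2_def Q3_def Q4_def)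
  then have Q_ge: "Q0 \<le> Q" "Q1 \<le> Q" "Q2 \<le> Q" "Q3 \<le> Q" "Q4 \<le> Q" "0 \<le> Q" by (simp_all add: Q_def)
  have abs3: "\<bar>a + b + c\<bar> \<le> (A + B + C) * g" "\<bar>a + b - c\<bar> \<le> (A + B + C) * g" "\<bar>a - b + c\<bar> \<le> (A + B + C) * g"
    "\<bar>- a - b - c\<bar> \<le> (A + B + C) * g"
    if "\<bar>a\<bar> \<le> A * g" "\<bar>b\<bar> \<le> B * g" "\<bar>c\<bar> \<le> C * g" for a b c A B C g :: real
    using that by (auto simp: distrib_right abs_le_iff)
  have absc: "\<bar>c * n\<bar> \<le> c * A * g" if "\<bar>n\<bar> \<le> A * g" "c \<ge> 0" for c n A g :: real
    using mult_left_mono[OF that] that(2) by (simp add: abs_mult mult.assoc)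
  have "\<exists>R S n. Denergy (mom (v, w, u, m)) (field (mom (v, w, u, m) + noise_vec \<eta>) + noise_vec \<beta>) = S + n * m\<^sup>2 + R
      \<and> S \<le> - D * (v\<^sup>2 + w\<^sup>2 + m\<^sup>2) \<and> \<bar>S\<bar> \<le> Q * (v\<^sup>2 + w\<^sup>2 + m\<^sup>2) \<and> \<bar>n\<bar> \<le> \<gamma> * amax * \<bar>\<eta>\<bar>
      \<and> \<bar>R\<bar> \<le> Q * gauge_term \<eta> \<beta> * (1 + \<bar>v\<bar> + \<bar>w\<bar> + \<bar>m\<bar>)" for v w u m \<eta> \<beta>
  proof -
    define s where "s = sin u"
    define k where "k = cos u"
    define N where "N = rden u * \<eta>"
    define g where "g = gauge_term \<eta> \<beta>"
    have s: "\<bar>s\<bar> \<le> 1" "\<bar>k\<bar> \<le> 1" by (simp_all add: s_def k_def)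
    have g: "g \<ge> 1" unfolding g_def by (rule gauge_term_ge)
    have N0: "\<bar>N\<bar> \<le> amax * \<bar>\<eta>\<bar>"
      using rden_bounds[of u] by (simp add: N_def abs_mult mult_right_mono)
    have N1: "\<bar>N\<bar> \<le> amax * g"
      unfolding g_def using amax by (intro order_trans[OF N0] mult_left_mono gauge_term_ge) simp
    have N2: "N\<^sup>2 \<le> amax\<^sup>2 * g"
    proof -
      have "N\<^sup>2 \<le> (amax * \<bar>\<eta>\<bar>)\<^sup>2" using power_mono[OF N0, of 2] by simp
      also have "\<dots> \<le> amax\<^sup>2 * g"
        using gauge_term_ge(3)[of \<eta> \<beta>] by (simp add: power_mult_distrib g_def mult_left_mono)
      finally show ?thesis .
    qed
    have le1: "\<bar>r * x\<bar> \<le> y" if "\<bar>r\<bar> \<le> 1" "\<bar>x\<bar> \<le> y" for r x y :: real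
      using mult_mono[OF that] that(2) by (simp add: abs_mult)
    define S where "S = - 2 * \<zeta>1 * w\<^sup>2 - 2 * \<gamma> * \<zeta>2 * m\<^sup>2 - eps * \<kappa>1 * v\<^sup>2 + eps * w\<^sup>2 - eps * \<gamma> * s * w * m - 2 * eps * \<zeta>1 * v * w"
    define cv where "cv = \<kappa>1 * N + eps * \<beta> - 2 * eps * \<zeta>1 * N"
    define cw where "cw = \<beta> - 2 * \<zeta>1 * N + eps * N"
    define cm where "cm = - 2 * \<gamma> * \<zeta>2 * (s * N) - \<gamma> * (k * s * N\<^sup>2) - eps * \<gamma> * (s * N)"
    have eq: "Denergy (mom (v, w, u, m)) (field (mom (v, w, u, m) + noise_vec \<eta>) + noise_vec \<beta>)
       = S + (- (\<gamma> * (k * N))) * m\<^sup>2 + (\<gamma> * \<kappa>2 * (s\<^sup>2 * N) + v * cv + w * cw + m * cm)"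
      unfolding Denergy_field S_def cv_def cw_def cm_def s_def k_def N_def by (simp add: algebra_simps)
    have \<beta>: "\<bar>\<beta>\<bar> \<le> 1 * g" using gauge_term_ge(4)[of \<beta> \<eta>] by (simp add: g_def)
    have cv: "\<bar>cv\<bar> \<le> Q1 * g" unfolding cv_def Q1_def
      using absc[OF N1, of \<kappa>1] absc[OF \<beta>, of eps] absc[OF N1, of "2 * eps * \<zeta>1"] \<kappa>1 \<zeta>1 eps_bounds(1)
      by (intro abs3) auto
    have cw: "\<bar>cw\<bar> \<le> Q2 * g" unfolding cw_def Q2_def
      using \<beta> absc[OF N1, of "2 * \<zeta>1"] absc[OF N1, of eps] \<zeta>1 eps_bounds(1)
      by (intro abs3) auto
    have sN: "\<bar>s * N\<bar> \<le> amax * g" by (rule le1[OF s(1) N1])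
    have kN: "\<bar>k * s * N\<^sup>2\<bar> \<le> amax\<^sup>2 * g"
      using le1[OF s(2) le1[OF s(1), of "N\<^sup>2"]] N2 by (simp add: mult.assoc)
    have cm: "\<bar>cm\<bar> \<le> Q3 * g"
    proof -
      have "cm = - (2 * \<gamma> * \<zeta>2 * (s * N)) - \<gamma> * (k * s * N\<^sup>2) - eps * \<gamma> * (s * N)" by (simp add: cm_def)
      then show ?thesis unfolding Q3_def
        using absc[OF sN, of "2 * \<gamma> * \<zeta>2"] absc[OF kN, of \<gamma>] absc[OF sN, of "eps * \<gamma>"] \<gamma> \<zeta>2 eps_bounds(1)
        by (simp only:) (intro abs3, auto)
    qed
    have c0: "\<bar>\<gamma> * \<kappa>2 * (s\<^sup>2 * N)\<bar> \<le> Q0 * g"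
    proof -
      have "\<bar>s\<^sup>2 * N\<bar> \<le> amax * g" using le1[OF s(1) sN] by (simp add: power2_eq_square mult.assoc)
      from absc[OF this, of "\<gamma> * \<kappa>2"] \<gamma> \<kappa>2 show ?thesis by (simp add: Q0_def)
    qed
    have prodb: "\<bar>z * c\<bar> \<le> Q * g * \<bar>z\<bar>" if "\<bar>c\<bar> \<le> q * g" "q \<le> Q" for z c q
    proof -
      have "\<bar>c\<bar> \<le> Q * g" using g by (intro order_trans[OF that(1)] mult_right_mono that(2)) simp
      then show ?thesis using mult_right_mono[of "\<bar>c\<bar>" "Q * g" "\<bar>z\<bar>"] by (simp add: abs_mult mult_ac)
    qed
    have R: "\<bar>\<gamma> * \<kappa>2 * (s\<^sup>2 * N) + v * cv + w * cw + m * cm\<bar> \<le> Q * g * (1 + \<bar>v\<bar> + \<bar>w\<bar> + \<bar>m\<bar>)"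
      using prodb[OF c0 Q_ge(1), of 1] prodb[OF cv Q_ge(2), of v] prodb[OF cw Q_ge(3), of w] prodb[OF cm Q_ge(4), of m]
      unfolding distrib_left by (simp add: abs_le_iff)
    have n: "\<bar>- (\<gamma> * (k * N))\<bar> \<le> \<gamma> * amax * \<bar>\<eta>\<bar>"
      using absc[of "k * N" amax "\<bar>\<eta>\<bar>" \<gamma>] le1[OF s(2) N0] \<gamma> by simp
    have swm: "\<bar>eps * \<gamma> * s * w * m\<bar> \<le> eps * \<gamma> * (w\<^sup>2 + m\<^sup>2) / 2"
    proof -
      have "\<bar>s * (w * m)\<bar> \<le> (w\<^sup>2 + m\<^sup>2) / 2" using abs_mult_le_squares[of w m] by (intro le1[OF s(1)]) simp
      from absc[of "s * (w * m)" "(w\<^sup>2 + m\<^sup>2) / 2" 1 "eps * \<gamma>"] this eps_bounds(1) \<gamma>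
      show ?thesis by (simp add: mult.assoc)
    qed
    \<comment> \<open>The weight \<kappa>1 spends half of the damping in \<open>v\<close> on this
      term; the coefficient of \<open>w\<^sup>2\<close> is the one provided for in the choice of
      \<open>eps\<close>.\<close>
    have vw: "\<bar>2 * eps * \<zeta>1 * v * w\<bar> \<le> eps * \<kappa>1 / 2 * v\<^sup>2 + eps * (2 * \<zeta>1\<^sup>2 / \<kappa>1) * w\<^sup>2"
    proof -
      have "\<bar>v\<bar> * (2 * \<zeta>1 * \<bar>w\<bar>) \<le> \<kappa>1 / 2 * \<bar>v\<bar>\<^sup>2 + (2 * \<zeta>1 * \<bar>w\<bar>)\<^sup>2 / (2 * \<kappa>1)" by (rule young[OF \<kappa>1])
      also have "(2 * \<zeta>1 * \<bar>w\<bar>)\<^sup>2 / (2 * \<kappa>1) = 2 * \<zeta>1\<^sup>2 / \<kappa>1 * w\<^sup>2"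
        using \<kappa>1 by (simp add: power_mult_distrib field_simps)
      finally have "eps * (\<bar>v\<bar> * (2 * \<zeta>1 * \<bar>w\<bar>)) \<le> eps * (\<kappa>1 / 2 * \<bar>v\<bar>\<^sup>2 + 2 * \<zeta>1\<^sup>2 / \<kappa>1 * w\<^sup>2)"
        using eps_bounds(1) by (intro mult_left_mono) auto
      then show ?thesis using eps_bounds(1) \<zeta>1 by (simp add: abs_mult algebra_simps)
    qed
    have S: "S \<le> - D * (v\<^sup>2 + w\<^sup>2 + m\<^sup>2)"
    proof -
      have "S \<le> - 2 * \<zeta>1 * w\<^sup>2 - 2 * \<gamma> * \<zeta>2 * m\<^sup>2 - eps * \<kappa>1 * v\<^sup>2 + eps * w\<^sup>2 + eps * \<gamma> * (w\<^sup>2 + m\<^sup>2) / 2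
          + (eps * \<kappa>1 / 2 * v\<^sup>2 + eps * (2 * \<zeta>1\<^sup>2 / \<kappa>1) * w\<^sup>2)"
        unfolding S_def using abs_le_D2[OF swm] abs_le_D2[OF vw] by linarith
      also have "\<dots> = (eps * (1 + \<gamma> / 2 + 2 * \<zeta>1\<^sup>2 / \<kappa>1) - 2 * \<zeta>1) * w\<^sup>2 + (eps * \<gamma> / 2 - 2 * \<gamma> * \<zeta>2) * m\<^sup>2 - eps * \<kappa>1 / 2 * v\<^sup>2"
        by (simp add: algebra_simps)
      also have "\<dots> \<le> - D * w\<^sup>2 + - D * m\<^sup>2 - D * v\<^sup>2"
      proof (intro add_mono diff_mono mult_right_mono zero_le_power2)
        show "eps * (1 + \<gamma> / 2 + 2 * \<zeta>1\<^sup>2 / \<kappa>1) - 2 * \<zeta>1 \<le> - D" using eps_bounds(2) D_le(1) by linarith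
        have "eps * \<gamma> \<le> \<zeta>2 * \<gamma>" using eps_bounds(3) \<gamma> by (intro mult_right_mono) auto
        then have "eps * \<gamma> / 2 - 2 * (\<gamma> * \<zeta>2) \<le> - D"
          using D_le(2) mult_pos_pos[OF \<gamma>(1) \<zeta>2] unfolding mult.commute[of \<zeta>2] by linarith
        then show "eps * \<gamma> / 2 - 2 * \<gamma> * \<zeta>2 \<le> - D" by (simp add: mult.assoc)
      qed (rule D_le)
      finally show ?thesis by (simp add: algebra_simps)
    qed
    have S': "\<bar>S\<bar> \<le> Q * (v\<^sup>2 + w\<^sup>2 + m\<^sup>2)"
    proof -
      define N where "N = v\<^sup>2 + w\<^sup>2 + m\<^sup>2"
      have pos: "eps * \<zeta>1 > 0" "\<gamma> * \<zeta>2 > 0" "eps * \<kappa>1 > 0" "eps * \<gamma> > 0"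
        using eps_bounds(1) \<zeta>1 \<zeta>2 \<gamma> \<kappa>1 by simp_all
      have N: "v\<^sup>2 \<le> N" "w\<^sup>2 \<le> N" "m\<^sup>2 \<le> N" "(w\<^sup>2 + m\<^sup>2) / 2 \<le> N" "0 \<le> N"
        unfolding N_def by auto
      have vwN: "\<bar>v * w\<bar> \<le> N"
        using abs_mult_le_squares[of v w] abs_ge_zero[of "v * w"] zero_le_power2[of m] unfolding N_def by linarith
      have "2 * \<zeta>1 * w\<^sup>2 \<le> 2 * \<zeta>1 * N" "2 * \<gamma> * \<zeta>2 * m\<^sup>2 \<le> 2 * \<gamma> * \<zeta>2 * N" "eps * \<kappa>1 * v\<^sup>2 \<le> eps * \<kappa>1 * N"
        "eps * \<gamma> * ((w\<^sup>2 + m\<^sup>2) / 2) \<le> eps * \<gamma> * N" "2 * eps * \<zeta>1 * \<bar>v * w\<bar> \<le> 2 * eps * \<zeta>1 * N"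
        using eps_bounds(1) \<zeta>1 \<zeta>2 \<gamma> \<kappa>1 by (intro mult_left_mono N vwN; simp)+
      moreover have "0 \<le> eps * w\<^sup>2" "0 \<le> eps * N" using eps_bounds(1) N(5) by simp_all
      moreover have "2 * eps * \<zeta>1 * v * w \<le> 2 * eps * \<zeta>1 * \<bar>v * w\<bar>"
        using pos mult_left_mono[OF abs_ge_self[of "v * w"], of "2 * (eps * \<zeta>1)"] by (simp add: mult.assoc)
      moreover have "eps * \<gamma> * s * w * m \<le> eps * \<gamma> * ((w\<^sup>2 + m\<^sup>2) / 2)" using abs_le_D1[OF swm] by simp
      ultimately have "S \<ge> - (2 * \<zeta>1 * N + 2 * \<gamma> * \<zeta>2 * N + eps * \<kappa>1 * N + eps * N + eps * \<gamma> * N + 2 * eps * \<zeta>1 * N)"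
        unfolding S_def by linarith
      then have "S \<ge> - (Q4 * (v\<^sup>2 + w\<^sup>2 + m\<^sup>2))"
        unfolding Q4_def N_def[symmetric] distrib_right .
      moreover have "Q4 * (v\<^sup>2 + w\<^sup>2 + m\<^sup>2) \<le> Q * (v\<^sup>2 + w\<^sup>2 + m\<^sup>2)" by (intro mult_right_mono Q_ge) auto
      moreover have "S \<le> 0"
      proof -
        have "0 \<le> D * (v\<^sup>2 + w\<^sup>2 + m\<^sup>2)" using D by simp
        with S show ?thesis by simp
      qed
      moreover have "0 \<le> Q * (v\<^sup>2 + w\<^sup>2 + m\<^sup>2)" using Q_ge(6) by simp
      ultimately show ?thesis by (simp add: abs_le_iff)
    qed
    show ?thesis using eq S S' n R unfolding g_def by blast
  qed
  then show ?thesis using that[OF Q_ge(6) D] by blast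
qed


lemma mom_surj: obtains v w u m where "p = mom (v, w, u, m)"
  by (metis mom_unmom prod.exhaust)

lemma energy_nonneg: "0 \<le> energy p"
proof -
  have "0 \<le> coer / 2 * sq_size (unmom p)" using coer_pos sq_size_nonneg by simp
  then show ?thesis using energy_lower[of "unmom p"] by simp
qed

lemma sq_size_le_energy: "sq_size (unmom p) \<le> 2 / coer * energy p"
  using energy_lower[of "unmom p"] coer_pos by (simp add: field_simps)

text \<open>Half of the dissipation absorbs the linear remainder, the other half turns into decay of
  the energy through \<open>energy_upper\<close>. The rate \<open>D / (2 * C1)\<close> and the noise
  coefficient \<open>2 * \<gamma> * amax / coer\<close> do not depend on \<eta> and \<beta>, so
  \<alpha> can be chosen after them.\<close>

lemma energy_dissipation:
  obtains c C K where "c > 0" "C \<ge> 0" "K \<ge> 0"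
    "\<And>p \<eta> \<beta>. Denergy p (field (p + noise_vec \<eta>) + noise_vec \<beta>)
       \<le> (- c + C * \<bar>\<eta>\<bar>) * energy p + K * (gauge_term \<eta> \<beta>)\<^sup>2"
proof -
  obtain Q D where QD: "Q \<ge> 0" "D > 0" and est:
    "\<And>v w u m \<eta> \<beta>. \<exists>R S n. Denergy (mom (v, w, u, m)) (field (mom (v, w, u, m) + noise_vec \<eta>) + noise_vec \<beta>) = S + n * m\<^sup>2 + R
      \<and> S \<le> - D * (v\<^sup>2 + w\<^sup>2 + m\<^sup>2) \<and> \<bar>S\<bar> \<le> Q * (v\<^sup>2 + w\<^sup>2 + m\<^sup>2) \<and> \<bar>n\<bar> \<le> \<gamma> * amax * \<bar>\<eta>\<bar>
      \<and> \<bar>R\<bar> \<le> Q * gauge_term \<eta> \<beta> * (1 + \<bar>v\<bar> + \<bar>w\<bar> + \<bar>m\<bar>)"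
    using Denergy_estimate by blast
  obtain C1 where C1: "C1 > 0" "\<And>X. energy (mom X) \<le> C1 * (1 + sq_size X)" using energy_upper by blast
  have "Denergy p (field (p + noise_vec \<eta>) + noise_vec \<beta>)
       \<le> (- (D / (2 * C1)) + 2 * \<gamma> * amax / coer * \<bar>\<eta>\<bar>) * energy p
          + (Q + 3 * Q\<^sup>2 / (2 * D) + D / 2) * (gauge_term \<eta> \<beta>)\<^sup>2" for p \<eta> \<beta>
  proof -
    obtain v w u m where p: "p = mom (v, w, u, m)" by (rule mom_surj)
    define N where "N = v\<^sup>2 + w\<^sup>2 + m\<^sup>2"
    define g where "g = gauge_term \<eta> \<beta>"
    obtain R S n where eq: "Denergy p (field (p + noise_vec \<eta>) + noise_vec \<beta>) = S + n * m\<^sup>2 + R"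
      and S: "S \<le> - D * N" and n: "\<bar>n\<bar> \<le> \<gamma> * amax * \<bar>\<eta>\<bar>"
      and R: "\<bar>R\<bar> \<le> Q * g * (1 + \<bar>v\<bar> + \<bar>w\<bar> + \<bar>m\<bar>)"
      using est[of v w u m \<eta> \<beta>] unfolding p N_def g_def by blast
    have g: "1 \<le> g" "g \<le> g\<^sup>2" "1 \<le> g\<^sup>2" using gauge_term_ge(1,5)[of \<eta> \<beta>] unfolding g_def by linarith+
    have N: "N \<le> 2 / coer * energy p" "energy p \<le> C1 * (1 + N)"
      using sq_size_le_energy[of p] C1(2)[of "(v, w, u, m)"] by (simp_all add: p sq_size_def N_def add.assoc)
    have n2: "n * m\<^sup>2 \<le> 2 * \<gamma> * amax / coer * \<bar>\<eta>\<bar> * energy p"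
    proof -
      have "n * m\<^sup>2 \<le> (\<gamma> * amax * \<bar>\<eta>\<bar>) * N"
        using n \<gamma> amax by (intro mult_mono) (auto simp: N_def)
      also have "\<dots> \<le> (\<gamma> * amax * \<bar>\<eta>\<bar>) * (2 / coer * energy p)"
        using \<gamma> amax by (intro mult_left_mono N) auto
      finally show ?thesis by (simp add: mult_ac)
    qed
    have y: "Q * g * \<bar>z\<bar> \<le> D / 2 * z\<^sup>2 + Q\<^sup>2 / (2 * D) * g\<^sup>2" for z
      using young[OF QD(2), of "\<bar>z\<bar>" "Q * g"] by (simp add: power_mult_distrib mult_ac)
    have "R \<le> Q * g * (1 + \<bar>v\<bar> + \<bar>w\<bar> + \<bar>m\<bar>)" using R by linarith
    also have "\<dots> = Q * g + (Q * g * \<bar>v\<bar> + Q * g * \<bar>w\<bar> + Q * g * \<bar>m\<bar>)" by (simp add: algebra_simps)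
    also have "\<dots> \<le> Q * g\<^sup>2 + ((D / 2 * v\<^sup>2 + Q\<^sup>2 / (2 * D) * g\<^sup>2) + (D / 2 * w\<^sup>2 + Q\<^sup>2 / (2 * D) * g\<^sup>2) + (D / 2 * m\<^sup>2 + Q\<^sup>2 / (2 * D) * g\<^sup>2))"
      by (intro add_mono mult_left_mono g y QD)
    also have "\<dots> = D / 2 * N + (Q + 3 * Q\<^sup>2 / (2 * D)) * g\<^sup>2"
      by (simp add: N_def algebra_simps)
    finally have R': "R \<le> D / 2 * N + (Q + 3 * Q\<^sup>2 / (2 * D)) * g\<^sup>2" .
    have "energy p / C1 \<le> 1 + N" using N(2) C1(1) by (simp add: pos_divide_le_eq mult.commute)
    then have "D / 2 * (energy p / C1) \<le> D / 2 * (1 + N)" using QD by (intro mult_left_mono) auto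
    also have "\<dots> \<le> D / 2 * N + D / 2 * g\<^sup>2" using QD g mult_left_mono[of 1 "g\<^sup>2" "D / 2"] by (simp add: distrib_left)
    finally have "- (D / 2 * N) \<le> - (D / (2 * C1)) * energy p + D / 2 * g\<^sup>2" by simp
    moreover have "- D * N + D / 2 * N = - (D / 2 * N)" by simp
    ultimately have "S + n * m\<^sup>2 + R \<le> (- (D / (2 * C1)) * energy p + D / 2 * g\<^sup>2) + 2 * \<gamma> * amax / coer * \<bar>\<eta>\<bar> * energy p
        + (Q + 3 * Q\<^sup>2 / (2 * D)) * g\<^sup>2"
      using S n2 R' by linarith
    moreover have "(- c * E + d * G) + b * E + q * G = (- c + b) * E + (q + d) * G" for b c d q E G :: real
      by (simp add: algebra_simps)
    ultimately show ?thesis unfolding eq g_def[symmetric] by (simp only:)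
  qed
  moreover have "D / (2 * C1) > 0" "2 * \<gamma> * amax / coer \<ge> 0" "Q + 3 * Q\<^sup>2 / (2 * D) + D / 2 \<ge> 0"
    using QD C1 \<gamma> amax coer_pos by simp_all
  ultimately show ?thesis using that by blast
qed

text \<open>For non-explosion forward and backward in time the derivative has to be bounded from
  both sides, so here the dissipation counts with its modulus.\<close>

lemma energy_growth:
  obtains K where "K \<ge> 0"
    "\<And>p \<eta> \<beta>. \<bar>Denergy p (field (p + noise_vec \<eta>) + noise_vec \<beta>)\<bar> \<le> K * (gauge_term \<eta> \<beta>)\<^sup>2 * (1 + energy p)"
proof -
  obtain Q D where QD: "Q \<ge> 0" "D > 0" and est:
    "\<And>v w u m \<eta> \<beta>. \<exists>R S n. Denergy (mom (v, w, u, m)) (field (mom (v, w, u, m) + noise_vec \<eta>) + noise_vec \<beta>) = S + n * m\<^sup>2 + R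
      \<and> S \<le> - D * (v\<^sup>2 + w\<^sup>2 + m\<^sup>2) \<and> \<bar>S\<bar> \<le> Q * (v\<^sup>2 + w\<^sup>2 + m\<^sup>2) \<and> \<bar>n\<bar> \<le> \<gamma> * amax * \<bar>\<eta>\<bar>
      \<and> \<bar>R\<bar> \<le> Q * gauge_term \<eta> \<beta> * (1 + \<bar>v\<bar> + \<bar>w\<bar> + \<bar>m\<bar>)"
    using Denergy_estimate by blast
  define K1 where "K1 = Q + \<gamma> * amax + 4 * Q"
  define K where "K = K1 * (1 + 2 / coer)"
  have K: "K1 \<ge> 0" "K \<ge> 0" using QD \<gamma> amax coer_pos by (simp_all add: K_def K1_def)
  have "\<bar>Denergy p (field (p + noise_vec \<eta>) + noise_vec \<beta>)\<bar> \<le> K * (gauge_term \<eta> \<beta>)\<^sup>2 * (1 + energy p)" for p \<eta> \<beta>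
  proof -
    obtain v w u m where p: "p = mom (v, w, u, m)" by (rule mom_surj)
    define N where "N = v\<^sup>2 + w\<^sup>2 + m\<^sup>2"
    define g where "g = gauge_term \<eta> \<beta>"
    obtain R S n where eq: "Denergy p (field (p + noise_vec \<eta>) + noise_vec \<beta>) = S + n * m\<^sup>2 + R"
      and S: "\<bar>S\<bar> \<le> Q * N" and n: "\<bar>n\<bar> \<le> \<gamma> * amax * \<bar>\<eta>\<bar>"
      and R: "\<bar>R\<bar> \<le> Q * g * (1 + \<bar>v\<bar> + \<bar>w\<bar> + \<bar>m\<bar>)"
      using est[of v w u m \<eta> \<beta>] unfolding p N_def g_def by blast
    have g: "1 \<le> g" "g \<le> g\<^sup>2" "1 \<le> g\<^sup>2" "\<bar>\<eta>\<bar> \<le> g\<^sup>2"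
      using gauge_term_ge(1,2,5)[of \<eta> \<beta>] unfolding g_def by linarith+
    have N: "N \<le> 2 / coer * energy p" "0 \<le> N"
      using sq_size_le_energy[of p] by (simp_all add: p sq_size_def N_def add.assoc)
    have one: "N \<le> g\<^sup>2 * (1 + N)" using mult_mono[of 1 "g\<^sup>2" N "1 + N"] g N by simp
    have b1: "\<bar>S\<bar> \<le> Q * (g\<^sup>2 * (1 + N))" using S mult_left_mono[OF one QD(1)] by linarith
    have b2: "\<bar>n * m\<^sup>2\<bar> \<le> \<gamma> * amax * (g\<^sup>2 * (1 + N))"
    proof -
      have "\<bar>n * m\<^sup>2\<bar> \<le> (\<gamma> * amax * \<bar>\<eta>\<bar>) * (1 + N)"
        unfolding abs_mult using n \<gamma> amax by (intro mult_mono) (auto simp: N_def)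
      also have "\<dots> \<le> (\<gamma> * amax * g\<^sup>2) * (1 + N)"
        using \<gamma> amax g N by (intro mult_right_mono mult_left_mono) auto
      finally show ?thesis by (simp add: mult.assoc)
    qed
    have sq: "\<bar>z\<bar> \<le> 1 + z\<^sup>2" for z :: real
      using abs_mult_le_squares[of z 1] zero_le_power2[of z] by simp
    have b3: "\<bar>R\<bar> \<le> 4 * Q * (g\<^sup>2 * (1 + N))"
    proof -
      have "1 + \<bar>v\<bar> + \<bar>w\<bar> + \<bar>m\<bar> \<le> 4 * (1 + N)"
        using sq[of v] sq[of w] sq[of m] zero_le_power2[of v] zero_le_power2[of w] zero_le_power2[of m] unfolding N_def distrib_left by linarith
      then have "Q * g * (1 + \<bar>v\<bar> + \<bar>w\<bar> + \<bar>m\<bar>) \<le> Q * g\<^sup>2 * (4 * (1 + N))"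
        using QD g by (intro mult_mono) auto
      also have "\<dots> = 4 * Q * (g\<^sup>2 * (1 + N))" by (simp only: mult_ac)
      finally show ?thesis by (rule order_trans[OF R])
    qed
    have "\<bar>S + n * m\<^sup>2 + R\<bar> \<le> \<bar>S\<bar> + \<bar>n * m\<^sup>2\<bar> + \<bar>R\<bar>" by linarith
    also have "\<dots> \<le> K1 * (g\<^sup>2 * (1 + N))" using b1 b2 b3 unfolding K1_def distrib_right by linarith
    also have "\<dots> \<le> K1 * (g\<^sup>2 * ((1 + 2 / coer) * (1 + energy p)))"
    proof -
      have "1 + N \<le> (1 + 2 / coer) * (1 + energy p)"
      proof -
        have "0 \<le> 2 / coer" using coer_pos by simp
        then show ?thesis
          using N(1) energy_nonneg[of p] unfolding distrib_left distrib_right mult_1 mult_1_right by linarith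
      qed
      then show ?thesis using K g by (intro mult_left_mono) auto
    qed
    finally show ?thesis unfolding eq g_def[symmetric] K_def by (simp add: mult_ac)
  qed
  then show ?thesis using that K by blast
qed

text \<open>On the cover the energy is periodic in the angle and cannot prevent its escape; the
  square of the angle repairs this. The 1 turns the affine growth of the energy into a
  multiplicative bound.\<close>

definition lyap :: "lifted \<Rightarrow> real" where
  "lyap p = 1 + energy p + (fst (snd (snd p)))\<^sup>2"

definition Dlyap :: "lifted \<Rightarrow> lifted \<Rightarrow> real" where
  "Dlyap p d = Denergy p d + 2 * fst (snd (snd p)) * fst (snd (snd d))"

lemma lyap_has_derivative:
  assumes "(p has_vector_derivative d) (at t)"
  shows "((\<lambda>t. lyap (p t)) has_real_derivative Dlyap (p t) d) (at t)"
proof -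
  have "bounded_linear (\<lambda>X::lifted. fst (snd (snd X)))" by (intro bounded_linear_intros)
  from bounded_linear.has_vector_derivative[OF this assms]
  have "((\<lambda>t. fst (snd (snd (p t)))) has_real_derivative fst (snd (snd d))) (at t)"
    by (simp add: has_real_derivative_iff_has_vector_derivative)
  then show ?thesis unfolding lyap_def Dlyap_def
    by (auto intro!: derivative_eq_intros energy_has_derivative[OF assms])
qed

lemma Dlyap_scale: "Dlyap p (r *\<^sub>R d) = r * Dlyap p d"
  by (simp add: Dlyap_def Denergy_scale algebra_simps)

lemma lyap_growth:
  obtains K where "K \<ge> 0" "\<And>p \<eta>. \<bar>Dlyap p (field (p + noise_vec \<eta>))\<bar> \<le> K * (gauge_term \<eta> 0)\<^sup>2 * lyap p"
proof -
  obtain K0 where K0: "K0 \<ge> 0"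
    "\<And>p \<eta> \<beta>. \<bar>Denergy p (field (p + noise_vec \<eta>) + noise_vec \<beta>)\<bar> \<le> K0 * (gauge_term \<eta> \<beta>)\<^sup>2 * (1 + energy p)"
    using energy_growth by blast
  define K where "K = K0 + 1 + 4 / coer + 2 * amax\<^sup>2"
  have "\<bar>Dlyap p (field (p + noise_vec \<eta>))\<bar> \<le> K * (gauge_term \<eta> 0)\<^sup>2 * lyap p" for p \<eta>
  proof -
    obtain v w u m where p: "p = mom (v, w, u, m)" by (rule mom_surj)
    define g where "g = gauge_term \<eta> 0"
    have g: "1 \<le> g" "g \<le> g\<^sup>2" "1 \<le> g\<^sup>2" "\<bar>\<eta>\<bar> \<le> g"
      using gauge_term_ge(1,2,5)[of \<eta> 0] unfolding g_def by linarith+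
    have E: "0 \<le> energy p" by (rule energy_nonneg)
    have l: "1 \<le> lyap p" "energy p \<le> lyap p" "u\<^sup>2 \<le> lyap p" "1 + energy p \<le> lyap p"
      using E by (simp_all add: lyap_def p mom_def)
    define du where "du = fst (snd (snd (field (p + noise_vec \<eta>))))"
    have du: "du = m + sin u * (rden u * \<eta>)"
      using vel_mom(2)[of w m u]
      by (simp add: du_def p mom_def field_def vel_shift)
    have "\<bar>sin u * (rden u * \<eta>)\<bar> \<le> 1 * (amax * g)"
      unfolding abs_mult using rden_bounds[of u] g by (intro mult_mono) auto
    then have "\<bar>du\<bar> \<le> \<bar>m\<bar> + amax * g" unfolding du by linarith
    then have "du\<^sup>2 \<le> (\<bar>m\<bar> + amax * g)\<^sup>2" using power_mono[of "\<bar>du\<bar>" _ 2] by simp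
    also have "\<dots> \<le> 2 * m\<^sup>2 + 2 * amax\<^sup>2 * g\<^sup>2"
      using sum_squares_bound[of "\<bar>m\<bar>" "amax * g"] by (simp add: power2_sum power_mult_distrib algebra_simps)
    also have "2 * m\<^sup>2 \<le> 2 * (2 / coer * energy p)"
      using sq_size_le_energy[of p] zero_le_power2[of v] zero_le_power2[of w] unfolding p sq_size_def unmom_mom prod.case by linarith
    finally have du2: "du\<^sup>2 \<le> 4 / coer * energy p + 2 * amax\<^sup>2 * g\<^sup>2" by simp
    have up: "x \<le> g\<^sup>2 * y" if "x \<le> y" "0 \<le> y" for x y :: real
      using that mult_right_mono[OF g(3) that(2)] by simp
    have "\<bar>2 * u * du\<bar> \<le> u\<^sup>2 + du\<^sup>2" using abs_mult_le_squares[of u du] by (simp add: abs_mult)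
    also have "\<dots> \<le> g\<^sup>2 * lyap p + (4 / coer * (g\<^sup>2 * lyap p) + 2 * amax\<^sup>2 * (g\<^sup>2 * lyap p))"
    proof (intro add_mono order_trans[OF du2])
      show "u\<^sup>2 \<le> g\<^sup>2 * lyap p" using l by (intro up) auto
      show "4 / coer * energy p \<le> 4 / coer * (g\<^sup>2 * lyap p)"
        using l coer_pos by (intro mult_left_mono up) auto
      have "g\<^sup>2 * 1 \<le> g\<^sup>2 * lyap p" using l by (intro mult_left_mono) auto
      then show "2 * amax\<^sup>2 * g\<^sup>2 \<le> 2 * amax\<^sup>2 * (g\<^sup>2 * lyap p)" by (intro mult_left_mono) auto
    qed
    finally have 1: "\<bar>2 * u * du\<bar> \<le> g\<^sup>2 * lyap p + (4 / coer * (g\<^sup>2 * lyap p) + 2 * amax\<^sup>2 * (g\<^sup>2 * lyap p))" .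
    have "\<bar>Denergy p (field (p + noise_vec \<eta>))\<bar> \<le> K0 * g\<^sup>2 * (1 + energy p)"
      using K0(2)[of p \<eta> 0] by (simp add: g_def)
    also have "\<dots> \<le> K0 * (g\<^sup>2 * lyap p)"
      using K0(1) l by (simp add: mult.assoc mult_left_mono)
    finally have 2: "\<bar>Denergy p (field (p + noise_vec \<eta>))\<bar> \<le> K0 * (g\<^sup>2 * lyap p)" .
    have "Dlyap p (field (p + noise_vec \<eta>)) = Denergy p (field (p + noise_vec \<eta>)) + 2 * u * du"
      by (simp add: Dlyap_def du_def p mom_def)
    then have "\<bar>Dlyap p (field (p + noise_vec \<eta>))\<bar> \<le> \<bar>Denergy p (field (p + noise_vec \<eta>))\<bar> + \<bar>2 * u * du\<bar>" by linarith
    also have "\<dots> \<le> K * (g\<^sup>2 * lyap p)" using 1 2 unfolding K_def distrib_right by linarith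
    finally show ?thesis by (simp add: g_def mult.assoc)
  qed
  moreover have "K \<ge> 0" using K0 coer_pos by (simp add: K_def)
  ultimately show ?thesis using that by blast
qed

lemma lyap_coercive: "(norm p)\<^sup>2 \<le> (1 + 8 / coer) * lyap p"
proof -
  obtain v w u m where p: "p = mom (v, w, u, m)" by (rule mom_surj)
  have sq: "(a + b)\<^sup>2 \<le> 2 * (a\<^sup>2 + b\<^sup>2)" for a b :: real
    using sum_squares_bound[of a b] by (simp add: power2_sum)
  have small: "(r * z)\<^sup>2 \<le> z\<^sup>2" if "\<bar>r\<bar> \<le> 1" for r z :: real
    using mult_mono[of "r\<^sup>2" 1 "z\<^sup>2" "z\<^sup>2"] that by (simp add: power_mult_distrib abs_square_le_1)
  have g: "\<bar>\<gamma> * sin u\<bar> \<le> 1" using mult_mono[of \<gamma> 1 "\<bar>sin u\<bar>" 1] \<gamma> by (simp add: abs_mult)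
  have "(w - \<gamma> * m * sin u)\<^sup>2 \<le> 2 * (w\<^sup>2 + m\<^sup>2)"
    using sq[of w "- (\<gamma> * sin u * m)"] small[OF g, of m] by (simp add: mult_ac)
  moreover have "(m - w * sin u)\<^sup>2 \<le> 2 * (m\<^sup>2 + w\<^sup>2)"
    using sq[of m "- (sin u * w)"] small[of "sin u" w] by (simp add: mult_ac)
  moreover have "sq_size (unmom p) = v\<^sup>2 + w\<^sup>2 + m\<^sup>2" by (simp add: p sq_size_def)
  moreover have "(norm p)\<^sup>2 = v\<^sup>2 + ((w - \<gamma> * m * sin u)\<^sup>2 + (u\<^sup>2 + (m - w * sin u)\<^sup>2))"
    by (simp add: p mom_def norm_prod_def)
  ultimately have "(norm p)\<^sup>2 \<le> 4 * sq_size (unmom p) + u\<^sup>2"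
    using zero_le_power2[of v] unfolding distrib_left by linarith
  also have "\<dots> \<le> 4 * (2 / coer * energy p) + u\<^sup>2" using sq_size_le_energy[of p] by simp
  also have "\<dots> \<le> 8 / coer * lyap p + 1 * lyap p"
  proof -
    have "energy p \<le> lyap p" "u\<^sup>2 \<le> lyap p"
      using energy_nonneg[of p] by (simp_all add: lyap_def p mom_def)
    then have "8 / coer * energy p \<le> 8 / coer * lyap p" using coer_pos by (intro mult_left_mono) auto
    with \<open>u\<^sup>2 \<le> lyap p\<close> show ?thesis by simp
  qed
  finally show ?thesis by (simp add: distrib_right)
qed

lemma lyap_ge_1: "lyap p \<ge> 1"
  using energy_nonneg[of p] by (simp add: lyap_def)

lemma lips_energy: "lips energy"
proof -
  have r: "lips (\<lambda>p. rden (f p))" if "lips f" for f :: "lifted \<Rightarrow> real"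
    unfolding rden_def inverse_eq_divide
    by (intro lips_divide[where c = "1 - \<gamma>"] lips_intros lips_den den_bounds that) (simp add: \<gamma>)
  show ?thesis unfolding energy_def case_prod_beta
    by (intro lips_intros lips_divide[where c = 2] r) auto
qed

lemma lips_lyap: "lips lyap"
  unfolding lyap_def by (intro lips_intros lips_energy)

end

section \<open>The flow and the solution map\<close>

lemma bounded_on_interval:
  assumes "continuous_on UNIV (\<omega> :: real \<Rightarrow> real)"
  obtains W where "W \<ge> 0" "\<And>t. \<bar>t\<bar> \<le> T \<Longrightarrow> \<bar>\<omega> t\<bar> \<le> W"
proof -
  have "compact (\<omega> ` {-T..T})"
    by (intro compact_continuous_image continuous_on_subset[OF assms]) auto
  from compact_imp_bounded[OF this] obtain W where "\<And>t. t \<in> {-T..T} \<Longrightarrow> norm (\<omega> t) \<le> W"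
    unfolding bounded_iff by blast
  note W = this
  have "\<bar>\<omega> t\<bar> \<le> max W 0" if "\<bar>t\<bar> \<le> T" for t
    using W[of t] that by (auto simp: abs_le_iff)
  then show thesis using that[of "max W 0"] by simp
qed

lemma path_spaceD: "\<omega> \<in> path_space \<Longrightarrow> continuous_on UNIV \<omega>" "\<omega> \<in> path_space \<Longrightarrow> \<omega> 0 = 0"
  by (simp_all add: path_space_def)

lemma continuous_on_wiener_shift:
  assumes "continuous_on UNIV \<omega>" shows "continuous_on UNIV (wiener_shift s \<omega>)"
  unfolding wiener_shift_def by (intro continuous_intros continuous_on_compose_UNIV[OF assms])

lemma wiener_shift_path_space: "\<omega> \<in> path_space \<Longrightarrow> wiener_shift s \<omega> \<in> path_space"
  using continuous_on_wiener_shift by (simp add: path_space_def) (simp add: wiener_shift_def)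

lemma trig_shift3: "sin (u + 2 * pi * of_int k) = sin u" "cos (u + 2 * pi * of_int k) = cos u"
  by (simp_all add: sin_add cos_add)

context pendulum
begin

abbreviation noise_field :: "(real \<Rightarrow> real) \<Rightarrow> real \<Rightarrow> lifted \<Rightarrow> lifted" where
  "noise_field \<omega> t p \<equiv> field (p + noise_vec (\<sigma> * \<omega> t))"

lemma norm_noise_vec_bound:
  assumes "norm z \<le> B" "\<bar>r\<bar> \<le> W" shows "norm (z + noise_vec (\<sigma> * r)) \<le> B + \<sigma> * W"
proof -
  have "norm (noise_vec (\<sigma> * r)) \<le> \<sigma> * W" using assms(2) \<sigma> by (simp add: abs_mult)
  then show ?thesis using norm_triangle_ineq[of z "noise_vec (\<sigma> * r)"] assms(1) by linarith
qed

lemma ball_lipschitz_noise_field: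
  assumes "continuous_on UNIV \<omega>" shows "ball_lipschitz (noise_field \<omega>)"
  unfolding ball_lipschitz_def
proof (intro allI)
  fix T M
  obtain W where W: "W \<ge> 0" "\<And>t. \<bar>t\<bar> \<le> T \<Longrightarrow> \<bar>\<omega> t\<bar> \<le> W" using bounded_on_interval[OF assms] by blast
  obtain L where L: "L \<ge> 0" "\<And>x y. norm x \<le> M + \<sigma> * W \<Longrightarrow> norm y \<le> M + \<sigma> * W \<Longrightarrow> norm (field x - field y) \<le> L * norm (x - y)"
    by (rule lipsE[OF lips_field]) (rule that)
  have "norm (noise_field \<omega> t x - noise_field \<omega> t y) \<le> L * norm (x - y)"
    if "\<bar>t\<bar> \<le> T" "norm x \<le> M" "norm y \<le> M" for t x y
  proof -
    have "norm (x + noise_vec (\<sigma> * \<omega> t)) \<le> M + \<sigma> * W" "norm (y + noise_vec (\<sigma> * \<omega> t)) \<le> M + \<sigma> * W"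
      by (intro norm_noise_vec_bound W that)+
    from L(2)[OF this] show ?thesis by simp
  qed
  then show "\<exists>L\<ge>0. \<forall>t x y. \<bar>t\<bar> \<le> T \<longrightarrow> norm x \<le> M \<longrightarrow> norm y \<le> M \<longrightarrow>
      norm (noise_field \<omega> t x - noise_field \<omega> t y) \<le> L * norm (x - y)"
    using L(1) by blast
qed

lemma gauge_term_mono: "\<bar>\<eta>\<bar> \<le> A \<Longrightarrow> (gauge_term \<eta> 0)\<^sup>2 \<le> (gauge_term A 0)\<^sup>2"
  using power_mono[of "\<bar>\<eta>\<bar>" A 2] unfolding gauge_term_def by (intro power_mono) auto

lemma lyap_growth_noise:
  "\<exists>K\<ge>0. \<forall>\<eta> p. \<bar>\<eta>\<bar> \<le> W \<longrightarrow> \<bar>Dlyap p (field (p + noise_vec (\<sigma> * \<eta>)))\<bar> \<le> K * lyap p"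
proof -
  obtain K where K: "K \<ge> 0" "\<And>p \<eta>. \<bar>Dlyap p (field (p + noise_vec \<eta>))\<bar> \<le> K * (gauge_term \<eta> 0)\<^sup>2 * lyap p"
    using lyap_growth by blast
  have "\<bar>Dlyap p (field (p + noise_vec (\<sigma> * \<eta>)))\<bar> \<le> (K * (gauge_term (\<sigma> * W) 0)\<^sup>2) * lyap p"
    if "\<bar>\<eta>\<bar> \<le> W" for \<eta> p
  proof -
    have "\<bar>\<sigma> * \<eta>\<bar> \<le> \<sigma> * W" using that \<sigma> by (simp add: abs_mult)
    then have "K * (gauge_term (\<sigma> * \<eta>) 0)\<^sup>2 * lyap p \<le> K * (gauge_term (\<sigma> * W) 0)\<^sup>2 * lyap p"
      using K(1) lyap_ge_1[of p] by (intro mult_right_mono mult_left_mono gauge_term_mono) auto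
    with K(2)[of p "\<sigma> * \<eta>"] show ?thesis by linarith
  qed
  then show ?thesis using K(1) by (intro exI[of _ "K * (gauge_term (\<sigma> * W) 0)\<^sup>2"]) auto
qed

lemma path_ode_exists:
  assumes \<omega>: "continuous_on UNIV \<omega>" shows "\<exists>p. p 0 = p0 \<and> path_ode \<omega> p"
proof -
  have "continuous_on UNIV (\<lambda>(t, p). noise_field \<omega> t p)"
    unfolding case_prod_beta noise_vec_def
    by (intro continuous_on_compose_UNIV[OF lips_continuous[OF lips_field]] continuous_intros
      continuous_on_compose_UNIV[OF \<omega>])
  moreover have "\<exists>C. \<forall>t x. \<bar>t\<bar> \<le> T \<longrightarrow> \<bar>Dlyap x (noise_field \<omega> t x)\<bar> \<le> C * lyap x" for T
  proof -
    obtain W where "\<And>t. \<bar>t\<bar> \<le> T \<Longrightarrow> \<bar>\<omega> t\<bar> \<le> W" using bounded_on_interval[OF \<omega>] by blast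
    moreover obtain K where "\<And>\<eta> p. \<bar>\<eta>\<bar> \<le> W \<Longrightarrow> \<bar>Dlyap p (field (p + noise_vec (\<sigma> * \<eta>)))\<bar> \<le> K * lyap p"
      using lyap_growth_noise by blast
    ultimately show ?thesis by blast
  qed
  ultimately have "\<exists>y. y 0 = p0 \<and> (\<forall>t. (y has_vector_derivative noise_field \<omega> t (y t)) (at t))"
    using coer_pos by (intro ode_global_existence[where V = lyap and DV = Dlyap and c = "1 + 8 / coer"]
      ball_lipschitz_noise_field \<omega> lyap_has_derivative Dlyap_scale lyap_coercive)
      (auto intro: add_pos_pos)
  then show ?thesis unfolding path_ode_def by blast
qed

definition flow :: "(real \<Rightarrow> real) \<Rightarrow> lifted \<Rightarrow> real \<Rightarrow> lifted" where
  "flow \<omega> p0 = (SOME p. p 0 = p0 \<and> path_ode \<omega> p)"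

lemma flow:
  assumes "continuous_on UNIV \<omega>" shows "flow \<omega> p0 0 = p0" "path_ode \<omega> (flow \<omega> p0)"
  using someI_ex[OF path_ode_exists[OF assms]] unfolding flow_def by auto

lemma flow_derivative:
  assumes "continuous_on UNIV \<omega>"
  shows "(flow \<omega> p0 has_vector_derivative noise_field \<omega> t (flow \<omega> p0 t)) (at t)"
  using flow(2)[OF assms] by (simp add: path_ode_def)

lemma flow_unique:
  assumes "continuous_on UNIV \<omega>" "path_ode \<omega> p" shows "flow \<omega> (p 0) = p"
proof
  fix t
  show "flow \<omega> (p 0) t = p t"
    by (rule ode_unique[OF ball_lipschitz_noise_field[OF assms(1)], where T = "\<bar>t\<bar>"])
      (use flow[OF assms(1)] assms(2) in \<open>auto simp: path_ode_def\<close>)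
qed

text \<open>The path enters only through its supremum over \<open>{-T..T}\<close>, hence one bound
  serves all paths near a given one.\<close>

lemma flow_bound:
  "\<exists>B. \<forall>\<omega> p0 t. continuous_on UNIV \<omega> \<longrightarrow> (\<forall>t. \<bar>t\<bar> \<le> T \<longrightarrow> \<bar>\<omega> t\<bar> \<le> W) \<longrightarrow> norm p0 \<le> M \<longrightarrow> \<bar>t\<bar> \<le> T
    \<longrightarrow> norm (flow \<omega> p0 t) \<le> B"
proof -
  obtain K where K: "K \<ge> 0" "\<And>\<eta> p. \<bar>\<eta>\<bar> \<le> W \<Longrightarrow> \<bar>Dlyap p (field (p + noise_vec (\<sigma> * \<eta>)))\<bar> \<le> K * lyap p"
    using lyap_growth_noise by blast
  obtain V where V: "V \<ge> 0" "\<And>p. norm p \<le> M \<Longrightarrow> norm (lyap p) \<le> V"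
    using lips_bounded[OF lips_lyap] by blast
  have "norm (flow \<omega> p0 t) \<le> sqrt ((1 + 8 / coer) * (V * exp (K * T)))"
    if \<omega>: "continuous_on UNIV \<omega>" and W: "\<And>t. \<bar>t\<bar> \<le> T \<Longrightarrow> \<bar>\<omega> t\<bar> \<le> W" and p0: "norm p0 \<le> M" and t: "\<bar>t\<bar> \<le> T" for \<omega> p0 t
  proof (rule real_le_rsqrt)
    have "lyap (flow \<omega> p0 t) \<le> lyap (flow \<omega> p0 0) * exp (K * \<bar>t\<bar>)"
    proof (rule growth_bound[OF lyap_has_derivative[OF flow_derivative[OF \<omega>]] _ t])
      fix s assume "\<bar>s\<bar> \<le> T"
      from K(2)[OF W[OF this]]
      show "\<bar>Dlyap (flow \<omega> p0 s) (noise_field \<omega> s (flow \<omega> p0 s))\<bar> \<le> K * lyap (flow \<omega> p0 s)" .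
    qed
    also have "\<dots> \<le> V * exp (K * T)"
      using V(2)[OF p0] V(1) flow(1)[OF \<omega>] K(1) t by (intro mult_mono) (auto intro: mult_left_mono)
    finally have "(1 + 8 / coer) * lyap (flow \<omega> p0 t) \<le> (1 + 8 / coer) * (V * exp (K * T))"
      using coer_pos by (intro mult_left_mono) auto
    then show "(norm (flow \<omega> p0 t))\<^sup>2 \<le> (1 + 8 / coer) * (V * exp (K * T))"
      using lyap_coercive order_trans by blast
  qed
  then show ?thesis by blast
qed

text \<open>The one estimate behind continuity in the state and measurability in the path. As the
  field is only locally Lipschitz, all nearby trajectories first have to be confined by
  \<open>flow_bound\<close> to a common ball, on which one constant is valid.\<close>

lemma flow_dependence:
  assumes \<omega>0: "continuous_on UNIV \<omega>0" and e: "e > 0"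
  shows "\<exists>\<delta>>0. \<forall>\<omega> p. continuous_on UNIV \<omega> \<longrightarrow> (\<forall>t. \<bar>t\<bar> \<le> T \<longrightarrow> \<bar>\<omega> t - \<omega>0 t\<bar> < \<delta>) \<longrightarrow> norm (p - p0) < \<delta> \<longrightarrow>
    (\<forall>t. \<bar>t\<bar> \<le> T \<longrightarrow> norm (flow \<omega> p t - flow \<omega>0 p0 t) < e)"
proof -
  obtain W where W: "W \<ge> 0" "\<And>t. \<bar>t\<bar> \<le> T \<Longrightarrow> \<bar>\<omega>0 t\<bar> \<le> W" using bounded_on_interval[OF \<omega>0] by blast
  obtain B where B': "\<forall>\<omega> p t. continuous_on UNIV \<omega> \<longrightarrow> (\<forall>t. \<bar>t\<bar> \<le> T \<longrightarrow> \<bar>\<omega> t\<bar> \<le> W + 1) \<longrightarrow> norm p \<le> norm p0 + 1 \<longrightarrow>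
     \<bar>t\<bar> \<le> T \<longrightarrow> norm (flow \<omega> p t) \<le> B"
    using flow_bound by blast
  note B = B'[rule_format]
  obtain L where L: "L \<ge> 0" "\<And>x y. norm x \<le> B + \<sigma> * (W + 1) \<Longrightarrow> norm y \<le> B + \<sigma> * (W + 1) \<Longrightarrow> norm (field x - field y) \<le> L * norm (x - y)"
    by (rule lipsE[OF lips_field]) (rule that)
  \<comment> \<open>The factor by which \<open>ode_dependence\<close>, with error
    \<open>L * \<sigma> * \<delta>\<close>, amplifies \<open>\<delta>\<^sup>2\<close>; with \<delta>
    at most \<open>e / (S + 1)\<close> the result stays strictly below
    \<open>e\<^sup>2\<close>.\<close>
  define S where "S = (1 + (L * \<sigma>)\<^sup>2) * exp ((2 * L + 1) * \<bar>T\<bar>)"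
  have S: "S \<ge> 0" by (simp add: S_def)
  define \<delta> where "\<delta> = min 1 (e / (S + 1))"
  have \<delta>: "\<delta> > 0" "\<delta> \<le> 1" "\<delta> \<le> e / (S + 1)" using e S by (simp_all add: \<delta>_def)
  have "norm (flow \<omega> p t - flow \<omega>0 p0 t) < e"
    if \<omega>: "continuous_on UNIV \<omega>" and close: "\<forall>t. \<bar>t\<bar> \<le> T \<longrightarrow> \<bar>\<omega> t - \<omega>0 t\<bar> < \<delta>" and p: "norm (p - p0) < \<delta>" and t: "\<bar>t\<bar> \<le> T"
    for \<omega> p t
  proof -
    have W': "\<bar>\<omega> s\<bar> \<le> W + 1" "\<bar>\<omega>0 s\<bar> \<le> W + 1" if "\<bar>s\<bar> \<le> T" for s
      using W(2)[OF that] close[rule_format, OF that] \<delta>(2) by linarith+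
    have "norm p \<le> norm p0 + 1" using norm_triangle_sub[of p p0] p \<delta>(2) by linarith
    then have b1: "norm (flow \<omega> p s) \<le> B" if "\<bar>s\<bar> \<le> T" for s by (intro B \<omega> W' that)
    have b0: "norm (flow \<omega>0 p0 s) \<le> B" if "\<bar>s\<bar> \<le> T" for s by (intro B \<omega>0 W' that) simp_all
    have "(norm (flow \<omega> p t - flow \<omega>0 p0 t))\<^sup>2 \<le> ((norm (flow \<omega> p 0 - flow \<omega>0 p0 0))\<^sup>2 + (L * \<sigma> * \<delta>)\<^sup>2) * exp ((2 * L + 1) * \<bar>t\<bar>)"
    proof (rule ode_dependence[OF flow_derivative[OF \<omega>] flow_derivative[OF \<omega>0] _ L(1) t])
      fix s assume s: "\<bar>s\<bar> \<le> T"
      have "norm (noise_field \<omega> s (flow \<omega> p s) - noise_field \<omega>0 s (flow \<omega>0 p0 s))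
         \<le> L * norm ((flow \<omega> p s + noise_vec (\<sigma> * \<omega> s)) - (flow \<omega>0 p0 s + noise_vec (\<sigma> * \<omega>0 s)))"
        by (intro L(2) norm_noise_vec_bound b1 b0 W' s)
      also have "(flow \<omega> p s + noise_vec (\<sigma> * \<omega> s)) - (flow \<omega>0 p0 s + noise_vec (\<sigma> * \<omega>0 s))
          = (flow \<omega> p s - flow \<omega>0 p0 s) + noise_vec (\<sigma> * (\<omega> s - \<omega>0 s))"
        by (simp add: noise_vec_def algebra_simps)
      also have "norm \<dots> \<le> norm (flow \<omega> p s - flow \<omega>0 p0 s) + \<sigma> * \<delta>"
        using close[rule_format, OF s] by (intro norm_noise_vec_bound) auto
      finally show "norm (noise_field \<omega> s (flow \<omega> p s) - noise_field \<omega>0 s (flow \<omega>0 p0 s))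
         \<le> L * norm (flow \<omega> p s - flow \<omega>0 p0 s) + L * \<sigma> * \<delta>"
        using L(1) by (simp add: distrib_left mult_left_mono mult.assoc)
    qed
    also have "\<dots> \<le> (\<delta>\<^sup>2 + (L * \<sigma> * \<delta>)\<^sup>2) * exp ((2 * L + 1) * \<bar>T\<bar>)"
      using p t L(1) flow(1)[OF \<omega>] flow(1)[OF \<omega>0]
      by (intro mult_mono add_mono power_mono order_refl) (auto intro!: mult_left_mono)
    also have "\<dots> = \<delta>\<^sup>2 * S" by (simp add: S_def power_mult_distrib algebra_simps)
    also have "\<dots> \<le> (e / (S + 1))\<^sup>2 * S" using \<delta> S by (intro mult_right_mono power_mono) auto
    also have "\<dots> = e\<^sup>2 * (S / (S + 1)\<^sup>2)" by (simp add: power_divide)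
    also have "\<dots> < e\<^sup>2 * 1"
    proof (intro mult_strict_left_mono)
      have "S < (S + 1)\<^sup>2" using S by (simp add: power2_eq_square algebra_simps add_pos_nonneg)
      then show "S / (S + 1)\<^sup>2 < 1" using S by (simp add: divide_less_eq_1)
    qed (use e in simp)
    finally show ?thesis using e by (simp add: power_less_imp_less_base)
  qed
  then show ?thesis using \<delta>(1) by blast
qed

text \<open>The deck transformations of the cover.\<close>

definition shift3 :: "int \<Rightarrow> lifted" where "shift3 k = (0, 0, 2 * pi * of_int k, 0)"

lemma shift3_equivariant:
  "mom (X + shift3 k) = mom X + shift3 k" "unmom (X + shift3 k) = unmom X + shift3 k"
  "field (X + shift3 k) = field X"
  by (cases X; simp add: mom_def unmom_def field_def shift3_def vel1_def vel2_def den_def trig_shift3)+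

lemma flow_shift3:
  assumes "continuous_on UNIV \<omega>" shows "flow \<omega> (p + shift3 k) t = flow \<omega> p t + shift3 k"
proof -
  have "path_ode \<omega> (\<lambda>t. flow \<omega> p t + shift3 k)"
    unfolding path_ode_def
  proof
    fix t
    have "field (flow \<omega> p t + shift3 k + noise_vec (\<sigma> * \<omega> t)) = noise_field \<omega> t (flow \<omega> p t)"
      using shift3_equivariant(3)[of "flow \<omega> p t + noise_vec (\<sigma> * \<omega> t)" k] by (simp add: add_ac)
    then show "((\<lambda>t. flow \<omega> p t + shift3 k) has_vector_derivative field (flow \<omega> p t + shift3 k + noise_vec (\<sigma> * \<omega> t))) (at t)"
      using flow_derivative[OF assms, of p t] by (simp add: has_vector_derivative_add_const)
  qed
  from flow_unique[OF assms this] show ?thesis using flow(1)[OF assms] by (simp add: fun_eq_iff)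
qed

text \<open>The shifted path has lost the constant \<open>\<omega> s\<close>; adding it to the
  momentum restores the same argument of \<open>field\<close>, and uniqueness identifies the two
  solutions.\<close>

lemma flow_wiener_shift:
  assumes "continuous_on UNIV \<omega>"
  shows "flow (wiener_shift s \<omega>) (flow \<omega> p s + noise_vec (\<sigma> * \<omega> s)) t = flow \<omega> p (t + s) + noise_vec (\<sigma> * \<omega> s)"
proof -
  have c: "continuous_on UNIV (wiener_shift s \<omega>)"
    unfolding wiener_shift_def by (intro continuous_intros continuous_on_compose_UNIV[OF assms])
  have "path_ode (wiener_shift s \<omega>) (\<lambda>t. flow \<omega> p (t + s) + noise_vec (\<sigma> * \<omega> s))"
    unfolding path_ode_def
  proof
    fix t
    have "noise_vec (\<sigma> * \<omega> s) + noise_vec (\<sigma> * wiener_shift s \<omega> t) = noise_vec (\<sigma> * \<omega> (t + s))"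
      by (simp add: noise_vec_def wiener_shift_def algebra_simps)
    moreover have "((\<lambda>t. flow \<omega> p (t + s)) has_vector_derivative noise_field \<omega> (t + s) (flow \<omega> p (t + s))) (at t)"
    proof -
      have "((\<lambda>t. t + s) has_vector_derivative 1) (at t)" by (auto intro!: derivative_eq_intros)
      from vector_diff_chain_at[OF this flow_derivative[OF assms]] show ?thesis by (simp add: o_def)
    qed
    ultimately show "((\<lambda>t. flow \<omega> p (t + s) + noise_vec (\<sigma> * \<omega> s)) has_vector_derivative
        noise_field (wiener_shift s \<omega>) t (flow \<omega> p (t + s) + noise_vec (\<sigma> * \<omega> s))) (at t)"
      by (simp add: has_vector_derivative_add_const add.assoc)
  qed
  from flow_unique[OF c this] show ?thesis by (simp add: fun_eq_iff)
qed

section \<open>The solution map on the cover and on the state space\<close>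

definition Phi :: "real \<Rightarrow> (real \<Rightarrow> real) \<Rightarrow> lifted \<Rightarrow> lifted" where
  "Phi t \<omega> X = unmom (flow \<omega> (mom X) t + noise_vec (\<sigma> * \<omega> t))"

abbreviation "sol \<equiv> solution_map \<zeta>1 \<zeta>2 \<kappa>1 \<kappa>2 \<gamma> \<sigma>"

lemma Phi_0: "\<omega> \<in> path_space \<Longrightarrow> Phi 0 \<omega> X = X"
  using flow(1) by (simp add: Phi_def path_spaceD)

lemma Phi_shift3: "\<omega> \<in> path_space \<Longrightarrow> Phi t \<omega> (X + shift3 k) = Phi t \<omega> X + shift3 k"
proof -
  assume \<omega>: "\<omega> \<in> path_space"
  have "flow \<omega> (mom X) t + shift3 k + noise_vec (\<sigma> * \<omega> t) = (flow \<omega> (mom X) t + noise_vec (\<sigma> * \<omega> t)) + shift3 k" by simp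
  then show ?thesis
    unfolding Phi_def shift3_equivariant(1) flow_shift3[OF path_spaceD(1)[OF \<omega>]] by (simp only: shift3_equivariant(2))
qed

lemma Phi_cocycle: 
  assumes "\<omega> \<in> path_space"
  shows "Phi (t + s) \<omega> X = Phi t (wiener_shift s \<omega>) (Phi s \<omega> X)"
proof -
  have "noise_vec (\<sigma> * \<omega> s) + noise_vec (\<sigma> * wiener_shift s \<omega> t) = noise_vec (\<sigma> * \<omega> (t + s))"
    by (simp add: noise_vec_def wiener_shift_def algebra_simps)
  then show ?thesis
    by (simp add: Phi_def flow_wiener_shift[OF path_spaceD(1)[OF assms]] add.assoc)
qed

lemma to_state_shift3: "to_state X = to_state Y \<longleftrightarrow> (\<exists>k. X = Y + shift3 k)"
  unfolding shift3_def by (rule to_state_eq_iff)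

lemma sde_solution_iff:
  assumes "\<omega> \<in> path_space"
  shows "sde_solution \<zeta>1 \<zeta>2 \<kappa>1 \<kappa>2 \<gamma> \<sigma> \<omega> v \<longleftrightarrow> (\<exists>X. v = (\<lambda>t. to_state (Phi t \<omega> X)))"
proof -
  note c = path_spaceD(1)[OF assms]
  have "sde_solution \<zeta>1 \<zeta>2 \<kappa>1 \<kappa>2 \<gamma> \<sigma> \<omega> v \<longleftrightarrow>
    (\<exists>V. (\<forall>t. v t = to_state (V t)) \<and> path_ode \<omega> (\<lambda>t. mom (V t) - noise_vec (\<sigma> * \<omega> t)))"
    unfolding sde_solution_def using sde_iff_path_ode[OF c] by meson
  also have "\<dots> \<longleftrightarrow> (\<exists>X. v = (\<lambda>t. to_state (Phi t \<omega> X)))"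
  proof
    assume "\<exists>V. (\<forall>t. v t = to_state (V t)) \<and> path_ode \<omega> (\<lambda>t. mom (V t) - noise_vec (\<sigma> * \<omega> t))"
    then obtain V where V: "\<And>t. v t = to_state (V t)" "path_ode \<omega> (\<lambda>t. mom (V t) - noise_vec (\<sigma> * \<omega> t))" by blast
    from flow_unique[OF c V(2)] have "flow \<omega> (mom (V 0)) = (\<lambda>t. mom (V t) - noise_vec (\<sigma> * \<omega> t))"
      by (simp add: path_spaceD(2)[OF assms])
    then have "Phi t \<omega> (V 0) = V t" for t by (simp add: Phi_def)
    then show "\<exists>X. v = (\<lambda>t. to_state (Phi t \<omega> X))" using V(1) by (intro exI[of _ "V 0"]) auto
  next
    assume "\<exists>X. v = (\<lambda>t. to_state (Phi t \<omega> X))"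
    then obtain X where X: "v = (\<lambda>t. to_state (Phi t \<omega> X))" by blast
    have "path_ode \<omega> (\<lambda>t. mom (Phi t \<omega> X) - noise_vec (\<sigma> * \<omega> t))"
      using flow(2)[OF c] by (simp add: Phi_def)
    with X show "\<exists>V. (\<forall>t. v t = to_state (V t)) \<and> path_ode \<omega> (\<lambda>t. mom (V t) - noise_vec (\<sigma> * \<omega> t))"
      by (intro exI[of _ "\<lambda>t. Phi t \<omega> X"]) simp
  qed
  finally show ?thesis .
qed

lemma sde_solution_Phi:
  "\<omega> \<in> path_space \<Longrightarrow> sde_solution \<zeta>1 \<zeta>2 \<kappa>1 \<kappa>2 \<gamma> \<sigma> \<omega> (\<lambda>t. to_state (Phi t \<omega> X))"
  unfolding sde_solution_iff by (rule exI, rule refl)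

text \<open>Two lifts of one initial state differ by a deck transformation, and these commute with
  the flow because the coefficients are periodic.\<close>

lemma sde_solution_unique:
  assumes "\<omega> \<in> path_space" "sde_solution \<zeta>1 \<zeta>2 \<kappa>1 \<kappa>2 \<gamma> \<sigma> \<omega> v" "v 0 = to_state X"
  shows "v = (\<lambda>t. to_state (Phi t \<omega> X))"
proof -
  obtain Y where Y: "v = (\<lambda>t. to_state (Phi t \<omega> Y))" using assms sde_solution_iff by blast
  then have "to_state Y = to_state X" using assms by (simp add: Phi_0)
  then obtain k where "Y = X + shift3 k" unfolding to_state_shift3 by blast
  then have "to_state (Phi t \<omega> Y) = to_state (Phi t \<omega> X)" for t
    unfolding to_state_shift3 using Phi_shift3[OF assms(1)] by blast
  then show ?thesis unfolding Y by simp
qed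

lemma sde_solution_ex1:
  assumes "\<omega> \<in> path_space"
  shows "\<exists>!v. sde_solution \<zeta>1 \<zeta>2 \<kappa>1 \<kappa>2 \<gamma> \<sigma> \<omega> v \<and> v 0 = x"
proof -
  obtain X where x: "x = to_state X" using to_state_surj by metis
  show ?thesis
  proof (rule ex1I[of _ "\<lambda>t. to_state (Phi t \<omega> X)"])
    show "sde_solution \<zeta>1 \<zeta>2 \<kappa>1 \<kappa>2 \<gamma> \<sigma> \<omega> (\<lambda>t. to_state (Phi t \<omega> X)) \<and> to_state (Phi 0 \<omega> X) = x"
      by (simp add: sde_solution_Phi[OF assms] Phi_0[OF assms] x)
  qed (use sde_solution_unique[OF assms] x in blast)
qed

lemma solution_map_to_state:
  assumes "\<omega> \<in> path_space" shows "sol t \<omega> (to_state X) = to_state (Phi t \<omega> X)"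
proof -
  have "(THE v. sde_solution \<zeta>1 \<zeta>2 \<kappa>1 \<kappa>2 \<gamma> \<sigma> \<omega> v \<and> v 0 = to_state X) = (\<lambda>t. to_state (Phi t \<omega> X))"
    by (intro the1_equality sde_solution_ex1[OF assms]) (simp add: sde_solution_Phi[OF assms] Phi_0[OF assms])
  then show ?thesis by (simp add: solution_map_def)
qed

lemma solution_map_0: "\<omega> \<in> path_space \<Longrightarrow> sol 0 \<omega> x = x"
  using to_state_surj[of x] by (auto simp: solution_map_to_state Phi_0)

lemma solution_map_cocycle:
  "\<omega> \<in> path_space \<Longrightarrow> sol (t + s) \<omega> x = sol t (wiener_shift s \<omega>) (sol s \<omega> x)"
  using to_state_surj[of x] by (auto simp: solution_map_to_state wiener_shift_path_space Phi_cocycle)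

lemma continuous_on_flow:
  assumes \<omega>: "continuous_on UNIV \<omega>" shows "continuous_on UNIV (\<lambda>(t, p). flow \<omega> p t)"
  unfolding continuous_on_iff
proof safe
  fix t0 :: real and a b c d e :: real assume e: "e > 0"
  let ?p0 = "(a, b, c, d)"
  obtain \<delta>1 where \<delta>1: "\<delta>1 > 0" "\<And>\<omega>' p t. continuous_on UNIV \<omega>' \<Longrightarrow> (\<forall>t. \<bar>t\<bar> \<le> \<bar>t0\<bar> + 1 \<longrightarrow> \<bar>\<omega>' t - \<omega> t\<bar> < \<delta>1) \<Longrightarrow> norm (p - ?p0) < \<delta>1 \<Longrightarrow>
    \<bar>t\<bar> \<le> \<bar>t0\<bar> + 1 \<Longrightarrow> norm (flow \<omega>' p t - flow \<omega> ?p0 t) < e / 2"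
    using flow_dependence[OF \<omega>, of "e / 2" "\<bar>t0\<bar> + 1" ?p0] e by auto
  have "continuous (at t0) (flow \<omega> ?p0)"
    using flow_derivative[OF \<omega>] has_vector_derivative_continuous by blast
  then obtain \<delta>2 where \<delta>2: "\<delta>2 > 0" "\<And>t. dist t t0 < \<delta>2 \<Longrightarrow> dist (flow \<omega> ?p0 t) (flow \<omega> ?p0 t0) < e / 2"
    unfolding continuous_at_eps_delta using e half_gt_zero by metis
  have "dist (flow \<omega> p t) (flow \<omega> ?p0 t0) < e" if "dist (t, p) (t0, ?p0) < min 1 (min \<delta>1 \<delta>2)" for t p
  proof -
    have d: "dist t t0 < min 1 (min \<delta>1 \<delta>2)" "dist p ?p0 < min 1 (min \<delta>1 \<delta>2)"
      using that dist_fst_le[of "(t, p)" "(t0, ?p0)"] dist_snd_le[of "(t, p)" "(t0, ?p0)"] by auto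
    then have "\<bar>t - t0\<bar> < 1" by (simp add: dist_real_def)
    then have "\<bar>t\<bar> \<le> \<bar>t0\<bar> + 1" by linarith
    then have "dist (flow \<omega> p t) (flow \<omega> ?p0 t) < e / 2"
      using \<delta>1(2)[OF \<omega>, of p t] \<delta>1(1) d by (simp add: dist_norm)
    moreover have "dist (flow \<omega> ?p0 t) (flow \<omega> ?p0 t0) < e / 2" using \<delta>2(2) d by simp
    ultimately show ?thesis using dist_triangle[of "flow \<omega> p t" "flow \<omega> ?p0 t0" "flow \<omega> ?p0 t"] by linarith
  qed
  then show "\<exists>\<delta>>0. \<forall>x'\<in>UNIV. dist x' (t0, ?p0) < \<delta> \<longrightarrow> dist (case x' of (t, p) \<Rightarrow> flow \<omega> p t) (flow \<omega> ?p0 t0) < e"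
    using \<delta>1(1) \<delta>2(1) by (intro exI[of _ "min 1 (min \<delta>1 \<delta>2)"]) auto
qed

lemma continuous_on_Phi:
  assumes \<omega>: "continuous_on UNIV \<omega>" shows "continuous_on UNIV (\<lambda>(t, X). Phi t \<omega> X)"
proof -
  have "continuous_on UNIV (\<lambda>q::real \<times> lifted. (\<lambda>(t, p). flow \<omega> p t) (fst q, mom (snd q)))"
    by (intro continuous_on_compose_UNIV[OF continuous_on_flow[OF \<omega>]] continuous_intros
      continuous_on_compose_UNIV[OF lips_continuous[OF lips_mom]])
  then have "continuous_on UNIV (\<lambda>q::real \<times> lifted. flow \<omega> (mom (snd q)) (fst q))" by simp
  then show ?thesis unfolding Phi_def case_prod_beta noise_vec_def
    by (intro continuous_on_compose_UNIV[OF lips_continuous[OF lips_unmom]] continuous_intros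
      continuous_on_compose_UNIV[OF \<omega>])
qed

lemma continuous_on_solution_map:
  assumes "\<omega> \<in> path_space" shows "continuous_on UNIV (\<lambda>(t, x). sol t \<omega> x)"
proof (rule continuous_on_state_descend)
  have "continuous_on UNIV (\<lambda>q. to_state (case q of (t, X) \<Rightarrow> Phi t \<omega> X))"
    by (intro continuous_on_compose_UNIV[OF continuous_on_to_state] continuous_on_Phi path_spaceD assms)
  then show "continuous_on UNIV (\<lambda>(t, X). sol t \<omega> (to_state X))"
    by (simp add: solution_map_to_state[OF assms] case_prod_beta)
qed

end

section \<open>Measurability on the path space\<close>

text \<open>Uniform closeness on an interval reduces to finitely many subbasic conditions: the
  interval is covered by finitely many balls on which the given path stays within
  \<open>\<delta> / 2\<close> of its value at the centre.\<close>

lemma generated_ball: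
  assumes "\<omega>0 \<in> path_space" "\<delta> > 0"
  shows "\<exists>N. openin compact_open_topology N \<and> \<omega>0 \<in> N \<and>
    (\<forall>\<omega>\<in>N. \<omega> \<in> path_space \<and> (\<forall>t. \<bar>t\<bar> \<le> T \<longrightarrow> \<bar>\<omega> t - \<omega>0 t\<bar> < \<delta>))"
proof -
  have cont: "continuous_on UNIV \<omega>0" using assms by (simp add: path_space_def)
  have "\<exists>d>0. \<omega>0 ` cball t d \<subseteq> ball (\<omega>0 t) (\<delta> / 2)" for t
  proof -
    obtain d where d: "d > 0" "\<And>s. dist s t < d \<Longrightarrow> dist (\<omega>0 s) (\<omega>0 t) < \<delta> / 2"
      using cont half_gt_zero[OF assms(2)] unfolding continuous_on_iff by (metis UNIV_I)
    then show ?thesis by (intro exI[of _ "d / 2"]) (fastforce simp: dist_commute)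
  qed
  then obtain d where d: "\<And>t. d t > 0" "\<And>t. \<omega>0 ` cball t (d t) \<subseteq> ball (\<omega>0 t) (\<delta> / 2)" by metis
  obtain C where C: "C \<subseteq> {-T..T}" "finite C" "{-T..T} \<subseteq> (\<Union>t\<in>C. ball t (d t))"
    by (rule compactE_image[of "{-T..T}" "{-T..T}" "\<lambda>t. ball t (d t)"]) (use d in auto)
  define B where "B t = {\<omega> \<in> path_space. \<omega> ` cball t (d t) \<subseteq> ball (\<omega>0 t) (\<delta> / 2)}" for t
  define N where "N = \<Inter> (insert path_space (B ` C))"
  have basis: "{\<omega> \<in> path_space. \<omega> ` K \<subseteq> U} \<in> {{\<omega> \<in> path_space. \<omega> ` K \<subseteq> U} | K U. compact K \<and> open U}"
    if "compact K" "open U" for K :: "real set" and U :: "real set"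
    using that by blast
  have "openin compact_open_topology X" if "X \<in> insert path_space (B ` C)" for X
  proof -
    have "path_space = {\<omega> \<in> path_space. \<omega> ` {} \<subseteq> (UNIV :: real set)}" by auto
    then have "X \<in> {{\<omega> \<in> path_space. \<omega> ` K \<subseteq> U} | K U. compact K \<and> open U}"
      using that basis[of "{}" UNIV] basis[OF compact_cball open_ball] unfolding B_def by auto
    then show ?thesis unfolding compact_open_topology_def by (rule topology_generated_by_Basis)
  qed
  then have "openin compact_open_topology N"
    unfolding N_def using C(2) by (intro openin_Inter) auto
  moreover have "\<omega>0 \<in> N" using assms d(2) by (auto simp: N_def B_def)
  moreover have "\<omega> \<in> path_space \<and> (\<forall>t. \<bar>t\<bar> \<le> T \<longrightarrow> \<bar>\<omega> t - \<omega>0 t\<bar> < \<delta>)" if "\<omega> \<in> N" for \<omega>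
  proof (intro conjI allI impI)
    show "\<omega> \<in> path_space" using that by (simp add: N_def)
    fix t :: real assume "\<bar>t\<bar> \<le> T"
    then have "t \<in> {-T..T}" by auto
    then obtain c where c: "c \<in> C" "t \<in> cball c (d c)" using C(3) by fastforce
    then have "\<omega> ` cball c (d c) \<subseteq> ball (\<omega>0 c) (\<delta> / 2)" using that by (auto simp: N_def B_def)
    then have "dist (\<omega>0 c) (\<omega> t) < \<delta> / 2" "dist (\<omega>0 c) (\<omega>0 t) < \<delta> / 2"
      using c d(2)[of c] by (auto simp: image_subset_iff)
    then have "dist (\<omega> t) (\<omega>0 t) < \<delta>" by (rule dist_triangle_half_r)
    then show "\<bar>\<omega> t - \<omega>0 t\<bar> < \<delta>" by (simp add: dist_real_def)
  qed
  ultimately show ?thesis by blast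
qed

text \<open>Replaces the generated topology by locally uniform convergence, in which measurability
  of functionals of the path becomes an \<epsilon>-\<delta> statement. For a subbasic set, a compact
  image inside an open set has a positive margin.\<close>

lemma openin_compact_open_iff:
  "openin compact_open_topology U \<longleftrightarrow> U \<subseteq> path_space \<and>
    (\<forall>\<omega>0\<in>U. \<exists>T. \<exists>\<delta>>0. \<forall>\<omega>\<in>path_space. (\<forall>t. \<bar>t\<bar> \<le> T \<longrightarrow> \<bar>\<omega> t - \<omega>0 t\<bar> < \<delta>) \<longrightarrow> \<omega> \<in> U)"
  (is "_ \<longleftrightarrow> ?lu U")
proof
  assume "openin compact_open_topology U"
  then have "generate_topology_on {{\<omega> \<in> path_space. \<omega> ` K \<subseteq> U} | K U. compact K \<and> open U} U"
    unfolding compact_open_topology_def openin_topology_generated_by_iff .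
  then show "?lu U"
  proof induction
    case (Int a b)
    show ?case
    proof (intro conjI ballI)
      fix \<omega>0 assume \<omega>0: "\<omega>0 \<in> a \<inter> b"
      obtain T1 \<delta>1 where 1: "\<delta>1 > 0" "\<And>\<omega>. \<omega> \<in> path_space \<Longrightarrow> (\<forall>t. \<bar>t\<bar> \<le> T1 \<longrightarrow> \<bar>\<omega> t - \<omega>0 t\<bar> < \<delta>1) \<Longrightarrow> \<omega> \<in> a"
        using Int.IH(1) \<omega>0 by blast
      obtain T2 \<delta>2 where 2: "\<delta>2 > 0" "\<And>\<omega>. \<omega> \<in> path_space \<Longrightarrow> (\<forall>t. \<bar>t\<bar> \<le> T2 \<longrightarrow> \<bar>\<omega> t - \<omega>0 t\<bar> < \<delta>2) \<Longrightarrow> \<omega> \<in> b"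
        using Int.IH(2) \<omega>0 by blast
      have "\<omega> \<in> a \<inter> b" if "\<omega> \<in> path_space" "\<forall>t. \<bar>t\<bar> \<le> max T1 T2 \<longrightarrow> \<bar>\<omega> t - \<omega>0 t\<bar> < min \<delta>1 \<delta>2" for \<omega>
        using that 1(2)[of \<omega>] 2(2)[of \<omega>] by (auto simp: le_max_iff_disj)
      then show "\<exists>T. \<exists>\<delta>>0. \<forall>\<omega>\<in>path_space. (\<forall>t. \<bar>t\<bar> \<le> T \<longrightarrow> \<bar>\<omega> t - \<omega>0 t\<bar> < \<delta>) \<longrightarrow> \<omega> \<in> a \<inter> b"
        using 1(1) 2(1) by (intro exI[of _ "max T1 T2"] exI[of _ "min \<delta>1 \<delta>2"]) auto
    qed (use Int.IH in auto)
  next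
    case (UN K)
    show ?case
    proof (intro conjI ballI)
      show "\<Union>K \<subseteq> path_space" using UN.IH by blast
      fix \<omega>0 assume "\<omega>0 \<in> \<Union>K"
      then obtain k where k: "k \<in> K" "\<omega>0 \<in> k" by blast
      then obtain T \<delta> where "\<delta> > 0" "\<forall>\<omega>\<in>path_space. (\<forall>t. \<bar>t\<bar> \<le> T \<longrightarrow> \<bar>\<omega> t - \<omega>0 t\<bar> < \<delta>) \<longrightarrow> \<omega> \<in> k"
        using UN.IH[OF k(1)] by blast
      then show "\<exists>T. \<exists>\<delta>>0. \<forall>\<omega>\<in>path_space. (\<forall>t. \<bar>t\<bar> \<le> T \<longrightarrow> \<bar>\<omega> t - \<omega>0 t\<bar> < \<delta>) \<longrightarrow> \<omega> \<in> \<Union>K"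
        using k(1) by (intro exI[of _ T] exI[of _ \<delta>]) auto
    qed
  next
    case (Basis s)
    then obtain K U where s: "s = {\<omega> \<in> path_space. \<omega> ` K \<subseteq> U}" "compact K" "open U" by blast
    show ?case
    proof (intro conjI ballI)
      fix \<omega>0 assume \<omega>0: "\<omega>0 \<in> s"
      then have c: "continuous_on K \<omega>0" unfolding s path_space_def using continuous_on_subset by blast
      obtain T where T: "\<And>t. t \<in> K \<Longrightarrow> \<bar>t\<bar> \<le> T"
        using compact_imp_bounded[OF s(2)] unfolding bounded_iff by auto
      obtain \<delta> where \<delta>: "\<delta> > 0" "(\<Union>x\<in>\<omega>0 ` K. ball x \<delta>) \<subseteq> U"
        using compact_subset_open_imp_ball_epsilon_subset[OF compact_continuous_image[OF c s(2)] s(3)] \<omega>0 s(1) by blast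
      have "\<omega> \<in> s" if "\<omega> \<in> path_space" "\<forall>t. \<bar>t\<bar> \<le> T \<longrightarrow> \<bar>\<omega> t - \<omega>0 t\<bar> < \<delta>" for \<omega>
      proof -
        have "\<omega> t \<in> U" if "t \<in> K" for t
        proof -
          have "\<omega> t \<in> ball (\<omega>0 t) \<delta>"
            using \<open>\<forall>t. \<bar>t\<bar> \<le> T \<longrightarrow> \<bar>\<omega> t - \<omega>0 t\<bar> < \<delta>\<close> T[OF that] by (simp add: dist_real_def abs_minus_commute)
          then show ?thesis using \<delta>(2) that by blast
        qed
        then show ?thesis using that(1) by (auto simp: s(1))
      qed
      then show "\<exists>T. \<exists>\<delta>>0. \<forall>\<omega>\<in>path_space. (\<forall>t. \<bar>t\<bar> \<le> T \<longrightarrow> \<bar>\<omega> t - \<omega>0 t\<bar> < \<delta>) \<longrightarrow> \<omega> \<in> s"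
        using \<delta>(1) by blast
    qed (use s in auto)
  qed auto
next
  assume lu: "?lu U"
  show "openin compact_open_topology U"
  proof (subst openin_subopen, intro ballI)
    fix \<omega>0 assume \<omega>0: "\<omega>0 \<in> U"
    then obtain T \<delta> where T: "\<delta> > 0" "\<And>\<omega>. \<omega> \<in> path_space \<Longrightarrow> (\<forall>t. \<bar>t\<bar> \<le> T \<longrightarrow> \<bar>\<omega> t - \<omega>0 t\<bar> < \<delta>) \<Longrightarrow> \<omega> \<in> U"
      using lu by blast
    have "\<omega>0 \<in> path_space" using \<omega>0 lu by blast
    obtain N where N: "openin compact_open_topology N" "\<omega>0 \<in> N"
      "\<forall>\<omega>\<in>N. \<omega> \<in> path_space \<and> (\<forall>t. \<bar>t\<bar> \<le> T \<longrightarrow> \<bar>\<omega> t - \<omega>0 t\<bar> < \<delta>)"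
      using generated_ball[OF \<open>\<omega>0 \<in> path_space\<close> T(1), of T] by (elim exE conjE) (rule that)
    have "N \<subseteq> U"
    proof
      fix \<omega> assume "\<omega> \<in> N"
      from bspec[OF N(3) this] show "\<omega> \<in> U" using T(2) by simp
    qed
    with N show "\<exists>N. openin compact_open_topology N \<and> \<omega>0 \<in> N \<and> N \<subseteq> U" by (intro exI[of _ N]) simp
  qed
qed

lemma space_path_borel [simp]: "space path_borel = path_space"
  and sets_path_borel: "sets path_borel = sigma_sets path_space {U. openin compact_open_topology U}"
proof -
  have *: "{U. openin compact_open_topology U} \<subseteq> Pow path_space" by (auto simp: openin_compact_open_iff)
  show "space path_borel = path_space" unfolding path_borel_def by (rule space_measure_of[OF *])
  show "sets path_borel = sigma_sets path_space {U. openin compact_open_topology U}"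
    unfolding path_borel_def by (rule sets_measure_of[OF *])
qed

lemma openin_path_borel: "openin compact_open_topology U \<Longrightarrow> U \<in> sets path_borel"
  unfolding sets_path_borel by (rule sigma_sets.Basic) simp

lemma path_borel_measurableI:
  fixes f :: "(real \<Rightarrow> real) \<Rightarrow> 'b::metric_space"
  assumes "\<And>\<omega>0 e. \<omega>0 \<in> path_space \<Longrightarrow> e > 0 \<Longrightarrow> \<exists>T. \<exists>\<delta>>0. \<forall>\<omega>\<in>path_space.
    (\<forall>t. \<bar>t\<bar> \<le> T \<longrightarrow> \<bar>\<omega> t - \<omega>0 t\<bar> < \<delta>) \<longrightarrow> dist (f \<omega>) (f \<omega>0) < e"
  shows "f \<in> borel_measurable path_borel"
proof (rule borel_measurableI)
  fix S :: "'b set" assume S: "open S"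
  have "openin compact_open_topology (f -` S \<inter> path_space)"
    unfolding openin_compact_open_iff
  proof (intro conjI ballI)
    fix \<omega>0 assume \<omega>0: "\<omega>0 \<in> f -` S \<inter> path_space"
    then obtain e where e: "e > 0" "\<And>y. dist y (f \<omega>0) < e \<Longrightarrow> y \<in> S" using S unfolding open_dist by blast
    obtain T \<delta> where "\<delta> > 0" "\<And>\<omega>. \<omega> \<in> path_space \<Longrightarrow> (\<forall>t. \<bar>t\<bar> \<le> T \<longrightarrow> \<bar>\<omega> t - \<omega>0 t\<bar> < \<delta>) \<Longrightarrow> dist (f \<omega>) (f \<omega>0) < e"
      using assms[of \<omega>0 e] \<omega>0 e(1) by blast
    then show "\<exists>T. \<exists>\<delta>>0. \<forall>\<omega>\<in>path_space. (\<forall>t. \<bar>t\<bar> \<le> T \<longrightarrow> \<bar>\<omega> t - \<omega>0 t\<bar> < \<delta>) \<longrightarrow> \<omega> \<in> f -` S \<inter> path_space"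
      using e(2) by blast
  qed auto
  then show "f -` S \<inter> space path_borel \<in> sets path_borel" by (simp add: openin_path_borel)
qed

lemma measurable_eval: "(\<lambda>\<omega>. \<omega> t) \<in> borel_measurable path_borel"
proof (rule path_borel_measurableI)
  fix \<omega>0 :: "real \<Rightarrow> real" and e :: real assume "e > 0"
  then show "\<exists>T. \<exists>\<delta>>0. \<forall>\<omega>\<in>path_space. (\<forall>t. \<bar>t\<bar> \<le> T \<longrightarrow> \<bar>\<omega> t - \<omega>0 t\<bar> < \<delta>) \<longrightarrow> dist (\<omega> t) (\<omega>0 t) < e"
    by (intro exI[of _ "\<bar>t\<bar>"] exI[of _ e]) (auto simp: dist_real_def)
qed

lemma measurable_wiener_shift: "wiener_shift s \<in> path_borel \<rightarrow>\<^sub>M path_borel"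
proof -
  have pre: "wiener_shift s -` U \<inter> path_space \<in> sets path_borel" if U: "openin compact_open_topology U" for U
  proof (rule openin_path_borel)
    show "openin compact_open_topology (wiener_shift s -` U \<inter> path_space)"
      unfolding openin_compact_open_iff
    proof (intro conjI ballI)
      fix \<omega>0 assume \<omega>0: "\<omega>0 \<in> wiener_shift s -` U \<inter> path_space"
      then obtain T \<delta> where T: "\<delta> > 0"
        "\<And>\<omega>. \<omega> \<in> path_space \<Longrightarrow> (\<forall>t. \<bar>t\<bar> \<le> T \<longrightarrow> \<bar>\<omega> t - wiener_shift s \<omega>0 t\<bar> < \<delta>) \<Longrightarrow> \<omega> \<in> U"
        using U unfolding openin_compact_open_iff by blast
      \<comment> \<open>A value of the shifted path is a difference of two values of the original
        one, so the tolerance is halved and the window enlarged by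
        \<open>\<bar>s\<bar>\<close>.\<close>
      have "wiener_shift s \<omega> \<in> U"
        if \<omega>: "\<omega> \<in> path_space" and cl: "\<forall>t. \<bar>t\<bar> \<le> \<bar>T\<bar> + \<bar>s\<bar> \<longrightarrow> \<bar>\<omega> t - \<omega>0 t\<bar> < \<delta> / 2" for \<omega>
      proof (rule T(2)[OF wiener_shift_path_space[OF \<omega>]], intro allI impI)
        fix t :: real assume t: "\<bar>t\<bar> \<le> T"
        have "\<bar>s + t\<bar> \<le> \<bar>T\<bar> + \<bar>s\<bar>" "\<bar>s\<bar> \<le> \<bar>T\<bar> + \<bar>s\<bar>" using t by linarith+
        then have "\<bar>\<omega> (s + t) - \<omega>0 (s + t)\<bar> < \<delta> / 2" "\<bar>\<omega> s - \<omega>0 s\<bar> < \<delta> / 2" using cl by blast+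
        then show "\<bar>wiener_shift s \<omega> t - wiener_shift s \<omega>0 t\<bar> < \<delta>" unfolding wiener_shift_def by linarith
      qed
      then show "\<exists>T. \<exists>\<delta>>0. \<forall>\<omega>\<in>path_space. (\<forall>t. \<bar>t\<bar> \<le> T \<longrightarrow> \<bar>\<omega> t - \<omega>0 t\<bar> < \<delta>) \<longrightarrow> \<omega> \<in> wiener_shift s -` U \<inter> path_space"
        using half_gt_zero[OF T(1)] by (intro exI[of _ "\<bar>T\<bar> + \<bar>s\<bar>"] exI[of _ "\<delta> / 2"]) auto
    qed auto
  qed
  show ?thesis
    by (rule measurable_sigma_sets[OF sets_path_borel]) (use wiener_shift_path_space pre in \<open>auto simp: openin_compact_open_iff\<close>)
qed

text \<open>A countably valued measurable choice \<open>d (g n x)\<close> of points near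
  \<open>x\<close> makes the approximating functions jointly measurable; continuity in
  \<open>x\<close> gives the pointwise limit.\<close>

lemma measurable_caratheodory:
  fixes f :: "'a::{metric_space, second_countable_topology} \<Rightarrow> 'w \<Rightarrow> 'b::metric_space"
  assumes cont: "\<And>\<omega>. \<omega> \<in> space M \<Longrightarrow> continuous_on UNIV (\<lambda>x. f x \<omega>)"
    and meas: "\<And>x. f x \<in> borel_measurable M"
  shows "(\<lambda>(x, \<omega>). f x \<omega>) \<in> borel \<Otimes>\<^sub>M M \<rightarrow>\<^sub>M borel"
proof -
  obtain D :: "'a set" where D: "countable D" "\<And>X. open X \<Longrightarrow> X \<noteq> {} \<Longrightarrow> \<exists>d\<in>D. d \<in> X"
    using countable_dense_exists by metis
  have "D \<noteq> {}" using D(2)[of UNIV] by auto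
  define d where "d = from_nat_into D"
  have dense: "\<exists>k. dist (d k) x < 1 / real (Suc n)" for x n
  proof -
    obtain y where "y \<in> D" "y \<in> ball x (1 / real (Suc n))" using D(2)[of "ball x (1 / real (Suc n))"] by auto
    then show ?thesis using from_nat_into_surj[OF D(1)] by (metis d_def dist_commute mem_ball)
  qed
  \<comment> \<open>Taking the least index makes the choice of the point a measurable function of
    \<open>x\<close>.\<close>
  define g where "g n x = (LEAST k. dist (d k) x < 1 / real (Suc n))" for n x
  have g: "dist (d (g n x)) x < 1 / real (Suc n)" for n x
    unfolding g_def using dense by (rule LeastI_ex)
  have gm: "g n \<in> borel \<rightarrow>\<^sub>M count_space UNIV" for n
    unfolding g_def
  proof (rule measurable_Least)
    fix i
    have "{x. dist (d i) x < 1 / real (Suc n)} = ball (d i) (1 / real (Suc n))" by auto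
    then show "(\<lambda>x. dist (d i) x < 1 / real (Suc n)) \<in> borel \<rightarrow>\<^sub>M count_space UNIV" by (simp add: pred_def)
  qed
  show ?thesis
  proof (rule borel_measurable_LIMSEQ_metric[where f = "\<lambda>n (x, \<omega>). f (d (g n x)) \<omega>"])
    fix n
    have "(\<lambda>p. (\<lambda>i p. f (d i) (snd p)) (g n (fst p)) p) \<in> borel \<Otimes>\<^sub>M M \<rightarrow>\<^sub>M borel"
      by (rule measurable_compose_countable)
        (auto intro!: measurable_compose[OF measurable_snd meas] measurable_compose[OF measurable_fst gm])
    then show "(\<lambda>(x, \<omega>). f (d (g n x)) \<omega>) \<in> borel \<Otimes>\<^sub>M M \<rightarrow>\<^sub>M borel" by (simp add: case_prod_beta)
  next
    fix p :: "'a \<times> 'w" assume p: "p \<in> space (borel \<Otimes>\<^sub>M M)"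
    obtain x \<omega> where xw: "p = (x, \<omega>)" by (cases p)
    have le: "dist (d (g n x)) x \<le> inverse (real (Suc n))" for n
      using less_imp_le[OF g[of n x]] by (simp add: inverse_eq_divide)
    have "(\<lambda>n. dist (d (g n x)) x) \<longlonglongrightarrow> 0"
    proof (rule tendsto_sandwich[OF always_eventually always_eventually tendsto_const LIMSEQ_inverse_real_of_nat]; intro allI)
      show "dist (d (g n x)) x \<le> inverse (real (Suc n))" for n by (rule le)
    qed simp
    then have "(\<lambda>n. d (g n x)) \<longlonglongrightarrow> x" by (rule tendsto_dist_iff[THEN iffD2])
    moreover have "isCont (\<lambda>x. f x \<omega>) x"
      using cont[of \<omega>] p xw by (auto simp: space_pair_measure continuous_on_eq_continuous_at)
    ultimately show "(\<lambda>n. (case p of (x, \<omega>) \<Rightarrow> f (d (g n x)) \<omega>)) \<longlonglongrightarrow> (case p of (x, \<omega>) \<Rightarrow> f x \<omega>)"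
      unfolding xw using isCont_tendsto_compose[of x "\<lambda>x. f x \<omega>"] by simp
  qed
qed

section \<open>Measurability of the flow and of the solution map\<close>

context pendulum
begin

lemma measurable_flow: "(\<lambda>\<omega>. flow \<omega> p t) \<in> borel_measurable path_borel"
proof (rule path_borel_measurableI)
  fix \<omega>0 and e :: real assume \<omega>0: "\<omega>0 \<in> path_space" and e: "e > 0"
  from flow_dependence[OF path_spaceD(1)[OF \<omega>0] e, of "\<bar>t\<bar>" p] obtain \<delta> where \<delta>: "\<delta> > 0"
    "\<forall>\<omega> q. continuous_on UNIV \<omega> \<longrightarrow> (\<forall>s. \<bar>s\<bar> \<le> \<bar>t\<bar> \<longrightarrow> \<bar>\<omega> s - \<omega>0 s\<bar> < \<delta>) \<longrightarrow> norm (q - p) < \<delta> \<longrightarrow>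
      (\<forall>s. \<bar>s\<bar> \<le> \<bar>t\<bar> \<longrightarrow> norm (flow \<omega> q s - flow \<omega>0 p s) < e)" by blast
  have "dist (flow \<omega> p t) (flow \<omega>0 p t) < e"
    if "\<omega> \<in> path_space" "\<forall>s. \<bar>s\<bar> \<le> \<bar>t\<bar> \<longrightarrow> \<bar>\<omega> s - \<omega>0 s\<bar> < \<delta>" for \<omega>
    using \<delta>(2)[rule_format, OF path_spaceD(1)[OF that(1)], of p t] that(2) \<delta>(1) by (simp add: dist_norm)
  then show "\<exists>T. \<exists>\<delta>>0. \<forall>\<omega>\<in>path_space. (\<forall>t. \<bar>t\<bar> \<le> T \<longrightarrow> \<bar>\<omega> t - \<omega>0 t\<bar> < \<delta>) \<longrightarrow> dist (flow \<omega> p t) (flow \<omega>0 p t) < e"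
    using \<delta>(1) by blast
qed

lemma measurable_solution_map: "(\<lambda>\<omega>. sol t \<omega> x) \<in> borel_measurable path_borel"
proof -
  obtain X where x: "x = to_state X" using to_state_surj by metis
  have noise_vec: "(\<lambda>\<omega>. noise_vec (\<sigma> * \<omega> t)) \<in> borel_measurable path_borel"
  proof -
    have "continuous_on UNIV (\<lambda>r. noise_vec (\<sigma> * r))" unfolding noise_vec_def by (intro continuous_intros)
    from borel_measurable_continuous_on[OF this measurable_eval] show ?thesis .
  qed
  have "(\<lambda>\<omega>. to_state (unmom (flow \<omega> (mom X) t + noise_vec (\<sigma> * \<omega> t)))) \<in> borel_measurable path_borel"
    by (intro borel_measurable_continuous_on[OF continuous_on_to_state]
      borel_measurable_continuous_on[OF lips_continuous[OF lips_unmom]] borel_measurable_add measurable_flow noise_vec)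
  then show ?thesis
    by (subst measurable_cong[where g = "\<lambda>\<omega>. to_state (unmom (flow \<omega> (mom X) t + noise_vec (\<sigma> * \<omega> t)))"])
      (simp_all add: x solution_map_to_state Phi_def)
qed

lemma continuous_rds_solution_map:
  assumes sets: "sets M = sets (restrict_space path_borel \<Omega>)" and \<Omega>: "\<Omega> \<subseteq> path_space"
  shows "continuous_rds M wiener_shift sol"
proof -
  have sp: "space M = \<Omega>" using sets_eq_imp_space_eq[OF sets] \<Omega> by (auto simp: space_restrict_space)
  have meas: "(\<lambda>\<omega>. sol t \<omega> x) \<in> borel_measurable M" for t x
    using measurable_restrict_space1[OF measurable_solution_map] measurable_cong_sets[OF sets refl] by blast
  \<comment> \<open>Time and state together form the variable in which the solution is continuous,
    so the arguments are regrouped.\<close>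
  have "(\<lambda>(tx, \<omega>). sol (fst tx) \<omega> (snd tx)) \<in> borel \<Otimes>\<^sub>M M \<rightarrow>\<^sub>M borel"
    using continuous_on_solution_map \<Omega>
    by (intro measurable_caratheodory meas) (auto simp: sp case_prod_beta)
  moreover have "(\<lambda>(t, \<omega>, x). ((t, x), \<omega>)) \<in> borel \<Otimes>\<^sub>M (M \<Otimes>\<^sub>M borel) \<rightarrow>\<^sub>M (borel :: (real \<times> state) measure) \<Otimes>\<^sub>M M"
    unfolding borel_prod[symmetric] by measurable
  ultimately have "(\<lambda>p. case (case p of (t, \<omega>, x) \<Rightarrow> ((t, x), \<omega>)) of (tx, \<omega>) \<Rightarrow> sol (fst tx) \<omega> (snd tx)) \<in> borel \<Otimes>\<^sub>M (M \<Otimes>\<^sub>M borel) \<rightarrow>\<^sub>M borel"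
    by (rule measurable_compose[rotated])
  then have "(\<lambda>(t, \<omega>, x). sol t \<omega> x) \<in> borel \<Otimes>\<^sub>M (M \<Otimes>\<^sub>M borel) \<rightarrow>\<^sub>M borel"
    by (simp add: case_prod_beta)
  then show ?thesis
    unfolding continuous_rds_def sp
    using \<Omega> continuous_on_solution_map solution_map_0 solution_map_cocycle by blast
qed

end

section \<open>The Ornstein--Uhlenbeck process\<close>

lemma signed_integral_diff:
  fixes g :: "real \<Rightarrow> 'a::euclidean_space"
  assumes "continuous_on UNIV g" "s \<le> t"
  shows "integral {s..t} g = signed_integral g t - signed_integral g s"
  using integrated_form_iff[OF assms(1), of "signed_integral g"] signed_integral_has_vector_derivative[OF assms(1)] assms(2)
  by simp

lemma set_integrable_exp_atMost_0:
  assumes "c > 0" shows "set_integrable lborel {..0} (\<lambda>s::real. exp (c * s))"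
proof -
  \<comment> \<open>The known integral over the positive axis, reflected; below, the end point 0 is
    added as a null set.\<close>
  have "integrable lborel (\<lambda>x. indicator {0<..} (0 + - 1 * x) *\<^sub>R exp (- ((0 + - 1 * x) * c)))"
    using integrable_I0i_exp_mscale[OF assms] lborel_integrable_real_affine_iff[of "-1" "\<lambda>x. indicator {0<..} x *\<^sub>R exp (- (x * c))" 0]
    unfolding set_integrable_def by simp
  then have i: "integrable lborel (\<lambda>x. indicator {..<0} x *\<^sub>R exp (c * x))"
    by (simp add: indicator_def mult.commute)
  show ?thesis
    unfolding set_integrable_def
  proof (rule Bochner_Integration.integrable_bound[OF i])
    show "AE x in lborel. norm (indicator {..0} x *\<^sub>R exp (c * x)) \<le> norm (indicator {..<0} x *\<^sub>R exp (c * x))"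
      using AE_lborel_singleton[of "0::real"] by eventually_elim (auto simp: indicator_def)
  qed simp
qed

lemma set_integrable_atMost_0_bound:
  fixes g :: "real \<Rightarrow> real"
  assumes g: "continuous_on UNIV g" and b: "\<And>s. s \<le> 0 \<Longrightarrow> \<bar>g s\<bar> \<le> K * exp (c * s)" and "c > 0"
  shows "set_integrable lborel {..0} g"
  unfolding set_integrable_def
proof (rule Bochner_Integration.integrable_bound)
  show "integrable lborel (\<lambda>x. K * (indicator {..0} x *\<^sub>R exp (c * x)))"
    using set_integrable_exp_atMost_0[OF \<open>c > 0\<close>] unfolding set_integrable_def by (rule integrable_mult_right)
  show "(\<lambda>x. indicator {..0} x *\<^sub>R g x) \<in> borel_measurable lborel"
    using borel_measurable_continuous_onI[OF g] by measurable
  show "AE x in lborel. norm (indicator {..0} x *\<^sub>R g x) \<le> norm (K * (indicator {..0} x *\<^sub>R exp (c * x)))"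
    using b by (intro AE_I2) (auto simp: indicator_def intro: order_trans[OF _ abs_ge_self])
qed

lemma LINT_Icc_eq_signed:
  fixes g :: "real \<Rightarrow> real"
  assumes "continuous_on UNIV g" "a \<le> b"
  shows "(LINT x:{a..b}|lborel. g x) = signed_integral g b - signed_integral g a"
proof -
  have "set_integrable lborel {a..b} g"
    by (rule borel_integrable_atLeastAtMost') (use assms continuous_on_subset in blast)
  then show ?thesis using assms by (simp add: set_borel_integral_eq_integral signed_integral_diff)
qed

lemma LINT_atMost_tendsto:
  fixes g :: "real \<Rightarrow> real"
  assumes g: "continuous_on UNIV g" and int: "set_integrable lborel {..0} g"
  shows "((\<lambda>a. signed_integral g t - signed_integral g a) \<longlongrightarrow> (LINT x:{..t}|lborel. g x)) at_bot"
proof -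
  have "set_integrable lborel {0..\<bar>t\<bar>} g"
    by (rule borel_integrable_atLeastAtMost') (use g continuous_on_subset in blast)
  from set_integrable_Un[OF int this] have "set_integrable lborel ({..0} \<union> {0..\<bar>t\<bar>}) g" by simp
  then have "set_integrable lborel {..t} g" by (rule set_integrable_subset) auto
  then have "((\<lambda>a. LINT x:{a..t}|lborel. g x) \<longlongrightarrow> (LINT x:{..t}|lborel. g x)) at_bot"
    by (intro tendsto_set_lebesgue_integral_at_bot) auto
  moreover have "\<forall>\<^sub>F a in at_bot. (LINT x:{a..t}|lborel. g x) = signed_integral g t - signed_integral g a"
    using eventually_le_at_bot[of t] by eventually_elim (rule LINT_Icc_eq_signed[OF g])
  ultimately show ?thesis by (rule Lim_transform_eventually)
qed

text \<open>Translation turns the half line into \<open>{..t}\<close>, from which the piece between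
  0 and \<open>t\<close>, of either sign, is split off.\<close>

lemma LINT_atMost_shift:
  fixes g :: "real \<Rightarrow> real"
  assumes g: "continuous_on UNIV g" and int: "set_integrable lborel {..0} g"
  shows "(LINT s:{..0}|lborel. g (t + s)) = (LINT s:{..0}|lborel. g s) + signed_integral g t"
proof -
  have "(LINT s:{..0}|lborel. g (t + s)) = (LINT s:{..t}|lborel. g s)"
    unfolding set_lebesgue_integral_def
    using lborel_integral_real_affine[of 1 "\<lambda>x. indicator {..t} x *\<^sub>R g x" t] by (simp add: indicator_def)
  moreover have "((\<lambda>a. (signed_integral g 0 - signed_integral g a) + signed_integral g t) \<longlongrightarrow> (LINT x:{..0}|lborel. g x) + signed_integral g t) at_bot"
    by (intro tendsto_add LINT_atMost_tendsto g int tendsto_const)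
  moreover have "(\<lambda>a. (signed_integral g 0 - signed_integral g a) + signed_integral g t) = (\<lambda>a. signed_integral g t - signed_integral g a)"
    by auto
  ultimately show ?thesis
    using tendsto_unique[OF _ LINT_atMost_tendsto[OF g int, of t]] by simp
qed

lemma LINT_exp_atMost_0:
  fixes c :: real
  assumes "c > 0" shows "(LINT s:{..0}|lborel. exp (c * s)) = 1 / c"
proof -
  have c: "continuous_on UNIV (\<lambda>s. exp (c * s))" by (intro continuous_intros)
  have eq: "signed_integral (\<lambda>s. exp (c * s)) 0 - signed_integral (\<lambda>s. exp (c * s)) a = 1 / c - exp (c * a) / c" if "a \<le> 0" for a
  proof -
    have "((\<lambda>s. exp (c * s)) has_integral (exp (c * 0) / c - exp (c * a) / c)) {a..0}"
      using assms that by (intro fundamental_theorem_of_calculus)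
        (auto intro!: derivative_eq_intros simp: has_real_derivative_iff_has_vector_derivative[symmetric])
    then show ?thesis using signed_integral_diff[OF c that] by (simp add: integral_unique)
  qed
  have "filterlim (\<lambda>a. c * a) at_bot at_bot"
    using assms by (intro filterlim_tendsto_pos_mult_at_bot[OF tendsto_const _ filterlim_ident])
  then have "((\<lambda>a. exp (c * a)) \<longlongrightarrow> 0) at_bot" by (rule filterlim_compose[OF exp_at_bot])
  then have "((\<lambda>a. 1 / c - exp (c * a) / c) \<longlongrightarrow> 1 / c - 0 / c) at_bot"
    using assms by (intro tendsto_intros) auto
  moreover have "\<forall>\<^sub>F a in at_bot. 1 / c - exp (c * a) / c = signed_integral (\<lambda>s. exp (c * s)) 0 - signed_integral (\<lambda>s. exp (c * s)) a"
    using eventually_le_at_bot[of 0] by eventually_elim (rule eq[symmetric])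
  ultimately have "((\<lambda>a. signed_integral (\<lambda>s. exp (c * s)) 0 - signed_integral (\<lambda>s. exp (c * s)) a) \<longlongrightarrow> 1 / c) at_bot"
    using Lim_transform_eventually by force
  from tendsto_unique[OF _ LINT_atMost_tendsto[OF c set_integrable_exp_atMost_0[OF assms], of 0] this]
  show ?thesis by simp
qed

section \<open>The stationary process as a Lebesgue integral over the past\<close>

definition sublinear_at_bot :: "(real \<Rightarrow> real) \<Rightarrow> bool" where
  "sublinear_at_bot \<omega> \<longleftrightarrow> continuous_on UNIV \<omega> \<and> \<omega> 0 = 0 \<and> ((\<lambda>t. \<bar>\<omega> t\<bar> / \<bar>t\<bar>) \<longlongrightarrow> 0) at_bot"

lemma exp_ge_abs: "1 + \<bar>s\<bar> \<le> (1 + 1 / c) * exp (c * \<bar>s\<bar>)" if "c > 0" for c s :: real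
proof -
  have a: "c * \<bar>s\<bar> \<le> exp (c * \<bar>s\<bar>)" using exp_ge_add_one_self[of "c * \<bar>s\<bar>"] by linarith
  have b: "1 \<le> exp (c * \<bar>s\<bar>)" using that by simp
  have "\<bar>s\<bar> \<le> exp (c * \<bar>s\<bar>) / c" using a that by (simp add: pos_le_divide_eq mult.commute)
  from add_mono[OF b this] show ?thesis by (simp add: distrib_right)
qed

lemma sublinear_bound:
  assumes "sublinear_at_bot \<omega>"
  obtains K where "K \<ge> 0" "\<And>s. s \<le> 0 \<Longrightarrow> \<bar>\<omega> s\<bar> \<le> K * (1 + \<bar>s\<bar>)"
proof -
  have \<omega>: "continuous_on UNIV \<omega>" "((\<lambda>t. \<bar>\<omega> t\<bar> / \<bar>t\<bar>) \<longlongrightarrow> 0) at_bot"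
    using assms by (auto simp: sublinear_at_bot_def)
  from order_tendstoD(2)[OF \<omega>(2), of 1] obtain N where N: "\<And>t. t \<le> N \<Longrightarrow> \<bar>\<omega> t\<bar> / \<bar>t\<bar> < 1"
    unfolding eventually_at_bot_linorder by auto
  have "compact (\<omega> ` {N..0})" by (intro compact_continuous_image continuous_on_subset[OF \<omega>(1)]) auto
  from compact_imp_bounded[OF this] obtain B where "\<forall>x\<in>\<omega> ` {N..0}. norm x \<le> B" unfolding bounded_iff by blast
  then have B: "\<bar>\<omega> t\<bar> \<le> B" if "t \<in> {N..0}" for t using that by simp
  have "\<bar>\<omega> s\<bar> \<le> max B 1 * (1 + \<bar>s\<bar>)" if "s \<le> 0" for s
  proof (cases "s \<ge> N")
    case True
    then have "\<bar>\<omega> s\<bar> \<le> max B 1 * 1" using B[of s] that by simp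
    also have "\<dots> \<le> max B 1 * (1 + \<bar>s\<bar>)" by (intro mult_left_mono) auto
    finally show ?thesis .
  next
    case False
    have "\<bar>\<omega> s\<bar> \<le> 1 + \<bar>s\<bar>"
    proof (cases "s = 0")
      case True then show ?thesis using assms by (simp add: sublinear_at_bot_def)
    next
      case noise_vec: False
      have "\<bar>\<omega> s\<bar> / \<bar>s\<bar> < 1" using N[of s] False by simp
      then have "\<bar>\<omega> s\<bar> < \<bar>s\<bar>" using noise_vec by (simp add: pos_divide_less_eq)
      then show ?thesis by simp
    qed
    also have "\<dots> \<le> max B 1 * (1 + \<bar>s\<bar>)" using mult_right_mono[of 1 "max B 1" "1 + \<bar>s\<bar>"] by simp
    finally show ?thesis .
  qed
  then show thesis using that[of "max B 1"] by simp
qed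

text \<open>Half of the exponential rate is spent on the growth of the path, the other half is left
  for integrability.\<close>

lemma sublinear_exp_bound:
  assumes "sublinear_at_bot \<omega>" "\<alpha> > 0"
  obtains K where "K \<ge> 0" "\<And>s. s \<le> 0 \<Longrightarrow> \<bar>exp (\<alpha> * s) * \<omega> s\<bar> \<le> K * exp (\<alpha> / 2 * s)"
proof -
  obtain K where K: "K \<ge> 0" "\<And>s. s \<le> 0 \<Longrightarrow> \<bar>\<omega> s\<bar> \<le> K * (1 + \<bar>s\<bar>)" using sublinear_bound[OF assms(1)] by blast
  have "\<bar>exp (\<alpha> * s) * \<omega> s\<bar> \<le> (K * (1 + 1 / (\<alpha> / 2))) * exp (\<alpha> / 2 * s)" if "s \<le> 0" for s
  proof -
    have "\<bar>exp (\<alpha> * s) * \<omega> s\<bar> \<le> exp (\<alpha> * s) * (K * (1 + \<bar>s\<bar>))"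
      using K(2)[OF that] by (simp add: abs_mult)
    also have "\<dots> \<le> exp (\<alpha> * s) * (K * ((1 + 1 / (\<alpha> / 2)) * exp (\<alpha> / 2 * \<bar>s\<bar>)))"
      using K(1) assms(2) by (intro mult_left_mono exp_ge_abs) auto
    also have "\<dots> = K * (1 + 1 / (\<alpha> / 2)) * (exp (\<alpha> * s) * exp (\<alpha> / 2 * \<bar>s\<bar>))" by (simp only: mult_ac)
    also have "exp (\<alpha> * s) * exp (\<alpha> / 2 * \<bar>s\<bar>) = exp (\<alpha> / 2 * s)"
      using that by (simp add: exp_add[symmetric] field_simps)
    finally show ?thesis .
  qed
  moreover have "K * (1 + 1 / (\<alpha> / 2)) \<ge> 0" using K(1) assms(2) by simp
  ultimately show thesis using that by blast
qed

lemma continuous_exp_mult: "continuous_on UNIV \<omega> \<Longrightarrow> continuous_on UNIV (\<lambda>s. exp (\<alpha> * s) * \<omega> s)" for \<alpha> :: real and \<omega> :: "real \<Rightarrow> real"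
  by (intro continuous_intros)

lemma sublinear_integrable:
  assumes "sublinear_at_bot \<omega>" "\<alpha> > 0"
  shows "set_integrable lborel {..0} (\<lambda>s. exp (\<alpha> * s) * \<omega> s)"
proof -
  obtain K where "K \<ge> 0" "\<And>s. s \<le> 0 \<Longrightarrow> \<bar>exp (\<alpha> * s) * \<omega> s\<bar> \<le> K * exp (\<alpha> / 2 * s)"
    using sublinear_exp_bound[OF assms] by blast
  then show ?thesis
    using assms by (intro set_integrable_atMost_0_bound[of _ K "\<alpha> / 2"] continuous_exp_mult) (auto simp: sublinear_at_bot_def)
qed

text \<open>Integration by parts: the boundary term at 0 vanishes because
  \<open>\<omega> 0 = 0\<close>, the one at minus infinity because the exponential beats sublinear
  growth. The absolutely convergent integral that remains is accessible to Fubini's theorem and to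
  measurability arguments.\<close>

lemma ou_eq:
  assumes \<omega>: "sublinear_at_bot \<omega>" and \<alpha>: "\<alpha> > 0"
  shows "ou \<alpha> \<sigma> \<omega> = - \<alpha> * \<sigma> * (LINT s:{..0}|lborel. exp (\<alpha> * s) * \<omega> s)"
proof -
  have c: "continuous_on UNIV \<omega>" "\<omega> 0 = 0" using \<omega> by (auto simp: sublinear_at_bot_def)
  let ?g = "\<lambda>s. exp (\<alpha> * s) * \<omega> s"
  have cg: "continuous_on UNIV ?g" by (intro continuous_exp_mult c)
  have rs: "rs_integral (\<lambda>s. exp (\<alpha> * s)) \<omega> a 0 = - ?g a - \<alpha> * (signed_integral ?g 0 - signed_integral ?g a)" if "a \<le> 0" for a
  proof -
    have "((\<lambda>s. exp (\<alpha> * s)) has_vector_derivative \<alpha> * exp (\<alpha> * r)) (at r within {a..0})" for r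
      by (auto intro!: derivative_eq_intros simp: has_real_derivative_iff_has_vector_derivative[symmetric])
    then have "has_rs_integral (\<lambda>s. exp (\<alpha> * s)) \<omega> a 0
      (\<omega> 0 *\<^sub>R exp (\<alpha> * 0) - \<omega> a *\<^sub>R exp (\<alpha> * a) - integral {a..0} (\<lambda>r. \<omega> r *\<^sub>R (\<alpha> * exp (\<alpha> * r))))"
      using that by (intro has_rs_integral_by_parts continuous_on_subset[OF c(1)] continuous_intros) auto
    moreover have "integral {a..0} (\<lambda>r. \<omega> r *\<^sub>R (\<alpha> * exp (\<alpha> * r))) = \<alpha> * integral {a..0} ?g"
      by (subst integral_mult_right[symmetric]) (rule integral_cong, simp)
    ultimately have "has_rs_integral (\<lambda>s. exp (\<alpha> * s)) \<omega> a 0 (- ?g a - \<alpha> * integral {a..0} ?g)"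
      by (simp add: c(2) mult.commute)
    then have "has_rs_integral (\<lambda>s. exp (\<alpha> * s)) \<omega> a 0 (- ?g a - \<alpha> * (signed_integral ?g 0 - signed_integral ?g a))"
      unfolding signed_integral_diff[OF cg that] .
    then show ?thesis unfolding rs_integral_def using has_rs_integral_unique[OF _ _ that] by (intro the_equality)
  qed
  obtain K where K: "K \<ge> 0" "\<And>s. s \<le> 0 \<Longrightarrow> \<bar>?g s\<bar> \<le> K * exp (\<alpha> / 2 * s)"
    using sublinear_exp_bound[OF \<omega> \<alpha>] by blast
  have g0: "(?g \<longlongrightarrow> 0) at_bot"
  proof (rule Lim_null_comparison)
    show "\<forall>\<^sub>F s in at_bot. norm (?g s) \<le> K * exp (\<alpha> / 2 * s)"
      using eventually_le_at_bot[of 0] by eventually_elim (use K(2) in simp)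
    have "filterlim (\<lambda>a. \<alpha> / 2 * a) at_bot at_bot"
      using \<alpha> by (intro filterlim_tendsto_pos_mult_at_bot[OF tendsto_const _ filterlim_ident]) auto
    then have "((\<lambda>a. exp (\<alpha> / 2 * a)) \<longlongrightarrow> 0) at_bot" by (rule filterlim_compose[OF exp_at_bot])
    then show "((\<lambda>s. K * exp (\<alpha> / 2 * s)) \<longlongrightarrow> 0) at_bot" by (rule tendsto_mult_right_zero)
  qed
  have "((\<lambda>a. - ?g a - \<alpha> * (signed_integral ?g 0 - signed_integral ?g a)) \<longlongrightarrow> - 0 - \<alpha> * (LINT s:{..0}|lborel. ?g s)) at_bot"
    by (intro tendsto_intros g0 LINT_atMost_tendsto cg sublinear_integrable \<omega> \<alpha>)
  moreover have "\<forall>\<^sub>F a in at_bot. - ?g a - \<alpha> * (signed_integral ?g 0 - signed_integral ?g a) = rs_integral (\<lambda>s. exp (\<alpha> * s)) \<omega> a 0"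
    using eventually_le_at_bot[of 0] by eventually_elim (rule rs[symmetric])
  ultimately have "((\<lambda>a. rs_integral (\<lambda>s. exp (\<alpha> * s)) \<omega> a 0) \<longlongrightarrow> - 0 - \<alpha> * (LINT s:{..0}|lborel. ?g s)) at_bot"
    by (rule Lim_transform_eventually)
  then have "Lim at_bot (\<lambda>a. rs_integral (\<lambda>s. exp (\<alpha> * s)) \<omega> a 0) = - 0 - \<alpha> * (LINT s:{..0}|lborel. ?g s)"
    by (intro tendsto_Lim) auto
  then show ?thesis by (simp add: ou_def)
qed

text \<open>Apart from \<open>\<sigma> * \<omega> t\<close>, time enters only through an exponential
  and an indefinite integral; hence \<open>\<sigma> * \<omega>\<close> minus the process is
  differentiable in time, although both are rough.\<close>

lemma ou_shift_eq:
  assumes \<omega>: "sublinear_at_bot \<omega>" and \<omega>': "sublinear_at_bot (wiener_shift t \<omega>)" and \<alpha>: "\<alpha> > 0"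
  shows "ou \<alpha> \<sigma> (wiener_shift t \<omega>) = \<sigma> * \<omega> t - \<alpha> * \<sigma> * exp (- \<alpha> * t) *
    ((LINT s:{..0}|lborel. exp (\<alpha> * s) * \<omega> s) + signed_integral (\<lambda>s. exp (\<alpha> * s) * \<omega> s) t)"
proof -
  have c: "continuous_on UNIV \<omega>" using \<omega> by (auto simp: sublinear_at_bot_def)
  let ?g = "\<lambda>s. exp (\<alpha> * s) * \<omega> s"
  have cg: "continuous_on UNIV ?g" by (intro continuous_exp_mult c)
  have e: "set_integrable lborel {..0} (\<lambda>s. exp (\<alpha> * s) * \<omega> t)"
    using set_integrable_exp_atMost_0[OF \<alpha>] by (rule set_integrable_mult_left)
  have "(LINT s:{..0}|lborel. exp (\<alpha> * s) * wiener_shift t \<omega> s)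
     = (LINT s:{..0}|lborel. exp (- \<alpha> * t) * ?g (t + s) - exp (\<alpha> * s) * \<omega> t)"
    by (intro arg_cong[where f = "set_lebesgue_integral lborel {..0}"])
      (auto simp: fun_eq_iff wiener_shift_def algebra_simps exp_add[symmetric] mult_exp_exp)
  also have "\<dots> = (LINT s:{..0}|lborel. exp (- \<alpha> * t) * ?g (t + s)) - (LINT s:{..0}|lborel. exp (\<alpha> * s) * \<omega> t)"
  proof (rule set_integral_diff(2)[OF _ e])
    have "set_integrable lborel {..0} (\<lambda>s. exp (\<alpha> * s) * wiener_shift t \<omega> s + exp (\<alpha> * s) * \<omega> t)"
      by (intro set_integral_add sublinear_integrable \<omega>' \<alpha> e)
    moreover have "(\<lambda>s. exp (\<alpha> * s) * wiener_shift t \<omega> s + exp (\<alpha> * s) * \<omega> t) = (\<lambda>s. exp (- \<alpha> * t) * ?g (t + s))"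
      by (auto simp: fun_eq_iff wiener_shift_def algebra_simps exp_add[symmetric] mult_exp_exp)
    ultimately show "set_integrable lborel {..0} (\<lambda>s. exp (- \<alpha> * t) * ?g (t + s))" by simp
  qed
  also have "(LINT s:{..0}|lborel. exp (- \<alpha> * t) * ?g (t + s)) = exp (- \<alpha> * t) * ((LINT s:{..0}|lborel. ?g s) + signed_integral ?g t)"
    unfolding set_integral_mult_right LINT_atMost_shift[OF cg sublinear_integrable[OF \<omega> \<alpha>], symmetric] ..
  also have "(LINT s:{..0}|lborel. exp (\<alpha> * s) * \<omega> t) = \<omega> t / \<alpha>"
    using LINT_exp_atMost_0[OF \<alpha>] by simp
  finally have eq: "(LINT s:{..0}|lborel. exp (\<alpha> * s) * wiener_shift t \<omega> s) =
    exp (- \<alpha> * t) * ((LINT s:{..0}|lborel. ?g s) + signed_integral ?g t) - \<omega> t / \<alpha>" .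
  have "- \<alpha> * \<sigma> * (E * J - w / \<alpha>) = \<sigma> * w - \<alpha> * \<sigma> * E * J" for E J w
    using \<alpha> by (simp add: field_simps)
  then show ?thesis unfolding ou_eq[OF \<omega>' \<alpha>] eq .
qed

lemma measurable_weighted_eval:
  "(\<lambda>(\<omega>, s). indicator {..0} s *\<^sub>R (exp (\<alpha> * s) * \<omega> s)) \<in> borel_measurable (path_borel \<Otimes>\<^sub>M lborel)"
proof -
  have "(\<lambda>(s, \<omega>). exp (\<alpha> * s) * \<omega> s) \<in> borel \<Otimes>\<^sub>M path_borel \<rightarrow>\<^sub>M borel"
  proof (rule measurable_caratheodory)
    show "continuous_on UNIV (\<lambda>s. exp (\<alpha> * s) * \<omega> s)" if "\<omega> \<in> space path_borel" for \<omega>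
      using that by (intro continuous_exp_mult) (simp add: path_space_def)
    show "(\<lambda>\<omega>. exp (\<alpha> * s) * \<omega> s) \<in> borel_measurable path_borel" for s
      by (intro borel_measurable_times borel_measurable_const measurable_eval)
  qed
  then have "(\<lambda>(\<omega>, s). indicator {..0} s *\<^sub>R (case (s, \<omega>) of (s, \<omega>) \<Rightarrow> exp (\<alpha> * s) * \<omega> s)) \<in> borel_measurable (path_borel \<Otimes>\<^sub>M lborel)"
    by measurable
  then show ?thesis by (simp add: case_prod_beta)
qed

lemma measurable_ou_formula: "(\<lambda>\<omega>. LINT s:{..0}|lborel. exp (\<alpha> * s) * \<omega> s) \<in> borel_measurable path_borel"
  unfolding set_lebesgue_integral_def
  by (rule lborel.borel_measurable_lebesgue_integral[OF measurable_weighted_eval])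

lemma wiener_shift_shift: "wiener_shift t (wiener_shift s \<omega>) = wiener_shift (s + t) \<omega>"
  by (auto simp: wiener_shift_def add.assoc)

text \<open>The increment is normal with variance \<open>- s\<close>, and its first absolute moment
  is \<open>sqrt (2 / pi)\<close> times the standard deviation; that factor is at most 1 and is
  dropped.\<close>

lemma wiener_abs_moment:
  assumes "wiener_measure P" "s \<le> 0"
  shows "(\<integral>\<^sup>+\<omega>. ennreal \<bar>\<omega> s\<bar> \<partial>P) \<le> ennreal (sqrt (- s))"
proof (cases "s = 0")
  case True
  have "(\<integral>\<^sup>+\<omega>. ennreal \<bar>\<omega> s\<bar> \<partial>P) = (\<integral>\<^sup>+\<omega>. 0 \<partial>P)"
    using assms(1) by (intro nn_integral_cong) (auto simp: True wiener_measure_def path_space_def)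
  then show ?thesis by simp
next
  case False
  then have s: "s < 0" using assms by simp
  then have sq: "sqrt (- s) > 0" by simp
  have d: "distributed P lborel (\<lambda>\<omega>. \<omega> 0 - \<omega> s) (normal_density 0 (sqrt (- s)))"
    using assms(1) s unfolding wiener_measure_def by force
  have "(\<integral>\<^sup>+\<omega>. ennreal \<bar>\<omega> s\<bar> \<partial>P) = (\<integral>\<^sup>+\<omega>. ennreal \<bar>\<omega> 0 - \<omega> s\<bar> \<partial>P)"
    using assms(1) by (intro nn_integral_cong) (auto simp: wiener_measure_def path_space_def)
  also have "\<dots> = (\<integral>\<^sup>+x. ennreal (normal_density 0 (sqrt (- s)) x) * ennreal \<bar>x\<bar> \<partial>lborel)"
    by (rule distributed_nn_integral[OF d, symmetric]) simp
  also have "\<dots> = (\<integral>\<^sup>+x. ennreal (normal_density 0 (sqrt (- s)) x * \<bar>x\<bar>) \<partial>lborel)"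
    by (simp add: ennreal_mult)
  also have "\<dots> = ennreal (\<integral>x. normal_density 0 (sqrt (- s)) x * \<bar>x\<bar> \<partial>lborel)"
    using integrable_normal_moment_abs[OF sq, of 0 1] by (intro nn_integral_eq_integral) auto
  also have "(\<integral>x. normal_density 0 (sqrt (- s)) x * \<bar>x\<bar> \<partial>lborel) = sqrt (- s) * sqrt (2 / pi)"
    using integral_normal_moment_abs_odd[OF sq, of 0 0] by simp
  also have "ennreal (sqrt (- s) * sqrt (2 / pi)) \<le> ennreal (sqrt (- s) * 1)"
    using sq pi_ge_two by (intro ennreal_leI mult_left_mono) (auto simp: real_sqrt_le_1_iff)
  finally show ?thesis by simp
qed

lemma sqrt_exp_bound: "sqrt x * exp (- x) \<le> exp (- x / 2)" if "x \<ge> 0" for x :: real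
proof -
  have "x \<le> exp x" using exp_ge_add_one_self[of x] by linarith
  then have "sqrt x \<le> sqrt (exp x)" by simp
  also have "sqrt (exp x) = exp (x / 2)" by (rule real_sqrt_unique) (auto simp: power2_eq_square exp_add[symmetric])
  finally have "sqrt x * exp (- x) \<le> exp (x / 2) * exp (- x)" by (rule mult_right_mono) simp
  also have "\<dots> = exp (- x / 2)" by (simp add: exp_add[symmetric])
  finally show ?thesis .
qed

text \<open>Fubini's theorem and the bound \<open>sqrt (- s)\<close> for the moment at time
  \<open>s\<close>; scaling time by \<alpha> explains the power of \<alpha>. What matters is that
  the bound tends to 0 as \<alpha> grows.\<close>

lemma ou_first_moment:
  assumes P: "wiener_measure P" and \<Omega>: "\<Omega> \<in> sets P" "\<And>\<omega>. \<omega> \<in> \<Omega> \<Longrightarrow> sublinear_at_bot \<omega>"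
    and \<alpha>: "\<alpha> > 0" and \<sigma>: "\<sigma> > 0"
  shows "(\<integral>\<omega>. \<bar>ou \<alpha> \<sigma> \<omega>\<bar> \<partial>restrict_space P \<Omega>) \<le> 2 * \<sigma> / sqrt \<alpha>"
proof -
  have PP: "prob_space P" and sp: "space P = path_space" and sets: "sets P = sets path_borel"
    using P by (auto simp: wiener_measure_def)
  interpret P: prob_space P by (rule PP)
  interpret pair_sigma_finite P lborel ..
  let ?f = "\<lambda>(\<omega>::real \<Rightarrow> real) s. indicator {..0} s *\<^sub>R (exp (\<alpha> * s) * \<omega> s)"
  have meas: "(\<lambda>(\<omega>, s). ?f \<omega> s) \<in> borel_measurable (P \<Otimes>\<^sub>M lborel)"
    using measurable_weighted_eval measurable_cong_sets[OF sets_pair_measure_cong[OF sets refl] refl] by blast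
  have "(\<integral>\<^sup>+\<omega>. ennreal \<bar>ou \<alpha> \<sigma> \<omega>\<bar> \<partial>restrict_space P \<Omega>) = (\<integral>\<^sup>+\<omega>. ennreal \<bar>ou \<alpha> \<sigma> \<omega>\<bar> * indicator \<Omega> \<omega> \<partial>P)"
    using \<Omega>(1) by (intro nn_integral_restrict_space) (simp add: sets.Int_space_eq2)
  also have "\<dots> \<le> (\<integral>\<^sup>+\<omega>. (\<integral>\<^sup>+s. ennreal (\<alpha> * \<sigma>) * ennreal (norm (?f \<omega> s)) \<partial>lborel) \<partial>P)"
  proof (rule nn_integral_mono)
    fix \<omega> show "ennreal \<bar>ou \<alpha> \<sigma> \<omega>\<bar> * indicator \<Omega> \<omega> \<le> (\<integral>\<^sup>+s. ennreal (\<alpha> * \<sigma>) * ennreal (norm (?f \<omega> s)) \<partial>lborel)"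
    proof (cases "\<omega> \<in> \<Omega>")
      case True
      have int: "integrable lborel (?f \<omega>)"
        using sublinear_integrable[OF \<Omega>(2)[OF True] \<alpha>] unfolding set_integrable_def .
      have "\<bar>ou \<alpha> \<sigma> \<omega>\<bar> = (\<alpha> * \<sigma>) * norm (integral\<^sup>L lborel (?f \<omega>))"
        using \<alpha> \<sigma> by (simp add: ou_eq[OF \<Omega>(2)[OF True] \<alpha>] set_lebesgue_integral_def abs_mult)
      then have "ennreal \<bar>ou \<alpha> \<sigma> \<omega>\<bar> = ennreal (\<alpha> * \<sigma>) * ennreal (norm (integral\<^sup>L lborel (?f \<omega>)))"
        using \<alpha> \<sigma> by (simp add: ennreal_mult)
      also have "\<dots> \<le> ennreal (\<alpha> * \<sigma>) * (\<integral>\<^sup>+s. ennreal (norm (?f \<omega> s)) \<partial>lborel)"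
        by (intro mult_left_mono integral_norm_bound_ennreal int) simp
      also have "\<dots> = (\<integral>\<^sup>+s. ennreal (\<alpha> * \<sigma>) * ennreal (norm (?f \<omega> s)) \<partial>lborel)"
        by (intro nn_integral_cmult[symmetric]
          measurable_compose[OF measurable_compose[OF borel_measurable_integrable[OF int] borel_measurable_norm] measurable_ennreal])
      finally show ?thesis using True by simp
    qed simp
  qed
  also have "\<dots> = (\<integral>\<^sup>+s. (\<integral>\<^sup>+\<omega>. ennreal (\<alpha> * \<sigma>) * ennreal (norm (?f \<omega> s)) \<partial>P) \<partial>lborel)"
    using meas by (intro Fubini'[symmetric]) (simp add: case_prod_beta)
  also have "\<dots> \<le> (\<integral>\<^sup>+s. ennreal (\<sigma> * sqrt \<alpha> * (indicator {..0} s *\<^sub>R exp (\<alpha> / 2 * s))) \<partial>lborel)"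
  proof (rule nn_integral_mono)
    fix s show "(\<integral>\<^sup>+\<omega>. ennreal (\<alpha> * \<sigma>) * ennreal (norm (?f \<omega> s)) \<partial>P) \<le> ennreal (\<sigma> * sqrt \<alpha> * (indicator {..0} s *\<^sub>R exp (\<alpha> / 2 * s)))"
    proof (cases "s \<le> 0")
      case True
      have ev: "(\<lambda>\<omega>. \<omega> s) \<in> borel_measurable P" using measurable_eval measurable_cong_sets[OF sets refl] by blast
      have "(\<integral>\<^sup>+\<omega>. ennreal (\<alpha> * \<sigma>) * ennreal (norm (?f \<omega> s)) \<partial>P) = (\<integral>\<^sup>+\<omega>. ennreal (\<alpha> * \<sigma> * exp (\<alpha> * s)) * ennreal \<bar>\<omega> s\<bar> \<partial>P)"
        using True \<alpha> \<sigma> by (intro nn_integral_cong) (simp add: abs_mult ennreal_mult[symmetric] mult.assoc)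
      also have "\<dots> = ennreal (\<alpha> * \<sigma> * exp (\<alpha> * s)) * (\<integral>\<^sup>+\<omega>. ennreal \<bar>\<omega> s\<bar> \<partial>P)"
        using ev by (intro nn_integral_cmult) measurable
      also have "\<dots> \<le> ennreal (\<alpha> * \<sigma> * exp (\<alpha> * s)) * ennreal (sqrt (- s))"
        by (intro mult_left_mono wiener_abs_moment P True) simp
      also have "\<dots> = ennreal (\<alpha> * \<sigma> * exp (\<alpha> * s) * sqrt (- s))" using \<alpha> \<sigma> True by (intro ennreal_mult[symmetric]) auto
      also have "\<dots> \<le> ennreal (\<sigma> * sqrt \<alpha> * exp (\<alpha> / 2 * s))"
      proof (rule ennreal_leI)
        \<comment> \<open>Half of the exponential compensates the root:
          \<open>sqrt_exp_bound\<close> at \<open>- \<alpha> * s\<close>.\<close>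
        have "sqrt (\<alpha> * (- s)) * exp (- (\<alpha> * (- s))) \<le> exp (- (\<alpha> * (- s)) / 2)"
          using True \<alpha> by (intro sqrt_exp_bound) (simp add: mult_nonneg_nonpos)
        then have "sqrt \<alpha> * sqrt (- s) * exp (\<alpha> * s) \<le> exp (\<alpha> / 2 * s)"
          unfolding real_sqrt_mult by simp
        then have "\<sigma> * sqrt \<alpha> * (sqrt \<alpha> * sqrt (- s) * exp (\<alpha> * s)) \<le> \<sigma> * sqrt \<alpha> * exp (\<alpha> / 2 * s)"
          using \<alpha> \<sigma> by (intro mult_left_mono) auto
        moreover have "\<sigma> * r * (r * x * e) = a * \<sigma> * e * x" if "r * r = a" for r x e a :: real
          unfolding that[symmetric] by (simp only: mult_ac)
        then have "\<sigma> * sqrt \<alpha> * (sqrt \<alpha> * sqrt (- s) * exp (\<alpha> * s)) = \<alpha> * \<sigma> * exp (\<alpha> * s) * sqrt (- s)"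
          using \<alpha> by simp
        ultimately show "\<alpha> * \<sigma> * exp (\<alpha> * s) * sqrt (- s) \<le> \<sigma> * sqrt \<alpha> * exp (\<alpha> / 2 * s)" by simp
      qed
      finally show ?thesis using True by simp
    qed simp
  qed
  also have "\<dots> = ennreal (\<integral>s. \<sigma> * sqrt \<alpha> * (indicator {..0} s *\<^sub>R exp (\<alpha> / 2 * s)) \<partial>lborel)"
    using set_integrable_exp_atMost_0[of "\<alpha> / 2"] \<alpha> \<sigma> unfolding set_integrable_def
    by (intro nn_integral_eq_integral) auto
  also have "(\<integral>s. \<sigma> * sqrt \<alpha> * (indicator {..0} s *\<^sub>R exp (\<alpha> / 2 * s)) \<partial>lborel) = \<sigma> * sqrt \<alpha> * (2 / \<alpha>)"
    using LINT_exp_atMost_0[of "\<alpha> / 2"] \<alpha> unfolding set_lebesgue_integral_def by simp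
  also have "\<sigma> * sqrt \<alpha> * (2 / \<alpha>) = 2 * \<sigma> / sqrt \<alpha>"
    using \<alpha> by (simp add: field_simps)
  finally have b: "(\<integral>\<^sup>+\<omega>. ennreal \<bar>ou \<alpha> \<sigma> \<omega>\<bar> \<partial>restrict_space P \<Omega>) \<le> ennreal (2 * \<sigma> / sqrt \<alpha>)" .
  show ?thesis
  proof (cases "integrable (restrict_space P \<Omega>) (\<lambda>\<omega>. \<bar>ou \<alpha> \<sigma> \<omega>\<bar>)")
    case True
    from nn_integral_eq_integral[OF this] b have "ennreal (\<integral>\<omega>. \<bar>ou \<alpha> \<sigma> \<omega>\<bar> \<partial>restrict_space P \<Omega>) \<le> ennreal (2 * \<sigma> / sqrt \<alpha>)" by simp
    then show ?thesis using \<alpha> \<sigma> by (simp add: ennreal_le_iff)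
  next
    \<comment> \<open>The Bochner integral of a function that is not integrable is 0 by
      convention.\<close>
    case False then show ?thesis using \<alpha> \<sigma> by (simp add: not_integrable_integral_eq)
  qed
qed

lemma signed_integral_shift:
  fixes g :: "real \<Rightarrow> real"
  assumes g: "continuous_on UNIV g"
  shows "signed_integral (\<lambda>r. g (t + r)) s = signed_integral g (t + s) - signed_integral g t"
proof -
  define h where "h r = g (t + r)" for r
  have h: "continuous_on UNIV h" unfolding h_def by (intro continuous_on_compose2[OF g] continuous_intros) auto
  have "((\<lambda>r. signed_integral g (t + r)) has_vector_derivative h r) (at r)" for r
  proof -
    have "((\<lambda>r. t + r) has_vector_derivative 1) (at r)" by (auto intro!: derivative_eq_intros)
    from vector_diff_chain_at[OF this signed_integral_has_vector_derivative[OF g]] show ?thesis by (simp add: o_def h_def)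
  qed
  then have "\<forall>a b. a \<le> b \<longrightarrow> signed_integral g (t + b) - signed_integral g (t + a) = integral {a..b} h"
    using integrated_form_iff[OF h, of "\<lambda>r. signed_integral g (t + r)"] by blast
  moreover have "integral {a..b} h = signed_integral h b - signed_integral h a" if "a \<le> b" for a b
    by (rule signed_integral_diff[OF h that])
  ultimately have *: "signed_integral g (t + b) - signed_integral g (t + a) = signed_integral h b - signed_integral h a" if "a \<le> b" for a b
    using that by metis
  show ?thesis using *[of 0 s] *[of s 0] unfolding h_def[symmetric] by (cases "0 \<le> s") auto
qed

section \<open>Energy decay along the stationary process\<close>

lemma LINT_Ioo_signed:
  fixes g :: "real \<Rightarrow> real"
  assumes g: "continuous_on UNIV g" shows "(LBINT r=0..ereal t. g r) = signed_integral g t"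
proof -
  have si: "set_integrable lborel {a..b} g" for a b
    by (rule borel_integrable_atLeastAtMost') (use g continuous_on_subset in blast)
  show ?thesis
  proof (cases "0 \<le> t")
    case True
    have "(LBINT r=ereal 0..ereal t. g r) = integral {0..t} g"
      by (rule interval_integral_eq_integral[OF True si])
    then show ?thesis using signed_integral_diff[OF g True] by (simp add: zero_ereal_def)
  next
    case False
    then have "(LBINT r=ereal t..ereal 0. g r) = integral {t..0} g"
      by (intro interval_integral_eq_integral si) simp
    then show ?thesis
      using signed_integral_diff[OF g, of t 0] False interval_integral_endpoints_reverse[of "ereal 0" "ereal t" g]
      by (simp add: zero_ereal_def)
  qed
qed

text \<open>Far in the past the limit gives the relative error \<epsilon>; on the remaining compact
  interval the error is bounded and goes into \<open>K\<close>.\<close>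

lemma linear_growth_bound:
  fixes F :: "real \<Rightarrow> real"
  assumes F: "continuous_on UNIV F" and lim: "((\<lambda>t. (1 / t) * F t) \<longlongrightarrow> m) at_bot" and \<epsilon>: "\<epsilon> > 0"
  obtains K where "K \<ge> 0" "\<And>t. t \<le> 0 \<Longrightarrow> \<bar>F t - m * t\<bar> \<le> \<epsilon> * \<bar>t\<bar> + K"
proof -
  have "\<forall>\<^sub>F t in at_bot. dist ((1 / t) * F t) m < \<epsilon>" using tendstoD[OF lim \<epsilon>] .
  then obtain N where N: "\<And>t. t \<le> N \<Longrightarrow> dist ((1 / t) * F t) m < \<epsilon>" unfolding eventually_at_bot_linorder by blast
  have "compact ((\<lambda>t. F t - m * t) ` {N..0})"
    by (intro compact_continuous_image continuous_intros continuous_on_subset[OF F]) auto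
  from compact_imp_bounded[OF this] obtain B where "\<forall>x\<in>(\<lambda>t. F t - m * t) ` {N..0}. norm x \<le> B" unfolding bounded_iff by blast
  then have B: "\<bar>F t - m * t\<bar> \<le> B" if "t \<in> {N..0}" for t using that by simp
  have "\<bar>F t - m * t\<bar> \<le> \<epsilon> * \<bar>t\<bar> + (\<bar>B\<bar> + \<bar>F 0\<bar>)" if "t \<le> 0" for t
  proof (cases "t = 0 \<or> t \<ge> N")
    case True
    have "0 \<le> \<epsilon> * \<bar>t\<bar>" using \<epsilon> by simp
    with True that B[of t] show ?thesis by auto
  next
    case False
    then have "dist ((1 / t) * F t) m < \<epsilon>" using N by simp
    then have "\<bar>(1 / t) * F t - m\<bar> * \<bar>t\<bar> \<le> \<epsilon> * \<bar>t\<bar>" by (intro mult_right_mono) (auto simp: dist_real_def)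
    moreover have "\<bar>(1 / t) * F t - m\<bar> * \<bar>t\<bar> = \<bar>F t - m * t\<bar>" using False by (simp add: abs_mult[symmetric] left_diff_distrib)
    ultimately show ?thesis by simp
  qed
  then show thesis using that[of "\<bar>B\<bar> + \<bar>F 0\<bar>"] by simp
qed

lemma exp_ge_square: "(1 + \<bar>s\<bar>)\<^sup>2 \<le> (1 + 2 / e)\<^sup>2 * exp (e * \<bar>s\<bar>)" if "e > 0" for e s :: real
proof -
  have "(1 + \<bar>s\<bar>)\<^sup>2 \<le> ((1 + 1 / (e / 2)) * exp (e / 2 * \<bar>s\<bar>))\<^sup>2"
    using that by (intro power_mono exp_ge_abs) auto
  also have "\<dots> = (1 + 2 / e)\<^sup>2 * (exp (e / 2 * \<bar>s\<bar>))\<^sup>2" by (simp add: power_mult_distrib)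
  also have "(exp (e / 2 * \<bar>s\<bar>))\<^sup>2 = exp (e * \<bar>s\<bar>)"
    unfolding power2_eq_square exp_add[symmetric] by simp
  finally show ?thesis .
qed

text \<open>Here \<alpha> is fixed. Together with \<open>ou_first_moment\<close>, the assumption
  \<open>small\<close> says that \<open>- c + C * m\<close>, where \<open>m\<close> is the mean of
  the modulus of the process, is at most \<open>- c / 2\<close>.\<close>

locale attractor_setup = pendulum +
  fixes P :: "(real \<Rightarrow> real) measure" and \<Omega> :: "(real \<Rightarrow> real) set" and c C K \<alpha> :: real
  assumes wiener: "wiener_measure P" and regular: "regular_noise P \<sigma> \<Omega>" and \<alpha>: "\<alpha> > 0"
    and constants: "c > 0" "C \<ge> 0" "K \<ge> 0"
    and dissipation: "\<And>p \<eta> \<beta>. Denergy p (field (p + noise_vec \<eta>) + noise_vec \<beta>)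
       \<le> (- c + C * \<bar>\<eta>\<bar>) * energy p + K * (gauge_term \<eta> \<beta>)\<^sup>2"
    and small: "C * (2 * \<sigma> / sqrt \<alpha>) \<le> c / 2"
begin

abbreviation "\<theta> \<equiv> wiener_shift"
abbreviation "M \<equiv> restrict_space P \<Omega>"

definition z :: "real \<Rightarrow> (real \<Rightarrow> real) \<Rightarrow> real" where "z t \<omega> = ou \<alpha> \<sigma> (\<theta> t \<omega>)"

definition m :: real where "m = (\<integral>\<omega>. \<bar>ou \<alpha> \<sigma> \<omega>\<bar> \<partial>M)"

lemma sets_P: "sets P = sets path_borel" and space_P: "space P = path_space"
  using wiener by (auto simp: wiener_measure_def)

lemma \<Omega>_sets: "\<Omega> \<in> sets P" and \<Omega>_path: "\<Omega> \<subseteq> path_space"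
  using regular sets.sets_into_space[of \<Omega> P] space_P by (auto simp: regular_noise_def)

lemma space_M [simp]: "space M = \<Omega>"
  using \<Omega>_path space_P by (auto simp: space_restrict_space)

lemma shift_\<Omega>: "\<omega> \<in> \<Omega> \<Longrightarrow> \<theta> t \<omega> \<in> \<Omega>"
  using regular unfolding regular_noise_def by blast

lemma cont_\<Omega>: "\<omega> \<in> \<Omega> \<Longrightarrow> continuous_on UNIV \<omega>"
  using \<Omega>_path path_spaceD by blast

lemma sublinear_\<Omega>: "\<omega> \<in> \<Omega> \<Longrightarrow> sublinear_at_bot \<omega>"
  using regular \<Omega>_path unfolding sublinear_at_bot_def regular_noise_def path_space_def by blast

lemma z_shift: "z t (\<theta> s \<omega>) = z (s + t) \<omega>"
  by (simp add: z_def wiener_shift_shift)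

text \<open>The Ornstein-Uhlenbeck equation in a form without differentials of the path: passing
  from the shift by \<open>\<sigma> * \<omega>\<close> to the shift by \<open>z\<close> adds the
  term \<open>\<alpha> * z\<close> to the momentum equation.\<close>

lemma z_deriv:
  assumes \<omega>: "\<omega> \<in> \<Omega>"
  shows "((\<lambda>t. \<sigma> * \<omega> t - z t \<omega>) has_real_derivative \<alpha> * z t \<omega>) (at t)"
proof -
  let ?g = "\<lambda>s. exp (\<alpha> * s) * \<omega> s"
  let ?I = "LINT s:{..0}|lborel. ?g s"
  have eq: "z t \<omega> = \<sigma> * \<omega> t - \<alpha> * \<sigma> * exp (- \<alpha> * t) * (?I + signed_integral ?g t)" for t
    unfolding z_def by (rule ou_shift_eq[OF sublinear_\<Omega>[OF \<omega>] sublinear_\<Omega>[OF shift_\<Omega>[OF \<omega>]] \<alpha>])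
  have "(\<lambda>t. \<sigma> * \<omega> t - z t \<omega>) = (\<lambda>t. \<alpha> * \<sigma> * exp (- \<alpha> * t) * (?I + signed_integral ?g t))"
    unfolding eq by simp
  moreover have "(signed_integral ?g has_real_derivative ?g t) (at t)"
    using signed_integral_has_vector_derivative[OF continuous_exp_mult[OF cont_\<Omega>[OF \<omega>]]]
    by (simp add: has_real_derivative_iff_has_vector_derivative)
  then have "((\<lambda>t. \<alpha> * \<sigma> * exp (- \<alpha> * t) * (?I + signed_integral ?g t)) has_real_derivative
      \<alpha> * \<sigma> * (exp (- \<alpha> * t) * - \<alpha>) * (?I + signed_integral ?g t) + \<alpha> * \<sigma> * exp (- \<alpha> * t) * ?g t) (at t)"
    by (auto intro!: derivative_eq_intros)
  moreover have "\<alpha> * \<sigma> * (exp (- \<alpha> * t) * - \<alpha>) * (?I + signed_integral ?g t) + \<alpha> * \<sigma> * exp (- \<alpha> * t) * ?g t = \<alpha> * z t \<omega>"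
  proof -
    have "exp (- \<alpha> * t) * exp (\<alpha> * t) = 1" by (simp add: exp_add[symmetric])
    then show ?thesis unfolding eq[of t] by algebra
  qed
  ultimately show ?thesis by simp
qed

lemma cont_z: assumes \<omega>: "\<omega> \<in> \<Omega>" shows "continuous_on UNIV (\<lambda>t. z t \<omega>)"
proof -
  have "continuous_on UNIV (\<lambda>t. \<sigma> * \<omega> t - z t \<omega>)"
    using z_deriv[OF \<omega>] by (meson DERIV_isCont continuous_at_imp_continuous_on)
  from continuous_on_diff[OF continuous_on_mult_left[OF cont_\<Omega>[OF \<omega>], of \<sigma>] this]
  have "continuous_on UNIV (\<lambda>t. \<sigma> * \<omega> t - (\<sigma> * \<omega> t - z t \<omega>))" .
  then show ?thesis by simp
qed

lemma z_growth: assumes "\<omega> \<in> \<Omega>" obtains B where "B \<ge> 0" "\<And>t. (z t \<omega>)\<^sup>2 \<le> B * (1 + \<bar>t\<bar>)"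
proof -
  obtain B where B: "\<And>t. \<bar>ou \<alpha> \<sigma> (\<theta> t \<omega>)\<bar>\<^sup>2 \<le> B * (1 + \<bar>t\<bar>)"
    using regular assms \<alpha> unfolding regular_noise_def by blast
  have "B \<ge> 0" using order_trans[OF zero_le_power2 B[of 0]] by simp
  then show thesis using that[of B] B by (simp add: z_def)
qed

lemma measurable_shift_M: "\<theta> t \<in> M \<rightarrow>\<^sub>M M"
proof -
  have "\<theta> t \<in> P \<rightarrow>\<^sub>M P" using measurable_wiener_shift[of t] measurable_cong_sets[OF sets_P sets_P] by blast
  then show ?thesis
    by (intro measurable_restrict_space2 measurable_restrict_space1) (use shift_\<Omega> in auto)
qed

lemma measurable_on_M: "f \<in> borel_measurable path_borel \<Longrightarrow> f \<in> borel_measurable M"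
  using measurable_cong_sets[OF sets_P refl] by (intro measurable_restrict_space1) blast

lemma measurable_z: "(\<lambda>\<omega>. z t \<omega>) \<in> borel_measurable M"
proof -
  have "(\<lambda>\<omega>. ou \<alpha> \<sigma> \<omega>) \<in> borel_measurable M"
  proof (subst measurable_cong)
    show "ou \<alpha> \<sigma> \<omega> = - \<alpha> * \<sigma> * (LINT s:{..0}|lborel. exp (\<alpha> * s) * \<omega> s)" if "\<omega> \<in> space M" for \<omega>
      using that by (intro ou_eq sublinear_\<Omega> \<alpha>) simp
    show "(\<lambda>\<omega>. - \<alpha> * \<sigma> * (LINT s:{..0}|lborel. exp (\<alpha> * s) * \<omega> s)) \<in> borel_measurable M"
      by (intro borel_measurable_times borel_measurable_const measurable_on_M measurable_ou_formula)
  qed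
  from measurable_compose[OF measurable_shift_M this] show ?thesis by (simp add: z_def)
qed

lemma m_bounds: "0 \<le> m" "C * m \<le> c / 2"
proof -
  show "0 \<le> m" by (simp add: m_def)
  have "m \<le> 2 * \<sigma> / sqrt \<alpha>" unfolding m_def by (rule ou_first_moment[OF wiener \<Omega>_sets sublinear_\<Omega> \<alpha> \<sigma>])
  then have "C * m \<le> C * (2 * \<sigma> / sqrt \<alpha>)" using constants by (intro mult_left_mono)
  with small show "C * m \<le> c / 2" by simp
qed

section \<open>The linear comparison equation and its stationary solution\<close>

definition zint where "zint t \<omega> = signed_integral (\<lambda>r. \<bar>z r \<omega>\<bar>) t"

lemma cont_abs_z: "\<omega> \<in> \<Omega> \<Longrightarrow> continuous_on UNIV (\<lambda>r. \<bar>z r \<omega>\<bar>)"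
  by (intro continuous_intros cont_z)

lemma zint_deriv: "\<omega> \<in> \<Omega> \<Longrightarrow> ((\<lambda>t. zint t \<omega>) has_real_derivative \<bar>z t \<omega>\<bar>) (at t)"
  using signed_integral_has_vector_derivative[OF cont_abs_z, of \<omega> t]
  by (simp add: zint_def[abs_def] has_real_derivative_iff_has_vector_derivative)

lemma cont_zint: "\<omega> \<in> \<Omega> \<Longrightarrow> continuous_on UNIV (\<lambda>t. zint t \<omega>)"
  using zint_deriv by (meson DERIV_isCont continuous_at_imp_continuous_on)

lemma zint_0 [simp]: "zint 0 \<omega> = 0"
  by (simp add: zint_def)

lemma zint_shift: "\<omega> \<in> \<Omega> \<Longrightarrow> zint t (\<theta> s \<omega>) = zint (s + t) \<omega> - zint s \<omega>"
  unfolding zint_def z_shift by (rule signed_integral_shift[OF cont_abs_z])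

text \<open>The ergodic limit is taken at minus infinity, since pullback attraction looks into the
  past.\<close>

lemma zint_growth:
  assumes \<omega>: "\<omega> \<in> \<Omega>" and "\<epsilon> > 0"
  obtains B where "B \<ge> 0" "\<And>t. t \<le> 0 \<Longrightarrow> \<bar>zint t \<omega> - m * t\<bar> \<le> \<epsilon> * \<bar>t\<bar> + B"
proof (rule linear_growth_bound[OF cont_zint[OF \<omega>] _ assms(2)])
  have "((\<lambda>t. (1 / t) * (LBINT r=0..ereal t. \<bar>ou \<alpha> \<sigma> (\<theta> r \<omega>)\<bar>)) \<longlongrightarrow> m) at_bot"
    using regular \<omega> \<alpha> unfolding regular_noise_def m_def by blast
  then show "((\<lambda>t. (1 / t) * zint t \<omega>) \<longlongrightarrow> m) at_bot"
    using LINT_Ioo_signed[OF cont_abs_z[OF \<omega>]] by (simp add: zint_def z_def)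
qed (use that in blast)

text \<open>The logarithm of the fundamental solution of the homogeneous comparison
  equation.\<close>

definition A where "A t \<omega> = - c * t + C * zint t \<omega>"

lemma A_0 [simp]: "A 0 \<omega> = 0" by (simp add: A_def)

lemma A_shift: "\<omega> \<in> \<Omega> \<Longrightarrow> A t (\<theta> s \<omega>) = A (s + t) \<omega> - A s \<omega>"
  by (simp add: A_def zint_shift algebra_simps)

lemma A_deriv: "\<omega> \<in> \<Omega> \<Longrightarrow> ((\<lambda>t. A t \<omega>) has_real_derivative (- c + C * \<bar>z t \<omega>\<bar>)) (at t)"
  unfolding A_def by (auto intro!: derivative_eq_intros zint_deriv)

lemma cont_A: "\<omega> \<in> \<Omega> \<Longrightarrow> continuous_on UNIV (\<lambda>t. A t \<omega>)"
  unfolding A_def by (intro continuous_intros cont_zint)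

text \<open>The error is proportional to the distances of both times from 0 and not to
  \<open>t - s\<close>, since the ergodic limit concerns averages that start at 0.\<close>

lemma A_growth:
  assumes \<omega>: "\<omega> \<in> \<Omega>" and \<epsilon>: "\<epsilon> > 0"
  obtains B where "B \<ge> 0" "\<And>s t. s \<le> t \<Longrightarrow> t \<le> 0 \<Longrightarrow> A t \<omega> - A s \<omega> \<le> - (c / 2) * (t - s) + \<epsilon> * (\<bar>s\<bar> + \<bar>t\<bar>) + B"
proof -
  \<comment> \<open>Division by \<open>C + 1\<close> because \<open>C\<close> may be 0.\<close>
  define \<delta> where "\<delta> = \<epsilon> / (C + 1)"
  have \<delta>: "\<delta> > 0" "C * \<delta> \<le> \<epsilon>" using \<epsilon> constants by (auto simp: \<delta>_def field_simps)
  obtain B where B: "B \<ge> 0" "\<And>t. t \<le> 0 \<Longrightarrow> \<bar>zint t \<omega> - m * t\<bar> \<le> \<delta> * \<bar>t\<bar> + B" using zint_growth[OF \<omega> \<delta>(1)] by blast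
  have "A t \<omega> - A s \<omega> \<le> - (c / 2) * (t - s) + \<epsilon> * (\<bar>s\<bar> + \<bar>t\<bar>) + 2 * C * B" if "s \<le> t" "t \<le> 0" for s t
  proof -
    have "zint t \<omega> - zint s \<omega> \<le> m * (t - s) + (\<delta> * (\<bar>s\<bar> + \<bar>t\<bar>) + 2 * B)"
      using B(2)[of t] B(2)[of s] that by (simp add: algebra_simps abs_le_iff)
    then have "C * (zint t \<omega> - zint s \<omega>) \<le> C * (m * (t - s) + (\<delta> * (\<bar>s\<bar> + \<bar>t\<bar>) + 2 * B))"
      using constants by (intro mult_left_mono)
    also have "\<dots> = C * m * (t - s) + (C * \<delta> * (\<bar>s\<bar> + \<bar>t\<bar>) + 2 * C * B)" by (simp add: algebra_simps)
    also have "\<dots> \<le> c / 2 * (t - s) + (\<epsilon> * (\<bar>s\<bar> + \<bar>t\<bar>) + 2 * C * B)"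
      using that \<delta> m_bounds constants B(1) by (intro add_mono mult_right_mono) auto
    finally have "C * (zint t \<omega> - zint s \<omega>) \<le> c / 2 * (t - s) + (\<epsilon> * (\<bar>s\<bar> + \<bar>t\<bar>) + 2 * C * B)" .
    moreover have "A t \<omega> - A s \<omega> = - c * (t - s) + C * (zint t \<omega> - zint s \<omega>)" by (simp add: A_def algebra_simps)
    moreover have "- c * (t - s) + c / 2 * (t - s) = - (c / 2) * (t - s)" by (simp add: field_simps)
    ultimately show ?thesis by linarith
  qed
  then show thesis using that[of "2 * C * B"] B(1) constants by simp
qed

text \<open>The summand 1 keeps the forcing positive even if \<open>K = 0\<close>, so that
  \<open>R\<close> is positive and there is room between the levels \<open>R\<close> and
  \<open>2 * R\<close>.\<close>

definition h where "h t \<omega> = K * (gauge_term (z t \<omega>) (\<alpha> * z t \<omega>))\<^sup>2 + 1"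

lemma h_ge: "h t \<omega> \<ge> 1"
  using constants by (simp add: h_def)

lemma h_shift: "h t (\<theta> s \<omega>) = h (s + t) \<omega>"
  by (simp add: h_def z_shift)

lemma cont_h: "\<omega> \<in> \<Omega> \<Longrightarrow> continuous_on UNIV (\<lambda>t. h t \<omega>)"
  unfolding h_def gauge_term_def by (intro continuous_intros cont_z)

lemma h_growth:
  assumes \<omega>: "\<omega> \<in> \<Omega>" obtains B where "B \<ge> 0" "\<And>t. h t \<omega> \<le> B * (1 + \<bar>t\<bar>)\<^sup>2"
proof -
  obtain B where B: "B \<ge> 0" "\<And>t. (z t \<omega>)\<^sup>2 \<le> B * (1 + \<bar>t\<bar>)" using z_growth[OF \<omega>] by blast
  define D where "D = 1 + (1 + \<alpha>) * (1 + B) + B"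
  have D: "D \<ge> 0" using B \<alpha> by (simp add: D_def)
  have "h t \<omega> \<le> (K * D\<^sup>2 + 1) * (1 + \<bar>t\<bar>)\<^sup>2" for t
  proof -
    have t: "1 \<le> 1 + \<bar>t\<bar>" by simp
    have "\<bar>z t \<omega>\<bar> \<le> 1 + (z t \<omega>)\<^sup>2"
      using abs_mult_le_squares[of "z t \<omega>" 1] zero_le_power2[of "z t \<omega>"] by simp
    also have "\<dots> \<le> 1 * (1 + \<bar>t\<bar>) + B * (1 + \<bar>t\<bar>)" using B(2)[of t] by simp
    finally have z1: "\<bar>z t \<omega>\<bar> \<le> (1 + B) * (1 + \<bar>t\<bar>)" by (simp add: distrib_right)
    have "gauge_term (z t \<omega>) (\<alpha> * z t \<omega>) = 1 + (1 + \<alpha>) * \<bar>z t \<omega>\<bar> + (z t \<omega>)\<^sup>2"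
      using \<alpha> by (simp add: gauge_term_def abs_mult algebra_simps)
    also have "\<dots> \<le> 1 * (1 + \<bar>t\<bar>) + (1 + \<alpha>) * ((1 + B) * (1 + \<bar>t\<bar>)) + B * (1 + \<bar>t\<bar>)"
      using \<alpha> z1 by (intro add_mono mult_left_mono B) auto
    also have "\<dots> = D * (1 + \<bar>t\<bar>)" by (simp add: D_def algebra_simps)
    finally have "(gauge_term (z t \<omega>) (\<alpha> * z t \<omega>))\<^sup>2 \<le> (D * (1 + \<bar>t\<bar>))\<^sup>2"
      using gauge_term_ge(1)[of "z t \<omega>" "\<alpha> * z t \<omega>"] by (intro power_mono) auto
    then have "K * (gauge_term (z t \<omega>) (\<alpha> * z t \<omega>))\<^sup>2 \<le> K * (D * (1 + \<bar>t\<bar>))\<^sup>2"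
      using constants by (intro mult_left_mono)
    moreover have "1 \<le> (1 + \<bar>t\<bar>)\<^sup>2" using power_mono[OF t, of 2] by simp
    ultimately show ?thesis unfolding h_def power_mult_distrib distrib_right mult.assoc mult_1_left by linarith
  qed
  then show thesis using that[of "K * D\<^sup>2 + 1"] constants by simp
qed

text \<open>The integrand of the variation of constants formula.\<close>

definition b where "b s \<omega> = exp (- A s \<omega>) * h s \<omega>"

lemma cont_b: "\<omega> \<in> \<Omega> \<Longrightarrow> continuous_on UNIV (\<lambda>s. b s \<omega>)"
  unfolding b_def by (intro continuous_intros cont_A cont_h)

text \<open>The bound on \<open>b\<close> is uniform in \<open>t\<close> up to a subexponential factor, which gives both the
  existence of \<open>R\<close> and its temperedness.\<close>

lemma b_bound:
  assumes \<omega>: "\<omega> \<in> \<Omega>" and \<epsilon>: "\<epsilon> > 0" "\<epsilon> \<le> c / 8"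
  obtains B where "B \<ge> 0" "\<And>s t. s \<le> t \<Longrightarrow> t \<le> 0 \<Longrightarrow> exp (A t \<omega>) * b s \<omega> \<le> B * exp (4 * \<epsilon> * \<bar>t\<bar>) * exp (c / 4 * (s - t))"
proof -
  obtain B1 where B1: "B1 \<ge> 0" "\<And>s t. s \<le> t \<Longrightarrow> t \<le> 0 \<Longrightarrow> A t \<omega> - A s \<omega> \<le> - (c / 2) * (t - s) + \<epsilon> * (\<bar>s\<bar> + \<bar>t\<bar>) + B1"
    using A_growth[OF \<omega> \<epsilon>(1)] by blast
  obtain B2 where B2: "B2 \<ge> 0" "\<And>t. h t \<omega> \<le> B2 * (1 + \<bar>t\<bar>)\<^sup>2" using h_growth[OF \<omega>] by blast
  define B where "B = B2 * (1 + 2 / \<epsilon>)\<^sup>2 * exp B1"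
  have "exp (A t \<omega>) * b s \<omega> \<le> B * exp (4 * \<epsilon> * \<bar>t\<bar>) * exp (c / 4 * (s - t))" if st: "s \<le> t" "t \<le> 0" for s t
  proof -
    have "exp (A t \<omega>) * b s \<omega> = exp (A t \<omega> - A s \<omega>) * h s \<omega>"
      by (simp add: b_def exp_diff exp_minus field_simps)
    also have "\<dots> \<le> exp (- (c / 2) * (t - s) + \<epsilon> * (\<bar>s\<bar> + \<bar>t\<bar>) + B1) * (B2 * ((1 + 2 / \<epsilon>)\<^sup>2 * exp (\<epsilon> * \<bar>s\<bar>)))"
    proof (rule mult_mono)
      have "h s \<omega> \<le> B2 * (1 + \<bar>s\<bar>)\<^sup>2" by (rule B2)
      also have "\<dots> \<le> B2 * ((1 + 2 / \<epsilon>)\<^sup>2 * exp (\<epsilon> * \<bar>s\<bar>))"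
        by (intro mult_left_mono exp_ge_square B2 \<epsilon>)
      finally show "h s \<omega> \<le> B2 * ((1 + 2 / \<epsilon>)\<^sup>2 * exp (\<epsilon> * \<bar>s\<bar>))" .
      show "0 \<le> h s \<omega>" using h_ge[of s \<omega>] by simp
    qed (use B1(2)[OF st] in auto)
    also have "\<dots> = B * exp (- (c / 2) * (t - s) + \<epsilon> * (\<bar>s\<bar> + \<bar>t\<bar>) + \<epsilon> * \<bar>s\<bar>)"
      by (simp add: B_def exp_add mult_ac)
    \<comment> \<open>For \<open>s \<le> t \<le> 0\<close> the moduli combine to
      \<open>2 * (t - s) + 3 * \<bar>t\<bar>\<close>, and \<open>\<epsilon> \<le> c / 8\<close> lets
      half of the decay pay for the first part.\<close>
    also have "\<dots> \<le> B * exp (4 * \<epsilon> * \<bar>t\<bar> + c / 4 * (s - t))"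
    proof (intro mult_left_mono iffD2[OF exp_le_cancel_iff])
      have e: "\<epsilon> * (t - s) \<le> c / 8 * (t - s)" using st \<epsilon> by (intro mult_right_mono) auto
      have et: "\<epsilon> * t \<le> 0" using st \<epsilon> by (simp add: mult_nonneg_nonpos)
      have "- (c / 2) * (t - s) + \<epsilon> * (\<bar>s\<bar> + \<bar>t\<bar>) + \<epsilon> * \<bar>s\<bar> = - (c / 2) * (t - s) + 2 * (\<epsilon> * (t - s)) - 3 * (\<epsilon> * t)"
        using st by (simp add: algebra_simps)
      also have "\<dots> \<le> - (c / 4) * (t - s) - 4 * (\<epsilon> * t)" using e et by (simp add: algebra_simps)
      also have "\<dots> = 4 * \<epsilon> * \<bar>t\<bar> + c / 4 * (s - t)" using st by (simp add: field_simps)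
      finally show "- (c / 2) * (t - s) + \<epsilon> * (\<bar>s\<bar> + \<bar>t\<bar>) + \<epsilon> * \<bar>s\<bar> \<le> 4 * \<epsilon> * \<bar>t\<bar> + c / 4 * (s - t)" .
      show "0 \<le> B" using B2 by (simp add: B_def)
    qed
    finally show ?thesis by (simp add: exp_add mult.assoc)
  qed
  moreover have "B \<ge> 0" using B2 by (simp add: B_def)
  ultimately show thesis using that by blast
qed

lemma b_integrable: assumes \<omega>: "\<omega> \<in> \<Omega>" shows "set_integrable lborel {..0} (\<lambda>s. b s \<omega>)"
proof -
  obtain B where "B \<ge> 0" and B: "\<And>s t. s \<le> t \<Longrightarrow> t \<le> 0 \<Longrightarrow> exp (A t \<omega>) * b s \<omega> \<le> B * exp (4 * (c / 8) * \<bar>t\<bar>) * exp (c / 4 * (s - t))"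
  proof -
    have "c / 8 > 0" using constants by simp
    show ?thesis by (rule b_bound[OF \<omega> \<open>c / 8 > 0\<close> order_refl]) (rule that)
  qed
  show ?thesis
  proof (rule set_integrable_atMost_0_bound[OF cont_b[OF \<omega>], of B "c / 4"])
    show "\<bar>b s \<omega>\<bar> \<le> B * exp (c / 4 * s)" if "s \<le> 0" for s
      using B[of s 0] that h_ge[of s \<omega>] by (simp add: b_def abs_mult)
  qed (use constants in simp)
qed

definition R where "R \<omega> = (LINT s:{..0}|lborel. b s \<omega>)"

text \<open>This is variation of constants: along an orbit of the shift, \<open>R\<close> solves the
  comparison equation with forcing \<open>h\<close>, started in the infinite past.\<close>

lemma R_shift:
  assumes \<omega>: "\<omega> \<in> \<Omega>" shows "R (\<theta> t \<omega>) = exp (A t \<omega>) * (R \<omega> + signed_integral (\<lambda>s. b s \<omega>) t)"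
proof -
  have "b s (\<theta> t \<omega>) = exp (A t \<omega>) * b (t + s) \<omega>" for s
    by (simp add: b_def A_shift[OF \<omega>] h_shift exp_diff exp_minus field_simps)
  then have "R (\<theta> t \<omega>) = exp (A t \<omega>) * (LINT s:{..0}|lborel. b (t + s) \<omega>)"
    by (simp add: R_def)
  then show ?thesis using LINT_atMost_shift[OF cont_b[OF \<omega>] b_integrable[OF \<omega>], of t] by (simp add: R_def)
qed

lemma R_shift_eq:
  assumes \<omega>: "\<omega> \<in> \<Omega>" shows "R (\<theta> t \<omega>) = (LINT s:{..0}|lborel. exp (A t \<omega>) * b (t + s) \<omega>)"
  using R_shift[OF \<omega>, of t] LINT_atMost_shift[OF cont_b[OF \<omega>] b_integrable[OF \<omega>], of t] by (simp add: R_def)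

lemma R_pos: assumes \<omega>: "\<omega> \<in> \<Omega>" shows "R \<omega> > 0"
proof -
  have "(LINT s:{-1..0}|lborel. b s \<omega>) \<le> R \<omega>"
    unfolding R_def set_lebesgue_integral_def
  proof (rule integral_mono)
    have "set_integrable lborel {-1..0} (\<lambda>s. b s \<omega>)" by (rule set_integrable_subset[OF b_integrable[OF \<omega>]]) auto
    then show "integrable lborel (\<lambda>s. indicator {-1..0} s *\<^sub>R b s \<omega>)" unfolding set_integrable_def .
    show "integrable lborel (\<lambda>s. indicator {..0} s *\<^sub>R b s \<omega>)" using b_integrable[OF \<omega>] unfolding set_integrable_def .
    show "indicator {-1..0} s *\<^sub>R b s \<omega> \<le> indicator {..0} s *\<^sub>R b s \<omega>" for s
      using h_ge[of s \<omega>] by (auto simp: b_def indicator_def)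
  qed
  moreover have "(LINT s:{-1..0}|lborel. b s \<omega>) > 0"
  proof -
    have "compact ((\<lambda>s. b s \<omega>) ` {-1..0})" "(\<lambda>s. b s \<omega>) ` {-1..0} \<noteq> {}"
      using cont_b[OF \<omega>] by (auto intro!: compact_continuous_image intro: continuous_on_subset)
    then obtain x where x: "x \<in> {-1..0::real}" "\<And>s. s \<in> {-1..0} \<Longrightarrow> b x \<omega> \<le> b s \<omega>"
      using compact_attains_inf[of "(\<lambda>s. b s \<omega>) ` {-1..0}"] by auto
    have pos: "b x \<omega> > 0" using h_ge[of x \<omega>] by (simp add: b_def)
    have int: "(\<lambda>s. b s \<omega>) integrable_on {-1..0}"
      using cont_b[OF \<omega>] by (intro integrable_continuous_real) (auto intro: continuous_on_subset)
    have "b x \<omega> = integral {-1..0::real} (\<lambda>s. b x \<omega>)" by simp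
    also have "\<dots> \<le> integral {-1..0} (\<lambda>s. b s \<omega>)" using x(2) by (intro integral_le int) auto
    also have "\<dots> = (LINT s:{-1..0}|lborel. b s \<omega>)"
      using LINT_Icc_eq_signed[OF cont_b[OF \<omega>], of "-1" 0] signed_integral_diff[OF cont_b[OF \<omega>], of "-1" 0] by simp
    finally show ?thesis using pos by simp
  qed
  ultimately show ?thesis by simp
qed

text \<open>The energy in the coordinates shifted by the stationary process, at time 0 of the
  path.\<close>

definition ev where "ev \<omega> X = energy (mom X - noise_vec (z 0 \<omega>))"

text \<open>The energy is a subsolution of the comparison equation, and \<open>l * R\<close> with
  \<open>l \<ge> 1\<close> is a supersolution, so their difference is dominated by the fundamental
  solution. The value \<open>l = 1\<close> gives absorption, \<open>l = 2\<close> invariance of the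
  absorbing set.\<close>

lemma energy_decay:
  assumes \<omega>: "\<omega> \<in> \<Omega>" and t: "t \<ge> 0" and l: "l \<ge> 1"
  shows "ev (\<theta> t \<omega>) (Phi t \<omega> X) - l * R (\<theta> t \<omega>) \<le> exp (A t \<omega>) * (ev \<omega> X - l * R \<omega>)"
proof -
  \<comment> \<open>\<open>flow\<close> is shifted by \<open>\<sigma> * \<omega>\<close>; the
    correction turns this into the shift by \<open>z\<close>.\<close>
  define p where "p t = flow \<omega> (mom X) t + noise_vec (\<sigma> * \<omega> t - z t \<omega>)" for t
  define S where "S t = R \<omega> + signed_integral (\<lambda>s. b s \<omega>) t" for t
  have p_eq: "energy (p t) = ev (\<theta> t \<omega>) (Phi t \<omega> X)" for t
  proof -
    have "noise_vec (\<sigma> * \<omega> t - z t \<omega>) = noise_vec (\<sigma> * \<omega> t) - noise_vec (z t \<omega>)" by (simp add: noise_vec_def zero_prod_def)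
    then show ?thesis by (simp add: ev_def p_def Phi_def z_shift add_diff_eq)
  qed
  have dp: "(p has_vector_derivative field (p s + noise_vec (z s \<omega>)) + noise_vec (\<alpha> * z s \<omega>)) (at s)" for s
  proof -
    have "((\<lambda>t. noise_vec (\<sigma> * \<omega> t - z t \<omega>)) has_vector_derivative noise_vec (\<alpha> * z s \<omega>)) (at s)"
      unfolding noise_vec_def has_vector_derivative_quad_iff using z_deriv[OF \<omega>] by simp
    from has_vector_derivative_add[OF flow_derivative[OF cont_\<Omega>[OF \<omega>]] this]
    have "(p has_vector_derivative noise_field \<omega> s (flow \<omega> (mom X) s) + noise_vec (\<alpha> * z s \<omega>)) (at s)"
      unfolding p_def .
    moreover have "p s + noise_vec (z s \<omega>) = flow \<omega> (mom X) s + noise_vec (\<sigma> * \<omega> s)" by (simp add: p_def noise_vec_def)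
    ultimately show ?thesis by simp
  qed
  have dS: "(S has_real_derivative b s \<omega>) (at s)" for s
    unfolding S_def using signed_integral_has_vector_derivative[OF cont_b[OF \<omega>], of s]
    by (auto simp: has_real_derivative_iff_has_vector_derivative intro!: derivative_eq_intros)
  have "exp (- A t \<omega>) * energy (p t) - l * S t \<le> exp (- A 0 \<omega>) * energy (p 0) - l * S 0"
  proof (rule DERIV_nonpos_imp_nonincreasing[OF t])
    fix s assume "0 \<le> s" "s \<le> t"
    let ?D = "Denergy (p s) (field (p s + noise_vec (z s \<omega>)) + noise_vec (\<alpha> * z s \<omega>))"
    let ?a = "- c + C * \<bar>z s \<omega>\<bar>"
    have "((\<lambda>s. exp (- A s \<omega>) * energy (p s) - l * S s) has_real_derivative
        (exp (- A s \<omega>) * - ?a) * energy (p s) + exp (- A s \<omega>) * ?D - l * b s \<omega>) (at s)"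
      by (auto intro!: derivative_eq_intros A_deriv[OF \<omega>] energy_has_derivative[OF dp] dS)
    moreover have "(exp (- A s \<omega>) * - ?a) * energy (p s) + exp (- A s \<omega>) * ?D - l * b s \<omega> \<le> 0"
    proof -
      have "?D \<le> ?a * energy (p s) + h s \<omega>" using dissipation[of "p s" "z s \<omega>" "\<alpha> * z s \<omega>"] by (simp add: h_def)
      then have "exp (- A s \<omega>) * ?D \<le> exp (- A s \<omega>) * (?a * energy (p s) + h s \<omega>)" by (intro mult_left_mono) auto
      moreover have "1 * b s \<omega> \<le> l * b s \<omega>" using l h_ge[of s \<omega>] by (intro mult_right_mono) (auto simp: b_def)
      ultimately show ?thesis by (simp add: b_def algebra_simps)
    qed
    ultimately show "\<exists>y. ((\<lambda>s. exp (- A s \<omega>) * energy (p s) - l * S s) has_real_derivative y) (at s) \<and> y \<le> 0" by blast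
  qed
  then have "exp (A t \<omega>) * (exp (- A t \<omega>) * energy (p t) - l * S t) \<le> exp (A t \<omega>) * (energy (p 0) - l * S 0)"
    by (intro mult_left_mono) auto
  moreover have "exp (A t \<omega>) * (exp (- A t \<omega>) * energy (p t) - l * S t) = energy (p t) - l * R (\<theta> t \<omega>)"
    by (simp add: R_shift[OF \<omega>] S_def right_diff_distrib mult.assoc[symmetric] exp_add[symmetric])
  moreover have "energy (p 0) = ev \<omega> X" "S 0 = R \<omega>"
    using p_eq[of 0] Phi_0[of \<omega> X] \<omega> \<Omega>_path by (auto simp: S_def ev_def z_shift)
  ultimately show ?thesis by (simp only: p_eq[symmetric])
qed

text \<open>The same argument is used twice, for \<open>zint\<close> and then for \<open>b\<close>:
  continuity in time and measurability at fixed times give joint measurability, which survives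
  integration over time.\<close>

lemma measurable_R: "R \<in> borel_measurable M"
proof -
  have zm: "(\<lambda>(s, \<omega>). z s \<omega>) \<in> borel \<Otimes>\<^sub>M M \<rightarrow>\<^sub>M borel"
    by (rule measurable_caratheodory) (use cont_z measurable_z in auto)
  have Fm: "(\<lambda>\<omega>. zint t \<omega>) \<in> borel_measurable M" for t
  proof -
    have "(\<lambda>\<omega>. LINT r:{min 0 t..max 0 t}|lborel. \<bar>z r \<omega>\<bar>) \<in> borel_measurable M"
      unfolding set_lebesgue_integral_def
    proof (rule lborel.borel_measurable_lebesgue_integral)
      have "(\<lambda>(\<omega>, r). indicator {min 0 t..max 0 t} r *\<^sub>R \<bar>case (r, \<omega>) of (s, \<omega>) \<Rightarrow> z s \<omega>\<bar>) \<in> borel_measurable (M \<Otimes>\<^sub>M lborel)"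
        using zm by measurable
      then show "(\<lambda>(\<omega>, r). indicator {min 0 t..max 0 t} r *\<^sub>R \<bar>z r \<omega>\<bar>) \<in> borel_measurable (M \<Otimes>\<^sub>M lborel)" by simp
    qed
    then have meas: "(\<lambda>\<omega>. (if 0 \<le> t then 1 else -1) * (LINT r:{min 0 t..max 0 t}|lborel. \<bar>z r \<omega>\<bar>)) \<in> borel_measurable M"
      by (intro borel_measurable_times borel_measurable_const)
    have eq: "zint t \<omega> = (if 0 \<le> t then 1 else -1) * (LINT r:{min 0 t..max 0 t}|lborel. \<bar>z r \<omega>\<bar>)" if "\<omega> \<in> space M" for \<omega>
      using LINT_Icc_eq_signed[OF cont_abs_z, of \<omega> "min 0 t" "max 0 t"] that by (auto simp: zint_def min_def max_def)
    show ?thesis by (rule iffD2[OF measurable_cong[OF eq] meas])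
  qed
  have "(\<lambda>\<omega>. b s \<omega>) \<in> borel_measurable M" for s
  proof -
    have [measurable]: "(\<lambda>\<omega>. zint s \<omega>) \<in> borel_measurable M" "(\<lambda>\<omega>. z s \<omega>) \<in> borel_measurable M" by (rule Fm measurable_z)+
    show ?thesis unfolding b_def A_def h_def gauge_term_def by measurable
  qed
  then have "(\<lambda>(s, \<omega>). b s \<omega>) \<in> borel \<Otimes>\<^sub>M M \<rightarrow>\<^sub>M borel"
    by (intro measurable_caratheodory) (use cont_b in auto)
  then have "(\<lambda>(\<omega>, s). indicator {..0} s *\<^sub>R (case (s, \<omega>) of (s, \<omega>) \<Rightarrow> b s \<omega>)) \<in> borel_measurable (M \<Otimes>\<^sub>M lborel)"
    by measurable
  then show ?thesis unfolding R_def[abs_def] set_lebesgue_integral_def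
    by (intro lborel.borel_measurable_lebesgue_integral) simp
qed

end

section \<open>The attractor\<close>

text \<open>Every angle has a representative in \<open>{0..2 * pi}\<close>, so bounded sets lie in
  images of compact boxes of the cover.\<close>

lemma compact_cball_origin: "compact {x::state. dist origin x \<le> r}"
proof -
  let ?K = "{-r..r} \<times> {-r..r} \<times> {0..2 * pi} \<times> {-r..r}"
  have K: "compact (to_state ` ?K)"
    by (intro compact_continuous_image continuous_on_to_state compact_Times) auto
  have "{x. dist origin x \<le> r} \<subseteq> to_state ` ?K"
  proof safe
    fix a b d :: real and \<phi> :: angle assume x: "dist origin (a, b, \<phi>, d) \<le> r"
    obtain u where u: "\<phi> = angle_of u" using angle_of_surj by blast
    define k where "k = \<lfloor>u / (2 * pi)\<rfloor>"
    have "of_int k \<le> u / (2 * pi)" "u / (2 * pi) < of_int k + 1" unfolding k_def by linarith+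
    then have k: "2 * pi * of_int k \<le> u" "u \<le> 2 * pi * of_int k + 2 * pi" by (simp_all add: field_simps)
    have eq: "(a, b, \<phi>, d) = to_state (a, b, u - 2 * pi * of_int k, d)"
      unfolding to_state_def u by (auto simp: angle_of_eq_iff)
    have "\<bar>a\<bar> \<le> r" "\<bar>b\<bar> \<le> r" "\<bar>d\<bar> \<le> r"
      by (rule order_trans[OF dist_origin_to_state_ge(1) x[unfolded eq]] order_trans[OF dist_origin_to_state_ge(2) x[unfolded eq]]
        order_trans[OF dist_origin_to_state_ge(3) x[unfolded eq]])+
    then have "(a, b, u - 2 * pi * of_int k, d) \<in> ?K" using k by auto
    then show "(a, b, \<phi>, d) \<in> to_state ` ?K" unfolding eq by (rule imageI)
  qed
  moreover have "closed {x::state. dist origin x \<le> r}"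
    by (intro closed_Collect_le continuous_intros)
  ultimately show ?thesis using compact_Int_closed[OF K] by (metis inf.absorb_iff2 inf_commute)
qed

text \<open>The finite intersection property, applied to the parts of the sets outside
  \<open>U\<close>.\<close>

lemma decreasing_compact_in_open:
  fixes K :: "nat \<Rightarrow> 'a::metric_space set"
  assumes "\<And>n. compact (K n)" "\<And>m n. m \<le> n \<Longrightarrow> K n \<subseteq> K m" "open U" "(\<Inter>n. K n) \<subseteq> U"
  shows "\<exists>n. K n \<subseteq> U"
proof (rule ccontr)
  assume *: "\<nexists>n. K n \<subseteq> U"
  have "K 0 \<inter> (\<Inter>n. K n - U) \<noteq> {}"
  proof (rule compact_imp_fip_image)
    show "compact (K 0)" by (rule assms)
    show "closed (K n - U)" for n using assms(1,3) by (intro closed_Diff compact_imp_closed)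
    fix I :: "nat set" assume I: "finite I"
    define n where "n = Max (insert 0 I)"
    have n: "i \<le> n" if "i \<in> I" for i using that I by (simp add: n_def)
    obtain x where "x \<in> K n - U" using * by blast
    moreover have "K n \<subseteq> K 0" "\<And>i. i \<in> I \<Longrightarrow> K n \<subseteq> K i" using assms(2) n by auto
    ultimately show "K 0 \<inter> (\<Inter>i\<in>I. K i - U) \<noteq> {}" by blast
  qed
  then show False using assms(4) by blast
qed

text \<open>Eventually the compact sets lie in any given neighbourhood of their intersection. This
  transfers measurability from the pullbacks to their limit.\<close>

lemma infdist_decreasing_tendsto:
  fixes K :: "nat \<Rightarrow> 'a::metric_space set"
  assumes K: "\<And>n. compact (K n)" "\<And>n. K n \<noteq> {}" "\<And>m n. m \<le> n \<Longrightarrow> K n \<subseteq> K m" and ne: "(\<Inter>n. K n) \<noteq> {}"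
  shows "(\<lambda>n. infdist x (K n)) \<longlonglongrightarrow> infdist x (\<Inter>n. K n)"
proof (rule LIMSEQ_I)
  fix e :: real assume e: "e > 0"
  let ?A = "\<Inter>n. K n"
  have "open {y. infdist y ?A < e / 2}" by (intro open_Collect_less continuous_intros)
  moreover have "?A \<subseteq> {y. infdist y ?A < e / 2}" using e by auto
  ultimately obtain N where N: "K N \<subseteq> {y. infdist y ?A < e / 2}"
    using decreasing_compact_in_open[of K] K by metis
  have "norm (infdist x (K n) - infdist x ?A) < e" if "n \<ge> N" for n
  proof -
    have "infdist x (K n) \<le> infdist x ?A" by (intro infdist_mono) (use ne in auto)
    moreover have "infdist x ?A - e / 2 \<le> infdist x (K n)"
      unfolding infdist_notempty[OF K(2)]
    proof (rule cINF_greatest[OF K(2)])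
      fix y assume "y \<in> K n"
      then have "infdist y ?A < e / 2" using N K(3)[OF that] by blast
      then show "infdist x ?A - e / 2 \<le> dist x y" using infdist_triangle[of x ?A y] by linarith
    qed
    ultimately show ?thesis using e by simp
  qed
  then show "\<exists>N. \<forall>n\<ge>N. norm (infdist x (K n) - infdist x ?A) < e" by blast
qed

context attractor_setup
begin

section \<open>Energy and distance on the state space\<close>

lemma energy_shift3: "energy (p + shift3 k) = energy p"
  by (cases p) (simp add: energy_def shift3_def trig_shift3 rden_def den_def)

text \<open>The choice of the lift is immaterial because the energy is periodic in the
  angle.\<close>

definition evs where "evs \<omega> x = ev \<omega> (SOME X. to_state X = x)"

lemma evs_to_state: "evs \<omega> (to_state X) = ev \<omega> X"
proof -
  have "to_state (SOME Y. to_state Y = to_state X) = to_state X" by (rule someI) (rule refl)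
  then obtain k where k: "(SOME Y. to_state Y = to_state X) = X + shift3 k" unfolding to_state_shift3 by blast
  have "mom X + shift3 k - noise_vec (z 0 \<omega>) = (mom X - noise_vec (z 0 \<omega>)) + shift3 k" by simp
  then show ?thesis unfolding evs_def k ev_def shift3_equivariant(1) by (simp only: energy_shift3)
qed

lemma evs_decay:
  assumes "\<omega> \<in> \<Omega>" "t \<ge> 0" "l \<ge> 1"
  shows "evs (\<theta> t \<omega>) (sol t \<omega> x) - l * R (\<theta> t \<omega>) \<le> exp (A t \<omega>) * (evs \<omega> x - l * R \<omega>)"
proof -
  obtain X where x: "x = to_state X" using to_state_surj by metis
  have "\<omega> \<in> path_space" using assms \<Omega>_path by blast
  then show ?thesis using energy_decay[OF assms, of X] by (simp add: x solution_map_to_state evs_to_state)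
qed

lemma continuous_evs: "continuous_on UNIV (evs \<omega>)"
proof -
  have "continuous_on UNIV (\<lambda>X. ev \<omega> X)"
    unfolding ev_def by (intro continuous_on_compose_UNIV[OF lips_continuous[OF lips_energy]] continuous_intros lips_continuous[OF lips_mom])
  from continuous_on_compose_UNIV[OF this continuous_on_snd[OF continuous_on_id]]
  have "continuous_on UNIV (\<lambda>p :: real \<times> lifted. ev \<omega> (snd p))" .
  then have "continuous_on UNIV (\<lambda>(t::real, X). evs \<omega> (to_state X))" by (simp add: evs_to_state case_prod_beta)
  from continuous_on_state_descend[OF this]
  have "continuous_on UNIV (\<lambda>x. case (0::real, x) of (t, x) \<Rightarrow> evs \<omega> x)"
    by (rule continuous_on_compose_UNIV) (intro continuous_intros)
  then show ?thesis by simp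
qed

lemma unmom_shifted:
  "unmom (mom (v1, v2, u1, u2) - noise_vec y) = (v1, v2 - rden u1 * y, u1, u2 - sin u1 * (rden u1 * y))"
proof -
  have "mom (v1, v2, u1, u2) - noise_vec y = (v1, v2 - \<gamma> * u2 * sin u1 + - y, u1, u2 - v2 * sin u1)"
    by (simp add: mom_def)
  then show ?thesis by (simp only: unmom_def prod.case vel_shift vel_mom) simp
qed

lemma rden_abs: "\<bar>rden u * y\<bar> \<le> amax * \<bar>y\<bar>" "\<bar>sin u * (rden u * y)\<bar> \<le> amax * \<bar>y\<bar>"
proof -
  show 1: "\<bar>rden u * y\<bar> \<le> amax * \<bar>y\<bar>" using rden_bounds[of u] by (simp add: abs_mult mult_right_mono)
  have "\<bar>sin u\<bar> * \<bar>rden u * y\<bar> \<le> 1 * (amax * \<bar>y\<bar>)" by (intro mult_mono 1) auto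
  then show "\<bar>sin u * (rden u * y)\<bar> \<le> amax * \<bar>y\<bar>" by (simp add: abs_mult)
qed

text \<open>With \<open>evs_le_dist\<close> this makes energy and distance comparable up to powers
  and the current value of \<open>z\<close>: this direction bounds the radius of the absorbing set,
  the other one the initial energy on a tempered set.\<close>

lemma dist_le_evs: "dist origin x \<le> 3 + 2 * pi + 2 / coer * evs \<omega> x + 2 * amax * \<bar>z 0 \<omega>\<bar>"
proof -
  obtain v1 v2 u1 u2 where x: "x = to_state (v1, v2, u1, u2)" using to_state_surj[of x] by (metis prod.exhaust)
  define w where "w = v2 - rden u1 * z 0 \<omega>"
  define n where "n = u2 - sin u1 * (rden u1 * z 0 \<omega>)"
  have "sq_size (unmom (mom (v1, v2, u1, u2) - noise_vec (z 0 \<omega>))) \<le> 2 / coer * evs \<omega> x"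
    unfolding x evs_to_state ev_def by (rule sq_size_le_energy)
  then have N: "v1\<^sup>2 + w\<^sup>2 + n\<^sup>2 \<le> 2 / coer * evs \<omega> x" by (simp add: unmom_shifted sq_size_def w_def n_def)
  have sq: "\<bar>a\<bar> \<le> 1 + a\<^sup>2" for a :: real using abs_mult_le_squares[of a 1] zero_le_power2[of a] by simp
  have "\<bar>v2\<bar> \<le> \<bar>w\<bar> + amax * \<bar>z 0 \<omega>\<bar>" "\<bar>u2\<bar> \<le> \<bar>n\<bar> + amax * \<bar>z 0 \<omega>\<bar>"
    using rden_abs[of u1 "z 0 \<omega>"] unfolding w_def n_def by linarith+
  then have "\<bar>v1\<bar> + \<bar>v2\<bar> + \<bar>u2\<bar> \<le> 3 + (v1\<^sup>2 + w\<^sup>2 + n\<^sup>2) + 2 * amax * \<bar>z 0 \<omega>\<bar>"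
    using sq[of v1] sq[of w] sq[of n] by linarith
  then show ?thesis using dist_origin_to_state_le[of v1 v2 u1 u2] N unfolding x by linarith
qed

lemma evs_le_dist: obtains D where "D > 0" "\<And>\<omega> x. evs \<omega> x \<le> D * (1 + (dist origin x)\<^sup>2 + (z 0 \<omega>)\<^sup>2)"
proof -
  obtain C1 where C1: "C1 > 0" "\<And>X. energy (mom X) \<le> C1 * (1 + sq_size X)" using energy_upper by blast
  define D where "D = C1 * (5 + 4 * amax\<^sup>2)"
  have "evs \<omega> x \<le> D * (1 + (dist origin x)\<^sup>2 + (z 0 \<omega>)\<^sup>2)" for \<omega> x
  proof -
    obtain v1 v2 u1 u2 where x: "x = to_state (v1, v2, u1, u2)" using to_state_surj[of x] by (metis prod.exhaust)
    define d where "d = dist origin x"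
    have sq: "(a - e)\<^sup>2 \<le> 2 * a\<^sup>2 + 2 * (amax\<^sup>2 * (z 0 \<omega>)\<^sup>2)" if "\<bar>e\<bar> \<le> amax * \<bar>z 0 \<omega>\<bar>" for a e :: real
    proof -
      have "e\<^sup>2 \<le> amax\<^sup>2 * (z 0 \<omega>)\<^sup>2" using power_mono[OF that, of 2] by (simp add: power_mult_distrib)
      moreover have "(a - e)\<^sup>2 \<le> 2 * a\<^sup>2 + 2 * e\<^sup>2"
        using zero_le_power2[of "a + e"] by (simp add: power2_sum power2_diff)
      ultimately show ?thesis by linarith
    qed
    have d: "v1\<^sup>2 \<le> d\<^sup>2" "v2\<^sup>2 \<le> d\<^sup>2" "u2\<^sup>2 \<le> d\<^sup>2"
    proof -
      have "\<bar>v1\<bar> \<le> d" "\<bar>v2\<bar> \<le> d" "\<bar>u2\<bar> \<le> d" unfolding d_def x by (rule dist_origin_to_state_ge)+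
      from power_mono[OF this(1), of 2] power_mono[OF this(2), of 2] power_mono[OF this(3), of 2]
      show "v1\<^sup>2 \<le> d\<^sup>2" "v2\<^sup>2 \<le> d\<^sup>2" "u2\<^sup>2 \<le> d\<^sup>2" by simp_all
    qed
    have "evs \<omega> x = energy (mom (unmom (mom (v1, v2, u1, u2) - noise_vec (z 0 \<omega>))))" unfolding x evs_to_state ev_def by simp
    also have "\<dots> \<le> C1 * (1 + sq_size (unmom (mom (v1, v2, u1, u2) - noise_vec (z 0 \<omega>))))" by (rule C1)
    also have "\<dots> = C1 * (1 + (v1\<^sup>2 + (v2 - rden u1 * z 0 \<omega>)\<^sup>2 + (u2 - sin u1 * (rden u1 * z 0 \<omega>))\<^sup>2))"
      by (simp add: unmom_shifted sq_size_def)
    also have "\<dots> \<le> C1 * ((5 + 4 * amax\<^sup>2) * (1 + d\<^sup>2 + (z 0 \<omega>)\<^sup>2))"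
    proof (rule mult_left_mono)
      have "0 \<le> amax\<^sup>2" "0 \<le> amax\<^sup>2 * d\<^sup>2" "0 \<le> d\<^sup>2" "0 \<le> (z 0 \<omega>)\<^sup>2" by auto
      then show "1 + (v1\<^sup>2 + (v2 - rden u1 * z 0 \<omega>)\<^sup>2 + (u2 - sin u1 * (rden u1 * z 0 \<omega>))\<^sup>2) \<le> (5 + 4 * amax\<^sup>2) * (1 + d\<^sup>2 + (z 0 \<omega>)\<^sup>2)"
        using sq[OF rden_abs(1)[of u1 "z 0 \<omega>"], of v2] sq[OF rden_abs(2)[of u1 "z 0 \<omega>"], of u2] d
        unfolding distrib_left distrib_right mult_1_right mult.assoc by linarith
    qed (use C1 in simp)
    finally show ?thesis by (simp add: D_def d_def mult.assoc)
  qed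
  moreover have "D > 0" using C1 by (simp add: D_def add_pos_nonneg)
  ultimately show thesis using that by blast
qed

text \<open>Not the closed sublevel set: as the closure of an open set it is determined by the
  points of a countable dense set in that open set, on which measurability rests.\<close>

definition absorb :: "(real \<Rightarrow> real) \<Rightarrow> state set" where
  "absorb \<omega> = closure {x. evs \<omega> x < 2 * R \<omega>}"

lemma absorb_subset: "absorb \<omega> \<subseteq> {x. evs \<omega> x \<le> 2 * R \<omega>}"
  unfolding absorb_def
  by (intro closure_minimal closed_Collect_le continuous_evs continuous_on_const) auto

text \<open>One more than the bound from \<open>dist_le_evs\<close>, because temperedness asks for
  open balls.\<close>

definition absorb_radius where "absorb_radius \<omega> = 4 + 2 * pi + 4 / coer * R \<omega> + 2 * amax * \<bar>z 0 \<omega>\<bar>"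

lemma absorb_dist: "x \<in> absorb \<omega> \<Longrightarrow> dist origin x \<le> absorb_radius \<omega> - 1"
proof -
  assume "x \<in> absorb \<omega>"
  then have "evs \<omega> x \<le> 2 * R \<omega>" using absorb_subset by blast
  then have "2 / coer * evs \<omega> x \<le> 2 / coer * (2 * R \<omega>)" using coer_pos by (intro mult_left_mono) auto
  then show ?thesis using dist_le_evs[of x \<omega>] by (simp add: absorb_radius_def)
qed

lemma compact_absorb: "compact (absorb \<omega>)"
proof -
  have "absorb \<omega> = {x. dist origin x \<le> absorb_radius \<omega> - 1} \<inter> absorb \<omega>" using absorb_dist by auto
  moreover have "compact ({x. dist origin x \<le> absorb_radius \<omega> - 1} \<inter> absorb \<omega>)"
    by (intro compact_Int_closed compact_cball_origin) (simp add: absorb_def)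
  ultimately show ?thesis by simp
qed

lemma absorb_nonempty: assumes "\<omega> \<in> \<Omega>" shows "absorb \<omega> \<noteq> {}"
proof -
  have "energy 0 = 0" by (simp add: energy_def zero_prod_def)
  \<comment> \<open>At this point the shifted momentum coordinates vanish, hence so does the
    energy.\<close>
  then have "evs \<omega> (to_state (unmom (noise_vec (z 0 \<omega>)))) = 0"
    unfolding evs_to_state ev_def by simp
  then have "to_state (unmom (noise_vec (z 0 \<omega>))) \<in> absorb \<omega>"
    using R_pos[OF assms] unfolding absorb_def by (intro subsetD[OF closure_subset]) simp
  then show ?thesis by blast
qed

lemma continuous_sol: "\<omega> \<in> \<Omega> \<Longrightarrow> continuous_on S (sol t \<omega>)"
proof -
  assume "\<omega> \<in> \<Omega>"
  then have "continuous_on UNIV (\<lambda>(t, x). sol t \<omega> x)" using \<Omega>_path continuous_on_solution_map by blast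
  from continuous_on_compose_UNIV[OF this, of UNIV "\<lambda>x. (t, x)"]
  have "continuous_on UNIV (sol t \<omega>)" by (simp add: continuous_on_Pair continuous_on_id continuous_on_const)
  then show ?thesis by (rule continuous_on_subset) simp
qed

text \<open>The decay estimate with \<open>l = 2\<close> preserves the sign of the energy minus
  \<open>2 * R\<close>; continuity extends the inclusion to the closure.\<close>

lemma absorb_invariant:
  assumes \<omega>: "\<omega> \<in> \<Omega>" and t: "t \<ge> 0" shows "sol t \<omega> ` absorb \<omega> \<subseteq> absorb (\<theta> t \<omega>)"
  unfolding absorb_def[of \<omega>]
proof (rule image_closure_subset[OF continuous_sol[OF \<omega>]])
  show "closed (absorb (\<theta> t \<omega>))" by (simp add: absorb_def)
  show "sol t \<omega> ` {x. evs \<omega> x < 2 * R \<omega>} \<subseteq> absorb (\<theta> t \<omega>)"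
  proof (rule image_subsetI)
    fix x assume "x \<in> {x. evs \<omega> x < 2 * R \<omega>}"
    then have "exp (A t \<omega>) * (evs \<omega> x - 2 * R \<omega>) < 0" by (simp add: mult_pos_neg)
    then have "evs (\<theta> t \<omega>) (sol t \<omega> x) < 2 * R (\<theta> t \<omega>)"
      using evs_decay[OF \<omega> t, of 2 "x"] by simp
    then show "sol t \<omega> x \<in> absorb (\<theta> t \<omega>)"
      unfolding absorb_def by (intro subsetD[OF closure_subset]) simp
  qed
qed

lemma shift_0: "\<omega> \<in> \<Omega> \<Longrightarrow> \<theta> 0 \<omega> = \<omega>"
proof -
  assume "\<omega> \<in> \<Omega>"
  then have "\<omega> 0 = 0" using \<Omega>_path path_spaceD(2) by blast
  then show ?thesis by (simp add: wiener_shift_def)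
qed

lemma sol_0: "\<omega> \<in> \<Omega> \<Longrightarrow> sol 0 \<omega> x = x"
  using solution_map_0 \<Omega>_path by blast

text \<open>A tempered set starts with energy at most of order
  \<open>exp (2 * \<epsilon> * t)\<close>, while the fundamental solution over the elapsed time is
  at most of order \<open>exp (- 3 * \<epsilon> * t)\<close>. Hence the excess over
  \<open>R\<close>, estimated with \<open>l = 1\<close>, finally falls below
  \<open>R\<close>.\<close>

lemma absorbing:
  assumes D: "D \<in> tempered_family M \<theta>" and \<omega>: "\<omega> \<in> \<Omega>"
  shows "\<exists>T. \<forall>t\<ge>T. sol t (\<theta> (- t) \<omega>) ` D (\<theta> (- t) \<omega>) \<subseteq> absorb \<omega>"
proof -
  \<comment> \<open>Then \<open>c / 2 = 4 * \<epsilon>\<close>, of which the error in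
    \<open>A_growth\<close> takes one \<epsilon> and the squared radius two, leaving one.\<close>
  define \<epsilon> where "\<epsilon> = c / 8"
  have \<epsilon>: "\<epsilon> > 0" using constants by (simp add: \<epsilon>_def)
  obtain \<rho> where \<rho>: "\<And>\<omega>. \<omega> \<in> \<Omega> \<Longrightarrow> D \<omega> \<subseteq> ball origin (\<rho> \<omega>)"
    "\<And>\<omega>. \<omega> \<in> \<Omega> \<Longrightarrow> ((\<lambda>t. (1 / t) * ln (max 1 (\<rho> (\<theta> (- t) \<omega>)))) \<longlongrightarrow> 0) at_top"
    using D unfolding tempered_family_def tempered_def by auto
  obtain E where E: "E > 0" "\<And>\<omega> x. evs \<omega> x \<le> E * (1 + (dist origin x)\<^sup>2 + (z 0 \<omega>)\<^sup>2)" using evs_le_dist by blast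
  obtain Z where Z: "Z \<ge> 0" "\<And>t. (z t \<omega>)\<^sup>2 \<le> Z * (1 + \<bar>t\<bar>)" using z_growth[OF \<omega>] by blast
  obtain B where B: "B \<ge> 0" "\<And>s t. s \<le> t \<Longrightarrow> t \<le> 0 \<Longrightarrow> A t \<omega> - A s \<omega> \<le> - (c / 2) * (t - s) + \<epsilon> * (\<bar>s\<bar> + \<bar>t\<bar>) + B"
    using A_growth[OF \<omega> \<epsilon>] by blast
  define Q where "Q = E * (2 + Z * (1 + 1 / \<epsilon>)) * exp B"
  have "\<forall>\<^sub>F t in at_top. (1 / t) * ln (max 1 (\<rho> (\<theta> (- t) \<omega>))) < \<epsilon>" using order_tendstoD(2)[OF \<rho>(2)[OF \<omega>] \<epsilon>] .
  moreover have "\<forall>\<^sub>F t in at_top. Q * exp (- \<epsilon> * t) < R \<omega>"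
  proof -
    have "filterlim (\<lambda>t. - \<epsilon> * t) at_bot at_top"
      using \<epsilon> by (intro filterlim_tendsto_neg_mult_at_bot[OF tendsto_const _ filterlim_ident]) auto
    then have "((\<lambda>t. exp (- \<epsilon> * t)) \<longlongrightarrow> 0) at_top" by (rule filterlim_compose[OF exp_at_bot])
    then have "((\<lambda>t. Q * exp (- \<epsilon> * t)) \<longlongrightarrow> 0) at_top" by (rule tendsto_mult_right_zero)
    from order_tendstoD(2)[OF this R_pos[OF \<omega>]] show ?thesis .
  qed
  ultimately have "\<forall>\<^sub>F t in at_top. (1 / t) * ln (max 1 (\<rho> (\<theta> (- t) \<omega>))) < \<epsilon> \<and> Q * exp (- \<epsilon> * t) < R \<omega> \<and> 1 \<le> t"
    using eventually_ge_at_top[of 1] by eventually_elim simp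
  then obtain T where T: "\<And>t. t \<ge> T \<Longrightarrow> (1 / t) * ln (max 1 (\<rho> (\<theta> (- t) \<omega>))) < \<epsilon> \<and> Q * exp (- \<epsilon> * t) < R \<omega> \<and> 1 \<le> t"
    unfolding eventually_at_top_linorder by blast
  have "sol t (\<theta> (- t) \<omega>) x \<in> absorb \<omega>" if "t \<ge> T" and x: "x \<in> D (\<theta> (- t) \<omega>)" for t x
  proof -
    have t: "(1 / t) * ln (max 1 (\<rho> (\<theta> (- t) \<omega>))) < \<epsilon>" "Q * exp (- \<epsilon> * t) < R \<omega>" "1 \<le> t"
      using T[OF that(1)] by auto
    let ?\<eta> = "\<theta> (- t) \<omega>" and ?r = "max 1 (\<rho> (\<theta> (- t) \<omega>))"
    have \<eta>: "?\<eta> \<in> \<Omega>" by (rule shift_\<Omega>[OF \<omega>])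
    have ret: "\<theta> t ?\<eta> = \<omega>" by (simp add: wiener_shift_shift shift_0[OF \<omega>])
    have "ln ?r \<le> \<epsilon> * t" using t(1,3) by (simp add: field_simps)
    then have "?r \<le> exp (\<epsilon> * t)" using exp_le_cancel_iff[of "ln ?r" "\<epsilon> * t"] by simp
    moreover have "dist origin x \<le> ?r" using \<rho>(1)[OF \<eta>] x by fastforce
    ultimately have "dist origin x \<le> exp (\<epsilon> * t)" by linarith
    then have "(dist origin x)\<^sup>2 \<le> (exp (\<epsilon> * t))\<^sup>2" by (intro power_mono) auto
    also have "(exp (\<epsilon> * t))\<^sup>2 = exp (2 * \<epsilon> * t)"
      unfolding power2_eq_square exp_add[symmetric] by (rule arg_cong[where f = exp]) simp
    finally have d: "(dist origin x)\<^sup>2 \<le> exp (2 * \<epsilon> * t)" .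
    have e1: "1 \<le> exp (2 * \<epsilon> * t)" using \<epsilon> t by simp
    have zb: "(z 0 ?\<eta>)\<^sup>2 \<le> Z * ((1 + 1 / \<epsilon>) * exp (2 * \<epsilon> * t))"
    proof -
      have "(z 0 ?\<eta>)\<^sup>2 \<le> Z * (1 + \<bar>t\<bar>)" using Z(2)[of "- t"] by (simp add: z_shift)
      also have "\<dots> \<le> Z * ((1 + 1 / \<epsilon>) * exp (\<epsilon> * \<bar>t\<bar>))" by (intro mult_left_mono exp_ge_abs \<epsilon> Z)
      also have "\<dots> \<le> Z * ((1 + 1 / \<epsilon>) * exp (2 * \<epsilon> * t))" using Z \<epsilon> t by (intro mult_left_mono) auto
      finally show ?thesis .
    qed
    have "evs ?\<eta> x \<le> E * (1 + (dist origin x)\<^sup>2 + (z 0 ?\<eta>)\<^sup>2)" by (rule E)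
    also have "\<dots> \<le> E * (exp (2 * \<epsilon> * t) + exp (2 * \<epsilon> * t) + Z * ((1 + 1 / \<epsilon>) * exp (2 * \<epsilon> * t)))"
      using E e1 d zb by (intro mult_left_mono add_mono) auto
    also have "\<dots> = E * (2 + Z * (1 + 1 / \<epsilon>)) * exp (2 * \<epsilon> * t)" by (simp add: algebra_simps)
    finally have ex: "evs ?\<eta> x \<le> E * (2 + Z * (1 + 1 / \<epsilon>)) * exp (2 * \<epsilon> * t)" .
    have "A t ?\<eta> = A 0 \<omega> - A (- t) \<omega>" using A_shift[OF \<omega>, of t "- t"] by simp
    also have "\<dots> \<le> - (c / 2) * t + \<epsilon> * t + B" using B(2)[of "- t" 0] t by simp
    also have "\<dots> = - 3 * \<epsilon> * t + B" by (simp add: \<epsilon>_def field_simps)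
    finally have a: "exp (A t ?\<eta>) \<le> exp (- 3 * \<epsilon> * t + B)" by simp
    have "evs \<omega> (sol t ?\<eta> x) - R \<omega> \<le> exp (A t ?\<eta>) * (evs ?\<eta> x - R ?\<eta>)"
      using evs_decay[OF \<eta>, of t 1 x] t by (simp add: ret)
    also have "\<dots> \<le> exp (A t ?\<eta>) * (E * (2 + Z * (1 + 1 / \<epsilon>)) * exp (2 * \<epsilon> * t))"
      using ex R_pos[OF \<eta>] by (intro mult_left_mono) auto
    also have "\<dots> \<le> exp (- 3 * \<epsilon> * t + B) * (E * (2 + Z * (1 + 1 / \<epsilon>)) * exp (2 * \<epsilon> * t))"
      using a E Z \<epsilon> by (intro mult_right_mono) auto
    also have "\<dots> = Q * (exp (- 3 * \<epsilon> * t) * exp (2 * \<epsilon> * t))"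
      unfolding Q_def exp_add by (simp only: mult_ac)
    also have "exp (- 3 * \<epsilon> * t) * exp (2 * \<epsilon> * t) = exp (- \<epsilon> * t)" by (simp add: exp_add[symmetric])
    finally have "evs \<omega> (sol t ?\<eta> x) < 2 * R \<omega>" using t(2) by simp
    then show ?thesis unfolding absorb_def by (intro subsetD[OF closure_subset]) simp
  qed
  then show ?thesis by blast
qed

text \<open>\<open>b_bound\<close> holds for arbitrarily small \<epsilon>, so \<open>R\<close> along
  the backward orbit grows slower than any exponential, and the growth of \<open>z\<close> is
  polynomial.\<close>

lemma absorb_radius_tempered:
  assumes \<omega>: "\<omega> \<in> \<Omega>" shows "((\<lambda>t. (1 / t) * ln (max 1 (absorb_radius (\<theta> (- t) \<omega>)))) \<longlongrightarrow> 0) at_top"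
proof (rule tendstoI)
  fix e :: real assume e: "e > 0"
  \<comment> \<open>The first entry is required by \<open>b_bound\<close>; the second makes the
    resulting rate \<open>4 * \<epsilon>\<close> at most \<open>e / 2\<close>.\<close>
  define \<epsilon> where "\<epsilon> = min (c / 8) (e / 8)"
  have \<epsilon>: "\<epsilon> > 0" "\<epsilon> \<le> c / 8" "4 * \<epsilon> \<le> e / 2" using constants e by (auto simp: \<epsilon>_def)
  obtain B where B: "B \<ge> 0" "\<And>s t. s \<le> t \<Longrightarrow> t \<le> 0 \<Longrightarrow> exp (A t \<omega>) * b s \<omega> \<le> B * exp (4 * \<epsilon> * \<bar>t\<bar>) * exp (c / 4 * (s - t))"
    using b_bound[OF \<omega> \<epsilon>(1,2)] by blast
  obtain Z where Z: "Z \<ge> 0" "\<And>t. (z t \<omega>)\<^sup>2 \<le> Z * (1 + \<bar>t\<bar>)" using z_growth[OF \<omega>] by blast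
  define Q where "Q = 4 + 2 * pi + 4 / coer * (B * (4 / c)) + 2 * amax * (1 + Z * (1 + 1 / (4 * \<epsilon>)))"
  have Q: "Q \<ge> 1"
  proof -
    have "0 \<le> 4 / coer * (B * (4 / c))" "0 \<le> 2 * amax * (1 + Z * (1 + 1 / (4 * \<epsilon>)))" using B Z \<epsilon> constants coer_pos amax by auto
    then show ?thesis using pi_gt_zero unfolding Q_def by linarith
  qed
  have absorb_radius_le: "absorb_radius (\<theta> (- t) \<omega>) \<le> Q * exp (4 * \<epsilon> * t)" if t: "t \<ge> 0" for t
  proof -
    have e1: "1 \<le> exp (4 * \<epsilon> * t)" using \<epsilon> t by simp
    have "R (\<theta> (- t) \<omega>) \<le> (LINT s:{..0}|lborel. (B * exp (4 * \<epsilon> * t)) * exp (c / 4 * s))"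
      unfolding R_shift_eq[OF \<omega>] set_lebesgue_integral_def
    proof (rule integral_mono')
      show "integrable lborel (\<lambda>s. indicator {..0} s *\<^sub>R (B * exp (4 * \<epsilon> * t) * exp (c / 4 * s)))"
        using set_integrable_mult_right[OF set_integrable_exp_atMost_0[of "c / 4"], of "B * exp (4 * \<epsilon> * t)"] constants
        unfolding set_integrable_def by simp
      fix s :: real
      show "indicator {..0} s *\<^sub>R (exp (A (- t) \<omega>) * b (- t + s) \<omega>) \<le> indicator {..0} s *\<^sub>R (B * exp (4 * \<epsilon> * t) * exp (c / 4 * s))"
        using B(2)[of "- t + s" "- t"] t by (auto simp: indicator_def)
      show "0 \<le> indicator {..0} s *\<^sub>R (B * exp (4 * \<epsilon> * t) * exp (c / 4 * s))" using B(1) by (simp add: indicator_def)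
    qed
    also have "\<dots> = (B * exp (4 * \<epsilon> * t)) * (LINT s:{..0}|lborel. exp (c / 4 * s))" by (rule set_integral_mult_right)
    also have "\<dots> = B * (4 / c) * exp (4 * \<epsilon> * t)" using LINT_exp_atMost_0[of "c / 4"] constants by simp
    finally have r: "4 / coer * R (\<theta> (- t) \<omega>) \<le> 4 / coer * (B * (4 / c) * exp (4 * \<epsilon> * t))"
      using coer_pos by (intro mult_left_mono) auto
    have "\<bar>z 0 (\<theta> (- t) \<omega>)\<bar> \<le> 1 + (z (- t) \<omega>)\<^sup>2"
      using abs_mult_le_squares[of "z (- t) \<omega>" 1] zero_le_power2[of "z (- t) \<omega>"] by (simp add: z_shift)
    also have "\<dots> \<le> 1 * exp (4 * \<epsilon> * t) + Z * ((1 + 1 / (4 * \<epsilon>)) * exp (4 * \<epsilon> * \<bar>t\<bar>))"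
    proof (intro add_mono)
      show "(z (- t) \<omega>)\<^sup>2 \<le> Z * ((1 + 1 / (4 * \<epsilon>)) * exp (4 * \<epsilon> * \<bar>t\<bar>))"
        using Z(2)[of "- t"] mult_left_mono[OF exp_ge_abs[of "4 * \<epsilon>" t] Z(1)] \<epsilon> by simp
    qed (use e1 in simp)
    also have "\<dots> = (1 + Z * (1 + 1 / (4 * \<epsilon>))) * exp (4 * \<epsilon> * t)" using t by (simp add: distrib_right mult.assoc)
    finally have zb: "2 * amax * \<bar>z 0 (\<theta> (- t) \<omega>)\<bar> \<le> 2 * amax * ((1 + Z * (1 + 1 / (4 * \<epsilon>))) * exp (4 * \<epsilon> * t))"
      using amax by (intro mult_left_mono) auto
    have "(4 + 2 * pi) * 1 \<le> (4 + 2 * pi) * exp (4 * \<epsilon> * t)" using e1 by (intro mult_left_mono) auto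
    then have p: "4 + 2 * pi \<le> (4 + 2 * pi) * exp (4 * \<epsilon> * t)" by (simp only: mult_1_right)
    have "absorb_radius (\<theta> (- t) \<omega>) \<le> (4 + 2 * pi) * exp (4 * \<epsilon> * t) + 4 / coer * (B * (4 / c) * exp (4 * \<epsilon> * t))
       + 2 * amax * ((1 + Z * (1 + 1 / (4 * \<epsilon>))) * exp (4 * \<epsilon> * t))"
      unfolding absorb_radius_def by (intro add_mono[OF add_mono[OF p r] zb])
    also have "\<dots> = Q * exp (4 * \<epsilon> * t)" unfolding Q_def by (simp only: distrib_right mult.assoc)
    finally show ?thesis .
  qed
  have "((\<lambda>t. ln Q / t) \<longlongrightarrow> 0) at_top" by (intro tendsto_divide_0[OF tendsto_const] filterlim_at_top_imp_at_infinity filterlim_ident)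
  from order_tendstoD(2)[OF this, of "e / 2"] e have "\<forall>\<^sub>F t in at_top. ln Q / t < e / 2" by simp
  then show "\<forall>\<^sub>F t in at_top. dist ((1 / t) * ln (max 1 (absorb_radius (\<theta> (- t) \<omega>)))) 0 < e"
    using eventually_ge_at_top[of 1]
  proof eventually_elim
    fix t :: real assume q: "ln Q / t < e / 2" and t: "1 \<le> t"
    let ?r = "max 1 (absorb_radius (\<theta> (- t) \<omega>))"
    have "1 * 1 \<le> Q * exp (4 * \<epsilon> * t)" using Q \<epsilon> t by (intro mult_mono) auto
    then have "?r \<le> Q * exp (4 * \<epsilon> * t)" using absorb_radius_le[of t] t by simp
    then have "ln ?r \<le> ln (Q * exp (4 * \<epsilon> * t))" by simp
    also have "\<dots> = ln Q + 4 * \<epsilon> * t" using Q by (simp add: ln_mult)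
    finally have "(1 / t) * ln ?r \<le> (1 / t) * (ln Q + 4 * \<epsilon> * t)" using t by (intro mult_left_mono) auto
    also have "\<dots> = ln Q / t + 4 * \<epsilon>" using t by (simp add: field_simps)
    finally have "(1 / t) * ln ?r < e" using q \<epsilon> by linarith
    moreover have "0 \<le> (1 / t) * ln ?r" using t by simp
    ultimately show "dist ((1 / t) * ln ?r) 0 < e" by (simp add: dist_real_def)
  qed
qed

lemma measurable_absorb_radius: "absorb_radius \<in> borel_measurable M"
proof -
  note [measurable] = measurable_R measurable_z
  show ?thesis unfolding absorb_radius_def[abs_def] by measurable
qed

section \<open>The pullbacks of the absorbing sets and their limit\<close>

definition pullback :: "real \<Rightarrow> (real \<Rightarrow> real) \<Rightarrow> state set" where
  "pullback t \<omega> = sol t (\<theta> (- t) \<omega>) ` absorb (\<theta> (- t) \<omega>)"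

lemma sol_cocycle: "\<omega> \<in> \<Omega> \<Longrightarrow> sol (t + s) \<omega> x = sol t (\<theta> s \<omega>) (sol s \<omega> x)"
  using solution_map_cocycle \<Omega>_path by blast

lemma pullback_compact: "\<omega> \<in> \<Omega> \<Longrightarrow> compact (pullback t \<omega>)"
  unfolding pullback_def by (intro compact_continuous_image continuous_sol compact_absorb shift_\<Omega>)

lemma pullback_nonempty: "\<omega> \<in> \<Omega> \<Longrightarrow> pullback t \<omega> \<noteq> {}"
  unfolding pullback_def using absorb_nonempty shift_\<Omega> by simp

text \<open>By forward invariance, what starts earlier in the absorbing set is still in it at the
  later starting time.\<close>

lemma pullback_mono:
  assumes \<omega>: "\<omega> \<in> \<Omega>" and "0 \<le> s" "s \<le> t" shows "pullback t \<omega> \<subseteq> pullback s \<omega>"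
proof -
  have eq: "sol t (\<theta> (- t) \<omega>) x = sol s (\<theta> (- s) \<omega>) (sol (t - s) (\<theta> (- t) \<omega>) x)" for x
    using sol_cocycle[OF shift_\<Omega>[OF \<omega>], of s "t - s" "- t" x] by (simp add: wiener_shift_shift)
  have "sol (t - s) (\<theta> (- t) \<omega>) ` absorb (\<theta> (- t) \<omega>) \<subseteq> absorb (\<theta> (- s) \<omega>)"
    using absorb_invariant[OF shift_\<Omega>[OF \<omega>], of "t - s" "- t"] assms by (simp add: wiener_shift_shift)
  then show ?thesis unfolding pullback_def by (auto simp: eq)
qed

lemma pullback_image:
  assumes \<omega>: "\<omega> \<in> \<Omega>" shows "sol t \<omega> ` pullback s \<omega> = pullback (t + s) (\<theta> t \<omega>)"
proof -
  have "sol t \<omega> (sol s (\<theta> (- s) \<omega>) x) = sol (t + s) (\<theta> (- s) \<omega>) x" for x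
    using sol_cocycle[OF shift_\<Omega>[OF \<omega>], of t s "- s" x] by (simp add: wiener_shift_shift shift_0[OF \<omega>])
  then show ?thesis unfolding pullback_def by (simp add: image_image wiener_shift_shift)
qed

text \<open>Integer times suffice since the pullbacks decrease, and a sequence of sets is what the
  arguments for compactness and measurability use.\<close>

definition pullback_limit :: "(real \<Rightarrow> real) \<Rightarrow> state set" where "pullback_limit \<omega> = (\<Inter>n. pullback (real n) \<omega>)"

text \<open>For the invariance the intersection has to range over all real times beyond an arbitrary
  start, because the flow by time \<open>t\<close> moves that start.\<close>

lemma pullback_limit_eq: assumes \<omega>: "\<omega> \<in> \<Omega>" and "r \<ge> 0" shows "pullback_limit \<omega> = (\<Inter>t\<in>{r..}. pullback t \<omega>)"
proof
  show "pullback_limit \<omega> \<subseteq> (\<Inter>t\<in>{r..}. pullback t \<omega>)"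
  proof (intro INT_greatest)
    fix t assume t: "t \<in> {r..}"
    obtain n where "t \<le> real n" using real_arch_simple by blast
    then have "pullback (real n) \<omega> \<subseteq> pullback t \<omega>" using t assms by (intro pullback_mono) auto
    then show "pullback_limit \<omega> \<subseteq> pullback t \<omega>" unfolding pullback_limit_def by blast
  qed
  show "(\<Inter>t\<in>{r..}. pullback t \<omega>) \<subseteq> pullback_limit \<omega>"
    unfolding pullback_limit_def
  proof (intro INT_greatest)
    fix n :: nat
    have "pullback (max r (real n)) \<omega> \<subseteq> pullback (real n) \<omega>" using assms by (intro pullback_mono) auto
    then show "(\<Inter>t\<in>{r..}. pullback t \<omega>) \<subseteq> pullback (real n) \<omega>" by force
  qed
qed

lemma pullback_limit_nonempty: assumes \<omega>: "\<omega> \<in> \<Omega>" shows "pullback_limit \<omega> \<noteq> {}"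
proof
  assume "pullback_limit \<omega> = {}"
  then have "\<exists>n. pullback (real n) \<omega> \<subseteq> {}"
    using pullback_compact[OF \<omega>] pullback_mono[OF \<omega>] unfolding pullback_limit_def
    by (intro decreasing_compact_in_open) auto
  then show False using pullback_nonempty[OF \<omega>] by blast
qed

lemma pullback_limit_subset: "\<omega> \<in> \<Omega> \<Longrightarrow> pullback_limit \<omega> \<subseteq> absorb \<omega>"
proof -
  assume \<omega>: "\<omega> \<in> \<Omega>"
  have "pullback (real 0) \<omega> = absorb \<omega>"
    by (simp add: pullback_def shift_0[OF \<omega>] sol_0[OF \<omega>])
  then show ?thesis unfolding pullback_limit_def by blast
qed

lemma pullback_limit_compact: assumes \<omega>: "\<omega> \<in> \<Omega>" shows "compact (pullback_limit \<omega>)"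
proof -
  have "closed (pullback_limit \<omega>)" unfolding pullback_limit_def using pullback_compact[OF \<omega>] by (intro closed_INT) (auto intro: compact_imp_closed)
  moreover have "pullback_limit \<omega> = absorb \<omega> \<inter> pullback_limit \<omega>" using pullback_limit_subset[OF \<omega>] by blast
  ultimately show ?thesis using compact_Int_closed[OF compact_absorb] by metis
qed

text \<open>Solutions exist backward in time, so \<open>sol t \<omega>\<close> is injective and
  taking images commutes with the intersection; \<open>pullback_image\<close> then only moves the
  start of the range of times.\<close>

lemma pullback_limit_invariant:
  assumes \<omega>: "\<omega> \<in> \<Omega>" and t: "t > 0" shows "sol t \<omega> ` pullback_limit \<omega> = pullback_limit (\<theta> t \<omega>)"
proof -
  have "inj (sol t \<omega>)"
  proof (rule inj_on_inverseI)
    fix x show "sol (- t) (\<theta> t \<omega>) (sol t \<omega> x) = x"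
      using sol_cocycle[OF \<omega>, of "- t" t x] by (simp add: sol_0[OF \<omega>])
  qed
  then have "sol t \<omega> ` pullback_limit \<omega> = (\<Inter>s\<in>{0..}. sol t \<omega> ` pullback s \<omega>)"
    unfolding pullback_limit_eq[OF \<omega> order_refl] by (intro image_INT[of _ UNIV]) auto
  also have "\<dots> = (\<Inter>s\<in>{0..}. pullback (t + s) (\<theta> t \<omega>))" unfolding pullback_image[OF \<omega>] ..
  also have "\<dots> = (\<Inter>s\<in>(+) t ` {0..}. pullback s (\<theta> t \<omega>))" by (simp only: image_image)
  also have "(+) t ` {0..} = {t..}" by simp
  also have "(\<Inter>s\<in>{t..}. pullback s (\<theta> t \<omega>)) = pullback_limit (\<theta> t \<omega>)"
    using pullback_limit_eq[OF shift_\<Omega>[OF \<omega>], of t t] t by simp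
  finally show ?thesis .
qed

lemma measurable_evs: "(\<lambda>\<omega>. evs \<omega> x) \<in> borel_measurable M"
proof -
  obtain X where x: "x = to_state X" using to_state_surj by metis
  have "continuous_on UNIV (\<lambda>r. energy (mom X - noise_vec r))"
    unfolding noise_vec_def by (intro continuous_on_compose_UNIV[OF lips_continuous[OF lips_energy]] continuous_intros)
  from borel_measurable_continuous_on[OF this measurable_z] show ?thesis by (simp add: x evs_to_state ev_def)
qed

text \<open>The distance to an uncountable set becomes a countable infimum: the set is the image of
  the closure of an open set, so being closer than \<open>r\<close> is witnessed by a point of a
  fixed countable dense set in that open set.\<close>

lemma measurable_infdist_pullback: "(\<lambda>\<omega>. infdist x (pullback t \<omega>)) \<in> borel_measurable M"
proof (rule borel_measurableI_less)
  fix r :: real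
  obtain D :: "state set" where D: "countable D" "\<And>X. open X \<Longrightarrow> X \<noteq> {} \<Longrightarrow> \<exists>d\<in>D. d \<in> X"
    using countable_dense_exists by metis
  let ?\<eta> = "\<theta> (- t)"
  have iff: "infdist x (pullback t \<omega>) < r \<longleftrightarrow> (\<exists>d\<in>D. evs (?\<eta> \<omega>) d < 2 * R (?\<eta> \<omega>) \<and> dist x (sol t (?\<eta> \<omega>) d) < r)" if \<omega>: "\<omega> \<in> \<Omega>" for \<omega>
  proof
    assume "infdist x (pullback t \<omega>) < r"
    then obtain y where y: "y \<in> pullback t \<omega>" "dist x y < r"
      using pullback_nonempty[OF \<omega>] by (auto simp: infdist_notempty cINF_less_iff)
    then obtain q where q: "q \<in> absorb (?\<eta> \<omega>)" "dist x (sol t (?\<eta> \<omega>) q) < r" by (auto simp: pullback_def)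
    let ?U = "{q. dist x (sol t (?\<eta> \<omega>) q) < r}" and ?V = "{x. evs (?\<eta> \<omega>) x < 2 * R (?\<eta> \<omega>)}"
    have U: "open ?U" by (intro open_Collect_less continuous_intros continuous_sol shift_\<Omega> \<omega>)
    have V: "open ?V" by (intro open_Collect_less continuous_intros continuous_evs)
    \<comment> \<open>An open set that meets the closure of \<open>?V\<close> meets
      \<open>?V\<close>, and the intersection, being open, contains a point of
      \<open>D\<close>.\<close>
    have "?U \<inter> closure ?V \<noteq> {}" using q unfolding absorb_def by blast
    then have "?U \<inter> ?V \<noteq> {}" using open_Int_closure_eq_empty[OF U, of ?V] by blast
    then obtain d where "d \<in> D" "d \<in> ?U \<inter> ?V" using D(2)[of "?U \<inter> ?V"] U V by (auto simp: open_Int)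
    then show "\<exists>d\<in>D. evs (?\<eta> \<omega>) d < 2 * R (?\<eta> \<omega>) \<and> dist x (sol t (?\<eta> \<omega>) d) < r" by blast
  next
    assume "\<exists>d\<in>D. evs (?\<eta> \<omega>) d < 2 * R (?\<eta> \<omega>) \<and> dist x (sol t (?\<eta> \<omega>) d) < r"
    then obtain d where d: "evs (?\<eta> \<omega>) d < 2 * R (?\<eta> \<omega>)" "dist x (sol t (?\<eta> \<omega>) d) < r" by blast
    then have "d \<in> absorb (?\<eta> \<omega>)" unfolding absorb_def by (intro subsetD[OF closure_subset]) simp
    then have "sol t (?\<eta> \<omega>) d \<in> pullback t \<omega>" unfolding pullback_def by (rule imageI)
    from infdist_le[OF this, of x] d(2) show "infdist x (pullback t \<omega>) < r" by simp
  qed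
  have [measurable]: "(\<lambda>\<omega>. evs (?\<eta> \<omega>) d) \<in> borel_measurable M" "(\<lambda>\<omega>. R (?\<eta> \<omega>)) \<in> borel_measurable M"
    "(\<lambda>\<omega>. sol t (?\<eta> \<omega>) d) \<in> borel_measurable M" for d
    by (intro measurable_compose[OF measurable_shift_M] measurable_evs measurable_R measurable_on_M measurable_solution_map)+
  have "{\<omega> \<in> space M. infdist x (pullback t \<omega>) < r} = (\<Union>d\<in>D. {\<omega> \<in> space M. evs (?\<eta> \<omega>) d < 2 * R (?\<eta> \<omega>) \<and> dist x (sol t (?\<eta> \<omega>) d) < r})"
    using iff by auto
  also have "\<dots> \<in> sets M"
  proof (rule sets.countable_UN''[OF D(1)])
    show "{\<omega> \<in> space M. evs (?\<eta> \<omega>) d < 2 * R (?\<eta> \<omega>) \<and> dist x (sol t (?\<eta> \<omega>) d) < r} \<in> sets M" for d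
      by measurable
  qed
  finally show "{\<omega> \<in> space M. infdist x (pullback t \<omega>) < r} \<in> sets M" .
qed

lemma pullback_limit_tempered_family: "pullback_limit \<in> tempered_family M \<theta>"
proof -
  have "(\<lambda>\<omega>. infdist x (pullback_limit \<omega>)) \<in> borel_measurable M" for x
  proof (rule borel_measurable_LIMSEQ_metric[OF measurable_infdist_pullback])
    fix \<omega> assume "\<omega> \<in> space M"
    then have \<omega>: "\<omega> \<in> \<Omega>" by simp
    show "(\<lambda>n. infdist x (pullback (real n) \<omega>)) \<longlonglongrightarrow> infdist x (pullback_limit \<omega>)"
      unfolding pullback_limit_def
      by (intro infdist_decreasing_tendsto pullback_compact pullback_nonempty \<omega> pullback_limit_nonempty[OF \<omega>, unfolded pullback_limit_def] pullback_mono) auto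
  qed
  moreover have "tempered M \<theta> pullback_limit"
    unfolding tempered_def
  proof (intro bexI[of _ absorb_radius] ballI conjI)
    fix \<omega> assume "\<omega> \<in> space M"
    then have \<omega>: "\<omega> \<in> \<Omega>" by simp
    show "pullback_limit \<omega> \<subseteq> ball origin (absorb_radius \<omega>)"
      using pullback_limit_subset[OF \<omega>] absorb_dist[of _ \<omega>] by fastforce
    show "((\<lambda>t. (1 / t) * ln (max 1 (absorb_radius (\<theta> (- t) \<omega>)))) \<longlongrightarrow> 0) at_top" by (rule absorb_radius_tempered[OF \<omega>])
  qed (rule measurable_absorb_radius)
  ultimately show ?thesis
    unfolding tempered_family_def compact_random_set_def using pullback_limit_compact pullback_limit_nonempty by simp
qed

text \<open>The evolution up to time 0 is split at \<open>- n\<close>: by then \<open>D\<close> has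
  entered the absorbing set, and the last \<open>n\<close> units of time carry that set into the
  pullback, which lies near the limit.\<close>

lemma pullback_limit_attracts:
  assumes D: "D \<in> tempered_family M \<theta>" and \<omega>: "\<omega> \<in> \<Omega>"
  shows "((\<lambda>t. hausdorff_semidist (sol t (\<theta> (- t) \<omega>) ` D (\<theta> (- t) \<omega>)) (pullback_limit \<omega>)) \<longlongrightarrow> 0) at_top"
proof (rule tendstoI)
  fix e :: real assume e: "e > 0"
  have "open {y. infdist y (pullback_limit \<omega>) < e / 2}" by (intro open_Collect_less continuous_intros)
  moreover have "pullback_limit \<omega> \<subseteq> {y. infdist y (pullback_limit \<omega>) < e / 2}" using e by auto
  ultimately have "\<exists>n. pullback (real n) \<omega> \<subseteq> {y. infdist y (pullback_limit \<omega>) < e / 2}"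
    using pullback_compact[OF \<omega>] pullback_mono[OF \<omega>]
    by (intro decreasing_compact_in_open[of "\<lambda>n. pullback (real n) \<omega>"]) (auto simp: pullback_limit_def)
  then obtain n where n: "pullback (real n) \<omega> \<subseteq> {y. infdist y (pullback_limit \<omega>) < e / 2}" ..
  obtain T where T: "\<And>t. t \<ge> T \<Longrightarrow> sol t (\<theta> (- t) (\<theta> (- real n) \<omega>)) ` D (\<theta> (- t) (\<theta> (- real n) \<omega>)) \<subseteq> absorb (\<theta> (- real n) \<omega>)"
    using absorbing[OF D shift_\<Omega>[OF \<omega>]] by blast
  have "dist (hausdorff_semidist (sol t (\<theta> (- t) \<omega>) ` D (\<theta> (- t) \<omega>)) (pullback_limit \<omega>)) 0 < e" if t: "t \<ge> T + real n" for t
  proof -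
    let ?\<eta> = "\<theta> (- t) \<omega>"
    have \<eta>: "?\<eta> \<in> \<Omega>" by (rule shift_\<Omega>[OF \<omega>])
    have sub: "sol t ?\<eta> ` D ?\<eta> \<subseteq> pullback (real n) \<omega>"
    proof
      fix y assume "y \<in> sol t ?\<eta> ` D ?\<eta>"
      then obtain x where x: "x \<in> D ?\<eta>" "y = sol t ?\<eta> x" by blast
      have s: "\<theta> (- (t - real n)) (\<theta> (- real n) \<omega>) = ?\<eta>" by (simp add: wiener_shift_shift)
      have "sol (t - real n) ?\<eta> x \<in> absorb (\<theta> (- real n) \<omega>)"
        using T[of "t - real n"] t x(1) unfolding s by auto
      moreover have "y = sol (real n) (\<theta> (- real n) \<omega>) (sol (t - real n) ?\<eta> x)"
        using sol_cocycle[OF \<eta>, of "real n" "t - real n" x] x(2) by (simp add: wiener_shift_shift)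
      ultimately show "y \<in> pullback (real n) \<omega>" unfolding pullback_def by blast
    qed
    have ne: "D ?\<eta> \<noteq> {}" using D \<eta> by (auto simp: tempered_family_def compact_random_set_def)
    have bd: "infdist y (pullback_limit \<omega>) \<le> e / 2" if "y \<in> sol t ?\<eta> ` D ?\<eta>" for y
      using subsetD[OF n subsetD[OF sub that]] by simp
    have "hausdorff_semidist (sol t ?\<eta> ` D ?\<eta>) (pullback_limit \<omega>) \<le> e / 2"
      unfolding hausdorff_semidist_def using ne by (intro cSUP_least bd) auto
    moreover have "0 \<le> hausdorff_semidist (sol t ?\<eta> ` D ?\<eta>) (pullback_limit \<omega>)"
    proof -
      obtain y where y: "y \<in> sol t ?\<eta> ` D ?\<eta>" using ne by blast
      \<comment> \<open>A supremum of reals bounds its members only if the set is bounded above;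
        \<open>bd\<close> provides this.\<close>
      have "bdd_above ((\<lambda>y. infdist y (pullback_limit \<omega>)) ` (sol t ?\<eta> ` D ?\<eta>))" using bd by (intro bdd_aboveI2)
      from cSUP_upper[OF y this] show ?thesis unfolding hausdorff_semidist_def using infdist_nonneg[of y "pullback_limit \<omega>"] by linarith
    qed
    ultimately show ?thesis using e by simp
  qed
  then show "\<forall>\<^sub>F t in at_top. dist (hausdorff_semidist (sol t (\<theta> (- t) \<omega>) ` D (\<theta> (- t) \<omega>)) (pullback_limit \<omega>)) 0 < e"
    unfolding eventually_at_top_linorder by blast
qed

lemma random_attractor_pullback_limit: "random_attractor M \<theta> sol pullback_limit"
  unfolding random_attractor_def using pullback_limit_tempered_family pullback_limit_invariant pullback_limit_attracts by simp

lemma continuous_rds_sol: "continuous_rds M \<theta> sol"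
proof (rule continuous_rds_solution_map[OF _ \<Omega>_path])
  show "sets M = sets (restrict_space path_borel \<Omega>)" by (simp add: sets_restrict_space sets_P)
qed

end

theorem theorem3p1:
  fixes \<zeta>1 \<zeta>2 \<kappa>1 \<kappa>2 \<gamma> \<sigma> :: real
    and P :: "(real \<Rightarrow> real) measure" and \<Omega> :: "(real \<Rightarrow> real) set"
  assumes "\<zeta>1 > 0" and "\<zeta>2 > 0" and "\<kappa>1 > 0" and "\<kappa>2 > 0" and "\<sigma> > 0"
    and "0 < \<gamma>" and "\<gamma> < 1"
    and "wiener_measure P"
    and "regular_noise P \<sigma> \<Omega>"
  shows "(\<forall>\<omega>\<in>\<Omega>. \<forall>x::state. \<exists>!v. sde_solution \<zeta>1 \<zeta>2 \<kappa>1 \<kappa>2 \<gamma> \<sigma> \<omega> v \<and> v 0 = x)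
    \<and> continuous_rds (restrict_space P \<Omega>) wiener_shift
          (solution_map \<zeta>1 \<zeta>2 \<kappa>1 \<kappa>2 \<gamma> \<sigma>)
    \<and> (\<exists>A. random_attractor (restrict_space P \<Omega>) wiener_shift
          (solution_map \<zeta>1 \<zeta>2 \<kappa>1 \<kappa>2 \<gamma> \<sigma>) A)"
proof -
  interpret pendulum \<zeta>1 \<zeta>2 \<kappa>1 \<kappa>2 \<gamma> \<sigma> by unfold_locales (use assms in auto)
  obtain c C K where constants: "c > 0" "C \<ge> 0" "K \<ge> 0"
    "\<And>p \<eta> \<beta>. Denergy p (field (p + noise_vec \<eta>) + noise_vec \<beta>) \<le> (- c + C * \<bar>\<eta>\<bar>) * energy p + K * (gauge_term \<eta> \<beta>)\<^sup>2"
    by (rule energy_dissipation) (rule that)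
  \<comment> \<open>The root of the rate \<alpha>: it comes from solving
    \<open>C * (2 * \<sigma> / r) \<le> c / 2\<close>, with \<open>C + 1\<close> in place of
    \<open>C\<close> so that it is positive if \<open>C = 0\<close>. Taking \<alpha> as a square
    makes \<open>sqrt \<alpha>\<close> explicit.\<close>
  define r where "r = 4 * \<sigma> * (C + 1) / c"
  have r: "r > 0" using assms constants by (simp add: r_def)
  have small: "C * (2 * \<sigma> / sqrt (r\<^sup>2)) \<le> c / 2"
  proof -
    have "C * (2 * \<sigma> / sqrt (r\<^sup>2)) = C * (2 * \<sigma> / r)" using r by simp
    also have "\<dots> = c / 2 * (C / (C + 1))"
      using assms(5) constants(1,2) unfolding r_def by (simp add: divide_simps)
    also have "\<dots> \<le> c / 2 * 1" using constants by (intro mult_left_mono) auto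
    finally show ?thesis by simp
  qed
  interpret attractor_setup \<zeta>1 \<zeta>2 \<kappa>1 \<kappa>2 \<gamma> \<sigma> P \<Omega> c C K "r\<^sup>2"
    using assms constants r small by unfold_locales auto
  show ?thesis using sde_solution_ex1 \<Omega>_path continuous_rds_sol random_attractor_pullback_limit by blast
qed

end
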